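(* Let $\mathcal{F}$ be a saturated family of regular star-extendible homomorphisms between digraph algebras belonging to a perturbationally stable family. Suppose that for every algebra in $\mathrm{Lim}\,\mathcal{F}$ any two standard regular masas are conjugate by an approximately inner automorphism. Then $\mathcal{F}$ is approximately functorial.
   Context: Digraph algebras. A digraph algebra is a subalgebra $A$ of a finite-dimensional C*-algebra that contains a maximal abelian self-adjoint subalgebra (masa) of that C*-algebra. $C^*(A)$ is the C*-algebra generated by $A$; it is a finite direct sum of full matrix algebras and ranks are computed there in the usual way. A homomorphism $\phi:A_1\to A_2$ of digraph algebras is star-extendible if it is the restriction of a *-homomorphism $C^*(A_1)\to C^*(A_2)$ (not necessarily unital); all maps are assumed star-extendible. It has multiplicity one if $\phi(p)$ has rank at most one for each rank one projection $p\in A_1$. It is regular if $\phi=\phi_1+\dots+\phi_s$ with each $\phi_i:A_1\to A_2$ star-extendible of multiplicity one and the projections $\phi_i(1)$ pairwise orthogonal. A family $\mathcal{F}$ of regular maps is saturated if it contains all regular maps $A\to B$ for every pair $A,B$ which are the domain and range algebras of a map in $\mathcal{F}$. Standard regular maps. For a masa $C$ in $A$, $N_C(A)$ is the set of partial isometries $v\in A$ with $v^*Cv\subseteq C$ and $vCv^*\subseteq C$. With chosen masas $C_i\subseteq A_i$, a regular map $\phi:A_1\to A_2$ is standard regular if $\phi(N_{C_1}(A_1))\subseteq N_{C_2}(A_2)$. Limits. For a direct system $\{A_k,\phi_k\}$ of digraph algebras, the closed limit is the norm closure of the algebraic limit in the C*-algebra limit of the $C^*(A_k)$. A homomorphism between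 closed limits is star-extendible if it is the restriction of a *-homomorphism between the C*-algebras they generate. $\mathrm{Lim}\,\mathcal{F}$ is the class of closed limits of direct systems with all connecting maps in $\mathcal{F}$. For a system of regular maps, masas $C_k\subseteq A_k$ can be chosen so that each $\phi_k$ is standard regular; the closure in the closed limit of $\mathrm{alg\,lim}\,C_k$ (or its image under a star-extendible isomorphism identifying the limit with a given algebra) is called a standard regular masa. Approximately inner. A (star-extendible) automorphism $\alpha$ of a closed limit $A$ is approximately inner if for every finite $S\subseteq A$ and $\epsilon>0$ there is a unitary $U$ in $A$ (in its unitisation if nonunital), with $U,U^*$ both in that algebra, such that $\|\alpha(a)-U^*aU\|<\epsilon$ for $a\in S$. Perturbational stability. A family $\mathcal{E}$ of digraph algebras is perturbationally stable if for each $A_1\in\mathcal{E}$ and $\epsilon>0$ there is $\delta>0$ such that for each $A_2\in\mathcal{E}$ and each star-extendible embedding $\phi:A_1\to C^*(A_2)$ with $\phi(A_1)\subseteq_\delta A_2$ (every element of the unit ball of $\phi(A_1)$ is within $\delta$ of $A_2$) there is a star-extendible embedding $\psi:A_1\to A_2$ with $\|\phi-\psi\|\le\epsilon$. Approximate functoriality. Given direct systems $\{A_k,\phi_k\}$, $\{B_k,\psi_k\}$ and star-extendible maps $\mu_k:A_k\to B_k$, $\nu_k:B_k\to A_{k+1}$, the resulting diagram is approximately commuting if $\sum_k\|\phi_k-\nu_k\circ\mu_k\|+\sum_k\|\psi_k-\mu_{k+1}\circ\nu_k\|<\infty$. The family $\mathcal{F}$ is approximately functorial if for every approximately commuting diagram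 with all $\phi_k,\psi_k\in\mathcal{F}$ there are indices $n_1\le m_1<n_2\le m_2<\cdots$ such that the compositions $\alpha_k:A_{n_k}\to A_{m_k}\to B_{m_k}$ (system map followed by $\mu_{m_k}$) and $\beta_k:B_{m_k}\to B_{n_{k+1}-1}\to A_{n_{k+1}}$ (system map followed by $\nu_{n_{k+1}-1}$) satisfy $\mathrm{dist}(\alpha_k,\mathcal{F})\to0$ and $\mathrm{dist}(\beta_k,\mathcal{F})\to0$ as $k\to\infty$. Here $\mathrm{dist}(\alpha,\mathcal{F})$ is the infimum of $\|\alpha-\gamma\|$ over $\gamma\in\mathcal{F}$ with the same domain and range algebra as $\alpha$.
   Formalization: "Saturated" is taken to mean that the family contains all regular maps A→B whenever A is the domain of some map in it and B is the range of some, possibly different, map in it; with one and the same map A→B required, the claim fails for two disjoint copies of C. *)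

theory Defs
  imports "HOL-Analysis.Analysis" "Jordan_Normal_Form.Schur_Decomposition"
    "Jordan_Normal_Form.DL_Rank"
begin

text \<open>
  A C*-algebra need not be unital. A type of this class serves as an ambient
  C*-algebra (for instance the bounded operators on a large Hilbert space), and the
  algebras under discussion are subsets of it with the inherited operations and norm.
\<close>

class cstar_algebra = banach + real_normed_algebra +
  fixes scaleC :: "complex \<Rightarrow> 'a \<Rightarrow> 'a" (infixr "*\<^sub>C" 75)
    and star :: "'a \<Rightarrow> 'a"
  assumes scaleC_add_right: "c *\<^sub>C (x + y) = c *\<^sub>C x + c *\<^sub>C y"
    and scaleC_add_left: "(c + d) *\<^sub>C x = c *\<^sub>C x + d *\<^sub>C x"
    and scaleC_scaleC: "c *\<^sub>C (d *\<^sub>C x) = (c * d) *\<^sub>C x"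
    and scaleC_of_real: "complex_of_real r *\<^sub>C x = r *\<^sub>R x"
    and scaleC_mult_left: "(c *\<^sub>C x) * y = c *\<^sub>C (x * y)"
    and scaleC_mult_right: "x * (c *\<^sub>C y) = c *\<^sub>C (x * y)"
    and norm_scaleC: "norm (c *\<^sub>C x) = cmod c * norm x"
    and star_star: "star (star x) = x"
    and star_add: "star (x + y) = star x + star y"
    and star_scaleC: "star (c *\<^sub>C x) = cnj c *\<^sub>C star x"
    and star_mult: "star (x * y) = star y * star x"
    and cstar_identity: "norm (star x * x) = (norm x)\<^sup>2"
begin

definition subalgebra :: "'a set \<Rightarrow> bool" where
  "subalgebra A \<longleftrightarrow> 0 \<in> A \<and> (\<forall>x\<in>A. \<forall>y\<in>A. x + y \<in> A \<and> x * y \<in> A) \<and> (\<forall>c. \<forall>x\<in>A. c *\<^sub>C x \<in> A)"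

definition star_subalgebra :: "'a set \<Rightarrow> bool" where
  "star_subalgebra A \<longleftrightarrow> subalgebra A \<and> (\<forall>x\<in>A. star x \<in> A)"

definition finite_dimensional :: "'a set \<Rightarrow> bool" where
  "finite_dimensional A \<longleftrightarrow>
     (\<exists>S. finite S \<and> S \<subseteq> A \<and> (\<forall>x\<in>A. \<exists>c. x = (\<Sum>s\<in>S. c s *\<^sub>C s)))"

definition abelian_star_subalgebra :: "'a set \<Rightarrow> bool" where
  "abelian_star_subalgebra C \<longleftrightarrow> star_subalgebra C \<and> (\<forall>x\<in>C. \<forall>y\<in>C. x * y = y * x)"

definition masa :: "'a set \<Rightarrow> 'a set \<Rightarrow> bool" where
  "masa C A \<longleftrightarrow> C \<subseteq> A \<and> abelian_star_subalgebra C \<and>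
     (\<forall>D. D \<subseteq> A \<and> abelian_star_subalgebra D \<and> C \<subseteq> D \<longrightarrow> D = C)"

definition is_unit :: "'a set \<Rightarrow> 'a \<Rightarrow> bool" where
  "is_unit A e \<longleftrightarrow> e \<in> A \<and> (\<forall>a\<in>A. e * a = a \<and> a * e = a)"

definition projection :: "'a \<Rightarrow> bool" where
  "projection p \<longleftrightarrow> star p = p \<and> p * p = p"

definition partial_isometry :: "'a \<Rightarrow> bool" where
  "partial_isometry v \<longleftrightarrow> v * star v * v = v"

end

definition generated_cstar :: "'a::cstar_algebra set \<Rightarrow> 'a set" where
  "generated_cstar A = \<Inter>{B. star_subalgebra B \<and> closed B \<and> A \<subseteq> B}"

definition star_hom ::
  "('a::cstar_algebra \<Rightarrow> 'b::cstar_algebra) \<Rightarrow> 'a set \<Rightarrow> 'b set \<Rightarrow> bool" where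
  "star_hom f A B \<longleftrightarrow> f ` A \<subseteq> B \<and>
     (\<forall>x\<in>A. \<forall>y\<in>A. f (x + y) = f x + f y \<and> f (x * y) = f x * f y) \<and>
     (\<forall>c. \<forall>x\<in>A. f (c *\<^sub>C x) = c *\<^sub>C f x) \<and> (\<forall>x\<in>A. f (star x) = star (f x))"

definition star_extendible ::
  "('a::cstar_algebra \<Rightarrow> 'b::cstar_algebra) \<Rightarrow> 'a set \<Rightarrow> 'b set \<Rightarrow> bool" where
  "star_extendible f A B \<longleftrightarrow> f ` A \<subseteq> B \<and>
     (\<exists>g. star_hom g (generated_cstar A) (generated_cstar B) \<and> (\<forall>a\<in>A. f a = g a))"

definition star_extendible_iso ::
  "('a::cstar_algebra \<Rightarrow> 'b::cstar_algebra) \<Rightarrow> 'a set \<Rightarrow> 'b set \<Rightarrow> bool" where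
  "star_extendible_iso f A B \<longleftrightarrow> bij_betw f A B \<and>
     star_extendible f A B \<and> star_extendible (inv_into A f) B A"

text \<open>The norm of \<open>f\<close> as a map on the subspace \<open>A\<close>.\<close>

definition map_norm ::
  "'a::real_normed_vector set \<Rightarrow> ('a \<Rightarrow> 'b::real_normed_vector) \<Rightarrow> real" where
  "map_norm A f = (SUP a\<in>{a\<in>A. norm a \<le> 1}. norm (f a))"

definition digraph_algebra :: "'a::cstar_algebra set \<Rightarrow> bool" where
  "digraph_algebra A \<longleftrightarrow> subalgebra A \<and>
     (\<exists>B. star_subalgebra B \<and> finite_dimensional B \<and> A \<subseteq> B \<and> (\<exists>C. masa C B \<and> C \<subseteq> A))"

text \<open>
  The direct sum of full matrix algebras of sizes \<open>ds\<close>, with entrywise operations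
  on lists of matrices.
\<close>

definition matrix_sum :: "nat list \<Rightarrow> complex Matrix.mat list set" where
  "matrix_sum ds = {Ms. list_all2 (\<lambda>M d. M \<in> carrier_mat d d) Ms ds}"

definition matrix_sum_iso ::
  "('a::cstar_algebra \<Rightarrow> complex Matrix.mat list) \<Rightarrow> 'a set \<Rightarrow> nat list \<Rightarrow> bool" where
  "matrix_sum_iso f B ds \<longleftrightarrow> bij_betw f B (matrix_sum ds) \<and>
     (\<forall>x\<in>B. \<forall>y\<in>B. f (x + y) = map2 (+) (f x) (f y) \<and> f (x * y) = map2 (*) (f x) (f y)) \<and>
     (\<forall>c. \<forall>x\<in>B. f (c *\<^sub>C x) = map (\<lambda>M. c \<cdot>\<^sub>m M) (f x)) \<and>
     (\<forall>x\<in>B. f (star x) = map mat_adjoint (f x))"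

text \<open>
  Rank of an element of a finite-dimensional C*-algebra \<open>B\<close>, read off from any
  identification of \<open>B\<close> with a direct sum of full matrix algebras (it does not depend
  on the identification).
\<close>

definition rank_in :: "'a::cstar_algebra set \<Rightarrow> 'a \<Rightarrow> nat" where
  "rank_in B x = (THE r. \<exists>ds f. 0 \<notin> set ds \<and> matrix_sum_iso f B ds \<and>
     r = (\<Sum>i<length ds. vec_space.rank (ds ! i) (f x ! i)))"

definition multiplicity_one ::
  "('a::cstar_algebra \<Rightarrow> 'a) \<Rightarrow> 'a set \<Rightarrow> 'a set \<Rightarrow> bool" where
  "multiplicity_one f A B \<longleftrightarrow>
     (\<forall>p\<in>A. projection p \<and> rank_in (generated_cstar A) p = 1 \<longrightarrow>
        rank_in (generated_cstar B) (f p) \<le> 1)"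

definition regular_map ::
  "('a::cstar_algebra \<Rightarrow> 'a) \<Rightarrow> 'a set \<Rightarrow> 'a set \<Rightarrow> bool" where
  "regular_map f A B \<longleftrightarrow> star_extendible f A B \<and>
     (\<exists>s::nat. \<exists>g :: nat \<Rightarrow> 'a \<Rightarrow> 'a.
        (\<forall>i<s. star_extendible (g i) A B \<and> multiplicity_one (g i) A B) \<and>
        (\<forall>e. is_unit A e \<longrightarrow> (\<forall>i<s. \<forall>j<s. i \<noteq> j \<longrightarrow> g i e * g j e = 0)) \<and>
        (\<forall>a\<in>A. f a = (\<Sum>i<s. g i a)))"

definition normaliser :: "'a::cstar_algebra set \<Rightarrow> 'a set \<Rightarrow> 'a set" where
  "normaliser C A = {v\<in>A. partial_isometry v \<and>
     (\<forall>c\<in>C. star v * c * v \<in> C) \<and> (\<forall>c\<in>C. v * c * star v \<in> C)}"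

definition standard_regular ::
  "('a::cstar_algebra \<Rightarrow> 'a) \<Rightarrow> 'a set \<Rightarrow> 'a set \<Rightarrow> 'a set \<Rightarrow> 'a set \<Rightarrow> bool" where
  "standard_regular f C A D B \<longleftrightarrow>
     regular_map f A B \<and> f ` normaliser C A \<subseteq> normaliser D B"

text \<open>
  Bounded sequences modulo null sequences, normed by the limit superior. Limits of direct
  systems of C*-algebras are realised in it: an element \<open>a\<close> of the \<open>k\<close>-th algebra goes to
  the class of the sequence with entries \<open>a\<close>, \<open>\<phi>\<^sub>k a\<close>, \<open>\<phi> (\<phi> a)\<close>, ... from place \<open>k\<close> on, whose
  norm is the limit of the norms of these entries.
\<close>

definition seq_equiv :: "(nat \<Rightarrow> 'a::real_normed_vector) \<Rightarrow> (nat \<Rightarrow> 'a) \<Rightarrow> bool" where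
  "seq_equiv x y \<longleftrightarrow> Bseq x \<and> Bseq y \<and> (\<lambda>n. x n - y n) \<longlonglongrightarrow> 0"

lemma seq_equiv_sym: "seq_equiv x y \<Longrightarrow> seq_equiv y x"
  unfolding seq_equiv_def using tendsto_minus[of "\<lambda>n. x n - y n" 0 sequentially] by auto

lemma part_equivp_seq_equiv: "part_equivp (seq_equiv :: (nat \<Rightarrow> 'a::real_normed_vector) \<Rightarrow> _)"
proof (rule part_equivpI)
  show "\<exists>x. seq_equiv x (x :: nat \<Rightarrow> 'a)"
    by (rule exI[of _ "\<lambda>_. 0"]) (simp add: seq_equiv_def)
  show "symp (seq_equiv :: (nat \<Rightarrow> 'a) \<Rightarrow> _)"
    by (auto intro: sympI seq_equiv_sym)
  show "transp (seq_equiv :: (nat \<Rightarrow> 'a) \<Rightarrow> _)"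
  proof (rule transpI)
    fix x y z :: "nat \<Rightarrow> 'a"
    assume a: "seq_equiv x y" and b: "seq_equiv y z"
    then have "(\<lambda>n. (x n - y n) + (y n - z n)) \<longlonglongrightarrow> 0 + 0"
      unfolding seq_equiv_def by (intro tendsto_add) auto
    then show "seq_equiv x z" using a b unfolding seq_equiv_def by simp
  qed
qed

quotient_type (overloaded) 'a seq_algebra =
  "nat \<Rightarrow> 'a::real_normed_vector" / partial: seq_equiv
  morphisms seq_rep seq_class
  by (rule part_equivp_seq_equiv)

definition seq_norm :: "(nat \<Rightarrow> 'a::real_normed_vector) \<Rightarrow> real" where
  "seq_norm x = real_of_ereal (limsup (\<lambda>n. ereal (norm (x n))))"

lemma Bseq_norm_le:
  assumes "Bseq x" "\<And>n. norm (y n) \<le> K * norm (x n)"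
  shows "Bseq y"
proof -
  from assms(1) obtain M where M: "M > 0" "\<And>n. norm (x n) \<le> M" unfolding Bseq_def by auto
  show ?thesis
  proof (rule BseqI'[of _ "\<bar>K\<bar> * M"])
    fix n
    have "norm (y n) \<le> \<bar>K\<bar> * norm (x n)"
      using assms(2)[of n] mult_right_mono[of K "\<bar>K\<bar>" "norm (x n)"] by force
    also have "\<dots> \<le> \<bar>K\<bar> * M" using M by (intro mult_left_mono) auto
    finally show "norm (y n) \<le> \<bar>K\<bar> * M" .
  qed
qed

lemma Bseq_plus:
  assumes "Bseq x" "Bseq y" shows "Bseq (\<lambda>n. x n + y n :: 'a::real_normed_vector)"
proof -
  from assms obtain K L where "\<And>n. norm (x n) \<le> K" "\<And>n. norm (y n) \<le> L"
    unfolding Bseq_def by auto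
  then show ?thesis by (intro BseqI'[of _ "K + L"]) (meson add_mono norm_triangle_le)
qed

lemma Bseq_uminus: "Bseq x \<Longrightarrow> Bseq (\<lambda>n. - x n :: 'a::real_normed_vector)"
  by (rule Bseq_norm_le[of x _ 1]) auto

lemma Bseq_diff: "Bseq x \<Longrightarrow> Bseq y \<Longrightarrow> Bseq (\<lambda>n. x n - y n :: 'a::real_normed_vector)"
  using Bseq_plus[OF _ Bseq_uminus, of x y] by simp

lemma Bseq_times:
  assumes "Bseq x" "Bseq y" shows "Bseq (\<lambda>n. x n * y n :: 'a::real_normed_algebra)"
proof -
  from assms(1) obtain K where "\<And>n. norm (x n) \<le> K" unfolding Bseq_def by auto
  then have "norm (x n * y n) \<le> K * norm (y n)" for n
    by (meson mult_right_mono norm_ge_zero norm_mult_ineq order_trans)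
  then show ?thesis by (rule Bseq_norm_le[OF assms(2)])
qed

lemma norm_star [simp]: "norm (star x) = norm (x :: 'a::cstar_algebra)"
proof -
  have le: "norm y \<le> norm (star y)" for y :: 'a
  proof (cases "y = 0")
    case False
    have "norm y * norm y \<le> norm (star y) * norm y"
      using cstar_identity[of y] norm_mult_ineq[of "star y" y] by (simp add: power2_eq_square)
    then show ?thesis using False by simp
  qed simp
  show ?thesis using le[of x] le[of "star x"] by (simp add: star_star)
qed

lemma Bseq_scaleR: "Bseq x \<Longrightarrow> Bseq (\<lambda>n. r *\<^sub>R (x n :: 'a::real_normed_vector))"
  by (rule Bseq_norm_le[of x _ "\<bar>r\<bar>"]) auto

lemma Bseq_scaleC: "Bseq x \<Longrightarrow> Bseq (\<lambda>n. c *\<^sub>C (x n :: 'a::cstar_algebra))"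
  by (rule Bseq_norm_le[of x _ "cmod c"]) (auto simp: norm_scaleC)

lemma Bseq_star: "Bseq x \<Longrightarrow> Bseq (\<lambda>n. star (x n :: 'a::cstar_algebra))"
  by (rule Bseq_norm_le[of x _ 1]) auto

lemma scaleC_diff_right: "c *\<^sub>C (x - y) = c *\<^sub>C x - c *\<^sub>C (y :: 'a::cstar_algebra)"
  using scaleC_add_right[of c "x - y" y] by (simp add: algebra_simps)

lemma star_diff: "star (x - y) = star x - star (y :: 'a::cstar_algebra)"
  using star_add[of "x - y" y] by (simp add: algebra_simps)

lemma seq_norm_le_iff:
  fixes x :: "nat \<Rightarrow> 'a::real_normed_vector"
  assumes "Bseq x"
  shows "seq_norm x \<le> c \<longleftrightarrow> (\<forall>y>c. \<forall>\<^sub>F n in sequentially. norm (x n) < y)"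
proof -
  let ?L = "limsup (\<lambda>n. ereal (norm (x n)))"
  obtain M where M: "\<And>n. norm (x n) \<le> M" using assms unfolding Bseq_def by auto
  have "?L \<le> ereal M" by (rule Limsup_bounded) (simp add: M)
  moreover have "0 \<le> ?L" by (rule le_Limsup) auto
  ultimately obtain l where l: "?L = ereal l" by (cases ?L) auto
  have "seq_norm x \<le> c \<longleftrightarrow> ?L \<le> ereal c" by (simp add: seq_norm_def l)
  also have "\<dots> \<longleftrightarrow> (\<forall>y>ereal c. \<forall>\<^sub>F n in sequentially. ereal (norm (x n)) < y)"
    by (rule Limsup_le_iff)
  also have "\<dots> \<longleftrightarrow> (\<forall>y>c. \<forall>\<^sub>F n in sequentially. norm (x n) < y)"
  proof (intro iffI allI impI)
    fix y assume "\<forall>y>ereal c. \<forall>\<^sub>F n in sequentially. ereal (norm (x n)) < y" "c < y"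
    then have "\<forall>\<^sub>F n in sequentially. ereal (norm (x n)) < ereal y"
      by (metis less_ereal.simps(1))
    then show "\<forall>\<^sub>F n in sequentially. norm (x n) < y" by simp
  next
    fix y assume *: "\<forall>y>c. \<forall>\<^sub>F n in sequentially. norm (x n) < y" "ereal c < y"
    show "\<forall>\<^sub>F n in sequentially. ereal (norm (x n)) < y" using * by (cases y) auto
  qed
  finally show ?thesis .
qed

lemma seq_norm_less:
  assumes "Bseq x" "seq_norm x < y"
  shows "\<forall>\<^sub>F n in sequentially. norm (x n) < y"
  using seq_norm_le_iff[OF assms(1), of "seq_norm x"] assms(2) by auto

lemma seq_norm_leI:
  assumes "Bseq x" "\<And>y. c < y \<Longrightarrow> \<forall>\<^sub>F n in sequentially. norm (x n) < y"
  shows "seq_norm x \<le> c"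
  using seq_norm_le_iff[OF assms(1)] assms(2) by auto

lemma seq_norm_nonneg:
  assumes "Bseq x" shows "0 \<le> seq_norm x"
proof (rule ccontr)
  assume "\<not> 0 \<le> seq_norm x"
  then have "\<forall>\<^sub>F n in sequentially. norm (x n) < 0" by (intro seq_norm_less[OF assms]) auto
  then show False by simp
qed

lemma seq_norm_eq_0:
  assumes "Bseq x" shows "seq_norm x = 0 \<longleftrightarrow> x \<longlonglongrightarrow> 0"
proof -
  have "seq_norm x = 0 \<longleftrightarrow> seq_norm x \<le> 0" using seq_norm_nonneg[OF assms] by auto
  also have "\<dots> \<longleftrightarrow> x \<longlonglongrightarrow> 0"
    by (simp add: seq_norm_le_iff[OF assms] tendsto_iff)
  finally show ?thesis .
qed

lemma seq_norm_triangle: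
  assumes "Bseq x" "Bseq y" shows "seq_norm (\<lambda>n. x n + y n) \<le> seq_norm x + seq_norm y"
proof (rule seq_norm_leI[OF Bseq_plus[OF assms]])
  fix c assume c: "seq_norm x + seq_norm y < c"
  define e where "e = (c - (seq_norm x + seq_norm y)) / 2"
  have "e > 0" using c by (simp add: e_def)
  then have "\<forall>\<^sub>F n in sequentially. norm (x n) < seq_norm x + e"
    "\<forall>\<^sub>F n in sequentially. norm (y n) < seq_norm y + e"
    using assms by (auto intro!: seq_norm_less)
  then show "\<forall>\<^sub>F n in sequentially. norm (x n + y n) < c"
  proof eventually_elim
    case (elim n)
    then show ?case using norm_triangle_ineq[of "x n" "y n"] unfolding e_def by argo
  qed
qed

lemma seq_norm_mono:
  assumes "Bseq x" "Bseq y" "\<And>n. norm (x n) \<le> norm (y n)"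
  shows "seq_norm x \<le> seq_norm y"
proof (rule seq_norm_leI[OF assms(1)])
  fix c assume "seq_norm y < c"
  from seq_norm_less[OF assms(2) this]
  show "\<forall>\<^sub>F n in sequentially. norm (x n) < c"
    by eventually_elim (use assms(3) in \<open>meson le_less_trans\<close>)
qed

lemma seq_norm_cong:
  assumes "seq_equiv x y" shows "seq_norm x = seq_norm y"
proof -
  have le: "seq_norm x \<le> seq_norm y" if e: "seq_equiv x y" for x y :: "nat \<Rightarrow> 'b::real_normed_vector"
  proof -
    have b: "Bseq x" "Bseq y" and l: "(\<lambda>n. x n - y n) \<longlonglongrightarrow> 0"
      using e by (auto simp: seq_equiv_def)
    have "seq_norm (\<lambda>n. (x n - y n) + y n) \<le> seq_norm (\<lambda>n. x n - y n) + seq_norm y"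
      by (rule seq_norm_triangle[OF Bseq_diff[OF b] b(2)])
    moreover have "seq_norm (\<lambda>n. x n - y n) = 0"
      using seq_norm_eq_0[OF Bseq_diff[OF b]] l by simp
    ultimately show ?thesis by simp
  qed
  show ?thesis using le[OF assms] le[OF seq_equiv_sym[OF assms]] by simp
qed

lemma seq_norm_scale_le:
  assumes "Bseq x" "Bseq y" "0 \<le> K" "\<And>n. norm (y n) = K * norm (x n)"
  shows "seq_norm y \<le> K * seq_norm x"
proof (rule seq_norm_leI[OF assms(2)])
  fix c assume c: "K * seq_norm x < c"
  show "\<forall>\<^sub>F n in sequentially. norm (y n) < c"
  proof (cases "K = 0")
    case False
    then have K: "K > 0" using assms by simp
    then have "seq_norm x < c / K" using c by (simp add: field_simps)
    from seq_norm_less[OF assms(1) this] show ?thesis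
      by eventually_elim (use K in \<open>simp add: assms(4) field_simps\<close>)
  qed (use c in \<open>simp add: assms(4)\<close>)
qed

lemma seq_norm_scale:
  assumes "Bseq x" "Bseq y" "0 \<le> K" "\<And>n. norm (y n) = K * norm (x n)"
  shows "seq_norm y = K * seq_norm x"
proof (cases "K = 0")
  case True
  then show ?thesis using seq_norm_scale_le[OF assms] seq_norm_nonneg[OF assms(2)] by simp
next
  case False
  then have "seq_norm x \<le> inverse K * seq_norm y"
    using assms by (intro seq_norm_scale_le) auto
  then show ?thesis using seq_norm_scale_le[OF assms] False assms(3)
    by (simp add: field_simps)
qed

lemma seq_norm_mult:
  fixes x y :: "nat \<Rightarrow> 'a::real_normed_algebra"
  assumes "Bseq x" "Bseq y" shows "seq_norm (\<lambda>n. x n * y n) \<le> seq_norm x * seq_norm y"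
proof -
  have *: "seq_norm (\<lambda>n. x n * y n) \<le> (seq_norm x + e) * seq_norm y + e * (seq_norm x + e)"
    if e: "e > 0" for e
  proof (rule seq_norm_leI[OF Bseq_times[OF assms]])
    fix c assume c: "(seq_norm x + e) * seq_norm y + e * (seq_norm x + e) < c"
    have "\<forall>\<^sub>F n in sequentially. norm (x n) < seq_norm x + e"
      "\<forall>\<^sub>F n in sequentially. norm (y n) < seq_norm y + e"
      using e assms by (auto intro!: seq_norm_less)
    then show "\<forall>\<^sub>F n in sequentially. norm (x n * y n) < c"
    proof eventually_elim
      case (elim n)
      have "norm (x n * y n) \<le> norm (x n) * norm (y n)" by (rule norm_mult_ineq)
      also have "\<dots> \<le> (seq_norm x + e) * (seq_norm y + e)"
        using elim e seq_norm_nonneg[OF assms(1)] by (intro mult_mono) auto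
      also have "\<dots> < c" using c by (simp add: algebra_simps)
      finally show ?case .
    qed
  qed
  have "((\<lambda>e. (seq_norm x + e) * seq_norm y + e * (seq_norm x + e)) \<longlongrightarrow>
      (seq_norm x + 0) * seq_norm y + 0 * (seq_norm x + 0)) (at_right 0)"
    by (intro tendsto_intros)
  moreover have "\<forall>\<^sub>F e in at_right 0. seq_norm (\<lambda>n. x n * y n)
      \<le> (seq_norm x + e) * seq_norm y + e * (seq_norm x + e)"
    using eventually_at_right_less[of 0] by (rule eventually_mono) (rule *)
  ultimately have "seq_norm (\<lambda>n. x n * y n) \<le> (seq_norm x + 0) * seq_norm y + 0 * (seq_norm x + 0)"
    by (rule tendsto_lowerbound) simp
  then show ?thesis by simp
qed

lemma seq_norm_cstar:
  fixes x :: "nat \<Rightarrow> 'a::cstar_algebra"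
  assumes "Bseq x" shows "seq_norm (\<lambda>n. star (x n) * x n) = (seq_norm x)\<^sup>2"
proof (rule antisym)
  have s: "seq_norm (\<lambda>n. star (x n)) = 1 * seq_norm x"
    by (rule seq_norm_scale[OF assms Bseq_star[OF assms]]) auto
  have "seq_norm (\<lambda>n. star (x n) * x n) \<le> seq_norm (\<lambda>n. star (x n)) * seq_norm x"
    by (rule seq_norm_mult[OF Bseq_star[OF assms] assms])
  then show "seq_norm (\<lambda>n. star (x n) * x n) \<le> (seq_norm x)\<^sup>2"
    by (simp add: s power2_eq_square)
next
  let ?b = "seq_norm (\<lambda>n. star (x n) * x n)"
  have b: "Bseq (\<lambda>n. star (x n) * x n)" by (rule Bseq_times[OF Bseq_star[OF assms] assms])
  have "seq_norm x \<le> sqrt ?b"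
  proof (rule seq_norm_leI[OF assms])
    fix c assume c: "sqrt ?b < c"
    have c0: "0 \<le> c" using c seq_norm_nonneg[OF b] real_sqrt_ge_zero[of ?b] by linarith
    have "(sqrt ?b)\<^sup>2 < c\<^sup>2"
      using c seq_norm_nonneg[OF b] by (intro power_strict_mono) auto
    then have "?b < c\<^sup>2" using seq_norm_nonneg[OF b] by simp
    from seq_norm_less[OF b this] show "\<forall>\<^sub>F n in sequentially. norm (x n) < c"
      by eventually_elim (use c0 in \<open>auto simp: cstar_identity dest: power_less_imp_less_base\<close>)
  qed
  then have "(seq_norm x)\<^sup>2 \<le> (sqrt ?b)\<^sup>2"
    using seq_norm_nonneg[OF assms] by (rule power_mono)
  then show "(seq_norm x)\<^sup>2 \<le> ?b" using seq_norm_nonneg[OF b] by simp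
qed

instantiation seq_algebra :: (real_normed_algebra) real_normed_algebra
begin

lift_definition zero_seq_algebra :: "'a seq_algebra" is "\<lambda>_. 0"
  by (simp add: seq_equiv_def)

lift_definition plus_seq_algebra :: "'a seq_algebra \<Rightarrow> 'a seq_algebra \<Rightarrow> 'a seq_algebra"
  is "\<lambda>x y n. x n + y n"
proof -
  fix x x' y y' :: "nat \<Rightarrow> 'a"
  assume a: "seq_equiv x x'" "seq_equiv y y'"
  then have "(\<lambda>n. (x n - x' n) + (y n - y' n)) \<longlonglongrightarrow> 0 + 0"
    unfolding seq_equiv_def by (intro tendsto_add) auto
  then show "seq_equiv (\<lambda>n. x n + y n) (\<lambda>n. x' n + y' n)"
    using a by (simp add: seq_equiv_def Bseq_plus algebra_simps)
qed

lift_definition uminus_seq_algebra :: "'a seq_algebra \<Rightarrow> 'a seq_algebra" is "\<lambda>x n. - x n"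
proof -
  fix x x' :: "nat \<Rightarrow> 'a"
  assume a: "seq_equiv x x'"
  then have "(\<lambda>n. - (x n - x' n)) \<longlonglongrightarrow> - 0"
    unfolding seq_equiv_def by (intro tendsto_minus) auto
  then show "seq_equiv (\<lambda>n. - x n) (\<lambda>n. - x' n)"
    using a by (simp add: seq_equiv_def Bseq_uminus algebra_simps)
qed

definition minus_seq_algebra :: "'a seq_algebra \<Rightarrow> 'a seq_algebra \<Rightarrow> 'a seq_algebra" where
  "minus_seq_algebra x y = x + - y"

lift_definition times_seq_algebra :: "'a seq_algebra \<Rightarrow> 'a seq_algebra \<Rightarrow> 'a seq_algebra"
  is "\<lambda>x y n. x n * y n"
proof -
  fix x x' y y' :: "nat \<Rightarrow> 'a"
  assume a: "seq_equiv x x'" "seq_equiv y y'"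
  then have z: "(\<lambda>n. x n - x' n) \<longlonglongrightarrow> 0" "(\<lambda>n. y n - y' n) \<longlonglongrightarrow> 0" and b: "Bseq y" "Bseq x'"
    by (auto simp: seq_equiv_def)
  have "(\<lambda>n. (x n - x' n) * y n + x' n * (y n - y' n)) \<longlonglongrightarrow> 0 + 0"
    using bounded_bilinear.Zfun_prod_Bfun[OF bounded_bilinear_mult, of "\<lambda>n. x n - x' n" sequentially y]
      bounded_bilinear.Bfun_prod_Zfun[OF bounded_bilinear_mult, of x' sequentially "\<lambda>n. y n - y' n"] z b
    by (intro tendsto_add) (simp_all add: tendsto_Zfun_iff)
  then show "seq_equiv (\<lambda>n. x n * y n) (\<lambda>n. x' n * y' n)"
    using a by (simp add: seq_equiv_def Bseq_times algebra_simps)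
qed

lift_definition scaleR_seq_algebra :: "real \<Rightarrow> 'a seq_algebra \<Rightarrow> 'a seq_algebra"
  is "\<lambda>r x n. r *\<^sub>R x n"
proof -
  fix r and x x' :: "nat \<Rightarrow> 'a"
  assume a: "seq_equiv x x'"
  then have "(\<lambda>n. r *\<^sub>R (x n - x' n)) \<longlonglongrightarrow> r *\<^sub>R 0"
    unfolding seq_equiv_def by (intro tendsto_intros) auto
  then show "seq_equiv (\<lambda>n. r *\<^sub>R x n) (\<lambda>n. r *\<^sub>R x' n)"
    using a by (simp add: seq_equiv_def Bseq_scaleR scaleR_diff_right)
qed

lift_definition norm_seq_algebra :: "'a seq_algebra \<Rightarrow> real" is seq_norm
  by (rule seq_norm_cong)

definition dist_seq_algebra :: "'a seq_algebra \<Rightarrow> 'a seq_algebra \<Rightarrow> real" where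
  "dist_seq_algebra x y = norm (x - y)"

definition sgn_seq_algebra :: "'a seq_algebra \<Rightarrow> 'a seq_algebra" where
  "sgn_seq_algebra x = inverse (norm x) *\<^sub>R x"

definition uniformity_seq_algebra :: "('a seq_algebra \<times> 'a seq_algebra) filter" where
  "uniformity_seq_algebra = (INF e\<in>{0<..}. principal {(x, y). dist x y < e})"

definition open_seq_algebra :: "'a seq_algebra set \<Rightarrow> bool" where
  "open_seq_algebra U \<longleftrightarrow> (\<forall>x\<in>U. \<forall>\<^sub>F (x', y) in uniformity. x' = x \<longrightarrow> y \<in> U)"

instance
proof
  fix x y z :: "'a seq_algebra" and r s :: real
  show "x + y + z = x + (y + z)" by transfer (simp add: seq_equiv_def Bseq_plus add.assoc)
  show "x + y = y + x" by transfer (simp add: seq_equiv_def Bseq_plus add.commute)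
  show "0 + x = x" by transfer (simp add: seq_equiv_def)
  show "- x + x = 0" by transfer (simp add: seq_equiv_def)
  show "x - y = x + - y" by (rule minus_seq_algebra_def)
  show "x * y * z = x * (y * z)" by transfer (simp add: seq_equiv_def Bseq_times mult.assoc)
  show "(x + y) * z = x * z + y * z"
    by transfer (simp add: seq_equiv_def Bseq_times Bseq_plus distrib_right)
  show "x * (y + z) = x * y + x * z"
    by transfer (simp add: seq_equiv_def Bseq_times Bseq_plus distrib_left)
  show "r *\<^sub>R (x + y) = r *\<^sub>R x + r *\<^sub>R y"
    by transfer (simp add: seq_equiv_def Bseq_plus Bseq_scaleR scaleR_add_right)
  show "(r + s) *\<^sub>R x = r *\<^sub>R x + s *\<^sub>R x"
    by transfer (simp add: seq_equiv_def Bseq_plus Bseq_scaleR scaleR_add_left)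
  show "r *\<^sub>R s *\<^sub>R x = (r * s) *\<^sub>R x"
    by transfer (simp add: seq_equiv_def Bseq_scaleR)
  show "1 *\<^sub>R x = x" by transfer (simp add: seq_equiv_def)
  show "r *\<^sub>R x * y = r *\<^sub>R (x * y)"
    by transfer (simp add: seq_equiv_def Bseq_scaleR Bseq_times)
  show "x * r *\<^sub>R y = r *\<^sub>R (x * y)"
    by transfer (simp add: seq_equiv_def Bseq_scaleR Bseq_times)
  show "dist x y = norm (x - y)" by (rule dist_seq_algebra_def)
  show "sgn x = inverse (norm x) *\<^sub>R x" by (rule sgn_seq_algebra_def)
  show "uniformity = (INF e\<in>{0<..}. principal {(x, y :: 'a seq_algebra). dist x y < e})"
    by (rule uniformity_seq_algebra_def)
  show "open U \<longleftrightarrow> (\<forall>x\<in>U. \<forall>\<^sub>F (x', y) in uniformity. x' = x \<longrightarrow> y \<in> U)" for U :: "'a seq_algebra set"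
    by (rule open_seq_algebra_def)
  show "norm x = 0 \<longleftrightarrow> x = 0" by transfer (simp add: seq_equiv_def seq_norm_eq_0)
  show "norm (x + y) \<le> norm x + norm y"
    by transfer (simp add: seq_equiv_def seq_norm_triangle)
  show "norm (r *\<^sub>R x) = \<bar>r\<bar> * norm x"
    by transfer (simp add: seq_equiv_def, rule seq_norm_scale, auto intro: Bseq_scaleR)
  show "norm (x * y) \<le> norm x * norm y"
    by transfer (simp add: seq_equiv_def seq_norm_mult)
qed

end

lemma seq_class_diff_norm_le:
  assumes "Bseq x" "Bseq y" "\<forall>\<^sub>F n in sequentially. norm (x n - y n) \<le> c"
  shows "norm (seq_class x - seq_class y :: 'a::real_normed_algebra seq_algebra) \<le> c"
proof -
  have e: "seq_equiv x x" "seq_equiv y y" using assms by (auto simp: seq_equiv_def)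
  have "seq_class x - seq_class y = seq_class (\<lambda>n. x n + - y n)"
    using e by (simp add: minus_seq_algebra_def uminus_seq_algebra.abs_eq plus_seq_algebra.abs_eq
        seq_equiv_def Bseq_uminus)
  moreover have b: "Bseq (\<lambda>n. x n + - y n)" using Bseq_diff[OF assms(1,2)] by simp
  ultimately have "norm (seq_class x - seq_class y) = seq_norm (\<lambda>n. x n + - y n)"
    by (simp add: norm_seq_algebra.abs_eq seq_equiv_def)
  also have "\<dots> \<le> c"
    by (rule seq_norm_leI[OF b]) (use assms(3) in \<open>auto elim: eventually_mono\<close>)
  finally show ?thesis .
qed

lemma seq_class_diff_norm_less:
  assumes "Bseq x" "Bseq y" "norm (seq_class x - seq_class y :: 'a::real_normed_algebra seq_algebra) < c"
  shows "\<forall>\<^sub>F n in sequentially. norm (x n - y n) < c"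
proof -
  have e: "seq_equiv x x" "seq_equiv y y" using assms by (auto simp: seq_equiv_def)
  have "seq_class x - seq_class y = seq_class (\<lambda>n. x n + - y n)"
    using e by (simp add: minus_seq_algebra_def uminus_seq_algebra.abs_eq plus_seq_algebra.abs_eq
        seq_equiv_def Bseq_uminus)
  moreover have b: "Bseq (\<lambda>n. x n + - y n)" using Bseq_diff[OF assms(1,2)] by simp
  ultimately have "norm (seq_class x - seq_class y) = seq_norm (\<lambda>n. x n + - y n)"
    by (simp add: norm_seq_algebra.abs_eq seq_equiv_def)
  with assms(3) have "seq_norm (\<lambda>n. x n + - y n) < c" by simp
  from seq_norm_less[OF b this] show ?thesis by simp
qed

lemma seq_class_cases:
  obtains x where "Bseq x" "X = seq_class x"
proof -
  obtain x where "seq_equiv x x" "X = seq_class x"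
    using Quotient_abs_rep[OF Quotient_seq_algebra, of X] Quotient_rep_reflp[OF Quotient_seq_algebra, of X]
    by metis
  then show ?thesis using that by (auto simp: seq_equiv_def)
qed

instance seq_algebra :: (real_normed_algebra) banach
proof
  fix X :: "nat \<Rightarrow> 'a seq_algebra"
  assume C: "Cauchy X"
  define e :: "nat \<Rightarrow> real" where "e i = (1/2) ^ i" for i
  have e0: "e i > 0" for i by (simp add: e_def)
  have "\<exists>M. \<forall>p\<ge>M. \<forall>q\<ge>M. norm (X p - X q) < e i" for i
    using C e0[of i] by (auto simp: Cauchy_def dist_norm)
  then obtain M where M: "\<And>i p q. p \<ge> M i \<Longrightarrow> q \<ge> M i \<Longrightarrow> norm (X p - X q) < e i" by metis
  define K where "K i = (\<Sum>j\<le>i. M j)" for i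
  have K: "M i \<le> K j" if "i \<le> j" for i j
    unfolding K_def using that by (intro member_le_sum) auto
  have "\<forall>i. \<exists>y. Bseq y \<and> X (K i) = seq_class y" by (meson seq_class_cases)
  then obtain y where y: "\<And>i. Bseq (y i)" "\<And>i. X (K i) = seq_class (y i)" by metis
  have "\<forall>\<^sub>F n in sequentially. \<forall>i\<in>{..j}. norm (y i n - y j n) < e i" for j
  proof (rule eventually_ball_finite)
    show "\<forall>i\<in>{..j}. \<forall>\<^sub>F n in sequentially. norm (y i n - y j n) < e i"
    proof
      fix i assume "i \<in> {..j}"
      then have "norm (seq_class (y i) - seq_class (y j)) < e i"
        using M[of i "K i" "K j"] K[of i i] K[of i j] by (simp add: y)
      then show "\<forall>\<^sub>F n in sequentially. norm (y i n - y j n) < e i"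
        by (rule seq_class_diff_norm_less[OF y(1) y(1)])
    qed
  qed simp
  then have "\<forall>j. \<exists>N. \<forall>n\<ge>N. \<forall>i\<le>j. norm (y i n - y j n) < e i"
    by (simp add: eventually_sequentially Ball_def)
  then obtain N where N: "\<And>j n i. n \<ge> N j \<Longrightarrow> i \<le> j \<Longrightarrow> norm (y i n - y j n) < e i" by metis
  define J where "J n = {j. j \<le> n \<and> N j \<le> n}" for n
  define z where "z n = (if J n = {} then 0 else y (Max (J n)) n)" for n
  have z: "norm (y i n - z n) < e i" if "n \<ge> max i (N i)" for i n
  proof -
    have i: "i \<in> J n" and f: "finite (J n)" using that by (auto simp: J_def)
    then have "Max (J n) \<in> J n" "i \<le> Max (J n)" by (auto intro: Max_in)
    then show ?thesis using N[of "Max (J n)" n i] i by (auto simp: z_def J_def)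
  qed
  have bz: "Bseq z"
  proof -
    obtain B where B: "\<And>n. norm (y 0 n) \<le> B" using y(1)[of 0] unfolding Bseq_def by auto
    have "norm (z n) \<le> B + e 0" if "n \<ge> N 0" for n
      using z[of 0 n] that B[of n] norm_triangle_ineq4[of "y 0 n" "y 0 n - z n"] by simp
    then have "Bseq (\<lambda>n. z (n + N 0))" by (intro BseqI'[of _ "B + e 0"]) simp
    then show ?thesis by (rule Bseq_offset)
  qed
  have lim: "norm (X (K i) - seq_class z) \<le> e i" for i
    unfolding y(2)
  proof (rule seq_class_diff_norm_le[OF y(1) bz])
    show "\<forall>\<^sub>F n in sequentially. norm (y i n - z n) \<le> e i"
      using eventually_ge_at_top[of "max i (N i)"] by eventually_elim (meson less_imp_le z)
  qed
  have "X \<longlonglongrightarrow> seq_class z"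
  proof (rule LIMSEQ_I)
    fix r :: real assume "r > 0"
    then obtain i where i: "e i < r / 2"
      unfolding e_def using real_arch_pow_inv[of "r / 2" "1 / 2"] by auto
    show "\<exists>n0. \<forall>n\<ge>n0. norm (X n - seq_class z) < r"
    proof (intro exI allI impI)
      fix n assume "n \<ge> M i"
      then have "norm (X n - X (K i)) < e i" using M K[of i i] by simp
      then show "norm (X n - seq_class z) < r"
        using lim[of i] i norm_triangle_ineq[of "X n - X (K i)" "X (K i) - seq_class z"] by simp
    qed
  qed
  then show "convergent X" by (auto simp: convergent_def)
qed

instantiation seq_algebra :: (cstar_algebra) cstar_algebra
begin

lift_definition scaleC_seq_algebra :: "complex \<Rightarrow> 'a seq_algebra \<Rightarrow> 'a seq_algebra"
  is "\<lambda>c x n. c *\<^sub>C x n"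
proof -
  fix c and x x' :: "nat \<Rightarrow> 'a"
  assume a: "seq_equiv x x'"
  then have "(\<lambda>n. cmod c * norm (x n - x' n)) \<longlonglongrightarrow> cmod c * 0"
    by (intro tendsto_mult_left tendsto_norm_zero) (simp add: seq_equiv_def)
  then have "(\<lambda>n. norm (c *\<^sub>C x n - c *\<^sub>C x' n)) \<longlonglongrightarrow> 0"
    by (simp add: norm_scaleC flip: scaleC_diff_right)
  then show "seq_equiv (\<lambda>n. c *\<^sub>C x n) (\<lambda>n. c *\<^sub>C x' n)"
    using a by (simp add: seq_equiv_def Bseq_scaleC tendsto_norm_zero_iff)
qed

lift_definition star_seq_algebra :: "'a seq_algebra \<Rightarrow> 'a seq_algebra" is "\<lambda>x n. star (x n)"
proof -
  fix x x' :: "nat \<Rightarrow> 'a"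
  assume a: "seq_equiv x x'"
  then have "(\<lambda>n. norm (x n - x' n)) \<longlonglongrightarrow> 0"
    by (intro tendsto_norm_zero) (simp add: seq_equiv_def)
  then have "(\<lambda>n. norm (star (x n) - star (x' n))) \<longlonglongrightarrow> 0" by (simp flip: star_diff)
  then show "seq_equiv (\<lambda>n. star (x n)) (\<lambda>n. star (x' n))"
    using a by (simp add: seq_equiv_def Bseq_star tendsto_norm_zero_iff)
qed

instance
proof
  fix x y z :: "'a seq_algebra" and c d :: complex and r :: real
  show "c *\<^sub>C (x + y) = c *\<^sub>C x + c *\<^sub>C y"
    by transfer (simp add: seq_equiv_def Bseq_plus Bseq_scaleC scaleC_add_right)
  show "(c + d) *\<^sub>C x = c *\<^sub>C x + d *\<^sub>C x"
    by transfer (simp add: seq_equiv_def Bseq_plus Bseq_scaleC scaleC_add_left)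
  show "c *\<^sub>C d *\<^sub>C x = (c * d) *\<^sub>C x"
    by transfer (simp add: seq_equiv_def Bseq_scaleC scaleC_scaleC)
  show "complex_of_real r *\<^sub>C x = r *\<^sub>R x"
    by transfer (simp add: seq_equiv_def Bseq_scaleR scaleC_of_real)
  show "c *\<^sub>C x * y = c *\<^sub>C (x * y)"
    by transfer (simp add: seq_equiv_def Bseq_times Bseq_scaleC scaleC_mult_left)
  show "x * c *\<^sub>C y = c *\<^sub>C (x * y)"
    by transfer (simp add: seq_equiv_def Bseq_times Bseq_scaleC scaleC_mult_right)
  show "norm (c *\<^sub>C x) = cmod c * norm x"
    by transfer (simp add: seq_equiv_def, rule seq_norm_scale, auto intro: Bseq_scaleC simp: norm_scaleC)
  show "star (star x) = x" by transfer (simp add: seq_equiv_def star_star)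
  show "star (x + y) = star x + star y"
    by transfer (simp add: seq_equiv_def Bseq_plus Bseq_star star_add)
  show "star (c *\<^sub>C x) = cnj c *\<^sub>C star x"
    by transfer (simp add: seq_equiv_def Bseq_scaleC Bseq_star star_scaleC)
  show "star (x * y) = star y * star x"
    by transfer (simp add: seq_equiv_def Bseq_times Bseq_star star_mult)
  show "norm (star x * x) = (norm x)\<^sup>2"
    by transfer (simp add: seq_equiv_def seq_norm_cstar)
qed

end

text \<open>
  For star-extendible \<open>\<phi>\<close> the eventually coherent sequences are bounded, and
  \<^term>\<open>generated_cstar (closed_limit A \<phi>)\<close> is the C*-algebra limit of the
  \<^term>\<open>generated_cstar (A k)\<close>, so \<^term>\<open>closed_limit A \<phi>\<close> is the closure of the
  algebraic limit taken in that C*-algebra.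
\<close>

definition coherent :: "(nat \<Rightarrow> 'a set) \<Rightarrow> (nat \<Rightarrow> 'a \<Rightarrow> 'a) \<Rightarrow> (nat \<Rightarrow> 'a) \<Rightarrow> bool" where
  "coherent A \<phi> x \<longleftrightarrow> (\<exists>k. \<forall>j\<ge>k. x j \<in> A j \<and> x (Suc j) = \<phi> j (x j))"

definition closed_limit ::
  "(nat \<Rightarrow> 'a::cstar_algebra set) \<Rightarrow> (nat \<Rightarrow> 'a \<Rightarrow> 'a) \<Rightarrow> 'a seq_algebra set" where
  "closed_limit A \<phi> = closure (seq_class ` {x. coherent A \<phi> x})"

text \<open>
  A map between digraph algebras is recorded with its domain and range algebra;
  the values of the function outside the domain algebra are irrelevant.
\<close>

type_synonym 'a algebra_map = "'a set \<times> ('a \<Rightarrow> 'a) \<times> 'a set"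

definition regular_family :: "'a::cstar_algebra algebra_map set \<Rightarrow> bool" where
  "regular_family F \<longleftrightarrow>
     (\<forall>(A, f, B)\<in>F. digraph_algebra A \<and> digraph_algebra B \<and> regular_map f A B)"

text \<open>
  \<open>A\<close> and \<open>B\<close> range independently over the domain algebras and the range algebras of
  maps in \<open>F\<close>. If a map \<open>A \<rightarrow> B\<close> in \<open>F\<close> were required to exist beforehand, \<open>F\<close> could split
  into unrelated parts, with no maps at all near the diagonal maps of a commuting diagram.
\<close>

definition saturated :: "'a::cstar_algebra algebra_map set \<Rightarrow> bool" where
  "saturated F \<longleftrightarrow>
     (\<forall>A B f. (\<exists>g B'. (A, g, B') \<in> F) \<and> (\<exists>A' g. (A', g, B) \<in> F) \<and> regular_map f A B
        \<longrightarrow> (A, f, B) \<in> F)"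

definition regular_system :: "(nat \<Rightarrow> 'a::cstar_algebra set) \<Rightarrow> (nat \<Rightarrow> 'a \<Rightarrow> 'a) \<Rightarrow> bool" where
  "regular_system A \<phi> \<longleftrightarrow>
     (\<forall>k. digraph_algebra (A k) \<and> regular_map (\<phi> k) (A k) (A (Suc k)))"

definition system_in ::
  "'a algebra_map set \<Rightarrow> (nat \<Rightarrow> 'a set) \<Rightarrow> (nat \<Rightarrow> 'a \<Rightarrow> 'a) \<Rightarrow> bool" where
  "system_in F A \<phi> \<longleftrightarrow> (\<forall>k. (A k, \<phi> k, A (Suc k)) \<in> F)"

definition Lim_class :: "'a::cstar_algebra algebra_map set \<Rightarrow> 'a seq_algebra set set" where
  "Lim_class F = {closed_limit A \<phi> | A \<phi>. system_in F A \<phi>}"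

text \<open>
  The presentation of \<open>L\<close> as a limit of regular maps is arbitrary, so two standard regular
  masas of \<open>L\<close> may come from different direct systems.
\<close>

definition standard_regular_masa ::
  "'a::cstar_algebra seq_algebra set \<Rightarrow> 'a seq_algebra set \<Rightarrow> bool" where
  "standard_regular_masa D L \<longleftrightarrow>
     (\<exists>A \<phi> C (\<theta> :: 'a seq_algebra \<Rightarrow> 'a seq_algebra). regular_system A \<phi> \<and> (\<forall>k. masa (C k) (A k)) \<and>
        (\<forall>k. standard_regular (\<phi> k) (C k) (A k) (C (Suc k)) (A (Suc k))) \<and>
        star_extendible_iso \<theta> (closed_limit A \<phi>) L \<and> D = \<theta> ` closed_limit C \<phi>)"

text \<open>The pair \<open>(\<lambda>, u)\<close> stands for the element \<open>\<lambda>1 + u\<close> of the unitisation.\<close>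

definition unitisation_mult ::
  "complex \<times> 'a::cstar_algebra \<Rightarrow> complex \<times> 'a \<Rightarrow> complex \<times> 'a" where
  "unitisation_mult U V =
     (fst U * fst V, fst U *\<^sub>C snd V + fst V *\<^sub>C snd U + snd U * snd V)"

definition unitisation_star :: "complex \<times> 'a::cstar_algebra \<Rightarrow> complex \<times> 'a" where
  "unitisation_star U = (cnj (fst U), star (snd U))"

definition approximately_inner ::
  "('a::cstar_algebra \<Rightarrow> 'a) \<Rightarrow> 'a set \<Rightarrow> bool" where
  "approximately_inner \<alpha> L \<longleftrightarrow> star_extendible_iso \<alpha> L L \<and>
     (\<forall>S \<epsilon>. finite S \<and> S \<subseteq> L \<and> \<epsilon> > 0 \<longrightarrow>
        (if \<exists>e. is_unit L e then
           (\<exists>U\<in>L. star U \<in> L \<and> is_unit L (star U * U) \<and> is_unit L (U * star U) \<and>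
              (\<forall>a\<in>S. norm (\<alpha> a - star U * a * U) < \<epsilon>))
         else
           (\<exists>U. snd U \<in> L \<and> star (snd U) \<in> L \<and>
              unitisation_mult (unitisation_star U) U = (1, 0) \<and>
              unitisation_mult U (unitisation_star U) = (1, 0) \<and>
              (\<forall>a\<in>S. norm (\<alpha> a -
                 snd (unitisation_mult (unitisation_mult (unitisation_star U) (0, a)) U)) < \<epsilon>))))"

definition perturbationally_stable :: "'a::cstar_algebra set set \<Rightarrow> bool" where
  "perturbationally_stable E \<longleftrightarrow> (\<forall>A\<in>E. digraph_algebra A) \<and>
     (\<forall>A1\<in>E. \<forall>\<epsilon>>0. \<exists>\<delta>>0. \<forall>A2\<in>E. \<forall>\<phi>.
        star_extendible \<phi> A1 (generated_cstar A2) \<and> inj_on \<phi> A1 \<and>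
        (\<forall>x\<in>\<phi> ` A1. norm x \<le> 1 \<longrightarrow> (\<exists>y\<in>A2. norm (x - y) \<le> \<delta>)) \<longrightarrow>
        (\<exists>\<psi>. star_extendible \<psi> A1 A2 \<and> inj_on \<psi> A1 \<and>
           map_norm A1 (\<lambda>a. \<phi> a - \<psi> a) \<le> \<epsilon>))"

text \<open>\<open>composite \<phi> i j\<close> is the system map from the \<open>i\<close>-th to the \<open>j\<close>-th algebra, for \<open>i \<le> j\<close>.\<close>

definition composite :: "(nat \<Rightarrow> 'a \<Rightarrow> 'a) \<Rightarrow> nat \<Rightarrow> nat \<Rightarrow> 'a \<Rightarrow> 'a" where
  "composite \<phi> i j = fold \<phi> [i..<j]"

definition approximately_commuting ::
  "(nat \<Rightarrow> 'a::cstar_algebra set) \<Rightarrow> (nat \<Rightarrow> 'a \<Rightarrow> 'a) \<Rightarrow> (nat \<Rightarrow> 'a set) \<Rightarrow> (nat \<Rightarrow> 'a \<Rightarrow> 'a) \<Rightarrow>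
     (nat \<Rightarrow> 'a \<Rightarrow> 'a) \<Rightarrow> (nat \<Rightarrow> 'a \<Rightarrow> 'a) \<Rightarrow> bool" where
  "approximately_commuting A \<phi> B \<psi> \<mu> \<nu> \<longleftrightarrow>
     (\<forall>k. star_extendible (\<mu> k) (A k) (B k)) \<and>
     (\<forall>k. star_extendible (\<nu> k) (B k) (A (Suc k))) \<and>
     summable (\<lambda>k. map_norm (A k) (\<lambda>a. \<phi> k a - \<nu> k (\<mu> k a))) \<and>
     summable (\<lambda>k. map_norm (B k) (\<lambda>b. \<psi> k b - \<mu> (Suc k) (\<nu> k b)))"

text \<open>Extended-real valued: the distance is infinite if \<open>F\<close> has no map \<open>A \<rightarrow> B\<close>.\<close>

definition family_dist ::
  "'a::cstar_algebra algebra_map set \<Rightarrow> 'a set \<Rightarrow> ('a \<Rightarrow> 'a) \<Rightarrow> 'a set \<Rightarrow> ereal" where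
  "family_dist F A \<alpha> B = (INF \<gamma>\<in>{\<gamma>. (A, \<gamma>, B) \<in> F}. ereal (map_norm A (\<lambda>a. \<alpha> a - \<gamma> a)))"

definition approximately_functorial :: "'a::cstar_algebra algebra_map set \<Rightarrow> bool" where
  "approximately_functorial F \<longleftrightarrow>
     (\<forall>A \<phi> B \<psi> \<mu> \<nu>. system_in F A \<phi> \<and> system_in F B \<psi> \<and>
        approximately_commuting A \<phi> B \<psi> \<mu> \<nu> \<longrightarrow>
        (\<exists>n m :: nat \<Rightarrow> nat. (\<forall>k. n k \<le> m k \<and> m k < n (Suc k)) \<and>
           (\<lambda>k. family_dist F (A (n k)) (\<mu> (m k) \<circ> composite \<phi> (n k) (m k)) (B (m k)))
             \<longlonglongrightarrow> 0 \<and>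
           (\<lambda>k. family_dist F (B (m k))
                  (\<nu> (n (Suc k) - 1) \<circ> composite \<psi> (m k) (n (Suc k) - 1)) (A (n (Suc k))))
             \<longlonglongrightarrow> 0))"

end

theory Submission
  imports Defs "HOL-Computational_Algebra.Fundamental_Theorem_Algebra"
begin

text \<open>
  In the limit an approximately commuting diagram becomes a star-extendible isomorphism
  \<open>\<theta>\<close> from \<open>lim A\<close> onto \<open>lim B\<close>, induced by the \<open>\<mu>\<^sub>k\<close>. It carries the masa \<open>lim C\<close> of the
  first system to a standard regular masa of \<open>lim B\<close>, so an approximately inner automorphism
  \<open>\<alpha>\<close> carries \<open>\<theta>(lim C)\<close> onto the masa \<open>lim D\<close> of the second system. Then \<open>\<alpha> \<circ> \<theta>\<close> maps the matrix
  units of \<open>A\<^sub>n\<close> to partial isometries normalising \<open>lim D\<close>. Such a partial isometry is close to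
  one of \<open>C\<^sup>*(B\<^sub>m)\<close> that normalises \<open>D\<^sub>m\<close>, and so \<open>\<alpha> \<circ> \<theta>\<close> is close, on \<open>A\<^sub>n\<close>, to a regular map
  \<open>A\<^sub>n \<rightarrow> B\<^sub>m\<close>. On the finite-dimensional \<open>A\<^sub>n\<close>, moreover, \<open>\<alpha>\<close> is nearly conjugation by a unitary,
  which lifts to unitaries of \<open>B\<^sub>j \<inter> B\<^sub>j\<^sup>*\<close> for large \<open>j\<close>. Undoing the conjugation shows that
  \<open>A\<^sub>n \<rightarrow> A\<^sub>j \<rightarrow> B\<^sub>j\<close> is close to a regular map. Deleting \<open>A\<^sub>0\<close> from the diagram exchanges the roles
  of the two systems.
\<close>

text \<open>The ambient C*-algebras are abstract, without Hilbert space, functional calculus or even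
  a unit. All finite-dimensional structure (unit, matrix units, rank, square roots) is therefore
  read off the atoms of masas. Two gaps turn approximations into exact statements. A projection of
  norm below 1 is zero, so approximate relations between projections in a limit masa become exact.
  And the corner between two minimal projections is at most a line, so an entry of an element of the
  generated algebra lies in the nonselfadjoint \<open>B m\<close> as soon as some element of
  \<open>B m\<close> has a nonzero entry in the same place; this is what brings the approximating
  maps into \<open>B m\<close> itself. The unitary raises the main obstacle: it lies in the limit
  together with its adjoint, but a sequence representing it in the \<open>B j\<close> need not have
  its adjoints there, and truncating it costs a factor that must stay bounded in \<open>j\<close>.
  Constants may depend on the one algebra \<open>A n\<close> on which maps are compared, never on
  \<open>j\<close>; so estimates are made on finitely many matrix units of
  \<open>A n\<close>.\<close>

interpretation cvs: vector_space "scaleC :: complex \<Rightarrow> 'a::cstar_algebra \<Rightarrow> 'a"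
proof
  show "1 *\<^sub>C x = x" for x :: 'a using scaleC_of_real[of 1 x] by simp
qed (simp_all add: scaleC_add_right scaleC_add_left scaleC_scaleC)

section \<open>Elementary identities and projections in a C*-algebra\<close>

declare star_star [simp]

lemma star_zero [simp]: "star (0::'a::cstar_algebra) = 0"
  using star_diff[of 0 "0::'a"] by simp

lemma star_sum: "star (sum f S) = (\<Sum>i\<in>S. star (f i :: 'a::cstar_algebra))"
  by (induction S rule: infinite_finite_induct) (auto simp: star_add)

lemma star_eq_iff: "star x = star y \<longleftrightarrow> x = (y::'a::cstar_algebra)"
  by (metis star_star)

lemma star_eq_0 [simp]: "star x = 0 \<longleftrightarrow> x = (0::'a::cstar_algebra)"
  using star_eq_iff[of x 0] by simp

lemma star_mult_self_eq_0 [simp]: "star x * x = 0 \<longleftrightarrow> x = (0::'a::cstar_algebra)"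
  using cstar_identity[of x] by (auto simp: power2_eq_square)

lemma mult_star_self_eq_0 [simp]: "x * star x = 0 \<longleftrightarrow> x = (0::'a::cstar_algebra)"
  using star_mult_self_eq_0[of "star x"] by simp

lemma cstar_identity': "norm (x * star x) = (norm (x::'a::cstar_algebra))\<^sup>2"
  using cstar_identity[of "star x"] by simp

context
  fixes A :: "'a::cstar_algebra set"
  assumes A: "subalgebra A"
begin

lemma subalgebra_zero: "0 \<in> A" using A by (simp add: subalgebra_def)
lemma subalgebra_add: "x \<in> A \<Longrightarrow> y \<in> A \<Longrightarrow> x + y \<in> A" using A by (simp add: subalgebra_def)
lemma subalgebra_mult: "x \<in> A \<Longrightarrow> y \<in> A \<Longrightarrow> x * y \<in> A" using A by (simp add: subalgebra_def)
lemma subalgebra_scale: "x \<in> A \<Longrightarrow> c *\<^sub>C x \<in> A" using A by (simp add: subalgebra_def)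
lemma subalgebra_minus: "x \<in> A \<Longrightarrow> - x \<in> A" using subalgebra_scale[of x "-1"] by simp
lemma subalgebra_diff: "x \<in> A \<Longrightarrow> y \<in> A \<Longrightarrow> x - y \<in> A"
  using subalgebra_add[of x "- y"] subalgebra_minus[of y] by simp
lemma subalgebra_sum: "(\<And>i. i \<in> S \<Longrightarrow> f i \<in> A) \<Longrightarrow> sum f S \<in> A"
  by (induction S rule: infinite_finite_induct) (auto simp: subalgebra_zero subalgebra_add)
lemma subalgebra_subspace: "cvs.subspace A"
  by (simp add: cvs.subspace_def subalgebra_zero subalgebra_add subalgebra_scale)

end

lemmas subalgebra_intros = subalgebra_zero subalgebra_add subalgebra_mult subalgebra_scale
  subalgebra_minus subalgebra_diff subalgebra_sum

lemma star_subalgebraD: "star_subalgebra A \<Longrightarrow> subalgebra A"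
  by (simp add: star_subalgebra_def)

lemma star_subalgebra_star: "star_subalgebra A \<Longrightarrow> x \<in> A \<Longrightarrow> star x \<in> A"
  by (simp add: star_subalgebra_def)

lemma projectionD: "projection p \<Longrightarrow> star p = p" "projection p \<Longrightarrow> p * p = p"
  by (simp_all add: projection_def)

lemma norm_projection:
  assumes "projection p" "p \<noteq> 0" shows "norm (p::'a::cstar_algebra) = 1"
proof -
  have "norm p = (norm p)\<^sup>2" using cstar_identity[of p] assms by (simp add: projection_def)
  then show ?thesis using assms(2) by (simp add: power2_eq_square)
qed

lemma norm_projection_le: "projection p \<Longrightarrow> norm (p::'a::cstar_algebra) \<le> 1"
  using norm_projection[of p] by (cases "p = 0") auto

text \<open>The gap in the norms of projections. Later it turns approximate identities between
  projections into exact ones.\<close>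

lemma projection_eq_0: "projection p \<Longrightarrow> norm (p::'a::cstar_algebra) < 1 \<Longrightarrow> p = 0"
  using norm_projection[of p] by force

lemma projection_star_mult:
  assumes "x * star x * x = (x::'a::cstar_algebra)" shows "projection (star x * x)"
  using assms unfolding projection_def by (simp add: star_mult mult.assoc)

lemma projection_commute_mult:
  assumes "projection p" "projection q" "p * q = q * (p::'a::cstar_algebra)"
  shows "projection (p * q)"
proof -
  have "p * q * (p * q) = p * (p * q) * q" using assms(3) by (metis mult.assoc)
  also have "\<dots> = p * q" using assms by (metis projectionD(2) mult.assoc)
  finally show ?thesis using assms by (simp add: projection_def star_mult)
qed

lemma projection_diff:
  assumes "projection p" "projection q" "p * q = (q::'a::cstar_algebra)"
  shows "projection (p - q)"
proof -
  have "q * p = q" using assms by (metis projectionD(1) star_mult)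
  then show ?thesis using assms by (simp add: projection_def star_diff algebra_simps)
qed

lemma projection_sum:
  assumes "\<And>i. i \<in> S \<Longrightarrow> projection (p i)" "\<And>i j. i \<in> S \<Longrightarrow> j \<in> S \<Longrightarrow> i \<noteq> j \<Longrightarrow> p i * p j = (0::'a::cstar_algebra)"
  shows "projection (sum p S)"
proof (cases "finite S")
  case True
  have "sum p S * sum p S = (\<Sum>i\<in>S. \<Sum>j\<in>S. p i * p j)" by (rule sum_product)
  also have "\<dots> = (\<Sum>i\<in>S. \<Sum>j\<in>S. if j = i then p i else 0)"
    using assms by (intro sum.cong refl) (auto simp: projection_def)
  also have "\<dots> = sum p S" using True by simp
  finally show ?thesis using assms(1) by (simp add: projection_def star_sum)
qed (simp add: projection_def)

primrec iterated_square :: "nat \<Rightarrow> 'a::cstar_algebra \<Rightarrow> 'a" where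
  "iterated_square 0 h = h"
| "iterated_square (Suc n) h = iterated_square n h * iterated_square n h"

lemma star_iterated_square: "star h = h \<Longrightarrow> star (iterated_square n h) = iterated_square n h"
  by (induction n) (auto simp: star_mult)

lemma norm_iterated_square: "star h = h \<Longrightarrow> norm (iterated_square n h) = norm h ^ (2 ^ n)"
proof (induction n)
  case (Suc n)
  then show ?case
    using cstar_identity[of "iterated_square n h"] star_iterated_square[of h n]
    by (simp add: power_mult[symmetric] mult.commute)
qed simp

lemma norm_iterated_square_le: "norm (iterated_square n h) \<le> norm h ^ (2 ^ n)"
proof (induction n)
  case (Suc n)
  have "norm (iterated_square n h * iterated_square n h) \<le> norm (iterated_square n h) * norm (iterated_square n h)"
    by (rule norm_mult_ineq)
  also have "\<dots> \<le> norm h ^ (2 ^ n) * norm h ^ (2 ^ n)"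
    by (intro mult_mono Suc) auto
  also have "\<dots> = norm h ^ (2 ^ Suc n)" by (simp add: power_add[symmetric] mult_2)
  finally show ?case by simp
qed simp

text \<open>If \<open>b < a\<close>, the powers of \<open>a / b\<close> are unbounded and overtake
  any constant \<open>K\<close>. The case \<open>b = 0\<close> is settled by \<open>n = 0\<close>
  alone.\<close>

lemma le_of_power_bound:
  fixes a b K :: real
  assumes "0 \<le> b" "\<And>n. a ^ (2 ^ n) \<le> K * b ^ (2 ^ n)"
  shows "a \<le> b"
proof (rule ccontr)
  assume "\<not> a \<le> b"
  then have ab: "b < a" by simp
  show False
  proof (cases "b = 0")
    case True
    then show False using assms(2)[of 0] ab by simp
  next
    case False
    then have b: "0 < b" using assms(1) by simp
    then have q: "1 < a / b" using ab by simp
    obtain n where n: "K < (a / b) ^ n" using real_arch_pow[OF q] by blast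
    also have "\<dots> \<le> (a / b) ^ (2 ^ n)" using q by (intro power_increasing) (auto intro: less_imp_le)
    also have "\<dots> \<le> K" using assms(2)[of n] b by (simp add: power_divide divide_simps)
    finally show False by simp
  qed
qed

text \<open>The norm estimates for orthogonal sums and for star-homomorphisms avoid the spectral radius: for self-adjoint \<open>h\<close> the C*-identity
  gives \<open>\<parallel>h\<^sup>N\<parallel> = \<parallel>h\<parallel>\<^sup>N\<close> for \<open>N = 2\<^sup>n\<close>, so a bound with a constant improves to a bound without.\<close>

lemma norm_orthogonal_sum_le:
  fixes x :: "'i \<Rightarrow> 'a::cstar_algebra"
  assumes "\<And>i j. i \<in> I \<Longrightarrow> j \<in> I \<Longrightarrow> i \<noteq> j \<Longrightarrow> star (x i) * x j = 0"
    "\<And>i j. i \<in> I \<Longrightarrow> j \<in> I \<Longrightarrow> i \<noteq> j \<Longrightarrow> x i * star (x j) = 0"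
    "\<And>i. i \<in> I \<Longrightarrow> norm (x i) \<le> c" "0 \<le> c"
  shows "norm (sum x I) \<le> c"
proof (cases "finite I")
  case fin: True
  define h where "h i = star (x i) * x i" for i
  have "star (sum x I) * sum x I = (\<Sum>i\<in>I. \<Sum>j\<in>I. star (x i) * x j)"
    by (simp add: star_sum sum_product)
  also have "\<dots> = (\<Sum>i\<in>I. \<Sum>j\<in>I. if j = i then h i else 0)"
    using assms(1) by (intro sum.cong refl) (auto simp: h_def)
  also have "\<dots> = sum h I" using fin by simp
  finally have H: "star (sum x I) * sum x I = sum h I" .
  have ort: "iterated_square n (h i) * iterated_square n (h j) = 0"
    if "i \<in> I" "j \<in> I" "i \<noteq> j" for n i j
  proof (induction n)
    case 0
    have "h i * h j = star (x i) * (x i * star (x j)) * x j" by (simp add: h_def mult.assoc)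
    then show ?case using assms(2) that by simp
  next
    case (Suc n)
    have "iterated_square (Suc n) (h i) * iterated_square (Suc n) (h j) =
      iterated_square n (h i) * (iterated_square n (h i) * iterated_square n (h j)) * iterated_square n (h j)"
      by (simp add: mult.assoc)
    then show ?case using Suc by simp
  qed
  have sq: "iterated_square n (sum h I) = (\<Sum>i\<in>I. iterated_square n (h i))" for n
  proof (induction n)
    case (Suc n)
    have "iterated_square (Suc n) (sum h I) = (\<Sum>i\<in>I. \<Sum>j\<in>I. iterated_square n (h i) * iterated_square n (h j))"
      by (simp add: Suc sum_product)
    also have "\<dots> = (\<Sum>i\<in>I. \<Sum>j\<in>I. if j = i then iterated_square (Suc n) (h i) else 0)"
      using ort by (intro sum.cong refl) auto
    finally show ?case using fin by simp
  qed simp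
  have hn: "norm (h i) \<le> c\<^sup>2" if "i \<in> I" for i
    using assms(3)[OF that] by (simp add: h_def cstar_identity power_mono)
  \<comment> \<open>The \<open>h i\<close> are self-adjoint with zero products, so squaring the sum
    squares each term. The triangle inequality then loses only the fixed factor
    \<open>card I\<close>, which \<open>le_of_power_bound\<close> removes.\<close>
  have "norm (sum h I) \<le> c\<^sup>2"
  proof (rule le_of_power_bound[where K = "real (card I)"])
    fix n
    have "norm (sum h I) ^ (2 ^ n) = norm (iterated_square n (sum h I))"
      by (rule norm_iterated_square[symmetric]) (simp add: star_sum h_def star_mult)
    also have "\<dots> \<le> (\<Sum>i\<in>I. norm (iterated_square n (h i)))" unfolding sq by (rule norm_sum)
    also have "\<dots> \<le> (\<Sum>i\<in>I. (c\<^sup>2) ^ (2 ^ n))"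
      by (intro sum_mono order_trans[OF norm_iterated_square_le] power_mono hn) auto
    finally show "norm (sum h I) ^ (2 ^ n) \<le> real (card I) * (c\<^sup>2) ^ (2 ^ n)" by simp
  qed simp
  then have "(norm (sum x I))\<^sup>2 \<le> c\<^sup>2" using cstar_identity[of "sum x I"] H by simp
  then show ?thesis using assms(4) by (rule power2_le_imp_le)
qed (simp add: assms(4))

lemma star_homD:
  assumes "star_hom f A B"
  shows "x \<in> A \<Longrightarrow> f x \<in> B" "x \<in> A \<Longrightarrow> y \<in> A \<Longrightarrow> f (x + y) = f x + f y"
    "x \<in> A \<Longrightarrow> y \<in> A \<Longrightarrow> f (x * y) = f x * f y" "x \<in> A \<Longrightarrow> f (c *\<^sub>C x) = c *\<^sub>C f x"
    "x \<in> A \<Longrightarrow> f (star x) = star (f x)"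
  using assms by (auto simp: star_hom_def)

lemma star_hom_zero: "star_hom f A B \<Longrightarrow> subalgebra A \<Longrightarrow> f 0 = 0"
  using star_homD(4)[of f A B 0 0] subalgebra_zero[of A] by simp

lemma star_hom_minus: "star_hom f A B \<Longrightarrow> x \<in> A \<Longrightarrow> f (- x) = - f x"
  using star_homD(4)[of f A B x "-1"] by simp

lemma star_hom_diff:
  "star_hom f A B \<Longrightarrow> subalgebra A \<Longrightarrow> x \<in> A \<Longrightarrow> y \<in> A \<Longrightarrow> f (x - y) = f x - f y"
  using star_homD(2)[of f A B x "- y"] star_hom_minus[of f A B y] subalgebra_minus[of A y] by simp

lemma star_hom_sum:
  "star_hom f A B \<Longrightarrow> subalgebra A \<Longrightarrow> (\<And>i. i \<in> S \<Longrightarrow> x i \<in> A) \<Longrightarrow> f (sum x S) = (\<Sum>i\<in>S. f (x i))"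
  by (induction S rule: infinite_finite_induct)
    (auto simp: star_hom_zero star_homD(2) subalgebra_sum)

lemma star_hom_projection:
  "star_hom f A B \<Longrightarrow> p \<in> A \<Longrightarrow> projection p \<Longrightarrow> projection (f p)"
  using star_homD(3,5)[of f A B p] by (metis projection_def)

lemma star_hom_contractive_if_bounded:
  assumes f: "star_hom f A B" and A: "star_subalgebra A" and x: "x \<in> A"
    and K: "\<And>x. x \<in> A \<Longrightarrow> norm (f x) \<le> K * norm x"
  shows "norm (f x) \<le> norm x"
proof -
  note sub = star_subalgebraD[OF A]
  define h where "h = star x * x"
  have h: "h \<in> A" using x by (simp add: h_def subalgebra_mult[OF sub] star_subalgebra_star[OF A])
  have sh: "star h = h" by (simp add: h_def star_mult)
  have it: "iterated_square n h \<in> A \<and> f (iterated_square n h) = iterated_square n (f h)" for n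
    by (induction n) (auto simp: h subalgebra_mult[OF sub] star_homD(3)[OF f])
  have fh: "f h = star (f x) * f x"
    unfolding h_def using x star_subalgebra_star[OF A x] by (simp add: star_homD[OF f])
  have "norm (f h) \<le> norm h"
  proof (rule le_of_power_bound[where K = K])
    fix n
    have "norm (f h) ^ (2 ^ n) = norm (f (iterated_square n h))"
      using it[of n] norm_iterated_square[of "f h" n] fh by (simp add: star_mult)
    also have "\<dots> \<le> K * norm h ^ (2 ^ n)" using K[of "iterated_square n h"] it[of n] sh
      by (simp add: norm_iterated_square)
    finally show "norm (f h) ^ (2 ^ n) \<le> K * norm h ^ (2 ^ n)" .
  qed simp
  then have "(norm (f x))\<^sup>2 \<le> (norm x)\<^sup>2"
    unfolding fh unfolding h_def by (simp only: cstar_identity)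
  then show ?thesis by (rule power2_le_imp_le) simp
qed

subsection \<open>Masas of finite-dimensional algebras\<close>

lemma finite_dimensionalE:
  assumes "finite_dimensional (A::'a::cstar_algebra set)"
  obtains S where "finite S" "S \<subseteq> A" "A \<subseteq> cvs.span S"
proof -
  from assms obtain S where S: "finite S" "S \<subseteq> A" "\<forall>x\<in>A. \<exists>c. x = (\<Sum>s\<in>S. c s *\<^sub>C s)"
    unfolding finite_dimensional_def by blast
  have "A \<subseteq> cvs.span S"
  proof
    fix x assume "x \<in> A"
    then obtain c where "x = (\<Sum>s\<in>S. c s *\<^sub>C s)" using S(3) by blast
    then show "x \<in> cvs.span S"
      by (auto intro: cvs.span_sum cvs.span_scale cvs.span_base)
  qed
  with S that show ?thesis by blast
qed

lemma finite_dimensionalI: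
  assumes "finite S" "S \<subseteq> A" "A \<subseteq> cvs.span S"
  shows "finite_dimensional (A::'a::cstar_algebra set)"
proof -
  have "\<exists>c. x = (\<Sum>s\<in>S. c s *\<^sub>C s)" if "x \<in> A" for x
    using that assms(3) unfolding cvs.span_finite[OF assms(1)] by auto
  then show ?thesis using assms(1,2) unfolding finite_dimensional_def by metis
qed

lemma finite_dimensional_basis:
  assumes "finite_dimensional (A::'a::cstar_algebra set)" "V \<subseteq> A"
  obtains T where "finite T" "T \<subseteq> V" "V \<subseteq> cvs.span T" "\<not> cvs.dependent T" "card T = cvs.dim V"
proof -
  obtain S where S: "finite S" "A \<subseteq> cvs.span S" using finite_dimensionalE[OF assms(1)] by metis
  obtain T where T: "T \<subseteq> V" "\<not> cvs.dependent T" "V \<subseteq> cvs.span T" "card T = cvs.dim V"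
    using cvs.basis_exists by metis
  have "T \<subseteq> cvs.span S" using T(1) assms(2) S(2) by blast
  then have "finite T" using cvs.independent_span_bound[OF S(1) T(2)] by blast
  with T that show ?thesis by blast
qed

lemma finite_dimensional_subset:
  assumes "finite_dimensional (A::'a::cstar_algebra set)" "V \<subseteq> A"
  shows "finite_dimensional V"
proof -
  obtain T where "finite T" "T \<subseteq> V" "V \<subseteq> cvs.span T" using finite_dimensional_basis[OF assms] .
  then show ?thesis by (rule finite_dimensionalI)
qed

lemma independent_card_le_dim:
  assumes "finite_dimensional (A::'a::cstar_algebra set)" "T \<subseteq> A" "\<not> cvs.dependent T"
  shows "finite T \<and> card T \<le> cvs.dim A"
proof -
  obtain S where S: "finite S" "A \<subseteq> cvs.span S" "card S = cvs.dim A"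
    using finite_dimensional_basis[OF assms(1) order_refl] by metis
  then show ?thesis using cvs.independent_span_bound[OF S(1) assms(3)] assms(2) by auto
qed

lemma dim_less:
  assumes "finite_dimensional (A::'a::cstar_algebra set)" "V \<subset> A" "cvs.subspace V"
  shows "cvs.dim V < cvs.dim A"
proof -
  obtain T where T: "finite T" "T \<subseteq> V" "V \<subseteq> cvs.span T" "\<not> cvs.dependent T" "card T = cvs.dim V"
    using finite_dimensional_basis[OF assms(1), of V] assms(2) by blast
  obtain x where x: "x \<in> A" "x \<notin> V" using assms(2) by blast
  have "cvs.span T \<subseteq> V" using T(2) assms(3) by (rule cvs.span_minimal)
  with x have nx: "x \<notin> cvs.span T" by blast
  then have "\<not> cvs.dependent (insert x T)" by (rule cvs.independent_insertI[OF _ T(4)])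
  moreover have "insert x T \<subseteq> A" using x T(2) assms(2) by blast
  ultimately have "card (insert x T) \<le> cvs.dim A"
    using independent_card_le_dim[OF assms(1)] by blast
  moreover have "x \<notin> T" using nx cvs.span_base by blast
  ultimately show ?thesis using T by simp
qed

text \<open>Left multiplication by \<open>x\<close> is an operator on the finite-dimensional space
  \<open>I\<close>. Take a nonzero polynomial \<open>p\<close> of least degree with
  \<open>p(x) z = 0\<close> and split off a linear factor, \<open>p = (X - c) r\<close>; then
  \<open>r(x) z\<close> is nonzero by minimality and is an eigenvector for \<open>c\<close>.\<close>

lemma eigenvector_exists:
  assumes fd: "finite_dimensional (I::'a::cstar_algebra set)" and sub: "cvs.subspace I"
    and z: "z \<in> I" "z \<noteq> 0" and x: "\<And>y. y \<in> I \<Longrightarrow> x * y \<in> I"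
  shows "\<exists>y\<in>I. y \<noteq> 0 \<and> (\<exists>c. x * y = c *\<^sub>C y)"
proof -
  \<comment> \<open>\<open>ev p\<close> is \<open>p(x) z\<close>, evaluated by Horner's rule on the
    vector \<open>z\<close>; no power of \<open>x\<close> is formed, since the constant term would
    need a unit.\<close>
  define ev where "ev p = fold_coeffs (\<lambda>a y. a *\<^sub>C z + x * y) p 0" for p
  have ev0 [simp]: "ev 0 = 0" by (simp add: ev_def)
  have evC: "ev (pCons a p) = a *\<^sub>C z + x * ev p" for a p
    by (cases "p = 0 \<and> a = 0") (auto simp: ev_def)
  have ev_add: "ev (p + q) = ev p + ev q" for p q
    by (induction p q rule: poly_induct2) (simp_all add: evC scaleC_add_left algebra_simps)
  have ev_smult: "ev (Polynomial.smult c p) = c *\<^sub>C ev p" for c p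
    by (induction p) (simp_all add: evC scaleC_add_right scaleC_scaleC scaleC_mult_right)
  have evI: "ev p \<in> I" for p
    by (induction p) (simp_all add: evC sub cvs.subspace_0 cvs.subspace_add cvs.subspace_scale x z)
  define v where "v i = ev (monom 1 i)" for i
  \<comment> \<open>The vectors \<open>v k\<close>, that is \<open>x^k z\<close>, all lie in
    \<open>I\<close>, so more than \<open>dim I\<close> of them cannot be independent.\<close>
  have "\<exists>k. v k \<in> cvs.span (v ` {..<k})"
  proof (rule ccontr)
    assume "\<not> ?thesis"
    then have nv: "v k \<notin> cvs.span (v ` {..<k})" for k by blast
    have ind: "\<not> cvs.dependent (v ` {..<k}) \<and> card (v ` {..<k}) = k" for k
    proof (induction k)
      case (Suc k)
      have "v k \<notin> v ` {..<k}" using nv[of k] by (metis cvs.span_base)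
      moreover have "v ` {..<Suc k} = insert (v k) (v ` {..<k})" by (simp add: lessThan_Suc)
      moreover have "\<not> cvs.dependent (insert (v k) (v ` {..<k}))"
        using Suc by (intro cvs.independent_insertI[OF nv[of k]]) simp
      ultimately show ?case using Suc by simp
    qed (simp add: cvs.independent_empty)
    have "v ` {..<Suc (cvs.dim I)} \<subseteq> I" using evI by (auto simp: v_def)
    with independent_card_le_dim[OF fd this] ind show False by (metis not_less_eq_eq order_refl)
  qed
  then obtain k where k: "v k \<in> cvs.span (v ` {..<k})" by blast
  define W where "W = {ev q |q. q = 0 \<or> degree q < k}"
  have mW: "ev q \<in> W" if "\<And>i. k \<le> i \<Longrightarrow> coeff q i = 0" for q
  proof -
    have "q = 0 \<or> degree q < k" using that[of "degree q"] by fastforce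
    then show ?thesis by (auto simp: W_def)
  qed
  have Wc: "\<exists>q. y = ev q \<and> (\<forall>i\<ge>k. coeff q i = 0)" if "y \<in> W" for y
    using that by (force simp: W_def coeff_eq_0)
  have "cvs.subspace W"
  proof (rule cvs.subspaceI)
    show "0 \<in> W" using mW[of 0] by simp
  next
    fix y y' assume "y \<in> W" "y' \<in> W"
    then show "y + y' \<in> W" using Wc[of y] Wc[of y'] mW by (auto simp flip: ev_add)
  next
    fix c y assume "y \<in> W"
    then show "c *\<^sub>C y \<in> W" using Wc[of y] mW by (auto simp flip: ev_smult)
  qed
  moreover have "v ` {..<k} \<subseteq> W" by (auto simp: v_def intro!: mW)
  ultimately have "cvs.span (v ` {..<k}) \<subseteq> W" by (simp add: cvs.span_minimal)
  with k obtain q where q: "v k = ev q" "\<forall>i\<ge>k. coeff q i = 0" using Wc by blast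
  define p0 where "p0 = monom 1 k + Polynomial.smult (-1) q"
  have p0: "ev p0 = 0" unfolding p0_def ev_add ev_smult using q(1) by (simp add: v_def)
  have "coeff p0 k = 1" using q(2) by (simp add: p0_def)
  then have "p0 \<noteq> 0" by auto
  then obtain p where p: "p \<noteq> 0" "ev p = 0" and
    min: "\<And>r. r \<noteq> 0 \<Longrightarrow> ev r = 0 \<Longrightarrow> degree p \<le> degree r"
    using ex_has_least_nat[of "\<lambda>p. p \<noteq> 0 \<and> ev p = 0" p0 degree] p0 by blast
  have "degree p \<noteq> 0"
  proof
    assume "degree p = 0"
    then obtain a where "p = [:a:]" by (meson degree_eq_zeroE)
    then show False using p z by (simp add: evC)
  qed
  then obtain c where "poly p c = 0"
    using fundamental_theorem_of_algebra constant_degree by metis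
  then obtain r where r: "p = [:- c, 1:] * r" by (meson dvdE poly_eq_0_iff_dvd)
  then have r0: "r \<noteq> 0" using p by auto
  have "degree p = Suc (degree r)" unfolding r using r0 by (subst degree_mult_eq) auto
  then have "ev r \<noteq> 0" using min[OF r0] by fastforce
  have pr: "p = Polynomial.smult (- c) r + pCons 0 r" unfolding r by simp
  have "ev p = - c *\<^sub>C ev r + x * ev r" unfolding pr ev_add ev_smult by (simp add: evC)
  then have "x * ev r = c *\<^sub>C ev r" using p(2) by simp
  then show ?thesis using evI \<open>ev r \<noteq> 0\<close> by blast
qed

text \<open>For an abelian finite-dimensional \<open>C\<close> these are its minimal projections,
  the points of its spectrum. Minimality is encoded as \<open>C\<close> acting on \<open>e\<close>
  by scalars, the form in which it is used.\<close>

definition atoms :: "'a::cstar_algebra set \<Rightarrow> 'a set" where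
  "atoms C = {e\<in>C. projection e \<and> e \<noteq> 0 \<and> (\<forall>x\<in>C. \<exists>c. x * e = c *\<^sub>C e)}"

lemma atoms_projection: "e \<in> atoms C \<Longrightarrow> projection e" by (simp add: atoms_def)
lemma atoms_nonzero: "e \<in> atoms C \<Longrightarrow> e \<noteq> 0" by (simp add: atoms_def)
lemma atoms_mem: "e \<in> atoms C \<Longrightarrow> e \<in> C" by (simp add: atoms_def)

lemma abelian_star_subalgebraD:
  "abelian_star_subalgebra C \<Longrightarrow> star_subalgebra C"
  "abelian_star_subalgebra C \<Longrightarrow> subalgebra C"
  "abelian_star_subalgebra C \<Longrightarrow> x \<in> C \<Longrightarrow> y \<in> C \<Longrightarrow> x * y = y * x"
  unfolding abelian_star_subalgebra_def star_subalgebra_def by blast+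

text \<open>On a nonzero ideal \<open>I\<close> of least dimension every \<open>x\<close> in
  \<open>C\<close> acts as a scalar: an eigenspace of \<open>x\<close> in \<open>I\<close> is again
  an ideal by commutativity, hence all of \<open>I\<close>. So \<open>h = star y * y\<close> in
  \<open>I\<close> satisfies \<open>h * h = c h\<close>, and \<open>h / c\<close> is an
  atom.\<close>

lemma atoms_nonempty:
  assumes C: "abelian_star_subalgebra C" "finite_dimensional C" and x: "x \<in> C" "x \<noteq> 0"
  shows "atoms (C::'a::cstar_algebra set) \<noteq> {}"
proof -
  note sub = abelian_star_subalgebraD(2)[OF C(1)] and com = abelian_star_subalgebraD(3)[OF C(1)]
  define ideal where "ideal I \<longleftrightarrow> I \<subseteq> C \<and> cvs.subspace I \<and> (\<exists>y\<in>I. y \<noteq> 0) \<and> (\<forall>x\<in>C. \<forall>y\<in>I. x * y \<in> I)" for I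
  have "ideal C"
    using x sub by (auto simp: ideal_def subalgebra_subspace subalgebra_mult)
  then obtain I where I: "ideal I" and min: "\<And>J. ideal J \<Longrightarrow> cvs.dim I \<le> cvs.dim J"
    using ex_has_least_nat[of ideal C cvs.dim] by blast
  from I have IC: "I \<subseteq> C" and sI: "cvs.subspace I" and mI: "\<And>x y. x \<in> C \<Longrightarrow> y \<in> I \<Longrightarrow> x * y \<in> I"
    by (auto simp: ideal_def)
  have fdI: "finite_dimensional I" using finite_dimensional_subset[OF C(2) IC] .
  from I obtain y where y: "y \<in> I" "y \<noteq> 0" by (auto simp: ideal_def)
  have scal: "\<exists>c. \<forall>z\<in>I. x * z = c *\<^sub>C z" if x: "x \<in> C" for x
  proof -
    obtain w c where w: "w \<in> I" "w \<noteq> 0" "x * w = c *\<^sub>C w"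
      using eigenvector_exists[OF fdI sI y mI[OF x]] by blast
    define J where "J = {z\<in>I. x * z = c *\<^sub>C z}"
    have "x * (x' * z) = c *\<^sub>C (x' * z)" if "x' \<in> C" "z \<in> J" for x' z
    proof -
      have "x * (x' * z) = x' * (x * z)" using com[OF x that(1)] by (metis mult.assoc)
      then show ?thesis using that(2) by (simp add: J_def scaleC_mult_right)
    qed
    then have "\<forall>x'\<in>C. \<forall>z\<in>J. x' * z \<in> J" using mI by (auto simp: J_def)
    moreover have sJ: "cvs.subspace J"
      using sI by (auto simp: J_def cvs.subspace_def distrib_left scaleC_add_right scaleC_mult_right
          scaleC_scaleC mult.commute)
    moreover have "J \<subseteq> C" "w \<in> J" using IC w by (auto simp: J_def)
    ultimately have "ideal J" using w(2) unfolding ideal_def by blast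
    then have "\<not> J \<subset> I" using min[of J] dim_less[OF fdI, of J] sJ by linarith
    then have "J = I" unfolding J_def by blast
    then show ?thesis unfolding J_def by blast
  qed
  define h where "h = star y * y"
  have yC: "y \<in> C" "star y \<in> C" using y IC C(1) by (auto simp: abelian_star_subalgebra_def star_subalgebra_def)
  have h: "h \<in> I" "star h = h" "h \<noteq> 0"
    using mI[OF yC(2) y(1)] y(2) by (auto simp: h_def star_mult)
  have hC: "h \<in> C" using h(1) IC by blast
  obtain c where c: "h * h = c *\<^sub>C h" using scal[OF hC] h(1) by blast
  have "h * h \<noteq> 0" using star_mult_self_eq_0[of h] h by simp
  then have c0: "c \<noteq> 0" using c by auto
  have "cnj c *\<^sub>C h = c *\<^sub>C h" using c h(2) by (metis star_mult star_scaleC)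
  then have cc: "cnj c = c" using h(3) by (simp add: cvs.scale_cancel_right)
  define e where "e = (1 / c) *\<^sub>C h"
  have eI: "e \<in> I" using h(1) sI by (simp add: e_def cvs.subspace_scale)
  have pe: "projection e"
    using c c0 cc h(2)
    by (simp add: projection_def e_def star_scaleC scaleC_mult_left scaleC_mult_right scaleC_scaleC)
  have e0: "e \<noteq> 0" using h(3) c0 by (simp add: e_def)
  have "e \<in> atoms C" unfolding atoms_def using eI IC pe e0 scal by blast
  then show ?thesis by blast
qed

text \<open>The product is a scalar multiple of \<open>e\<close> and of \<open>f\<close> at once. If
  it is nonzero, idempotency forces both scalars to be 1, so \<open>e = f\<close>.\<close>

lemma atoms_mult:
  assumes C: "abelian_star_subalgebra C" and e: "e \<in> atoms C" and f: "f \<in> atoms C"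
  shows "e * f = (if e = f then e else (0::'a::cstar_algebra))"
proof (cases "e * f = 0")
  case True
  then show ?thesis using e atoms_projection[OF e] by (auto simp: projection_def atoms_def)
next
  case False
  obtain c d where c: "e * f = c *\<^sub>C f" and d: "f * e = d *\<^sub>C e"
    using e f unfolding atoms_def by blast
  have com: "e * f = f * e" using abelian_star_subalgebraD(3)[OF C] e f by (auto simp: atoms_def)
  have p: "e * e = e" "f * f = f" using e f by (auto simp: atoms_def projection_def)
  have "(e * f) * f = e * f" using p by (simp add: mult.assoc)
  have 1: "c *\<^sub>C f = d *\<^sub>C e" using c d com by simp
  have "c \<noteq> 0" "d \<noteq> 0" using c d com False by auto
  have "e * (e * f) = e * f" using p by (simp flip: mult.assoc)
  then have "c *\<^sub>C (c *\<^sub>C f) = c *\<^sub>C f" using c by (simp add: scaleC_mult_right)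
  then have "c = 1" using \<open>c \<noteq> 0\<close> f by (simp add: scaleC_scaleC cvs.scale_cancel_right atoms_def)
  moreover have "f * (f * e) = f * e" using p by (simp flip: mult.assoc)
  then have "d *\<^sub>C (d *\<^sub>C e) = d *\<^sub>C e" using d by (simp add: scaleC_mult_right)
  then have "d = 1" using \<open>d \<noteq> 0\<close> e by (simp add: scaleC_scaleC cvs.scale_cancel_right atoms_def)
  ultimately have "e = f" using 1 by simp
  then show ?thesis using p by simp
qed

lemma orthogonal_projections_independent:
  assumes "\<And>e. e \<in> Q \<Longrightarrow> projection e \<and> e \<noteq> 0"
    "\<And>e f. e \<in> Q \<Longrightarrow> f \<in> Q \<Longrightarrow> e \<noteq> f \<Longrightarrow> e * f = (0::'a::cstar_algebra)"
  shows "\<not> cvs.dependent Q"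
proof
  assume "cvs.dependent Q"
  then obtain t u v where t: "finite t" "t \<subseteq> Q" "(\<Sum>v\<in>t. u v *\<^sub>C v) = 0" "v \<in> t" "u v \<noteq> 0"
    unfolding cvs.dependent_explicit by blast
  have "0 = (\<Sum>w\<in>t. u w *\<^sub>C w) * v" using t by simp
  also have "\<dots> = (\<Sum>w\<in>t. if w = v then u v *\<^sub>C v else 0)"
    unfolding sum_distrib_right
    using assms t by (intro sum.cong refl) (auto simp: scaleC_mult_left projection_def subset_iff)
  also have "\<dots> = u v *\<^sub>C v" using t by simp
  finally show False using t assms(1)[of v] by auto
qed

lemma finite_atoms:
  assumes "abelian_star_subalgebra C" "finite_dimensional (C::'a::cstar_algebra set)"
  shows "finite (atoms C)"
proof -
  have "\<not> cvs.dependent (atoms C)"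
  proof (rule orthogonal_projections_independent)
    show "projection e \<and> e \<noteq> 0" if "e \<in> atoms C" for e using that by (simp add: atoms_def)
    show "e * f = 0" if "e \<in> atoms C" "f \<in> atoms C" "e \<noteq> f" for e f
      using atoms_mult[OF assms(1), of e f] that by auto
  qed
  then show ?thesis using independent_card_le_dim[OF assms(2)] atoms_mem by blast
qed

lemma sum_atoms_projection:
  assumes "abelian_star_subalgebra C" "S \<subseteq> atoms (C::'a::cstar_algebra set)"
  shows "projection (\<Sum>S)"
proof (rule projection_sum)
  show "projection e" if "e \<in> S" for e using that assms(2) atoms_projection by blast
  show "e * f = 0" if "e \<in> S" "f \<in> S" "e \<noteq> f" for e f
    using atoms_mult[OF assms(1), of e f] that assms(2) by auto
qed

lemma atoms_sum_mult:
  assumes C: "abelian_star_subalgebra C" "finite_dimensional (C::'a::cstar_algebra set)"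
    and e: "e \<in> atoms C"
  shows "(\<Sum>(atoms C)) * e = e" "e * (\<Sum>(atoms C)) = e"
proof -
  have "(\<Sum>(atoms C)) * e = (\<Sum>f\<in>atoms C. if f = e then e else 0)"
    unfolding sum_distrib_right using atoms_mult[OF C(1) _ e] by (intro sum.cong refl) auto
  then show 1: "(\<Sum>(atoms C)) * e = e" using finite_atoms[OF C] e by simp
  have "(\<Sum>(atoms C)) \<in> C"
    using atoms_mem abelian_star_subalgebraD(2)[OF C(1)] by (auto intro: subalgebra_sum)
  then show "e * (\<Sum>(atoms C)) = e"
    using 1 abelian_star_subalgebraD(3)[OF C(1)] e atoms_mem by metis
qed

text \<open>The elements of \<open>C\<close> killed by \<open>?p\<close> form an abelian star
  subalgebra \<open>C'\<close>. An atom of \<open>C'\<close> would be an atom of \<open>C\<close>,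
  hence below \<open>?p\<close>, hence zero; so \<open>C'\<close> has no atoms and vanishes by
  \<open>atoms_nonempty\<close>. It contains \<open>x - x * ?p\<close>.\<close>

lemma atoms_unit:
  assumes C: "abelian_star_subalgebra C" "finite_dimensional (C::'a::cstar_algebra set)" and x: "x \<in> C"
  shows "x * (\<Sum>(atoms C)) = x"
proof -
  note sub = abelian_star_subalgebraD(2)[OF C(1)] and ssub = abelian_star_subalgebraD(1)[OF C(1)]
    and com = abelian_star_subalgebraD(3)[OF C(1)]
  let ?p = "\<Sum>(atoms C)"
  have pC: "?p \<in> C" using atoms_mem sub by (auto intro: subalgebra_sum)
  have pp: "projection ?p" by (rule sum_atoms_projection[OF C(1) order_refl])
  define C' where "C' = {x\<in>C. x * ?p = 0}"
  have "abelian_star_subalgebra C'"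
  proof -
    have "star y * ?p = 0" if "y \<in> C" "y * ?p = 0" for y
    proof -
      have "star y * ?p = ?p * star y" by (rule com) (use that pC ssub star_subalgebra_star in auto)
      also have "\<dots> = star (y * ?p)" using pp by (simp add: star_mult projection_def)
      finally show ?thesis using that by simp
    qed
    then show ?thesis using sub ssub com
      unfolding abelian_star_subalgebra_def star_subalgebra_def C'_def
      by (auto simp: subalgebra_def distrib_right mult.assoc scaleC_mult_left)
  qed
  moreover have "finite_dimensional C'"
    by (rule finite_dimensional_subset[OF C(2)]) (auto simp: C'_def)
  moreover have C'E: "atoms C' = {}"
  proof (rule ccontr)
    assume "atoms C' \<noteq> {}"
    then obtain e where e: "e \<in> atoms C'" by blast
    then have eC: "e \<in> C" "e * ?p = 0" by (auto simp: atoms_def C'_def)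
    have pe: "?p * e = 0" using eC com pC by metis
    have "\<exists>c. y * e = c *\<^sub>C e" if y: "y \<in> C" for y
    proof -
      have "y - y * ?p \<in> C'"
        using y pC sub pp by (simp add: C'_def subalgebra_diff subalgebra_mult left_diff_distrib
            mult.assoc projection_def)
      then obtain c where "(y - y * ?p) * e = c *\<^sub>C e" using e by (auto simp: atoms_def)
      then show ?thesis using pe by (auto simp: left_diff_distrib mult.assoc)
    qed
    then have eA: "e \<in> atoms C" using e eC by (auto simp: atoms_def)
    have "e = 0" using atoms_sum_mult(2)[OF C eA] eC by simp
    then show False using eA by (simp add: atoms_def)
  qed
  ultimately have "y = 0" if "y \<in> C'" for y using atoms_nonempty[of C' y] that by blast
  moreover have "x - x * ?p \<in> C'"
    using x pC sub pp by (simp add: C'_def subalgebra_diff subalgebra_mult left_diff_distrib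
            mult.assoc projection_def)
  ultimately show ?thesis by (metis eq_iff_diff_eq_0)
qed

lemma atoms_expansion:
  assumes C: "abelian_star_subalgebra C" "finite_dimensional (C::'a::cstar_algebra set)" and x: "x \<in> C"
  shows "\<exists>c. x = (\<Sum>e\<in>atoms C. c e *\<^sub>C e)"
proof -
  have "\<forall>e\<in>atoms C. \<exists>c. x * e = c *\<^sub>C e" using x by (auto simp: atoms_def)
  then obtain c where c: "\<forall>e\<in>atoms C. x * e = c e *\<^sub>C e" by metis
  have "x = (\<Sum>e\<in>atoms C. x * e)"
    using atoms_unit[OF C x] by (simp add: sum_distrib_left)
  with c show ?thesis by (intro exI[of _ c]) simp
qed

text \<open>Rank one without ranks: the corner \<open>e B e\<close> is a line. In finite dimension
  it agrees with rank one by \<open>rank_in_eq_1_iff\<close>, and it is the form that corner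
  computations use.\<close>

definition minimal_in :: "'a::cstar_algebra set \<Rightarrow> 'a \<Rightarrow> bool" where
  "minimal_in B e \<longleftrightarrow> e \<in> B \<and> projection e \<and> e \<noteq> 0 \<and> (\<forall>x\<in>B. \<exists>c. e * x * e = c *\<^sub>C e)"

lemma minimal_inD:
  assumes "minimal_in B e"
  shows "e \<in> B" "projection e" "e \<noteq> 0" "star e = e" "e * e = e"
    "x \<in> B \<Longrightarrow> \<exists>c. e * x * e = c *\<^sub>C e"
  using assms by (auto simp: minimal_in_def projection_def)

lemma masaD:
  assumes "masa C A"
  shows "C \<subseteq> A" "abelian_star_subalgebra C" "star_subalgebra C" "subalgebra C"
  using assms by (auto simp: masa_def abelian_star_subalgebra_def star_subalgebra_def)

text \<open>The bicommutant of \<open>C \<union> {h}\<close> in \<open>A \<inter> A\<^sup>*\<close> is abelian and contains \<open>C\<close>.\<close>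

lemma masa_commutant:
  assumes A: "subalgebra A" and C: "masa C A" and h: "h \<in> A" "star h = (h::'a::cstar_algebra)"
    and com: "\<And>c. c \<in> C \<Longrightarrow> h * c = c * h"
  shows "h \<in> C"
proof -
  let ?S = "insert h C"
  define Z where "Z = {y. \<forall>s\<in>?S. y * s = s * y}"
  define D where "D = {x\<in>A. star x \<in> A \<and> (\<forall>y\<in>Z. x * y = y * x)}"
  have starZ: "star y \<in> Z" if "y \<in> Z" for y
  proof -
    have "star y * s = s * star y" if s: "s \<in> ?S" for s
    proof -
      have "star s \<in> ?S" using s h(2) masaD(3)[OF C] star_subalgebra_star by auto
      then have "y * star s = star s * y" using \<open>y \<in> Z\<close> unfolding Z_def by blast
      then have "star (y * star s) = star (star s * y)" by simp
      then show ?thesis by (simp add: star_mult)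
    qed
    then show ?thesis by (simp add: Z_def)
  qed
  have D_star: "star x * y = y * star x" if "x \<in> D" "y \<in> Z" for x y
  proof -
    have "x * star y = star y * x" using that starZ unfolding D_def by blast
    then have "star (x * star y) = star (star y * x)" by simp
    then show ?thesis by (simp add: star_mult)
  qed
  have SZ: "?S \<subseteq> Z"
    using com abelian_star_subalgebraD(3)[OF masaD(2)[OF C]] unfolding Z_def by auto
  have SD: "?S \<subseteq> D"
    using h masaD(1,3)[OF C] star_subalgebra_star unfolding D_def Z_def by fastforce
  have "subalgebra D"
    unfolding subalgebra_def
  proof (intro conjI ballI allI)
    show "0 \<in> D" using A by (simp add: D_def subalgebra_zero)
  next
    fix x y assume xy: "x \<in> D" "y \<in> D"
    then show "x + y \<in> D" using A by (simp add: D_def subalgebra_add star_add distrib_left distrib_right)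
    have "x * y * z = z * (x * y)" if "z \<in> Z" for z
      using xy that by (simp add: D_def) (metis mult.assoc)
    then show "x * y \<in> D" using A xy by (simp add: D_def subalgebra_mult star_mult)
  next
    fix c x assume "x \<in> D"
    then show "c *\<^sub>C x \<in> D"
      using A by (simp add: D_def subalgebra_scale star_scaleC scaleC_mult_left scaleC_mult_right)
  qed
  moreover have "\<forall>x\<in>D. star x \<in> D" using D_star by (auto simp: D_def)
  moreover have "x * y = y * x" if "x \<in> D" "y \<in> D" for x y
  proof -
    have "y \<in> Z" using that SZ unfolding D_def Z_def by auto
    then show ?thesis using that by (simp add: D_def)
  qed
  ultimately have "abelian_star_subalgebra D"
    by (simp add: abelian_star_subalgebra_def star_subalgebra_def)
  moreover have "D \<subseteq> A" by (auto simp: D_def)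
  ultimately have "D = C" using C SD unfolding masa_def by blast
  then show ?thesis using SD by blast
qed

text \<open>Take an abelian star subalgebra between \<open>C\<close> and \<open>A\<close> of
  greatest dimension; dimensions are bounded by that of \<open>A\<close>, and a proper extension
  would raise the dimension.\<close>

lemma masa_extension:
  assumes A: "finite_dimensional A" and C: "abelian_star_subalgebra C" "C \<subseteq> (A::'a::cstar_algebra set)"
  shows "\<exists>D. masa D A \<and> C \<subseteq> D"
proof -
  define P where "P D \<longleftrightarrow> abelian_star_subalgebra D \<and> C \<subseteq> D \<and> D \<subseteq> A" for D
  have dimle: "cvs.dim D \<le> cvs.dim A" if D: "P D" for D
  proof (cases "D = A")
    case False
    then have "D \<subset> A" using D unfolding P_def by blast
    moreover have "cvs.subspace D" using D abelian_star_subalgebraD(2)[of D] subalgebra_subspace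
      unfolding P_def by blast
    ultimately show ?thesis using dim_less[OF A] less_imp_le by blast
  qed simp
  have "P C" using C by (simp add: P_def)
  then have "\<exists>D. P D \<and> (\<forall>E. P E \<longrightarrow> cvs.dim E \<le> cvs.dim D)"
    using dimle by (intro ex_has_greatest_nat[where b = "Suc (cvs.dim A)"]) (auto simp: less_Suc_eq_le)
  then obtain D where D: "P D" and max: "\<And>E. P E \<Longrightarrow> cvs.dim E \<le> cvs.dim D" by blast
  have "masa D A"
    unfolding masa_def
  proof (intro conjI allI impI)
    show "D \<subseteq> A" "abelian_star_subalgebra D" using D by (auto simp: P_def)
  next
    fix E assume E: "E \<subseteq> A \<and> abelian_star_subalgebra E \<and> D \<subseteq> E"
    then have "P E" using D unfolding P_def by blast
    then have "\<not> cvs.dim D < cvs.dim E" using max[of E] by simp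
    moreover have "finite_dimensional E" using finite_dimensional_subset[OF A] E by blast
    moreover have "cvs.subspace D" using D abelian_star_subalgebraD(2)[of D] subalgebra_subspace
      unfolding P_def by blast
    ultimately have "\<not> D \<subset> E" using dim_less by blast
    then show "E = D" using E by blast
  qed
  then show ?thesis using D by (auto simp: P_def)
qed

lemma trivial_abelian: "abelian_star_subalgebra {0::'a::cstar_algebra}"
  by (simp add: abelian_star_subalgebra_def star_subalgebra_def subalgebra_def)

text \<open>A self-adjoint \<open>h\<close> in \<open>A\<close> with \<open>e h = h = h e\<close>
  commutes with \<open>C\<close>, because \<open>C\<close> acts on \<open>e\<close> by scalars; by
  \<open>masa_commutant\<close> it lies in \<open>C\<close> and is a multiple of \<open>e\<close>.
  For general \<open>x\<close> this is applied to the real and imaginary parts of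
  \<open>e x e\<close>, which lie in the possibly nonselfadjoint \<open>A\<close> because
  \<open>star x\<close> does.\<close>

lemma masa_corner:
  assumes A: "subalgebra A" "finite_dimensional A" and C: "masa C A" and e: "e \<in> atoms C"
    and x: "x \<in> A" "star x \<in> (A::'a::cstar_algebra set)"
  shows "\<exists>c. e * x * e = c *\<^sub>C e"
proof -
  note ab = masaD(2)[OF C] and pe = projectionD[OF atoms_projection[OF e]]
  have eA: "e \<in> A" using e masaD(1)[OF C] atoms_mem by blast
  have sa: "\<exists>c. h = c *\<^sub>C e" if h: "h \<in> A" "star h = h" "e * h = h" "h * e = h" for h
  proof -
    have "h * d = d * h" if d: "d \<in> C" for d
    proof -
      obtain c where c: "d * e = c *\<^sub>C e" using e d by (auto simp: atoms_def)
      have ed: "e * d = c *\<^sub>C e" using c abelian_star_subalgebraD(3)[OF ab] e d atoms_mem by metis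
      have "h * d = h * (e * d)" using h by (simp flip: mult.assoc)
      also have "\<dots> = c *\<^sub>C h" using h by (simp add: ed scaleC_mult_right)
      also have "\<dots> = (d * e) * h" using h by (simp add: c scaleC_mult_left)
      also have "\<dots> = d * h" using h by (simp add: mult.assoc)
      finally show ?thesis .
    qed
    then have "h \<in> C" using masa_commutant[OF A(1) C h(1,2)] by blast
    then show ?thesis using e h(4) unfolding atoms_def by force
  qed
  define y where "y = e * x * e"
  have y: "y \<in> A" "star y \<in> A" "e * y = y" "y * e = y" "e * star y = star y" "star y * e = star y"
  proof -
    have sy: "star y = e * star x * e" using pe by (simp add: y_def star_mult mult.assoc)
    show "y \<in> A" "star y \<in> A" unfolding sy unfolding y_def using A(1) eA x by (simp_all add: subalgebra_mult)
    show "e * y = y" "e * star y = star y" unfolding sy unfolding y_def using pe(2) by (metis mult.assoc)+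
    show "y * e = y" "star y * e = star y" unfolding sy unfolding y_def using pe(2) by (metis mult.assoc)+
  qed
  obtain a where a: "y + star y = a *\<^sub>C e"
    using sa[of "y + star y"] y subalgebra_add[OF A(1)]
    by (metis add.commute distrib_left distrib_right star_add star_star)
  obtain b where b: "\<i> *\<^sub>C (y - star y) = b *\<^sub>C e"
  proof -
    let ?h = "\<i> *\<^sub>C (y - star y)"
    have "?h \<in> A" using y A(1) by (simp add: subalgebra_diff subalgebra_scale)
    moreover have "star ?h = ?h" by (simp add: star_scaleC star_diff scaleC_diff_right)
    moreover have "e * ?h = ?h" using y by (simp add: scaleC_mult_right right_diff_distrib)
    moreover have "?h * e = ?h" using y by (simp add: scaleC_mult_left left_diff_distrib)
    ultimately show ?thesis using sa that by blast
  qed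
  have "y - star y = (- \<i>) *\<^sub>C (\<i> *\<^sub>C (y - star y))" by (simp add: scaleC_scaleC)
  then have "y - star y = (- \<i> * b) *\<^sub>C e" by (simp only: b scaleC_scaleC)
  then have "(y + star y) + (y - star y) = (a - \<i> * b) *\<^sub>C e" unfolding a by (simp add: cvs.scale_left_diff_distrib)
  then have "2 *\<^sub>C y = (a - \<i> * b) *\<^sub>C e"
    using scaleC_add_left[of 1 1 y] by simp
  then have "(1/2) *\<^sub>C (2 *\<^sub>C y) = (1/2) *\<^sub>C ((a - \<i> * b) *\<^sub>C e)" by (rule arg_cong)
  then have "y = (1/2 * (a - \<i> * b)) *\<^sub>C e" unfolding scaleC_scaleC by simp
  then show ?thesis unfolding y_def by blast
qed

lemma masa_fd: "masa C A \<Longrightarrow> finite_dimensional A \<Longrightarrow> finite_dimensional (C::'a::cstar_algebra set)"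
  using finite_dimensional_subset masaD(1) by metis

text \<open>The masa supplies the unit of \<open>B\<close>. For \<open>y = x - ?p * x\<close> the
  self-adjoint \<open>y * star y\<close> is orthogonal to \<open>?p\<close>, so it commutes with
  \<open>C\<close>, lies in \<open>C\<close> by maximality, and vanishes because \<open>?p\<close>
  is a unit of \<open>C\<close>.\<close>

lemma masa_unit:
  assumes B: "star_subalgebra B" "finite_dimensional B" and C: "masa C B" and x: "x \<in> (B::'a::cstar_algebra set)"
  shows "(\<Sum>(atoms C)) * x = x" "x * (\<Sum>(atoms C)) = x"
proof -
  note sub = star_subalgebraD[OF B(1)] and ab = masaD(2)[OF C] and fdC = masa_fd[OF C B(2)]
  let ?p = "\<Sum>(atoms C)"
  have pp: "projection ?p" by (rule sum_atoms_projection[OF ab order_refl])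
  have pC: "?p \<in> C" using masaD(4)[OF C] atoms_mem by (auto intro: subalgebra_sum)
  then have pB: "?p \<in> B" using masaD(1)[OF C] by blast
  have L: "?p * x = x" if x: "x \<in> B" for x
  proof -
    define y where "y = x - ?p * x"
    have y: "y \<in> B" using x pB sub by (simp add: y_def subalgebra_diff subalgebra_mult)
    have py: "?p * y = 0" using pp by (simp add: y_def right_diff_distrib projection_def flip: mult.assoc)
    then have yp: "star y * ?p = 0" by (metis pp projectionD(1) star_mult star_zero)
    define h where "h = y * star y"
    have hB: "h \<in> B" using y sub B(1) by (simp add: h_def subalgebra_mult star_subalgebra_star)
    have hp: "h * ?p = 0" "?p * h = 0" using py yp by (simp_all add: h_def mult.assoc) (simp flip: mult.assoc)
    have "h * d = d * h" if d: "d \<in> C" for d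
    proof -
      have "d * ?p = d" by (rule atoms_unit[OF ab fdC d])
      moreover have "?p * d = d * ?p" using abelian_star_subalgebraD(3)[OF ab pC d] .
      ultimately have "h * d = h * ?p * d" "d * h = d * (?p * h)" by (simp_all add: mult.assoc) (simp flip: mult.assoc)
      then show ?thesis using hp by simp
    qed
    then have "h \<in> C" by (intro masa_commutant[OF sub C hB]) (simp_all add: h_def star_mult)
    then have "h = 0" using hp atoms_unit[OF ab fdC] by metis
    then show ?thesis by (simp add: h_def y_def)
  qed
  show "?p * x = x" by (rule L[OF x])
  have "?p * star x = star x" by (rule L) (use x B in \<open>simp add: star_subalgebra_star\<close>)
  then have "star (?p * star x) = star (star x)" by simp
  then show "x * ?p = x" using pp by (simp add: star_mult projection_def)
qed

text \<open>Minimality makes the two products scalar multiples of \<open>f\<close> and of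
  \<open>e\<close>, and the C*-identity gives the modulus of the scalar. What needs an argument is
  its sign: that \<open>star y * y\<close> is positive is not an axiom of an abstract
  C*-algebra.\<close>

lemma minimal_corner:
  assumes B: "star_subalgebra B" and e: "minimal_in B e" and f: "minimal_in B f"
    and ef: "e = f \<or> e * f = (0::'a::cstar_algebra)" and x: "x \<in> B" and y: "y = e * x * f"
  shows "star y * y = complex_of_real ((norm y)\<^sup>2) *\<^sub>C f"
    "y * star y = complex_of_real ((norm y)\<^sup>2) *\<^sub>C e"
proof -
  note sub = star_subalgebraD[OF B]
  note E = minimal_inD(1,3-5)[OF e] and F = minimal_inD(1,3-5)[OF f]
  have sx: "star x \<in> B" using x B by (simp add: star_subalgebra_star)
  obtain a where "f * (star x * e * x) * f = a *\<^sub>C f"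
    using minimal_inD(6)[OF f] x sx E(1) sub by (meson subalgebra_mult)
  then have a: "star y * y = a *\<^sub>C f"
    using E F by (simp add: y star_mult mult.assoc) (metis E(4) mult.assoc)
  obtain b where "e * (x * f * star x) * e = b *\<^sub>C e"
    using minimal_inD(6)[OF e] x sx F(1) sub by (meson subalgebra_mult)
  then have b: "y * star y = b *\<^sub>C e"
    using E F by (simp add: y star_mult mult.assoc) (metis F(4) mult.assoc)
  have ey: "e * y = y" "y * f = y" using E F by (simp_all add: y mult.assoc) (simp flip: mult.assoc)
  have na: "cmod a = (norm y)\<^sup>2"
    using a cstar_identity[of y] norm_projection[OF minimal_inD(2)[OF f] F(2)] by (simp add: norm_scaleC)
  have "a = complex_of_real ((norm y)\<^sup>2) \<and> b = complex_of_real ((norm y)\<^sup>2)" if y0: "y \<noteq> 0"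
  proof -
    have "a *\<^sub>C y = y * (star y * y)" using ey by (simp add: a scaleC_mult_right)
    also have "\<dots> = b *\<^sub>C y" using ey by (simp add: b scaleC_mult_left flip: mult.assoc)
    finally have ab: "a = b" using y0 by (simp add: cvs.scale_cancel_right)
    have "star (star y * y) = star y * y" by (simp add: star_mult)
    then have "cnj a *\<^sub>C f = a *\<^sub>C f" using a F by (simp add: star_scaleC)
    then have "cnj a = a" using F by (simp add: cvs.scale_cancel_right)
    then obtain r where r: "a = complex_of_real r" by (metis Reals_cases Reals_cnj_iff)
    have "0 \<le> r"
    proof (rule ccontr)
      assume "\<not> 0 \<le> r"
      then have neg: "r < 0" by simp
      consider "e = f" | "e * f = 0" using ef by blast
      then show False
      proof cases
        case 1
        obtain c where c: "y = c *\<^sub>C f" using minimal_inD(6)[OF f x] y 1 by blast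
        then have "star y * y = (cnj c * c) *\<^sub>C f" using F
          by (simp add: star_scaleC scaleC_mult_left scaleC_mult_right scaleC_scaleC mult.commute)
        then have "cnj c * c = complex_of_real r" using a r F by (simp add: cvs.scale_cancel_right)
        then have "complex_of_real ((cmod c)\<^sup>2) = complex_of_real r"
          by (simp add: complex_norm_square[of c] mult.commute del: of_real_power)
        then have "(cmod c)\<^sup>2 = r" by (simp only: of_real_eq_iff)
        then show False using neg by (metis not_less zero_le_power2)
      next
        case 2
        have fe: "f * e = 0" using 2 E F by (metis star_mult star_zero)
        have ye: "y * e = 0" using fe by (simp add: y mult.assoc)
        have es: "e * star y = 0" using ye E by (metis star_mult star_zero)
        have yy: "y * y = 0" using fe by (simp add: y mult.assoc) (metis mult.assoc mult_zero_left mult_zero_right)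
        then have ss: "star y * star y = 0" by (metis star_mult star_zero)
        have fy: "f * y = 0" using fe by (simp add: y flip: mult.assoc)
        then have sf: "star y * f = 0" using F by (metis star_mult star_zero)
        have se: "star y * e = star y" "f * star y = star y" using ey E F by (metis star_mult)+
        define w where "w = y + star y"
        define P where "P = e + f"
        have ww: "w * w = a *\<^sub>C P"
          using a b ab yy ss by (simp add: w_def P_def distrib_left distrib_right scaleC_add_right)
        have pw: "P * w = w" "w * P = w"
          using ey es fy se ye sf by (simp_all add: w_def P_def distrib_left distrib_right)
        have pp: "P * P = P" "star P = P"
          using E F 2 fe by (simp_all add: P_def distrib_left distrib_right star_add)
        define s where "s = complex_of_real (sqrt (- r))"
        have s: "s * s = - a" "s \<noteq> 0" "cnj s = s" using neg r by (simp_all add: s_def flip: of_real_mult)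
        \<comment> \<open>If the scalar were \<open>r < 0\<close>, the self-adjoint
          \<open>w = y + star y\<close> would satisfy \<open>w * w = r P\<close>. With
          \<open>s = sqrt (- r)\<close> this gives \<open>star z * z = 0\<close>, although the
          corner of \<open>z\<close> at \<open>e\<close> is the nonzero \<open>s e\<close>.\<close>
        define z where "z = s *\<^sub>C P + \<i> *\<^sub>C w"
        have sz: "star z = s *\<^sub>C P - \<i> *\<^sub>C w"
          using pp s by (simp add: z_def w_def star_add star_scaleC add.commute)
        have "star z * z = (s * s) *\<^sub>C P + w * w"
          unfolding sz unfolding z_def
          by (simp add: distrib_left left_diff_distrib scaleC_mult_left scaleC_mult_right pp pw scaleC_scaleC
              scaleC_diff_right mult.commute)
        then have "star z * z = 0" using ww s by simp
        then have z0: "z = 0" by simp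
        have ewe: "e * w * e = 0" using ye es by (simp add: w_def distrib_left distrib_right mult.assoc)
        have "e * z * e = s *\<^sub>C e"
          using E 2 ewe by (simp add: z_def P_def distrib_left distrib_right scaleC_mult_left scaleC_mult_right)
        then show False using z0 s E by simp
      qed
    qed
    then show ?thesis using na r ab by simp
  qed
  then show "star y * y = complex_of_real ((norm y)\<^sup>2) *\<^sub>C f"
    "y * star y = complex_of_real ((norm y)\<^sup>2) *\<^sub>C e"
    using a b by (cases "y = 0"; simp)+
qed

text \<open>With \<open>z = e y f\<close> nonzero, \<open>f\<close> is a multiple of
  \<open>star z * z\<close>. Inserting this on the right of \<open>e x f\<close> leaves an element
  of the corner at \<open>e\<close>, which is a scalar, times \<open>z\<close>.\<close>

lemma minimal_corner_line:
  assumes B: "star_subalgebra B" and e: "minimal_in B e" and f: "minimal_in B f"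
    and ef: "e = f \<or> e * f = (0::'a::cstar_algebra)" and x: "x \<in> B" and y: "y \<in> B" "e * y * f \<noteq> 0"
  shows "\<exists>c. e * x * f = c *\<^sub>C (e * y * f)"
proof -
  define z where "z = e * y * f"
  define n where "n = complex_of_real ((norm z)\<^sup>2)"
  have n0: "n \<noteq> 0" using y(2) by (simp add: n_def z_def)
  note E = minimal_inD[OF e] and F = minimal_inD[OF f] and sub = star_subalgebraD[OF B]
  have zz: "star z * z = n *\<^sub>C f" unfolding n_def by (rule minimal_corner(1)[OF B e f ef y(1) z_def])
  have ez: "e * z = z" "star z * e = star z" using E(4,5)
    by (simp_all add: z_def star_mult mult.assoc) (simp_all flip: mult.assoc)
  have "x * f * star z \<in> B" using x y E(1) F(1) B sub by (simp add: z_def subalgebra_mult star_subalgebra_star)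
  then obtain c where c: "e * (x * f * star z) * e = c *\<^sub>C e" using E(6) by blast
  have "n *\<^sub>C (e * x * f) = e * x * f * (n *\<^sub>C f)" using F(5) by (simp add: scaleC_mult_right mult.assoc)
  also have "\<dots> = e * x * f * (star z * z)" by (simp add: zz)
  also have "\<dots> = e * (x * f * (star z * e)) * z" by (simp add: ez mult.assoc)
  also have "\<dots> = (e * (x * f * star z) * e) * z" by (simp add: mult.assoc)
  also have "\<dots> = c *\<^sub>C z" by (simp add: c scaleC_mult_left ez)
  finally have "(1 / n) *\<^sub>C (n *\<^sub>C (e * x * f)) = (1 / n) *\<^sub>C (c *\<^sub>C z)" by simp
  then show ?thesis using n0 by (auto simp: z_def scaleC_scaleC)
qed

lemma closed_line: "closed (range (\<lambda>c. c *\<^sub>C (u::'a::cstar_algebra)))"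
proof (cases "u = 0")
  case False
  show ?thesis
    unfolding closed_sequential_limits
  proof (intro allI impI)
    fix x l assume "(\<forall>n. x n \<in> range (\<lambda>c. c *\<^sub>C u)) \<and> x \<longlonglongrightarrow> l"
    then have "\<forall>n. \<exists>c. x n = c *\<^sub>C u" and l: "x \<longlonglongrightarrow> l" by blast+
    then obtain c where c: "\<And>n. x n = c n *\<^sub>C u" by metis
    have d: "dist (x m) (x n) = dist (c m) (c n) * norm u" for m n
      by (simp add: c dist_norm norm_scaleC flip: cvs.scale_left_diff_distrib)
    have "Cauchy x" using l by (simp add: LIMSEQ_imp_Cauchy)
    have "Cauchy c"
      unfolding Cauchy_def
    proof (intro allI impI)
      fix r :: real assume "r > 0"
      then have "r * norm u > 0" using False by simp
      with \<open>Cauchy x\<close> obtain M where "\<forall>m\<ge>M. \<forall>n\<ge>M. dist (x m) (x n) < r * norm u"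
        unfolding Cauchy_def by blast
      then show "\<exists>M. \<forall>m\<ge>M. \<forall>n\<ge>M. dist (c m) (c n) < r" using False by (auto simp: d)
    qed
    then obtain a where a: "c \<longlonglongrightarrow> a" using Cauchy_convergent_iff convergent_def by blast
    have "x \<longlonglongrightarrow> a *\<^sub>C u"
    proof (rule tendstoI)
      fix r :: real assume "r > 0"
      then have "\<forall>\<^sub>F n in sequentially. dist (c n) a < r / norm u" using a False by (intro tendstoD) auto
      then show "\<forall>\<^sub>F n in sequentially. dist (x n) (a *\<^sub>C u) < r"
      proof eventually_elim
        case (elim n)
        have "dist (x n) (a *\<^sub>C u) = dist (c n) a * norm u"
          by (simp add: c dist_norm norm_scaleC flip: cvs.scale_left_diff_distrib)
        then show ?case using elim False by (simp add: pos_less_divide_eq)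
      qed
    qed
    then show "l \<in> range (\<lambda>c. c *\<^sub>C u)" using l LIMSEQ_unique by blast
  qed
qed simp

lemma fd_masa_atoms:
  assumes B: "star_subalgebra B" "finite_dimensional B" and C: "masa C B"
    and e: "e \<in> atoms (C::'a::cstar_algebra set)"
  shows "minimal_in B e"
  using masa_corner[OF star_subalgebraD[OF B(1)] B(2) C e] star_subalgebra_star[OF B(1)]
    masaD(1)[OF C] atoms_mem[OF e] atoms_projection[OF e] atoms_nonzero[OF e]
  by (auto simp: minimal_in_def)

text \<open>\<open>generated_cstar\<close> intersects closed subalgebras only, so finite-dimensional
  ones must be shown to be closed. Cut the limit \<open>l\<close> by the atoms of a masa: each
  corner of the sequence runs in a fixed line of \<open>B\<close>, lines are closed because the
  complex numbers are complete, and \<open>l\<close> is the sum of its corners.\<close>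

lemma fd_closed:
  assumes B: "star_subalgebra B" "finite_dimensional (B::'a::cstar_algebra set)"
  shows "closed B"
  unfolding closed_sequential_limits
proof (intro allI impI)
  note sub = star_subalgebraD[OF B(1)]
  obtain C where C: "masa C B"
    using masa_extension[OF B(2) trivial_abelian] subalgebra_zero[OF sub] by blast
  fix x l assume "(\<forall>n. x n \<in> B) \<and> x \<longlonglongrightarrow> l"
  then have x: "\<And>n. x n \<in> B" and l: "x \<longlonglongrightarrow> l" by auto
  let ?p = "\<Sum>(atoms C)"
  have "(\<lambda>n. ?p * x n * ?p) \<longlonglongrightarrow> ?p * l * ?p" by (intro tendsto_intros l)
  then have "x \<longlonglongrightarrow> ?p * l * ?p" using masa_unit[OF B C x] by simp
  then have lp: "l = ?p * l * ?p" using l LIMSEQ_unique by blast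
  have "e * l * f \<in> B" if e: "e \<in> atoms C" and f: "f \<in> atoms C" for e f
  proof -
    have "(\<lambda>n. e * x n * f) \<longlonglongrightarrow> e * l * f" by (intro tendsto_intros l)
    obtain u where u: "u \<in> B" "\<And>n. e * x n * f \<in> range (\<lambda>c. c *\<^sub>C u)"
    proof (cases "\<exists>n. e * x n * f \<noteq> 0")
      case True
      then obtain n where n: "e * x n * f \<noteq> 0" by blast
      have ef: "e = f \<or> e * f = 0" using atoms_mult[OF masaD(2)[OF C] e f] by auto
      show ?thesis
      proof
        show "e * x n * f \<in> B" using x e f masaD(1)[OF C] atoms_mem sub by (meson subalgebra_mult subsetD)
        show "e * x m * f \<in> range (\<lambda>c. c *\<^sub>C (e * x n * f))" for m
          using minimal_corner_line[OF B(1) fd_masa_atoms[OF B C e] fd_masa_atoms[OF B C f] ef x x n, of m] by auto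
      qed
    next
      case False
      then show ?thesis using that[of 0] subalgebra_zero[OF sub] by auto
    qed
    have "e * l * f \<in> range (\<lambda>c. c *\<^sub>C u)"
      using closed_sequentially[OF closed_line, of "\<lambda>n. e * x n * f"] u(2)
        \<open>(\<lambda>n. e * x n * f) \<longlonglongrightarrow> e * l * f\<close> by blast
    then show ?thesis using u(1) sub by (auto simp: subalgebra_scale)
  qed
  then have "(\<Sum>e\<in>atoms C. \<Sum>f\<in>atoms C. e * l * f) \<in> B" by (intro subalgebra_sum[OF sub])
  also have "(\<Sum>e\<in>atoms C. \<Sum>f\<in>atoms C. e * l * f) = ?p * l * ?p"
    by (simp add: sum_distrib_left sum_distrib_right) (rule sum.swap)
  finally show "l \<in> B" using lp by simp
qed

subsection \<open>Digraph algebras\<close>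

lemma generated_superset: "A \<subseteq> generated_cstar A"
  unfolding generated_cstar_def by blast

lemma generated_closed: "closed (generated_cstar A)"
  unfolding generated_cstar_def by (rule closed_Inter) blast

lemma generated_least: "star_subalgebra B \<Longrightarrow> closed B \<Longrightarrow> A \<subseteq> B \<Longrightarrow> generated_cstar A \<subseteq> B"
  unfolding generated_cstar_def by blast

lemma generated_star_subalgebra: "star_subalgebra (generated_cstar A)"
proof -
  have *: "star_subalgebra (\<Inter>S)" if "\<And>B. B \<in> S \<Longrightarrow> star_subalgebra B" for S :: "'a set set"
    using that by (simp add: star_subalgebra_def subalgebra_def)
  show ?thesis unfolding generated_cstar_def by (rule *) simp
qed

lemma generated_subalgebra: "subalgebra (generated_cstar A)"
  by (rule star_subalgebraD[OF generated_star_subalgebra])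

lemma digraph_subalgebra: "digraph_algebra A \<Longrightarrow> subalgebra A"
  by (simp add: digraph_algebra_def)

lemma digraph_algebraE:
  assumes "digraph_algebra A"
  obtains B C where "star_subalgebra B" "finite_dimensional B" "A \<subseteq> B" "masa C B" "C \<subseteq> A" "generated_cstar A \<subseteq> B"
proof -
  obtain B C where "star_subalgebra B" "finite_dimensional B" "A \<subseteq> B" "masa C B" "C \<subseteq> A"
    using assms unfolding digraph_algebra_def by blast
  then show ?thesis using that generated_least[OF _ fd_closed] by metis
qed

lemma digraph_generated_fd: "digraph_algebra A \<Longrightarrow> finite_dimensional (generated_cstar A)"
  by (metis digraph_algebraE finite_dimensional_subset)

lemma digraph_fd: "digraph_algebra A \<Longrightarrow> finite_dimensional A"
  by (metis digraph_algebraE finite_dimensional_subset)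

text \<open>The intersection of \<open>T\<close> with the finite-dimensional
  \<open>generated_cstar A\<close> is finite-dimensional, hence closed, even when \<open>T\<close>
  is not known to be closed.\<close>

lemma digraph_least:
  assumes A: "digraph_algebra A" and T: "star_subalgebra T" "A \<subseteq> T"
  shows "generated_cstar A \<subseteq> T"
proof -
  have "star_subalgebra (T \<inter> generated_cstar A)"
    using T(1) generated_star_subalgebra[of A] by (simp add: star_subalgebra_def subalgebra_def)
  moreover from this have "closed (T \<inter> generated_cstar A)"
    by (rule fd_closed) (rule finite_dimensional_subset[OF digraph_generated_fd[OF A]], simp)
  ultimately have "generated_cstar A \<subseteq> T \<inter> generated_cstar A"
    by (rule generated_least) (use T generated_superset in auto)
  then show ?thesis by blast
qed

lemma fd_masa_exists:
  assumes "subalgebra B" "finite_dimensional (B::'a::cstar_algebra set)"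
  obtains C where "masa C B"
  using masa_extension[OF assms(2) trivial_abelian] subalgebra_zero[OF assms(1)] by blast

lemma fd_digraph:
  assumes "star_subalgebra B" "finite_dimensional (B::'a::cstar_algebra set)"
  shows "digraph_algebra B" "generated_cstar B = B"
proof -
  obtain C where "masa C B" using fd_masa_exists[OF star_subalgebraD] assms by blast
  then have "star_subalgebra B \<and> finite_dimensional B \<and> B \<subseteq> B \<and> (\<exists>C. masa C B \<and> C \<subseteq> B)"
    using assms masaD(1) by blast
  then show "digraph_algebra B"
    unfolding digraph_algebra_def using star_subalgebraD by blast
  show "generated_cstar B = B"
    using generated_least[OF assms(1) fd_closed[OF assms]] generated_superset by blast
qed

text \<open>Up to the factor \<open>\<beta>\<close> the element \<open>u\<close> is a partial
  isometry from \<open>q\<close> to \<open>e\<close>. So \<open>e b e\<close> can be rewritten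
  through \<open>u (q (star u b u) q) star u\<close>, and the corner at \<open>q\<close> is scalar.
  The factor allows \<open>u\<close> to be a product of two projections.\<close>

lemma minimal_transfer:
  assumes B: "star_subalgebra B" and q: "minimal_in B q" and u: "u \<in> B" "u * q = u"
    and e: "u * star u = \<beta> *\<^sub>C e" "\<beta> \<noteq> 0" "projection e" "e \<noteq> 0" "e \<in> (B::'a::cstar_algebra set)"
  shows "minimal_in B e"
proof -
  note Q = minimal_inD[OF q] and sub = star_subalgebraD[OF B]
  have "\<exists>c. e * b * e = c *\<^sub>C e" if b: "b \<in> B" for b
  proof -
    have "star u * b * u \<in> B" using u b B sub by (simp add: subalgebra_mult star_subalgebra_star)
    then obtain c where c: "q * (star u * b * u) * q = c *\<^sub>C q" using Q(6) by blast
    have qu: "q * star u = star u" using u(2) Q(4) by (metis star_mult)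
    have "(\<beta> *\<^sub>C e) * b * (\<beta> *\<^sub>C e) = u * (q * (star u * b * u) * q) * star u"
      unfolding e(1)[symmetric] using qu u(2) by (metis mult.assoc)
    also have "\<dots> = (c * \<beta>) *\<^sub>C e"
      by (simp add: c scaleC_mult_left scaleC_mult_right u(2) e(1) scaleC_scaleC)
    finally have "(\<beta> * \<beta>) *\<^sub>C (e * b * e) = (c * \<beta>) *\<^sub>C e"
      by (simp add: scaleC_mult_left scaleC_mult_right scaleC_scaleC)
    then have "inverse (\<beta> * \<beta>) *\<^sub>C ((\<beta> * \<beta>) *\<^sub>C (e * b * e)) = inverse (\<beta> * \<beta>) *\<^sub>C ((c * \<beta>) *\<^sub>C e)"
      by (rule arg_cong)
    moreover have "inverse (\<beta> * \<beta>) * (\<beta> * \<beta>) = 1" by (rule left_inverse) (use e(2) in simp)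
    ultimately have "e * b * e = (inverse (\<beta> * \<beta>) * (c * \<beta>)) *\<^sub>C e"
      by (metis scaleC_scaleC cvs.scale_one)
    then show ?thesis by blast
  qed
  then show ?thesis using e by (simp add: minimal_in_def)
qed

context
  fixes A C :: "'a::cstar_algebra set"
  assumes A: "digraph_algebra A" and C: "masa C A"
begin

lemma digraph_atoms_finite: "finite (atoms C)"
  by (rule finite_atoms[OF masaD(2)[OF C] masa_fd[OF C digraph_fd[OF A]]])

lemma digraph_atoms_mem: "e \<in> atoms C \<Longrightarrow> e \<in> A"
  using masaD(1)[OF C] atoms_mem by blast

lemma digraph_atoms_mult: "e \<in> atoms C \<Longrightarrow> f \<in> atoms C \<Longrightarrow> e * f = (if e = f then e else 0)"
  by (rule atoms_mult[OF masaD(2)[OF C]])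

lemma digraph_unit_mem: "(\<Sum>(atoms C)) \<in> C" "(\<Sum>(atoms C)) \<in> A" "(\<Sum>(atoms C)) \<in> generated_cstar A"
proof -
  show "(\<Sum>(atoms C)) \<in> C" using masaD(4)[OF C] atoms_mem by (auto intro: subalgebra_sum)
  then show "(\<Sum>(atoms C)) \<in> A" "(\<Sum>(atoms C)) \<in> generated_cstar A"
    using masaD(1)[OF C] generated_superset by blast+
qed

text \<open>The masa \<open>C0\<close> of the larger algebra \<open>B\<close> yields a unit of
  \<open>B\<close>. That unit is self-adjoint, lies in \<open>A\<close> and commutes with
  everything, so it belongs to the given masa \<open>C\<close> of \<open>A\<close> and coincides
  with the sum of its atoms.\<close>

lemma digraph_unit:
  assumes x: "x \<in> generated_cstar A"
  shows "(\<Sum>(atoms C)) * x = x" "x * (\<Sum>(atoms C)) = x"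
proof -
  obtain B C0 where B: "star_subalgebra B" "finite_dimensional B" "A \<subseteq> B" "masa C0 B" "C0 \<subseteq> A" "generated_cstar A \<subseteq> B"
    using digraph_algebraE[OF A] .
  let ?p = "\<Sum>(atoms C0)"
  have pC0: "?p \<in> C0" using masaD(4)[OF B(4)] atoms_mem by (auto intro: subalgebra_sum)
  have pu: "?p * y = y" "y * ?p = y" if "y \<in> B" for y
    using masa_unit[OF B(1,2,4) that] by simp_all
  have "star ?p = ?p" using sum_atoms_projection[OF masaD(2)[OF B(4)] order_refl] by (rule projectionD)
  moreover have "?p \<in> A" using pC0 B(5) by blast
  moreover have "?p * c = c * ?p" if "c \<in> C" for c
    using that pu[of c] masaD(1)[OF C] B(3) by auto
  ultimately have "?p \<in> C" using masa_commutant[OF digraph_subalgebra[OF A] C] by blast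
  then have "?p * (\<Sum>(atoms C)) = ?p"
    using atoms_unit[OF masaD(2)[OF C] masa_fd[OF C digraph_fd[OF A]]] by blast
  then have "(\<Sum>(atoms C)) = ?p" using pu(1)[of "\<Sum>(atoms C)"] digraph_unit_mem(2) B(3) by auto
  then show "(\<Sum>(atoms C)) * x = x" "x * (\<Sum>(atoms C)) = x" using pu[of x] x B(6) by auto
qed

lemma digraph_expand:
  assumes x: "x \<in> generated_cstar A"
  shows "x = (\<Sum>e\<in>atoms C. \<Sum>f\<in>atoms C. e * x * f)"
proof -
  have "x = (\<Sum>(atoms C)) * x * (\<Sum>(atoms C))" using digraph_unit[OF x] by simp
  also have "\<dots> = (\<Sum>e\<in>atoms C. \<Sum>f\<in>atoms C. e * x * f)"
    by (simp add: sum_distrib_left sum_distrib_right) (rule sum.swap)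
  finally show ?thesis .
qed

text \<open>\<open>C\<close> is maximal only among subalgebras of \<open>A\<close>, so minimality of
  its atoms in the generated algebra is not automatic. Some atom \<open>q\<close> of the masa of
  \<open>B\<close> meets \<open>e\<close>; both lie in \<open>A\<close>, so
  \<open>masa_corner\<close> makes \<open>e q e\<close> scalar, and \<open>minimal_transfer\<close>
  along \<open>u = e q\<close> carries the minimality of \<open>q\<close> to
  \<open>e\<close>.\<close>

lemma digraph_atoms_minimal:
  assumes e: "e \<in> atoms C"
  shows "minimal_in (generated_cstar A) e"
proof -
  obtain B C0 where B: "star_subalgebra B" "finite_dimensional B" "A \<subseteq> B" "masa C0 B" "C0 \<subseteq> A" "generated_cstar A \<subseteq> B"
    using digraph_algebraE[OF A] .
  have eA: "e \<in> A" by (rule digraph_atoms_mem[OF e])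
  then have eB: "e \<in> B" using B by blast
  note pe = projectionD[OF atoms_projection[OF e]]
  have "\<exists>q\<in>atoms C0. e * q \<noteq> 0"
  proof (rule ccontr)
    assume "\<not> ?thesis"
    then have "e * (\<Sum>(atoms C0)) = 0" by (simp add: sum_distrib_left)
    then show False using masa_unit(2)[OF B(1,2,4) eB] atoms_nonzero[OF e] by simp
  qed
  then obtain q where q: "q \<in> atoms C0" "e * q \<noteq> 0" by blast
  have qA: "q \<in> A" using q B(5) atoms_mem by blast
  note pq = projectionD[OF atoms_projection[OF q(1)]]
  define u where "u = e * q"
  obtain \<beta> where \<beta>: "e * q * e = \<beta> *\<^sub>C e"
    using masa_corner[OF digraph_subalgebra[OF A] digraph_fd[OF A] C e qA] qA pq by auto
  have uu: "u * star u = \<beta> *\<^sub>C e"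
    using \<beta> pe pq by (simp add: u_def star_mult) (metis mult.assoc)
  have "\<beta> \<noteq> 0" using uu q(2) by (auto simp: u_def)
  have "minimal_in B e"
    by (rule minimal_transfer[OF B(1) fd_masa_atoms[OF B(1,2,4) q(1)] _ _ uu \<open>\<beta> \<noteq> 0\<close>])
      (use eB qA B(1,3) pq atoms_projection[OF e] atoms_nonzero[OF e] star_subalgebraD[OF B(1)] in
        \<open>auto simp: u_def mult.assoc subalgebra_mult\<close>)
  then show ?thesis using B(6) eA generated_superset by (auto simp: minimal_in_def)
qed

lemma digraph_atoms_orthogonal: "e \<in> atoms C \<Longrightarrow> f \<in> atoms C \<Longrightarrow> e = f \<or> e * f = 0"
  using digraph_atoms_mult[of e f] by auto

lemma digraph_line:
  assumes e: "e \<in> atoms C" and f: "f \<in> atoms C" and x: "x \<in> generated_cstar A"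
    and y: "y \<in> generated_cstar A" "e * y * f \<noteq> 0"
  shows "\<exists>c. e * x * f = c *\<^sub>C (e * y * f)"
  by (rule minimal_corner_line[OF generated_star_subalgebra digraph_atoms_minimal[OF e]
        digraph_atoms_minimal[OF f] digraph_atoms_orthogonal[OF e f] x y])

lemma digraph_corner_norm:
  assumes e: "e \<in> atoms C" and f: "f \<in> atoms C" shows "norm (e * x * f) \<le> norm x"
proof -
  have "norm (e * x * f) \<le> norm e * norm x * norm f"
    by (meson mult_right_mono norm_ge_zero norm_mult_ineq order_trans)
  also have "norm e = 1" by (rule norm_projection[OF atoms_projection[OF e] atoms_nonzero[OF e]])
  also have "norm f = 1" by (rule norm_projection[OF atoms_projection[OF f] atoms_nonzero[OF f]])
  finally show ?thesis by simp
qed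

lemma digraph_atom_overlap:
  assumes "x \<in> generated_cstar A" "x \<noteq> 0"
  shows "\<exists>e\<in>atoms C. x * e \<noteq> 0"
proof (rule ccontr)
  assume "\<not> ?thesis"
  then have "x * (\<Sum>(atoms C)) = 0" by (simp add: sum_distrib_left)
  then show False using digraph_unit(2)[OF assms(1)] assms(2) by simp
qed

end

definition complex_linear_on :: "'a::cstar_algebra set \<Rightarrow> ('a \<Rightarrow> 'b::cstar_algebra) \<Rightarrow> bool" where
  "complex_linear_on A g \<longleftrightarrow> (\<forall>x\<in>A. \<forall>y\<in>A. g (x + y) = g x + g y) \<and> (\<forall>c. \<forall>x\<in>A. g (c *\<^sub>C x) = c *\<^sub>C g x)"

lemma star_hom_linear: "star_hom f A B \<Longrightarrow> complex_linear_on A f"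
  by (auto simp: star_hom_def complex_linear_on_def)

lemma complex_linear_on_diff:
  "complex_linear_on A f \<Longrightarrow> complex_linear_on A g \<Longrightarrow> complex_linear_on A (\<lambda>x. f x - g x)"
  by (simp add: complex_linear_on_def scaleC_diff_right)

lemma complex_linear_on_subset: "complex_linear_on A f \<Longrightarrow> A' \<subseteq> A \<Longrightarrow> complex_linear_on A' f"
  unfolding complex_linear_on_def by blast

text \<open>The finite test set consists of the normalised matrix units that lie in \<open>A\<close>.\<close>

lemma digraph_finite_test:
  assumes A: "digraph_algebra (A::'a::cstar_algebra set)"
  shows "\<exists>S K. finite S \<and> S \<subseteq> A \<and> 0 \<le> K \<and>
    (\<forall>(g::'a \<Rightarrow> 'b::cstar_algebra) \<delta>. complex_linear_on A g \<longrightarrow> 0 \<le> \<delta> \<longrightarrow> (\<forall>s\<in>S. norm (g s) \<le> \<delta>)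
       \<longrightarrow> (\<forall>x\<in>A. norm (g x) \<le> K * \<delta> * norm x))"
proof -
  obtain C where C: "masa C A" using fd_masa_exists[OF digraph_subalgebra digraph_fd] A by blast
  note sub = digraph_subalgebra[OF A]
  define P where "P = atoms C"
  have finP: "finite P" using digraph_atoms_finite[OF A C] by (simp add: P_def)
  have "\<exists>u. u \<in> A \<and> (\<forall>x\<in>A. \<exists>c. e * x * f = c *\<^sub>C u \<and> cmod c \<le> norm x)" if ef: "e \<in> P" "f \<in> P" for e f
  proof (cases "\<exists>y\<in>A. e * y * f \<noteq> 0")
    case True
    then obtain y where y: "y \<in> A" "e * y * f \<noteq> 0" by blast
    define n where "n = norm (e * y * f)"
    have n: "n > 0" using y by (simp add: n_def)
    define u where "u = complex_of_real (1 / n) *\<^sub>C (e * y * f)"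
    have "e * y * f \<in> A" using y ef digraph_atoms_mem[OF A C] sub by (simp add: P_def subalgebra_mult)
    then have uA: "u \<in> A" using sub by (simp add: u_def subalgebra_scale)
    have nu: "norm u = 1" using n by (simp add: u_def norm_scaleC n_def norm_divide)
    have "\<exists>c. e * x * f = c *\<^sub>C u \<and> cmod c \<le> norm x" if x: "x \<in> A" for x
    proof -
      obtain c where c: "e * x * f = c *\<^sub>C (e * y * f)"
        using digraph_line[OF A C _ _ _ _ y(2)] x y ef generated_superset unfolding P_def by blast
      define c' where "c' = c * complex_of_real n"
      have 1: "e * x * f = c' *\<^sub>C u" using n by (simp add: c u_def c'_def scaleC_scaleC)
      then have "cmod c' = norm (e * x * f)" using nu by (simp add: norm_scaleC)
      also have "\<dots> \<le> norm x" using digraph_corner_norm[OF A C] ef by (simp add: P_def)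
      finally show ?thesis using 1 by blast
    qed
    then show ?thesis using uA by blast
  next
    case False
    then show ?thesis by (intro exI[of _ 0]) (auto simp: subalgebra_zero[OF sub] intro!: exI[of _ 0])
  qed
  then obtain u where u: "\<And>e f. e \<in> P \<Longrightarrow> f \<in> P \<Longrightarrow> u e f \<in> A"
    "\<And>e f x. e \<in> P \<Longrightarrow> f \<in> P \<Longrightarrow> x \<in> A \<Longrightarrow> \<exists>c. e * x * f = c *\<^sub>C u e f \<and> cmod c \<le> norm x"
    by metis
  define S where "S = (\<lambda>(e, f). u e f) ` (P \<times> P)"
  \<comment> \<open>The constant counts pairs of atoms: there is one test element per pair, and its
    coefficient in \<open>x\<close> is at most \<open>norm x\<close>.\<close>
  show ?thesis
  proof (intro exI[of _ S] exI[of _ "real (card P) * real (card P)"] conjI allI impI ballI)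
    show "finite S" using finP by (simp add: S_def)
    show "S \<subseteq> A" using u(1) by (auto simp: S_def)
    show "0 \<le> real (card P) * real (card P)" by simp
  next
    fix g :: "'a \<Rightarrow> 'b" and \<delta> x
    assume "complex_linear_on A g" and \<delta>: "0 \<le> \<delta>" and S: "\<forall>s\<in>S. norm (g s) \<le> \<delta>" and x: "x \<in> A"
    then have add: "\<And>x y. x \<in> A \<Longrightarrow> y \<in> A \<Longrightarrow> g (x + y) = g x + g y"
      and sc: "\<And>c x. x \<in> A \<Longrightarrow> g (c *\<^sub>C x) = c *\<^sub>C g x"
      by (simp_all add: complex_linear_on_def)
    have g0: "g 0 = 0" using sc[of 0 0] subalgebra_zero[OF sub] by simp
    have gs: "g (sum h T) = (\<Sum>i\<in>T. g (h i))" if "\<And>i. i \<in> T \<Longrightarrow> h i \<in> A" for h :: "'a \<Rightarrow> 'a" and T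
      using that by (induction T rule: infinite_finite_induct) (auto simp: g0 add subalgebra_sum[OF sub])
    have mem: "e * x * f \<in> A" if "e \<in> P" "f \<in> P" for e f
      using that x digraph_atoms_mem[OF A C] sub by (simp add: P_def subalgebra_mult)
    have xg: "x \<in> generated_cstar A" using x generated_superset by blast
    have "g x = g (\<Sum>e\<in>P. \<Sum>f\<in>P. e * x * f)" using digraph_expand[OF A C xg] by (simp add: P_def)
    also have "\<dots> = (\<Sum>e\<in>P. \<Sum>f\<in>P. g (e * x * f))"
      using mem sub by (simp add: gs subalgebra_sum)
    finally have "norm (g x) \<le> (\<Sum>e\<in>P. norm (\<Sum>f\<in>P. g (e * x * f)))" by (simp add: norm_sum)
    also have "\<dots> \<le> (\<Sum>e\<in>P. \<Sum>f\<in>P. norm (g (e * x * f)))" by (intro sum_mono norm_sum)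
    also have "\<dots> \<le> (\<Sum>e\<in>P. \<Sum>f\<in>P. \<delta> * norm x)"
    proof (intro sum_mono)
      fix e f assume ef: "e \<in> P" "f \<in> P"
      obtain c where c: "e * x * f = c *\<^sub>C u e f" "cmod c \<le> norm x" using u(2)[OF ef x] by blast
      have "norm (g (e * x * f)) = cmod c * norm (g (u e f))" using c(1) sc u(1)[OF ef] by (simp add: norm_scaleC)
      also have "\<dots> \<le> norm x * \<delta>" using c(2) S ef by (intro mult_mono) (auto simp: S_def)
      finally show "norm (g (e * x * f)) \<le> \<delta> * norm x" by (simp add: mult.commute)
    qed
    also have "\<dots> = real (card P) * real (card P) * \<delta> * norm x" by simp
    finally show "norm (g x) \<le> real (card P) * real (card P) * \<delta> * norm x" .
  qed
qed

text \<open>\<open>digraph_finite_test\<close> gives some bound for the norm of \<open>f\<close>,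
  and \<open>star_hom_contractive_if_bounded\<close> improves any bound to 1.\<close>

lemma star_hom_contractive:
  assumes B: "star_subalgebra B" "finite_dimensional (B::'a::cstar_algebra set)"
    and f: "star_hom f B (B'::'b::cstar_algebra set)" and x: "x \<in> B"
  shows "norm (f x) \<le> norm x"
proof -
  obtain S K where S: "finite S" and
    K: "\<And>(g::'a \<Rightarrow> 'b) \<delta>. complex_linear_on B g \<Longrightarrow> 0 \<le> \<delta> \<Longrightarrow> \<forall>s\<in>S. norm (g s) \<le> \<delta>
       \<Longrightarrow> \<forall>x\<in>B. norm (g x) \<le> K * \<delta> * norm x"
    using digraph_finite_test[OF fd_digraph(1)[OF B], where ?'b = 'b] by metis
  define \<delta> where "\<delta> = (\<Sum>s\<in>S. norm (f s))"
  have "norm (f s) \<le> \<delta>" if "s \<in> S" for s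
    unfolding \<delta>_def using S that by (intro member_le_sum) auto
  moreover have "0 \<le> \<delta>" by (simp add: \<delta>_def sum_nonneg)
  ultimately have "norm (f y) \<le> K * \<delta> * norm y" if "y \<in> B" for y
    using K[OF star_hom_linear[OF f], of \<delta>] that by blast
  then show ?thesis using star_hom_contractive_if_bounded[OF f B(1) x] by blast
qed

text \<open>Multiplicity one is tested on projections of \<open>A\<close>, in particular on atoms;
  this extends it to all minimal projections of the generated algebra. Such an \<open>f\<close>
  meets an atom \<open>e\<close>, and the image of \<open>f * e\<close> transfers minimality from
  \<open>h e\<close> to \<open>h f\<close>; if \<open>h e\<close> were zero, so would be
  \<open>h f\<close>.\<close>

lemma hom_minimal:
  assumes A: "digraph_algebra A" and C: "masa C A" and B: "star_subalgebra B"
    and h: "star_hom h (generated_cstar A) B"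
    and at: "\<And>e. e \<in> atoms C \<Longrightarrow> h e = 0 \<or> minimal_in B (h e)"
    and f: "minimal_in (generated_cstar A) (f::'a::cstar_algebra)"
  shows "h f = (0::'b::cstar_algebra) \<or> minimal_in B (h f)"
proof (cases "h f = 0")
  case False
  note F = minimal_inD[OF f] and hD = star_homD[OF h]
  obtain e where e: "e \<in> atoms C" "f * e \<noteq> 0" using digraph_atom_overlap[OF A C F(1,3)] by blast
  note E = minimal_inD[OF digraph_atoms_minimal[OF A C e(1)]]
  obtain \<beta> where \<beta>: "f * e * f = \<beta> *\<^sub>C f" using F(6)[OF E(1)] by blast
  have feG: "f * e \<in> generated_cstar A" using F(1) E(1) by (simp add: subalgebra_mult[OF generated_subalgebra])
  have u: "(f * e) * star (f * e) = \<beta> *\<^sub>C f" using \<beta> E F by (simp add: star_mult) (metis mult.assoc)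
  have b0: "\<beta> \<noteq> 0" using u e(2) by auto
  have hu: "h (f * e) * star (h (f * e)) = \<beta> *\<^sub>C h f"
    using u hD(3,5)[of "f * e"] hD(3)[of "f * e" "star (f * e)"] hD(4)[OF F(1)] feG
      star_subalgebra_star[OF generated_star_subalgebra feG] by metis
  have "h e \<noteq> 0"
  proof
    assume "h e = 0"
    then have "h (f * e) = 0" using hD(3)[OF F(1) E(1)] by simp
    then show False using hu b0 False by simp
  qed
  then have me: "minimal_in B (h e)" using at[OF e(1)] by blast
  have "minimal_in B (h f)"
  proof (rule minimal_transfer[OF B me _ _ hu b0])
    show "h (f * e) \<in> B" using hD(1) feG by blast
    show "h (f * e) * h e = h (f * e)" using hD(3)[OF feG E(1)] E(5) by (simp add: mult.assoc)
    show "projection (h f)" by (rule star_hom_projection[OF h F(1,2)])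
    show "h f \<in> B" using hD(1) F(1) by blast
  qed (rule False)
  then show ?thesis ..
qed simp

section \<open>Matrix units of the C*-algebra generated by a digraph algebra\<close>

definition linked :: "'a::cstar_algebra set \<Rightarrow> 'a \<Rightarrow> 'a \<Rightarrow> bool" where
  "linked A e f \<longleftrightarrow> (\<exists>x\<in>generated_cstar A. e * x * f \<noteq> 0)"

text \<open>The classes of \<open>linked\<close> on the atoms correspond to the simple summands of
  the generated algebra, and \<open>root\<close> selects one atom in each. Linked atoms share their
  root because they present the same predicate to the choice operator.\<close>

definition root :: "'a::cstar_algebra set \<Rightarrow> 'a set \<Rightarrow> 'a \<Rightarrow> 'a" where
  "root A C e = (SOME f. f \<in> atoms C \<and> linked A e f)"

text \<open>Only one column of each block is chosen, leading from the root to \<open>e\<close>. The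
  other matrix units are the products of one such element with the adjoint of another of the same
  root, so the matrix relations follow.\<close>

definition matrix_unit :: "'a::cstar_algebra set \<Rightarrow> 'a set \<Rightarrow> 'a \<Rightarrow> 'a" where
  "matrix_unit A C e = (SOME u. u \<in> generated_cstar A \<and> e * u * root A C e = u \<and>
     star u * u = root A C e \<and> u * star u = e)"

text \<open>For atoms with different roots the element on the left is zero, so the coefficient is
  zero and sums may run over all pairs of atoms.\<close>

definition matrix_coeff :: "'a::cstar_algebra set \<Rightarrow> 'a set \<Rightarrow> 'a \<Rightarrow> 'a \<Rightarrow> 'a \<Rightarrow> complex" where
  "matrix_coeff A C x e f = (SOME c. star (matrix_unit A C e) * x * matrix_unit A C f = c *\<^sub>C root A C e)"

context
  fixes A C :: "'a::cstar_algebra set"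
  assumes A: "digraph_algebra A" and C: "masa C A"
begin

abbreviation (input) "rt \<equiv> root A C"
abbreviation (input) "mu \<equiv> matrix_unit A C"
abbreviation (input) "cf \<equiv> matrix_coeff A C"

lemma linked_refl: "e \<in> atoms C \<Longrightarrow> linked A e e"
  unfolding linked_def using minimal_inD(1,3,5)[OF digraph_atoms_minimal[OF A C]] by metis

lemma linked_sym:
  assumes "e \<in> atoms C" "f \<in> atoms C" "linked A e f" shows "linked A f e"
proof -
  obtain x where x: "x \<in> generated_cstar A" "e * x * f \<noteq> 0" using assms(3) by (auto simp: linked_def)
  have "star (e * x * f) = f * star x * e"
    using assms(1,2)[THEN atoms_projection, THEN projectionD(1)] by (simp add: star_mult mult.assoc)
  then have "f * star x * e \<noteq> 0" using x(2) star_eq_0 by metis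
  then show ?thesis unfolding linked_def using x(1) star_subalgebra_star[OF generated_star_subalgebra] by blast
qed

text \<open>Rests on minimality: for \<open>u = e x f\<close> nonzero, \<open>star u * u\<close> is
  a nonzero multiple of \<open>f\<close>, so multiplying \<open>f y g\<close> by \<open>u\<close>
  cannot give zero.\<close>

lemma linked_trans:
  assumes e: "e \<in> atoms C" and f: "f \<in> atoms C" and g: "g \<in> atoms C" and l: "linked A e f" "linked A f g"
  shows "linked A e g"
proof -
  obtain x y where x: "x \<in> generated_cstar A" "e * x * f \<noteq> 0" and y: "y \<in> generated_cstar A" "f * y * g \<noteq> 0"
    using l by (auto simp: linked_def)
  define u where "u = e * x * f"
  have "star u * u = complex_of_real ((norm u)\<^sup>2) *\<^sub>C f"
    using minimal_corner(1)[OF generated_star_subalgebra digraph_atoms_minimal[OF A C e]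
        digraph_atoms_minimal[OF A C f] digraph_atoms_orthogonal[OF A C e f] x(1) u_def] .
  then have "star u * (u * (y * g)) = complex_of_real ((norm u)\<^sup>2) *\<^sub>C (f * (y * g))"
    by (metis mult.assoc scaleC_mult_left)
  moreover have "f * (y * g) \<noteq> 0" using y(2) by (simp add: mult.assoc)
  moreover have "norm u \<noteq> 0" using x(2) by (simp add: u_def)
  ultimately have "u * (y * g) \<noteq> 0" by (metis cvs.scale_eq_0_iff mult_zero_right of_real_eq_0_iff power2_eq_square mult_eq_0_iff)
  then have "e * (x * f * y) * g \<noteq> 0" by (simp add: u_def mult.assoc)
  moreover have "x * f * y \<in> generated_cstar A"
    using x(1) y(1) minimal_inD(1)[OF digraph_atoms_minimal[OF A C f]]
    by (simp add: subalgebra_mult[OF generated_subalgebra])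
  ultimately show ?thesis unfolding linked_def by blast
qed

lemma root_atom: assumes "e \<in> atoms C" shows "rt e \<in> atoms C" "linked A e (rt e)"
  using someI_ex[of "\<lambda>f. f \<in> atoms C \<and> linked A e f"] linked_refl[OF assms] assms
  unfolding root_def by blast+

lemma root_eq:
  assumes "e \<in> atoms C" "f \<in> atoms C" "linked A e f" shows "rt e = rt f"
proof -
  have "(\<lambda>g. g \<in> atoms C \<and> linked A e g) = (\<lambda>g. g \<in> atoms C \<and> linked A f g)"
    using linked_trans linked_sym assms by blast
  then show ?thesis unfolding root_def by presburger
qed

lemma root_eq_iff_linked:
  assumes "e \<in> atoms C" "f \<in> atoms C" shows "rt e = rt f \<longleftrightarrow> linked A e f"
  using root_eq[OF assms] linked_trans[OF assms(1) root_atom(1)[OF assms(2)] assms(2)]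
    linked_sym root_atom assms by metis

lemma matrix_unit:
  assumes e: "e \<in> atoms C"
  shows "mu e \<in> generated_cstar A" "e * mu e = mu e" "mu e * rt e = mu e"
    "star (mu e) * mu e = rt e" "mu e * star (mu e) = e"
proof -
  note r = root_atom[OF e]
  note E = digraph_atoms_minimal[OF A C e] and R = digraph_atoms_minimal[OF A C r(1)]
  obtain x where x: "x \<in> generated_cstar A" "e * x * rt e \<noteq> 0" using r(2) by (auto simp: linked_def)
  define y where "y = e * x * rt e"
  define n where "n = norm y"
  have n0: "n \<noteq> 0" using x(2) by (simp add: y_def n_def)
  define u where "u = complex_of_real (1 / n) *\<^sub>C y"
  note mc = minimal_corner[OF generated_star_subalgebra E R digraph_atoms_orthogonal[OF A C e r(1)] x(1) y_def]
  have k: "complex_of_real (1 / n) * complex_of_real (1 / n) * complex_of_real (n\<^sup>2) = 1"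
    using n0 by (simp add: power2_eq_square flip: of_real_mult)
  have 1: "star u * u = rt e" "u * star u = e"
    using mc k by (simp_all add: u_def star_scaleC scaleC_mult_left scaleC_mult_right scaleC_scaleC flip: n_def)
  have 2: "u \<in> generated_cstar A"
    using x(1) minimal_inD(1)[OF E] minimal_inD(1)[OF R]
    by (simp add: u_def y_def subalgebra_scale[OF generated_subalgebra] subalgebra_mult[OF generated_subalgebra])
  have "e * y * rt e = y" using minimal_inD(5)[OF E] minimal_inD(5)[OF R]
    by (simp add: y_def mult.assoc) (simp flip: mult.assoc)
  then have 3: "e * u * rt e = u" by (simp add: u_def scaleC_mult_left scaleC_mult_right)
  have ex: "mu e \<in> generated_cstar A \<and> e * mu e * rt e = mu e \<and> star (mu e) * mu e = rt e \<and> mu e * star (mu e) = e"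
    unfolding matrix_unit_def by (rule someI[of _ u]) (use 1 2 3 in auto)
  then show "mu e \<in> generated_cstar A" "star (mu e) * mu e = rt e" "mu e * star (mu e) = e" by auto
  have ee: "e * e = e" "rt e * rt e = rt e" using minimal_inD(5)[OF E] minimal_inD(5)[OF R] by auto
  show "e * mu e = mu e" using ex ee by (metis mult.assoc)
  show "mu e * rt e = mu e" using ex ee by (metis mult.assoc)
qed

lemma star_matrix_unit:
  assumes e: "e \<in> atoms C"
  shows "star (mu e) \<in> generated_cstar A" "star (mu e) * e = star (mu e)" "rt e * star (mu e) = star (mu e)"
proof -
  show "star (mu e) \<in> generated_cstar A"
    using matrix_unit(1)[OF e] star_subalgebra_star[OF generated_star_subalgebra] by blast
  show "star (mu e) * e = star (mu e)"
    using matrix_unit(2)[OF e] projectionD(1)[OF atoms_projection[OF e]] by (metis star_mult)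
  show "rt e * star (mu e) = star (mu e)"
    using matrix_unit(3)[OF e] projectionD(1)[OF atoms_projection[OF root_atom(1)[OF e]]] by (metis star_mult)
qed

lemma matrix_unit_orthogonal:
  assumes "e \<in> atoms C" "f \<in> atoms C" "e \<noteq> f" shows "star (mu e) * mu f = 0"
proof -
  have "star (mu e) * mu f = star (mu e) * (e * f) * mu f"
    using star_matrix_unit(2)[OF assms(1)] matrix_unit(2)[OF assms(2)] by (metis mult.assoc)
  then show ?thesis using digraph_atoms_mult[OF A C assms(1,2)] assms(3) by simp
qed

lemma coeff_unique:
  assumes e: "e \<in> atoms C" and "star (mu e) * x * mu f = c *\<^sub>C rt e"
  shows "cf x e f = c"
proof -
  have "star (mu e) * x * mu f = cf x e f *\<^sub>C rt e"
    unfolding matrix_coeff_def by (rule someI) (rule assms(2))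
  then show ?thesis using assms(2) atoms_nonzero[OF root_atom(1)[OF e]] by (simp add: cvs.scale_cancel_right)
qed

lemma unlinked_zero:
  assumes "x \<in> generated_cstar A" "e \<in> atoms C" "f \<in> atoms C" "rt e \<noteq> rt f" shows "e * x * f = 0"
  using assms root_eq_iff_linked[OF assms(2,3)] unfolding linked_def by blast

lemma coeff:
  assumes x: "x \<in> generated_cstar A" and e: "e \<in> atoms C" and f: "f \<in> atoms C"
  shows "star (mu e) * x * mu f = cf x e f *\<^sub>C rt e" "rt e \<noteq> rt f \<Longrightarrow> cf x e f = 0"
    "e * x * f = cf x e f *\<^sub>C (mu e * star (mu f))"
proof -
  have eq: "star (mu e) * x * mu f = star (mu e) * (e * x * f) * mu f"
    using star_matrix_unit(2)[OF e] matrix_unit(2)[OF f] by (metis mult.assoc)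
  have ex: "\<exists>c. star (mu e) * x * mu f = c *\<^sub>C rt e"
  proof (cases "rt e = rt f")
    case True
    have "star (mu e) * x * mu f \<in> generated_cstar A"
      using x matrix_unit(1)[OF f] star_matrix_unit(1)[OF e] by (simp add: subalgebra_mult[OF generated_subalgebra])
    then obtain c where "rt e * (star (mu e) * x * mu f) * rt e = c *\<^sub>C rt e"
      using minimal_inD(6)[OF digraph_atoms_minimal[OF A C root_atom(1)[OF e]]] by blast
    moreover have "rt e * (star (mu e) * x * mu f) * rt e = star (mu e) * x * mu f"
      using star_matrix_unit(3)[OF e] matrix_unit(3)[OF f] True by (metis mult.assoc)
    ultimately show ?thesis by metis
  next
    case False
    then have "star (mu e) * x * mu f = 0 *\<^sub>C rt e" using eq unlinked_zero[OF x e f] by simp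
    then show ?thesis by blast
  qed
  then show 1: "star (mu e) * x * mu f = cf x e f *\<^sub>C rt e" using coeff_unique[OF e] by blast
  show "cf x e f = 0" if "rt e \<noteq> rt f"
    by (rule coeff_unique[OF e]) (use eq unlinked_zero[OF x e f that] in simp)
  have "e * x * f = mu e * (star (mu e) * x * mu f) * star (mu f)"
    using matrix_unit(5)[OF e] matrix_unit(5)[OF f] by (metis mult.assoc)
  then show "e * x * f = cf x e f *\<^sub>C (mu e * star (mu f))"
    by (simp add: 1 scaleC_mult_left scaleC_mult_right matrix_unit(3)[OF e])
qed

lemma coeff_expand:
  assumes x: "x \<in> generated_cstar A"
  shows "x = (\<Sum>e\<in>atoms C. \<Sum>f\<in>atoms C. cf x e f *\<^sub>C (mu e * star (mu f)))"
  using digraph_expand[OF A C x] coeff(3)[OF x] by simp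

lemma coeff_add:
  assumes "x \<in> generated_cstar A" "y \<in> generated_cstar A" "e \<in> atoms C" "f \<in> atoms C"
  shows "cf (x + y) e f = cf x e f + cf y e f"
  by (rule coeff_unique[OF assms(3)])
    (use coeff(1)[OF assms(1,3,4)] coeff(1)[OF assms(2-4)] in \<open>simp add: distrib_left distrib_right scaleC_add_left\<close>)

lemma coeff_scale:
  assumes "x \<in> generated_cstar A" "e \<in> atoms C" "f \<in> atoms C"
  shows "cf (c *\<^sub>C x) e f = c * cf x e f"
  by (rule coeff_unique[OF assms(2)])
    (use coeff(1)[OF assms] in \<open>simp add: scaleC_mult_left scaleC_mult_right scaleC_scaleC\<close>)

lemma coeff_star:
  assumes x: "x \<in> generated_cstar A" and e: "e \<in> atoms C" and f: "f \<in> atoms C"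
  shows "cf (star x) e f = cnj (cf x f e)"
proof (cases "rt e = rt f")
  case True
  show ?thesis
  proof (rule coeff_unique[OF e])
    have "star (mu e) * star x * mu f = star (star (mu f) * x * mu e)"
      by (simp add: star_mult mult.assoc)
    also have "\<dots> = cnj (cf x f e) *\<^sub>C rt e"
      using coeff(1)[OF x f e] True projectionD(1)[OF atoms_projection[OF root_atom(1)[OF f]]]
      by (simp add: star_scaleC)
    finally show "star (mu e) * star x * mu f = cnj (cf x f e) *\<^sub>C rt e" .
  qed
next
  case False
  then show ?thesis
    using coeff(2)[OF x f e] coeff(2)[OF star_subalgebra_star[OF generated_star_subalgebra x] e f] by auto
qed

lemma coeff_mult:
  assumes x: "x \<in> generated_cstar A" and y: "y \<in> generated_cstar A" and e: "e \<in> atoms C" and f: "f \<in> atoms C"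
  shows "cf (x * y) e f = (\<Sum>g\<in>atoms C. cf x e g * cf y g f)"
proof (rule coeff_unique[OF e])
  have "star (mu e) * (x * y) * mu f = star (mu e) * x * (\<Sum>(atoms C)) * y * mu f"
    using digraph_unit(1)[OF A C y] by (simp add: mult.assoc)
  also have "\<dots> = (\<Sum>g\<in>atoms C. star (mu e) * x * g * y * mu f)"
    by (simp add: sum_distrib_left sum_distrib_right)
  also have "\<dots> = (\<Sum>g\<in>atoms C. (cf x e g * cf y g f) *\<^sub>C rt e)"
  proof (intro sum.cong refl)
    fix g assume g: "g \<in> atoms C"
    have "star (mu e) * x * g * y * mu f = (star (mu e) * x * mu g) * (star (mu g) * y * mu f)"
      using matrix_unit(5)[OF g] by (metis mult.assoc)
    also have "\<dots> = (cf x e g * cf y g f) *\<^sub>C (rt e * rt g)"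
      by (simp add: coeff(1)[OF x e g] coeff(1)[OF y g f] scaleC_mult_left scaleC_mult_right scaleC_scaleC mult.commute)
    also have "\<dots> = (cf x e g * cf y g f) *\<^sub>C rt e"
      using coeff(2)[OF x e g] projectionD(2)[OF atoms_projection[OF root_atom(1)[OF e]]] by (cases "rt e = rt g") auto
    finally show "star (mu e) * x * g * y * mu f = (cf x e g * cf y g f) *\<^sub>C rt e" .
  qed
  also have "\<dots> = (\<Sum>g\<in>atoms C. cf x e g * cf y g f) *\<^sub>C rt e" by (simp add: cvs.scale_sum_left)
  finally show "star (mu e) * (x * y) * mu f = (\<Sum>g\<in>atoms C. cf x e g * cf y g f) *\<^sub>C rt e" .
qed

lemma unit_product_mem:
  assumes "e \<in> atoms C" "f \<in> atoms C" shows "mu e * star (mu f) \<in> generated_cstar A"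
  using matrix_unit(1)[OF assms(1)] star_matrix_unit(1)[OF assms(2)] by (rule subalgebra_mult[OF generated_subalgebra])

lemma coeff_unit_product:
  assumes "e \<in> atoms C" "f \<in> atoms C" "g \<in> atoms C" "h \<in> atoms C" "rt e = rt f"
  shows "cf (mu e * star (mu f)) g h = (if g = e \<and> h = f then 1 else 0)"
proof (rule coeff_unique[OF assms(3)])
  have "star (mu g) * (mu e * star (mu f)) * mu h = (star (mu g) * mu e) * (star (mu f) * mu h)" by (simp add: mult.assoc)
  then show "star (mu g) * (mu e * star (mu f)) * mu h = (if g = e \<and> h = f then 1 else 0) *\<^sub>C rt g"
    using matrix_unit(4)[OF assms(1)] matrix_unit(4)[OF assms(2)] assms(5)
      matrix_unit_orthogonal[OF assms(3,1)] matrix_unit_orthogonal[OF assms(2,4)]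
      projectionD(2)[OF atoms_projection[OF root_atom(1)[OF assms(2)]]] by auto
qed

end

text \<open>The linear map that carries each matrix unit, a product of one column element with the
  adjoint of another, to \<open>w e * star (w f)\<close>. The regular summands in
  \<open>near_regular\<close> are built this way.\<close>

definition unit_map ::
  "'a::cstar_algebra set \<Rightarrow> 'a set \<Rightarrow> ('a \<Rightarrow> 'b::cstar_algebra) \<Rightarrow> 'a \<Rightarrow> 'b" where
  "unit_map A C w x = (\<Sum>e\<in>atoms C. \<Sum>f\<in>atoms C. matrix_coeff A C x e f *\<^sub>C (w e * star (w f)))"

text \<open>The \<open>w e\<close> have to satisfy the relations of a column of matrix units:
  orthogonal ranges, and an initial projection \<open>R\<close> that depends on the root alone.
  \<open>R\<close> may vanish on some blocks, so the map may kill summands.\<close>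

lemma unit_map_star_hom:
  fixes w :: "'a::cstar_algebra \<Rightarrow> 'b::cstar_algebra"
  assumes A: "digraph_algebra A" and C: "masa C A" and B: "star_subalgebra B"
    and wB: "\<And>e. e \<in> atoms C \<Longrightarrow> w e \<in> B"
    and ort: "\<And>e f. e \<in> atoms C \<Longrightarrow> f \<in> atoms C \<Longrightarrow> e \<noteq> f \<Longrightarrow> star (w e) * w f = 0"
    and R: "\<And>e. e \<in> atoms C \<Longrightarrow> star (w e) * w e = R (root A C e)"
    and wR: "\<And>e. e \<in> atoms C \<Longrightarrow> w e * R (root A C e) = w e"
  shows "star_hom (unit_map A C w) (generated_cstar A) B"
proof -
  let ?P = "atoms C" and ?G = "generated_cstar A" and ?c = "matrix_coeff A C"
  note sub = star_subalgebraD[OF B] and fin = digraph_atoms_finite[OF A C]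
  have mem: "unit_map A C w x \<in> B" for x
    unfolding unit_map_def using wB sub B
    by (intro subalgebra_sum[OF sub] subalgebra_scale[OF sub] subalgebra_mult[OF sub] star_subalgebra_star[OF B]) auto
  have add: "unit_map A C w (x + y) = unit_map A C w x + unit_map A C w y" if "x \<in> ?G" "y \<in> ?G" for x y
    using that by (simp add: unit_map_def coeff_add[OF A C] scaleC_add_left sum.distrib)
  have sc: "unit_map A C w (c *\<^sub>C x) = c *\<^sub>C unit_map A C w x" if "x \<in> ?G" for c x
    using that by (simp add: unit_map_def coeff_scale[OF A C] scaleC_scaleC cvs.scale_sum_right)
  have st: "unit_map A C w (star x) = star (unit_map A C w x)" if "x \<in> ?G" for x
  proof -
    have "star (unit_map A C w x) = (\<Sum>e\<in>?P. \<Sum>f\<in>?P. cnj (?c x e f) *\<^sub>C (w f * star (w e)))"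
      by (simp add: unit_map_def star_sum star_scaleC star_mult)
    also have "\<dots> = (\<Sum>f\<in>?P. \<Sum>e\<in>?P. cnj (?c x e f) *\<^sub>C (w f * star (w e)))" by (rule sum.swap)
    finally show ?thesis using that by (simp add: unit_map_def coeff_star[OF A C])
  qed
  have mult: "unit_map A C w (x * y) = unit_map A C w x * unit_map A C w y" if x: "x \<in> ?G" and y: "y \<in> ?G" for x y
  proof -
    have trm: "(?c x e g *\<^sub>C (w e * star (w g))) * (?c y g' f *\<^sub>C (w g' * star (w f)))
        = (if g' = g then (?c x e g * ?c y g f) *\<^sub>C (w e * star (w f)) else 0)"
      if e: "e \<in> ?P" and g: "g \<in> ?P" and g': "g' \<in> ?P" and f: "f \<in> ?P" for e g g' f
    proof (cases "g' = g")
      case True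
      have "(?c x e g *\<^sub>C (w e * star (w g))) * (?c y g f *\<^sub>C (w g * star (w f)))
          = (?c x e g * ?c y g f) *\<^sub>C (w e * (star (w g) * w g) * star (w f))"
        by (simp add: scaleC_mult_left scaleC_mult_right scaleC_scaleC mult.assoc mult.commute[of "?c x e g"])
      also have "\<dots> = (?c x e g * ?c y g f) *\<^sub>C (w e * star (w f))"
        using coeff(2)[OF A C x e g] R[OF g] wR[OF e] by (cases "root A C e = root A C g") auto
      finally show ?thesis using True by simp
    next
      case False
      have "(w e * star (w g)) * (w g' * star (w f)) = w e * (star (w g) * w g') * star (w f)" by (simp add: mult.assoc)
      then show ?thesis using ort[OF g g'] False by (simp add: scaleC_mult_left scaleC_mult_right)
    qed
    have "unit_map A C w x * unit_map A C w y =
        (\<Sum>e\<in>?P. \<Sum>g\<in>?P. \<Sum>g'\<in>?P. \<Sum>f\<in>?P. (?c x e g *\<^sub>C (w e * star (w g))) * (?c y g' f *\<^sub>C (w g' * star (w f))))"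
      unfolding unit_map_def sum_product by (intro sum.cong refl sum.swap)
    also have "\<dots> = (\<Sum>e\<in>?P. \<Sum>g\<in>?P. \<Sum>g'\<in>?P. if g' = g then (\<Sum>f\<in>?P. (?c x e g * ?c y g f) *\<^sub>C (w e * star (w f))) else 0)"
      by (intro sum.cong refl) (auto simp: trm)
    also have "\<dots> = (\<Sum>e\<in>?P. \<Sum>g\<in>?P. \<Sum>f\<in>?P. (?c x e g * ?c y g f) *\<^sub>C (w e * star (w f)))"
      using fin by (simp add: sum.delta)
    also have "\<dots> = (\<Sum>e\<in>?P. \<Sum>f\<in>?P. \<Sum>g\<in>?P. (?c x e g * ?c y g f) *\<^sub>C (w e * star (w f)))"
      by (intro sum.cong refl sum.swap)
    also have "\<dots> = unit_map A C w (x * y)"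
      unfolding unit_map_def using x y by (simp add: coeff_mult[OF A C] cvs.scale_sum_left)
    finally show ?thesis by simp
  qed
  show ?thesis unfolding star_hom_def using mem add sc st mult by blast
qed

lemma unit_map_unit_product:
  assumes A: "digraph_algebra A" and C: "masa C A" and ef: "e \<in> atoms C" "f \<in> atoms C" "root A C e = root A C f"
  shows "unit_map A C w (matrix_unit A C e * star (matrix_unit A C f)) = w e * star (w f)"
proof -
  have "unit_map A C w (matrix_unit A C e * star (matrix_unit A C f)) =
    (\<Sum>g\<in>atoms C. \<Sum>h\<in>atoms C. if g = e then if h = f then w e * star (w f) else 0 else 0)"
    unfolding unit_map_def using coeff_unit_product[OF A C ef(1,2) _ _ ef(3)] by (intro sum.cong refl) auto
  also have "\<dots> = (\<Sum>g\<in>atoms C. if g = e then (\<Sum>h\<in>atoms C. if h = f then w e * star (w f) else 0) else 0)"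
    by (intro sum.cong refl) auto
  also have "\<dots> = w e * star (w f)" using digraph_atoms_finite[OF A C] ef by simp
  finally show ?thesis .
qed

lemma unit_map_atom:
  assumes A: "digraph_algebra A" and C: "masa C A" and e: "e \<in> atoms C"
  shows "unit_map A C w e = w e * star (w e)"
  using unit_map_unit_product[OF A C e e refl, of w] matrix_unit(5)[OF A C e] by simp

subsection \<open>Rank\<close>

lemma mat_adjoint_index:
  assumes "M \<in> carrier_mat n n" "i < n" "j < n"
  shows "mat_adjoint M $$ (i, j) = cnj (M $$ (j, i) :: complex)"
  using assms unfolding mat_adjoint_def by (simp add: mat_of_rows_def cols_length)

lemma coeff_of_sum:
  assumes A: "digraph_algebra A" and C: "masa C A"
    and c: "\<And>e f. e \<in> atoms C \<Longrightarrow> f \<in> atoms C \<Longrightarrow> root A C e \<noteq> root A C f \<Longrightarrow> c e f = 0"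
    and g: "g \<in> atoms C" and h: "h \<in> atoms C"
  shows "matrix_coeff A C (\<Sum>e\<in>atoms C. \<Sum>f\<in>atoms C. c e f *\<^sub>C (matrix_unit A C e * star (matrix_unit A C f))) g h = c g h"
proof (rule coeff_unique[OF A C g])
  let ?u = "matrix_unit A C" and ?r = "root A C"
  have "star (?u g) * (\<Sum>e\<in>atoms C. \<Sum>f\<in>atoms C. c e f *\<^sub>C (?u e * star (?u f))) * ?u h =
     (\<Sum>e\<in>atoms C. \<Sum>f\<in>atoms C. c e f *\<^sub>C ((star (?u g) * ?u e) * (star (?u f) * ?u h)))"
    by (simp add: sum_distrib_left sum_distrib_right scaleC_mult_left scaleC_mult_right mult.assoc)
  also have "\<dots> = (\<Sum>e\<in>atoms C. if e = g then (\<Sum>f\<in>atoms C. if f = h then c g h *\<^sub>C ?r g else 0) else 0)"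
  proof (intro sum.cong refl)
    fix e assume e: "e \<in> atoms C"
    have "(\<Sum>f\<in>atoms C. c e f *\<^sub>C ((star (?u g) * ?u e) * (star (?u f) * ?u h))) =
      (\<Sum>f\<in>atoms C. if f = h then c g h *\<^sub>C ?r g else 0)" if "e = g"
    proof (intro sum.cong refl)
      fix f assume f: "f \<in> atoms C"
      show "c e f *\<^sub>C ((star (?u g) * ?u e) * (star (?u f) * ?u h)) = (if f = h then c g h *\<^sub>C ?r g else 0)"
        using matrix_unit(4)[OF A C g] matrix_unit(4)[OF A C h] matrix_unit_orthogonal[OF A C f h] that
          c[OF g h] projectionD(2)[OF atoms_projection[OF root_atom(1)[OF A C g]]]
        by (cases "?r g = ?r h") auto
    qed
    then show "(\<Sum>f\<in>atoms C. c e f *\<^sub>C ((star (?u g) * ?u e) * (star (?u f) * ?u h))) =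
      (if e = g then (\<Sum>f\<in>atoms C. if f = h then c g h *\<^sub>C ?r g else 0) else 0)"
      using matrix_unit_orthogonal[OF A C g e] by auto
  qed
  also have "\<dots> = c g h *\<^sub>C ?r g" using digraph_atoms_finite[OF A C] g h by simp
  finally show "star (?u g) * (\<Sum>e\<in>atoms C. \<Sum>f\<in>atoms C. c e f *\<^sub>C (?u e * star (?u f))) * ?u h = c g h *\<^sub>C ?r g" .
qed

lemma list_position:
  assumes "finite S"
  shows "\<exists>xs pos. distinct xs \<and> set xs = S \<and>
    (\<forall>a\<in>S. pos a < length xs \<and> xs ! pos a = a) \<and> (\<forall>i<length xs. pos (xs ! i) = i)"
proof -
  obtain xs where xs: "set xs = S" "distinct xs" using finite_distinct_list[OF assms] by blast
  define pos where "pos a = (SOME i. i < length xs \<and> xs ! i = a)" for a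
  have 1: "pos a < length xs \<and> xs ! pos a = a" if "a \<in> S" for a
  proof -
    have "\<exists>i. i < length xs \<and> xs ! i = a" using that unfolding xs(1)[symmetric] in_set_conv_nth by blast
    from someI_ex[OF this] show ?thesis by (simp only: pos_def)
  qed
  have "pos (xs ! i) = i" if i: "i < length xs" for i
  proof -
    have "xs ! i \<in> S" using i xs(1) nth_mem by blast
    then have "pos (xs ! i) < length xs" "xs ! pos (xs ! i) = xs ! i" using 1 by auto
    then show ?thesis using nth_eq_iff_index_eq[OF xs(2)] i by blast
  qed
  with 1 xs show ?thesis by blast
qed

text \<open>Existence for the description in \<open>rank_in\<close>. The blocks are listed by the
  roots \<open>rs\<close>, the rows of a block by the atoms \<open>es r\<close> with root
  \<open>r\<close>, and the entries are matrix coefficients; \<open>pos\<close> and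
  \<open>ps\<close> invert the two listings.\<close>

lemma matrix_sum_iso_exists:
  assumes A: "digraph_algebra A"
  shows "\<exists>ds f. 0 \<notin> set ds \<and> matrix_sum_iso f (generated_cstar A) ds"
proof -
  obtain C where C: "masa C A" using fd_masa_exists[OF digraph_subalgebra digraph_fd] A by blast
  let ?P = "atoms C" and ?r = "root A C" and ?u = "matrix_unit A C" and ?c = "matrix_coeff A C" and ?G = "generated_cstar A"
  note fin = digraph_atoms_finite[OF A C]
  obtain rs pos where rs: "distinct rs" "set rs = ?r ` ?P" and
    pos: "\<And>a. a \<in> ?r ` ?P \<Longrightarrow> pos a < length rs \<and> rs ! pos a = a" "\<And>i. i < length rs \<Longrightarrow> pos (rs ! i) = i"
    using list_position[OF finite_imageI[OF fin, of ?r]] by blast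
  have "\<forall>r. \<exists>xs ps. distinct xs \<and> set xs = {e\<in>?P. ?r e = r} \<and>
    (\<forall>a\<in>{e\<in>?P. ?r e = r}. ps a < length xs \<and> xs ! ps a = a) \<and> (\<forall>i<length xs. ps (xs ! i) = i)"
  proof
    fix r
    have "finite {e\<in>?P. ?r e = r}" using fin by simp
    from list_position[OF this] show "\<exists>xs ps. distinct xs \<and> set xs = {e\<in>?P. ?r e = r} \<and>
    (\<forall>a\<in>{e\<in>?P. ?r e = r}. ps a < length xs \<and> xs ! ps a = a) \<and> (\<forall>i<length xs. ps (xs ! i) = i)" .
  qed
  from choice[OF this] obtain es where "\<forall>r. \<exists>ps. distinct (es r) \<and> set (es r) = {e\<in>?P. ?r e = r} \<and>
    (\<forall>a\<in>{e\<in>?P. ?r e = r}. ps a < length (es r) \<and> es r ! ps a = a) \<and> (\<forall>i<length (es r). ps (es r ! i) = i)" ..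
  from choice[OF this] obtain ps where es0: "\<forall>r. distinct (es r) \<and> set (es r) = {e\<in>?P. ?r e = r} \<and>
    (\<forall>a\<in>{e\<in>?P. ?r e = r}. ps r a < length (es r) \<and> es r ! ps r a = a) \<and> (\<forall>i<length (es r). ps r (es r ! i) = i)" ..
  then have es: "\<And>r. distinct (es r)" "\<And>r. set (es r) = {e\<in>?P. ?r e = r}"
    and ps: "\<And>e. e \<in> ?P \<Longrightarrow> ps (?r e) e < length (es (?r e)) \<and> es (?r e) ! ps (?r e) e = e"
      "\<And>r i. i < length (es r) \<Longrightarrow> ps r (es r ! i) = i" by auto
  have esP: "es r ! i \<in> ?P" "?r (es r ! i) = r" if "i < length (es r)" for r i
    using es(2)[of r] nth_mem[OF that] by auto
  define N where "N r = length (es r)" for r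
  define ds where "ds = map N rs"
  define F where "F x r = mat (N r) (N r) (\<lambda>(i, j). ?c x (es r ! i) (es r ! j))" for x r
  define f where "f x = map (F x) rs" for x
  have Fc: "F x r \<in> carrier_mat (N r) (N r)" for x r by (simp add: F_def)
  have Fi: "F x r $$ (i, j) = ?c x (es r ! i) (es r ! j)" if "i < N r" "j < N r" for x r i j
    using that by (simp add: F_def)
  have "0 \<notin> set ds"
  proof
    assume "0 \<in> set ds"
    then obtain e where e: "e \<in> ?P" "N (?r e) = 0" using rs(2) by (auto simp: ds_def)
    then show False using ps(1)[OF e(1)] by (simp add: N_def)
  qed
  moreover have "matrix_sum_iso f ?G ds"
    unfolding matrix_sum_iso_def
  proof (intro conjI ballI allI)
    show "bij_betw f ?G (matrix_sum ds)"
    proof (rule bij_betw_imageI)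
      show "inj_on f ?G"
      proof (rule inj_onI)
        fix x y assume x: "x \<in> ?G" and y: "y \<in> ?G" and fxy: "f x = f y"
        have "?c x e g = ?c y e g" if e: "e \<in> ?P" and g: "g \<in> ?P" for e g
        proof (cases "?r e = ?r g")
          case True
          have "?r e \<in> set rs" using rs(2) e by blast
          then have "F x (?r e) = F y (?r e)" using fxy by (simp add: f_def)
          then have "F x (?r e) $$ (ps (?r e) e, ps (?r e) g) = F y (?r e) $$ (ps (?r e) e, ps (?r e) g)" by simp
          then show ?thesis using ps(1)[OF e] ps(1)[OF g] True by (simp add: Fi N_def)
        next
          case False
          then show ?thesis using coeff(2)[OF A C] x y e g by simp
        qed
        then show "x = y" using coeff_expand[OF A C x] coeff_expand[OF A C y] by simp
      qed
      show "f ` ?G = matrix_sum ds"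
      proof
        show "f ` ?G \<subseteq> matrix_sum ds"
          by (auto simp: matrix_sum_def f_def ds_def list_all2_map1 list_all2_map2 Fc intro!: list.rel_refl_strong)
        show "matrix_sum ds \<subseteq> f ` ?G"
        proof
          fix Ms assume "Ms \<in> matrix_sum ds"
          then have Ms: "length Ms = length rs" "\<And>k. k < length rs \<Longrightarrow> Ms ! k \<in> carrier_mat (N (rs ! k)) (N (rs ! k))"
            by (auto simp: matrix_sum_def list_all2_conv_all_nth ds_def)
          define c where "c e g = (if ?r e = ?r g then Ms ! pos (?r e) $$ (ps (?r e) e, ps (?r g) g) else 0)" for e g
          define x where "x = (\<Sum>e\<in>?P. \<Sum>g\<in>?P. c e g *\<^sub>C (?u e * star (?u g)))"
          have xG: "x \<in> ?G" unfolding x_def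
            using unit_product_mem[OF A C] by (intro subalgebra_sum[OF generated_subalgebra] subalgebra_scale[OF generated_subalgebra]) auto
          have cx: "?c x e g = c e g" if "e \<in> ?P" "g \<in> ?P" for e g
            unfolding x_def by (rule coeff_of_sum[OF A C _ that]) (simp add: c_def)
          have "f x = Ms"
          proof (rule nth_equalityI)
            show "length (f x) = length Ms" using Ms by (simp add: f_def)
            fix k assume "k < length (f x)"
            then have k: "k < length rs" by (simp add: f_def)
            have "F x (rs ! k) = Ms ! k"
            proof (rule eq_matI)
              show "dim_row (F x (rs ! k)) = dim_row (Ms ! k)" "dim_col (F x (rs ! k)) = dim_col (Ms ! k)"
                using Ms(2)[OF k] Fc[of x "rs ! k"] by auto
              fix i j assume "i < dim_row (Ms ! k)" "j < dim_col (Ms ! k)"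
              then have ij: "i < N (rs ! k)" "j < N (rs ! k)" using Ms(2)[OF k] by auto
              then show "F x (rs ! k) $$ (i, j) = Ms ! k $$ (i, j)"
                using esP[of i "rs ! k"] esP[of j "rs ! k"] ps(2) pos(2)[OF k] by (simp add: Fi cx c_def N_def)
            qed
            then show "f x ! k = Ms ! k" using k by (simp add: f_def)
          qed
          then show "Ms \<in> f ` ?G" using xG by blast
        qed
      qed
    qed
  next
    fix x y assume x: "x \<in> ?G" and y: "y \<in> ?G"
    have "F (x + y) r = F x r + F y r" for r
      by (rule eq_matI) (use esP in \<open>auto simp: F_def N_def coeff_add[OF A C x y]\<close>)
    then show "f (x + y) = map2 (+) (f x) (f y)" by (simp add: f_def map2_map_map)
    have "F (x * y) r = F x r * F y r" for r
    proof (rule eq_matI)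
      show "dim_row (F (x * y) r) = dim_row (F x r * F y r)" "dim_col (F (x * y) r) = dim_col (F x r * F y r)"
        by (simp_all add: F_def)
      fix i j assume "i < dim_row (F x r * F y r)" "j < dim_col (F x r * F y r)"
      then have ij: "i < N r" "j < N r" by (simp_all add: F_def)
      note eP = esP[OF ij(1)[unfolded N_def]] esP[OF ij(2)[unfolded N_def]]
      have bij: "bij_betw ((!) (es r)) {0..<N r} {e\<in>?P. ?r e = r}"
        unfolding N_def by (rule bij_betw_nth[OF es(1)]) (auto simp: es(2) lessThan_atLeast0)
      have "F (x * y) r $$ (i, j) = (\<Sum>g\<in>?P. ?c x (es r ! i) g * ?c y g (es r ! j))"
        using ij eP by (simp add: Fi coeff_mult[OF A C x y])
      also have "\<dots> = (\<Sum>g\<in>{e\<in>?P. ?r e = r}. ?c x (es r ! i) g * ?c y g (es r ! j))"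
        using fin coeff(2)[OF A C x eP(1)] eP(2) by (intro sum.mono_neutral_right) auto
      also have "\<dots> = (\<Sum>k = 0..<N r. ?c x (es r ! i) (es r ! k) * ?c y (es r ! k) (es r ! j))"
        by (rule sum.reindex_bij_betw[OF bij, symmetric])
      also have "\<dots> = (F x r * F y r) $$ (i, j)"
        using ij by (simp add: F_def scalar_prod_def)
      finally show "F (x * y) r $$ (i, j) = (F x r * F y r) $$ (i, j)" .
    qed
    then show "f (x * y) = map2 (*) (f x) (f y)" by (simp add: f_def map2_map_map)
  next
    fix c x assume x: "x \<in> ?G"
    have "F (c *\<^sub>C x) r = c \<cdot>\<^sub>m F x r" for r
      by (rule eq_matI) (use esP in \<open>auto simp: F_def N_def coeff_scale[OF A C x]\<close>)
    then show "f (c *\<^sub>C x) = map (\<lambda>M. c \<cdot>\<^sub>m M) (f x)" by (simp add: f_def)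
  next
    fix x assume x: "x \<in> ?G"
    have "F (star x) r = mat_adjoint (F x r)" for r
    proof (rule eq_matI)
      show "dim_row (F (star x) r) = dim_row (mat_adjoint (F x r))" "dim_col (F (star x) r) = dim_col (mat_adjoint (F x r))"
        by (simp_all add: F_def mat_adjoint_def)
      fix i j assume "i < dim_row (mat_adjoint (F x r))" "j < dim_col (mat_adjoint (F x r))"
      then have ij: "i < N r" "j < N r" by (simp_all add: F_def mat_adjoint_def)
      then show "F (star x) r $$ (i, j) = mat_adjoint (F x r) $$ (i, j)"
        using esP(1) by (simp add: mat_adjoint_index[OF Fc] Fi coeff_star[OF A C x] N_def)
    qed
    then show "f (star x) = map mat_adjoint (f x)" by (simp add: f_def)
  qed
  ultimately show ?thesis by blast
qed

definition total_rank :: "nat list \<Rightarrow> complex Matrix.mat list \<Rightarrow> nat" where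
  "total_rank ds Ms = (\<Sum>l<length ds. vec_space.rank (ds ! l) (Ms ! l))"

text \<open>Rank is only subadditive, whereas the trace is additive. The trace of the unit equates
  the total size of the blocks with the number of atoms, which supplies the lower bound for ranks in
  \<open>rank_in_sum_minimal\<close>.\<close>

definition total_trace :: "nat list \<Rightarrow> complex Matrix.mat list \<Rightarrow> complex" where
  "total_trace ds Ms = (\<Sum>l<length ds. \<Sum>i<ds ! l. Ms ! l $$ (i, i))"

context
  fixes f :: "'a::cstar_algebra \<Rightarrow> complex Matrix.mat list" and B ds
  assumes f: "matrix_sum_iso f B ds" and B: "star_subalgebra B"
begin

lemma iso_mem: "x \<in> B \<Longrightarrow> f x \<in> matrix_sum ds"
  using f unfolding matrix_sum_iso_def bij_betw_def by blast

lemma iso_carrier: "x \<in> B \<Longrightarrow> l < length ds \<Longrightarrow> f x ! l \<in> carrier_mat (ds ! l) (ds ! l)"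
  using iso_mem[of x] by (simp add: matrix_sum_def list_all2_conv_all_nth)

lemma iso_length: "x \<in> B \<Longrightarrow> length (f x) = length ds"
  using iso_mem[of x] by (simp add: matrix_sum_def list_all2_conv_all_nth)

lemma iso_surj: "(\<And>l. l < length ds \<Longrightarrow> M l \<in> carrier_mat (ds ! l) (ds ! l)) \<Longrightarrow>
  \<exists>x\<in>B. \<forall>l<length ds. f x ! l = M l"
proof -
  assume M: "\<And>l. l < length ds \<Longrightarrow> M l \<in> carrier_mat (ds ! l) (ds ! l)"
  then have "map M [0..<length ds] \<in> matrix_sum ds" by (auto simp: matrix_sum_def list_all2_conv_all_nth)
  then obtain x where x: "x \<in> B" "f x = map M [0..<length ds]"
    using f unfolding matrix_sum_iso_def bij_betw_def by (metis imageE)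
  then have "\<forall>l<length ds. f x ! l = M l" by simp
  then show "\<exists>x\<in>B. \<forall>l<length ds. f x ! l = M l" using x(1) by blast
qed

lemma iso_inj: "x \<in> B \<Longrightarrow> y \<in> B \<Longrightarrow> (\<And>l. l < length ds \<Longrightarrow> f x ! l = f y ! l) \<Longrightarrow> x = y"
  using f iso_length[of x] iso_length[of y] unfolding matrix_sum_iso_def bij_betw_def
  by (metis inj_onD nth_equalityI)

lemma iso_add: "x \<in> B \<Longrightarrow> y \<in> B \<Longrightarrow> l < length ds \<Longrightarrow> f (x + y) ! l = f x ! l + f y ! l"
  using f iso_length[of x] iso_length[of y] by (simp add: matrix_sum_iso_def)

lemma iso_mult: "x \<in> B \<Longrightarrow> y \<in> B \<Longrightarrow> l < length ds \<Longrightarrow> f (x * y) ! l = f x ! l * f y ! l"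
  using f iso_length[of x] iso_length[of y] by (simp add: matrix_sum_iso_def)

lemma iso_scale: "x \<in> B \<Longrightarrow> l < length ds \<Longrightarrow> f (c *\<^sub>C x) ! l = c \<cdot>\<^sub>m (f x ! l)"
  using f iso_length[of x] by (simp add: matrix_sum_iso_def)

lemma iso_zero: "l < length ds \<Longrightarrow> f 0 ! l = 0\<^sub>m (ds ! l) (ds ! l)"
  using iso_scale[of 0 l 0] iso_carrier[of 0 l] subalgebra_zero[OF star_subalgebraD[OF B]]
  by (metis carrier_matD cvs.scale_zero_right index_smult_mat(1,2,3) index_zero_mat(1,2,3) eq_matI mult_zero_left)

lemma iso_unit:
  assumes u: "u \<in> B" "\<And>x. x \<in> B \<Longrightarrow> u * x = x" and l: "l < length ds"
  shows "f u ! l = 1\<^sub>m (ds ! l)"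
proof -
  obtain y where y: "y \<in> B" "\<forall>l<length ds. f y ! l = 1\<^sub>m (ds ! l)" using iso_surj[of "\<lambda>l. 1\<^sub>m (ds ! l)"] by auto
  have "f u ! l * f y ! l = f y ! l" using iso_mult[OF u(1) y(1) l] u(2)[OF y(1)] by simp
  then show ?thesis using y(2) l iso_carrier[OF u(1) l] by simp
qed

lemma total_rank_add:
  "x \<in> B \<Longrightarrow> y \<in> B \<Longrightarrow> total_rank ds (f (x + y)) \<le> total_rank ds (f x) + total_rank ds (f y)"
  unfolding total_rank_def sum.distrib[symmetric]
  by (intro sum_mono) (simp add: iso_add vec_space.rank_subadditive[OF iso_carrier iso_carrier])

lemma total_trace_add:
  assumes "x \<in> B" "y \<in> B"
  shows "total_trace ds (f (x + y)) = total_trace ds (f x) + total_trace ds (f y)"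
  unfolding total_trace_def sum.distrib[symmetric]
proof (intro sum.cong refl)
  fix l i assume l: "l \<in> {..<length ds}" and i: "i \<in> {..<ds ! l}"
  then show "f (x + y) ! l $$ (i, i) = f x ! l $$ (i, i) + f y ! l $$ (i, i)"
    using iso_carrier[OF assms(1), of l] iso_carrier[OF assms(2), of l] by (simp add: iso_add[OF assms])
qed

lemma total_rank_zero: "total_rank ds (f 0) = 0"
  by (simp add: total_rank_def iso_zero vec_space.rank_0I)

lemma total_trace_zero: "total_trace ds (f 0) = 0"
  by (simp add: total_trace_def iso_zero)

text \<open>Minimality is tested against an elementary matrix \<open>X\<close> placed at
  \<open>(a, b)\<close> where \<open>M $$ (b, a)\<close> is nonzero. It gives
  \<open>c M_ij = M_ia M_bj\<close> with \<open>c = M_ba\<close>, so the block is an outer product;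
  in the other blocks \<open>c\<close> times the block is zero, and idempotency yields trace
  1.\<close>

lemma minimal_rank_trace:
  assumes e: "minimal_in B e"
  shows "total_rank ds (f e) \<le> 1" "total_trace ds (f e) = 1"
proof -
  note sub = star_subalgebraD[OF B] and E = minimal_inD[OF e]
  obtain l0 where l0: "l0 < length ds" "f e ! l0 \<noteq> 0\<^sub>m (ds ! l0) (ds ! l0)"
    using iso_inj[OF E(1) subalgebra_zero[OF sub]] iso_zero E(3) by metis
  define d where "d = ds ! l0"
  define M where "M = f e ! l0"
  have Mc: "M \<in> carrier_mat d d" using iso_carrier[OF E(1) l0(1)] by (simp add: M_def d_def)
  have "\<exists>b<d. \<exists>a<d. M $$ (b, a) \<noteq> 0"
  proof (rule ccontr)
    assume "\<not> ?thesis"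
    then have "M = 0\<^sub>m d d" using Mc by (intro eq_matI) auto
    then show False using l0(2) by (simp add: M_def d_def)
  qed
  then obtain a b where ab: "a < d" "b < d" "M $$ (b, a) \<noteq> 0" by blast
  define X where "X = mat d d (\<lambda>(i, j). if i = a then if j = b then 1 else 0 else (0::complex))"
  have "(if l = l0 then X else 0\<^sub>m (ds ! l) (ds ! l)) \<in> carrier_mat (ds ! l) (ds ! l)" for l
    by (simp add: X_def d_def)
  from iso_surj[OF this] obtain y where
    y: "y \<in> B" "\<forall>l<length ds. f y ! l = (if l = l0 then X else 0\<^sub>m (ds ! l) (ds ! l))" by blast
  obtain c where c: "e * y * e = c *\<^sub>C e" using E(6)[OF y(1)] by blast
  have key: "f e ! l * f y ! l * f e ! l = c \<cdot>\<^sub>m (f e ! l)" if "l < length ds" for l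
    using iso_mult[OF subalgebra_mult[OF sub E(1) y(1)] E(1) that] iso_mult[OF E(1) y(1) that]
      iso_scale[OF E(1) that, of c] c by simp
  have MXM: "(M * X * M) $$ (i, j) = M $$ (i, a) * M $$ (b, j)" if "i < d" "j < d" for i j
  proof -
    have MX: "(M * X) $$ (i, k) = (if k = b then M $$ (i, a) else 0)" if k: "k < d" for k
    proof -
      have "(M * X) $$ (i, k) = (\<Sum>m = 0..<d. M $$ (i, m) * X $$ (m, k))"
        using Mc \<open>i < d\<close> k by (simp add: scalar_prod_def X_def)
      also have "\<dots> = (\<Sum>m = 0..<d. if m = a then (if k = b then M $$ (i, a) else 0) else 0)"
        using k by (intro sum.cong refl) (auto simp: X_def)
      finally show ?thesis using ab by simp
    qed
    have "(M * X * M) $$ (i, j) = (\<Sum>k = 0..<d. (M * X) $$ (i, k) * M $$ (k, j))"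
      using Mc that by (simp add: scalar_prod_def X_def)
    also have "\<dots> = (\<Sum>k = 0..<d. if k = b then M $$ (i, a) * M $$ (b, j) else 0)"
      by (intro sum.cong refl) (auto simp: MX)
    finally show ?thesis using ab by simp
  qed
  have cM: "c * M $$ (i, j) = M $$ (i, a) * M $$ (b, j)" if "i < d" "j < d" for i j
    using MXM[OF that] key[OF l0(1)] y(2) l0(1) Mc that by (simp add: M_def)
  have cba: "c = M $$ (b, a)" using cM[OF ab(2,1)] ab(3) by simp
  then have c0: "c \<noteq> 0" using ab by simp
  have other: "f e ! l = 0\<^sub>m (ds ! l) (ds ! l)" if l: "l < length ds" "l \<noteq> l0" for l
  proof (rule eq_matI)
    note cl = iso_carrier[OF E(1) l(1)]
    show "dim_row (f e ! l) = dim_row (0\<^sub>m (ds ! l) (ds ! l))" "dim_col (f e ! l) = dim_col (0\<^sub>m (ds ! l) (ds ! l))"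
      using cl by auto
    have "c \<cdot>\<^sub>m (f e ! l) = 0\<^sub>m (ds ! l) (ds ! l)" using key[OF l(1)] y(2) l cl by simp
    then have "(c \<cdot>\<^sub>m (f e ! l)) $$ (i, j) = 0" if "i < ds ! l" "j < ds ! l" for i j using that by simp
    then show "f e ! l $$ (i, j) = 0\<^sub>m (ds ! l) (ds ! l) $$ (i, j)"
      if "i < dim_row (0\<^sub>m (ds ! l) (ds ! l))" "j < dim_col (0\<^sub>m (ds ! l) (ds ! l))" for i j
      using that c0 cl by simp
  qed
  have "vec_space.rank d M \<le> 1"
  proof (rule vec_space.rank_le_1_product_entries[OF Mc])
    fix i j assume "i < dim_row M" "j < dim_col M"
    then have ij: "i < d" "j < d" using Mc by auto
    show "M $$ (i, j) = M $$ (i, a) * (M $$ (b, j) / c)" using cM[OF ij] c0 by (simp add: field_simps)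
  qed
  have "total_rank ds (f e) = (\<Sum>l<length ds. if l = l0 then vec_space.rank d M else 0)"
    unfolding total_rank_def using other by (intro sum.cong refl) (auto simp: M_def d_def vec_space.rank_0I)
  also have "\<dots> = vec_space.rank d M" using l0 by simp
  finally show "total_rank ds (f e) \<le> 1" using \<open>vec_space.rank d M \<le> 1\<close> by simp
  have "c * (\<Sum>i<d. M $$ (i, i)) = (\<Sum>i<d. M $$ (b, i) * M $$ (i, a))"
    unfolding sum_distrib_left using cM by (intro sum.cong refl) (simp add: mult.commute)
  also have "\<dots> = (M * M) $$ (b, a)" using Mc ab by (simp add: scalar_prod_def lessThan_atLeast0)
  also have "M * M = M" using iso_mult[OF E(1) E(1) l0(1)] E(5) by (simp add: M_def)
  finally have tr: "(\<Sum>i<d. M $$ (i, i)) = 1" using cba c0 by simp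
  have "total_trace ds (f e) = (\<Sum>l<length ds. if l = l0 then (\<Sum>i<d. M $$ (i, i)) else 0)"
    unfolding total_trace_def using other by (intro sum.cong refl) (auto simp: M_def d_def)
  then show "total_trace ds (f e) = 1" using l0 tr by simp
qed

lemma sum_minimal_rank_trace:
  assumes "finite S" "\<And>e. e \<in> S \<Longrightarrow> minimal_in B e"
  shows "total_rank ds (f (\<Sum>S)) \<le> card S" "total_trace ds (f (\<Sum>S)) = of_nat (card S)"
proof -
  have "total_rank ds (f (\<Sum>S)) \<le> card S \<and> total_trace ds (f (\<Sum>S)) = of_nat (card S)"
    using assms
  proof (induction S rule: finite_induct)
    case (insert e S)
    have e: "minimal_in B e" and S: "\<Sum>S \<in> B"
      using insert.prems minimal_inD(1) by (auto intro!: subalgebra_sum[OF star_subalgebraD[OF B]])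
    note m = minimal_rank_trace[OF e] and eB = minimal_inD(1)[OF e]
    show ?case using insert m total_rank_add[OF eB S] total_trace_add[OF eB S] by auto
  qed (simp add: total_rank_zero total_trace_zero)
  then show "total_rank ds (f (\<Sum>S)) \<le> card S" "total_trace ds (f (\<Sum>S)) = of_nat (card S)" by auto
qed

end

text \<open>The unit has rank equal to the number of atoms. Splitting it into the sum over
  \<open>S\<close> and the sum over the complement, subadditivity forces both ranks to attain their
  upper bounds. The argument holds for every identification \<open>f\<close>, so the definite
  description in \<open>rank_in\<close> denotes.\<close>

lemma rank_in_sum_minimal:
  assumes B: "star_subalgebra B" "finite_dimensional B" and C: "masa C B" and S: "S \<subseteq> atoms C"
  shows "rank_in B (\<Sum>S) = card S"
proof -
  note dg = fd_digraph[OF B]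
  let ?P = "atoms C"
  have fin: "finite ?P" by (rule digraph_atoms_finite[OF dg(1) C])
  then have finS: "finite S" using S finite_subset by blast
  have min: "minimal_in B e" if "e \<in> ?P" for e using digraph_atoms_minimal[OF dg(1) C that] dg(2) by simp
  have mem: "(\<Sum>T) \<in> B" if "T \<subseteq> ?P" for T
    using that min minimal_inD(1) by (intro subalgebra_sum[OF star_subalgebraD[OF B(1)]]) blast
  have rank: "total_rank ds (f (\<Sum>S)) = card S" if f: "matrix_sum_iso f B ds" for ds f
  proof -
    note F = f B(1)
    have 1: "f (\<Sum>?P) ! l = 1\<^sub>m (ds ! l)" if "l < length ds" for l
      by (rule iso_unit[OF F mem[OF order_refl] _ that]) (use digraph_unit(1)[OF dg(1) C] dg(2) in simp)
    have "vec_space.rank n (1\<^sub>m n :: complex Matrix.mat) = n" for n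
      using vec_space.det_rank_iff[of "1\<^sub>m n" n] by simp
    then have "total_rank ds (f (\<Sum>?P)) = (\<Sum>l<length ds. ds ! l)" using 1 by (simp add: total_rank_def)
    moreover have "total_trace ds (f (\<Sum>?P)) = of_nat (\<Sum>l<length ds. ds ! l)"
      using 1 by (simp add: total_trace_def)
    ultimately have all: "total_rank ds (f (\<Sum>?P)) = card ?P"
      using sum_minimal_rank_trace(2)[OF F fin min] by (metis of_nat_eq_iff)
    have "(\<Sum>?P) = (\<Sum>S) + (\<Sum>(?P - S))" using sum.subset_diff[OF S fin] by (simp add: add.commute)
    then have "card ?P \<le> total_rank ds (f (\<Sum>S)) + total_rank ds (f (\<Sum>(?P - S)))"
      using total_rank_add[OF F mem[OF S] mem[of "?P - S"]] all by auto
    moreover have "total_rank ds (f (\<Sum>(?P - S))) \<le> card (?P - S)"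
      using fin min by (intro sum_minimal_rank_trace(1)[OF F]) auto
    moreover have "total_rank ds (f (\<Sum>S)) \<le> card S"
      using finS S min by (intro sum_minimal_rank_trace(1)[OF F]) auto
    moreover have "card ?P = card S + card (?P - S)" using card_Diff_subset[OF finS S] card_mono[OF fin S] by simp
    ultimately show ?thesis by linarith
  qed
  obtain ds f where f: "0 \<notin> set ds" "matrix_sum_iso f B ds" using matrix_sum_iso_exists[OF dg(1)] dg(2) by auto
  show ?thesis
    unfolding rank_in_def total_rank_def[symmetric]
  proof (rule the_equality)
    show "\<exists>ds f. 0 \<notin> set ds \<and> matrix_sum_iso f B ds \<and> card S = total_rank ds (f (\<Sum>S))"
      using f rank[OF f(2)] by (intro exI[of _ ds] exI[of _ f]) simp
  qed (auto simp: rank)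
qed

text \<open>Extend the line through \<open>p\<close> to a masa. On each of its atoms
  \<open>p\<close> acts by a scalar with \<open>c * c = c\<close>, so \<open>p\<close> is the sum of
  the atoms on which \<open>c = 1\<close>.\<close>

lemma projection_sum_atoms:
  assumes B: "star_subalgebra B" "finite_dimensional B" and p: "p \<in> B" "projection p"
  obtains C S where "masa C B" "S \<subseteq> atoms C" "p = \<Sum>S" "p \<in> C"
proof -
  note sub = star_subalgebraD[OF B(1)] and pp = projectionD[OF p(2)]
  let ?L = "range (\<lambda>c. c *\<^sub>C p)"
  have "abelian_star_subalgebra ?L"
    unfolding abelian_star_subalgebra_def star_subalgebra_def subalgebra_def
  proof (intro conjI ballI allI)
    show "0 \<in> ?L" by (rule range_eqI[of _ _ 0]) simp
  qed (auto simp: pp scaleC_scaleC scaleC_mult_left scaleC_mult_right star_scaleC mult.commute simp flip: scaleC_add_left)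
  moreover have "?L \<subseteq> B" using p sub by (auto simp: subalgebra_scale)
  ultimately obtain C where C: "masa C B" "?L \<subseteq> C" using masa_extension[OF B(2)] by blast
  have pC: "p \<in> C" using C(2) by (auto intro: range_eqI[of _ _ 1])
  note ab = masaD(2)[OF C(1)] and fdC = masa_fd[OF C(1) B(2)]
  define S where "S = {e\<in>atoms C. p * e = e}"
  have pe: "p * e = (if e \<in> S then e else 0)" if e: "e \<in> atoms C" for e
  proof -
    obtain c where c: "p * e = c *\<^sub>C e" using e pC unfolding atoms_def by blast
    have "p * (p * e) = p * e" using pp by (simp flip: mult.assoc)
    then have "(c * c) *\<^sub>C e = c *\<^sub>C e" using c by (simp add: scaleC_mult_right scaleC_scaleC)
    then have "c * c = c" using atoms_nonzero[OF e] by (simp add: cvs.scale_cancel_right)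
    then have "c = 0 \<or> c = 1" by simp
    then show ?thesis using c e by (auto simp: S_def)
  qed
  have "p = p * (\<Sum>(atoms C))" using atoms_unit[OF ab fdC pC] by simp
  also have "\<dots> = (\<Sum>e\<in>atoms C. if e \<in> S then e else 0)" by (simp add: sum_distrib_left pe)
  also have "\<dots> = \<Sum>S" using finite_atoms[OF ab fdC]
    by (simp add: sum.If_cases S_def Int_def conj_commute cong: conj_cong)
  finally have pS: "p = \<Sum>S" .
  have "S \<subseteq> atoms C" by (auto simp: S_def)
  then show thesis by (rule that[OF C(1) _ pS pC])
qed

lemma rank_in_eq_1_iff:
  assumes B: "star_subalgebra B" "finite_dimensional B" and p: "p \<in> B" "projection p"
  shows "rank_in B p = 1 \<longleftrightarrow> minimal_in B p"
proof -
  obtain C S where C: "masa C B" "S \<subseteq> atoms C" "p = \<Sum>S" using projection_sum_atoms[OF B p] .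
  have r: "rank_in B p = card S" using rank_in_sum_minimal[OF B C(1,2)] C(3) by simp
  show ?thesis
  proof
    assume "rank_in B p = 1"
    then obtain e where "S = {e}" using r card_1_singletonE by metis
    then show "minimal_in B p" using C fd_masa_atoms[OF B C(1)] by auto
  next
    assume m: "minimal_in B p"
    have fin: "finite S" using C(2) finite_atoms[OF masaD(2)[OF C(1)] masa_fd[OF C(1) B(2)]] finite_subset by blast
    have eq: "e = p" if e: "e \<in> S" for e
    proof -
      have eC: "e \<in> atoms C" using e C(2) by blast
      have pe: "p * e = e"
      proof -
        have "p * e = (\<Sum>f\<in>S. if f = e then e else 0)"
          unfolding C(3) sum_distrib_right using atoms_mult[OF masaD(2)[OF C(1)] _ eC] C(2)
          by (intro sum.cong refl) (metis subsetD)
        then show ?thesis using fin e by simp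
      qed
      have ep: "e * p = e" using pe projectionD(1)[OF p(2)] projectionD(1)[OF atoms_projection[OF eC]] by (metis star_mult)
      have eB: "e \<in> B" using eC atoms_mem masaD(1)[OF C(1)] by blast
      obtain c where "p * e * p = c *\<^sub>C p" using minimal_inD(6)[OF m eB] by blast
      then have c: "e = c *\<^sub>C p" using pe ep by simp
      have "e * e = e" using projectionD(2)[OF atoms_projection[OF eC]] .
      then have "(c * c) *\<^sub>C p = c *\<^sub>C p"
        using projectionD(2)[OF p(2)] unfolding c by (simp add: scaleC_mult_left scaleC_mult_right scaleC_scaleC)
      then have "c * c = c" using minimal_inD(3)[OF m] by (simp add: cvs.scale_cancel_right)
      moreover have "c \<noteq> 0" using c atoms_nonzero[OF eC] by auto
      ultimately show ?thesis using c by simp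
    qed
    have "S \<noteq> {}" using C(3) minimal_inD(3)[OF m] by auto
    then have "S = {p}" using eq by blast
    then show "rank_in B p = 1" using r by simp
  qed
qed

lemma rank_in_le_1_iff:
  assumes B: "star_subalgebra B" "finite_dimensional B" and p: "p \<in> B" "projection p"
  shows "rank_in B p \<le> 1 \<longleftrightarrow> p = 0 \<or> minimal_in B p"
proof -
  obtain C S where C: "masa C B" "S \<subseteq> atoms C" "p = \<Sum>S" using projection_sum_atoms[OF B p] .
  have r: "rank_in B p = card S" using rank_in_sum_minimal[OF B C(1,2)] C(3) by simp
  have fin: "finite S" using C(2) finite_atoms[OF masaD(2)[OF C(1)] masa_fd[OF C(1) B(2)]] finite_subset by blast
  have "p = 0 \<longleftrightarrow> rank_in B p = 0"
  proof
    assume "p = 0"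
    have "e = 0" if "e \<in> S" for e
    proof -
      have eC: "e \<in> atoms C" using that C(2) by blast
      have "p * e = (\<Sum>f\<in>S. if f = e then e else 0)"
        unfolding C(3) sum_distrib_right using atoms_mult[OF masaD(2)[OF C(1)] _ eC] C(2)
        by (intro sum.cong refl) (metis subsetD)
      then show ?thesis using fin that \<open>p = 0\<close> by simp
    qed
    then have "S = {}" using C(2) atoms_nonzero by blast
    then show "rank_in B p = 0" using r by simp
  next
    assume "rank_in B p = 0"
    then show "p = 0" using r fin C(3) by auto
  qed
  then show ?thesis using rank_in_eq_1_iff[OF assms] by linarith
qed

subsection \<open>Regular maps\<close>

text \<open>\<open>regular_map\<close> in terms of the extensions to the generated C*-algebras, with minimal
  projections in place of ranks and an arbitrary finite index set.\<close>

definition regular_family_on ::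
  "'i set \<Rightarrow> ('i \<Rightarrow> 'a \<Rightarrow> 'a) \<Rightarrow> 'a::cstar_algebra set \<Rightarrow> 'a set \<Rightarrow> bool" where
  "regular_family_on I g A B \<longleftrightarrow> finite I \<and>
     (\<forall>i\<in>I. star_hom (g i) (generated_cstar A) (generated_cstar B) \<and> g i ` A \<subseteq> B \<and>
        (\<forall>e. minimal_in (generated_cstar A) e \<longrightarrow> g i e = 0 \<or> minimal_in (generated_cstar B) (g i e))) \<and>
     (\<forall>i\<in>I. \<forall>j\<in>I. i \<noteq> j \<longrightarrow> (\<forall>x\<in>generated_cstar A. \<forall>y\<in>generated_cstar A. g i x * g j y = 0))"

lemma regular_family_onD:
  assumes "regular_family_on I g A B"
  shows "finite I" "i \<in> I \<Longrightarrow> star_hom (g i) (generated_cstar A) (generated_cstar B)"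
    "i \<in> I \<Longrightarrow> x \<in> A \<Longrightarrow> g i x \<in> B"
    "i \<in> I \<Longrightarrow> minimal_in (generated_cstar A) e \<Longrightarrow> g i e = 0 \<or> minimal_in (generated_cstar B) (g i e)"
    "i \<in> I \<Longrightarrow> j \<in> I \<Longrightarrow> i \<noteq> j \<Longrightarrow> x \<in> generated_cstar A \<Longrightarrow> y \<in> generated_cstar A \<Longrightarrow> g i x * g j y = 0"
  using assms unfolding regular_family_on_def by blast+

lemma regular_family_onI:
  assumes "finite I" "\<And>i. i \<in> I \<Longrightarrow> star_hom (g i) (generated_cstar A) (generated_cstar B)"
    "\<And>i x. i \<in> I \<Longrightarrow> x \<in> A \<Longrightarrow> g i x \<in> B"
    "\<And>i e. i \<in> I \<Longrightarrow> minimal_in (generated_cstar A) e \<Longrightarrow> g i e = 0 \<or> minimal_in (generated_cstar B) (g i e)"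
    "\<And>i j x y. i \<in> I \<Longrightarrow> j \<in> I \<Longrightarrow> i \<noteq> j \<Longrightarrow> x \<in> generated_cstar A \<Longrightarrow> y \<in> generated_cstar A \<Longrightarrow> g i x * g j y = 0"
  shows "regular_family_on I g A B"
  using assms unfolding regular_family_on_def by blast

lemma regular_family_star_hom:
  assumes r: "regular_family_on I g A B"
  shows "star_hom (\<lambda>x. \<Sum>i\<in>I. g i x) (generated_cstar A) (generated_cstar B)"
proof -
  note R = regular_family_onD[OF r] and H = star_homD[OF R(2)]
  have "(\<Sum>i\<in>I. g i x) \<in> generated_cstar B" if "x \<in> generated_cstar A" for x
    using H(1) that by (intro subalgebra_sum[OF generated_subalgebra]) auto
  moreover have "(\<Sum>i\<in>I. g i (x * y)) = (\<Sum>i\<in>I. g i x) * (\<Sum>i\<in>I. g i y)"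
    if x: "x \<in> generated_cstar A" and y: "y \<in> generated_cstar A" for x y
  proof -
    have "(\<Sum>i\<in>I. g i x) * (\<Sum>i\<in>I. g i y) = (\<Sum>i\<in>I. \<Sum>j\<in>I. g i x * g j y)" by (rule sum_product)
    also have "\<dots> = (\<Sum>i\<in>I. \<Sum>j\<in>I. if j = i then g i (x * y) else 0)"
      using R(5) H(3) x y by (intro sum.cong refl) auto
    finally show ?thesis using R(1) by simp
  qed
  ultimately show ?thesis
    unfolding star_hom_def using H(2,4,5)
    by (auto simp: sum.distrib cvs.scale_sum_right star_sum)
qed

lemma regular_family_into:
  "regular_family_on I g A B \<Longrightarrow> subalgebra B \<Longrightarrow> x \<in> A \<Longrightarrow> (\<Sum>i\<in>I. g i x) \<in> B"
  using regular_family_onD(3)[of I g A B] by (intro subalgebra_sum) auto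

lemma regular_family_reindex:
  assumes "regular_family_on I g A B" "bij_betw h J I"
  shows "regular_family_on J (\<lambda>j. g (h j)) A B"
proof -
  note R = regular_family_onD[OF assms(1)]
  have hI: "h j \<in> I" if "j \<in> J" for j using assms(2) that by (auto simp: bij_betw_def)
  have hh: "h i \<noteq> h j" if "i \<in> J" "j \<in> J" "i \<noteq> j" for i j
    using assms(2) that by (auto simp: bij_betw_def inj_on_def)
  show ?thesis
  proof (rule regular_family_onI)
    show "finite J" using bij_betw_finite[OF assms(2)] R(1) by simp
    show "g (h i) x * g (h j) y = 0"
      if "i \<in> J" "j \<in> J" "i \<noteq> j" "x \<in> generated_cstar A" "y \<in> generated_cstar A" for i j x y
      by (rule R(5)[OF hI hI hh]) (use that in auto)
  qed (use R(2-4) hI in blast)+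
qed

lemma regular_mapI:
  assumes A: "digraph_algebra A" and B: "digraph_algebra B" and r: "regular_family_on I g A B"
    and f: "\<And>a. a \<in> A \<Longrightarrow> f a = (\<Sum>i\<in>I. g i a)"
  shows "regular_map f A B"
proof -
  note G = generated_star_subalgebra digraph_generated_fd
  obtain h where h: "bij_betw h {0..<card I} I"
    using ex_bij_betw_nat_finite[OF regular_family_onD(1)[OF r]] by blast
  define k where "k j = g (h j)" for j
  have k: "regular_family_on {0..<card I} k A B"
    unfolding k_def by (rule regular_family_reindex[OF r h])
  note K = regular_family_onD[OF k]
  have fk: "f a = (\<Sum>i<card I. k i a)" if "a \<in> A" for a
    using f[OF that] sum.reindex_bij_betw[OF h, of "\<lambda>i. g i a"] by (simp add: k_def lessThan_atLeast0)
  have se: "star_extendible (k i) A B" if "i < card I" for i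
    unfolding star_extendible_def using K(2)[of i] K(3)[of i] that by auto
  have mo: "multiplicity_one (k i) A B" if i: "i < card I" for i
    unfolding multiplicity_one_def
  proof (intro ballI impI)
    fix p assume p: "p \<in> A" "projection p \<and> rank_in (generated_cstar A) p = 1"
    have pG: "p \<in> generated_cstar A" using p(1) generated_superset by blast
    have "minimal_in (generated_cstar A) p"
      using rank_in_eq_1_iff[OF G(1) G(2)[OF A] pG] p(2) by blast
    then have "k i p = 0 \<or> minimal_in (generated_cstar B) (k i p)" using K(4)[of i] i by simp
    moreover have "k i p \<in> generated_cstar B" "projection (k i p)"
      using K(2)[of i] i star_homD(1) star_hom_projection pG p(2) by (metis atLeastLessThan_iff le0)+
    ultimately show "rank_in (generated_cstar B) (k i p) \<le> 1"
      using rank_in_le_1_iff[OF G(1) G(2)[OF B]] by blast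
  qed
  have "star_extendible f A B"
    unfolding star_extendible_def
  proof (intro conjI exI[of _ "\<lambda>x. \<Sum>i\<in>{0..<card I}. k i x"] ballI)
    show "f ` A \<subseteq> B"
      using fk regular_family_into[OF k digraph_subalgebra[OF B]] by (auto simp: lessThan_atLeast0)
    show "star_hom (\<lambda>x. \<Sum>i = 0..<card I. k i x) (generated_cstar A) (generated_cstar B)"
      by (rule regular_family_star_hom[OF k])
    show "f a = (\<Sum>i = 0..<card I. k i a)" if "a \<in> A" for a using fk[OF that] by (simp add: lessThan_atLeast0)
  qed
  moreover have "k i e * k j e = 0" if "is_unit A e" "i < card I" "j < card I" "i \<noteq> j" for i j e
    using K(5)[of i j e e] that generated_superset by (auto simp: is_unit_def)
  ultimately show ?thesis unfolding regular_map_def using se mo fk by blast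
qed

text \<open>The multiplicity and orthogonality conditions concern elements of \<open>A\<close>,
  while the family is needed on the generated algebra. Atoms lie in \<open>A\<close>, so
  \<open>hom_minimal\<close> extends the first; the unit lies in \<open>A\<close>, and inserting it
  between two factors extends the second.\<close>

lemma regular_mapE:
  assumes f: "regular_map f A B" and A: "digraph_algebra A" and B: "digraph_algebra B"
  shows "\<exists>(s::nat) g. regular_family_on {..<s} g A B \<and> (\<forall>a\<in>A. f a = (\<Sum>i<s. g i a))"
proof -
  note G = generated_star_subalgebra digraph_generated_fd
  obtain C where C: "masa C A" using fd_masa_exists[OF digraph_subalgebra digraph_fd] A by blast
  let ?u = "\<Sum>(atoms C)"
  have u: "is_unit A ?u"
    unfolding is_unit_def using digraph_unit[OF A C] digraph_unit_mem(2)[OF A C] generated_superset by blast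
  obtain s :: nat and g where g: "\<forall>i<s. star_extendible (g i) A B \<and> multiplicity_one (g i) A B"
    and ort0: "\<forall>e. is_unit A e \<longrightarrow> (\<forall>i<s. \<forall>j<s. i \<noteq> j \<longrightarrow> g i e * g j e = 0)"
    and fs: "\<forall>a\<in>A. f a = (\<Sum>i<s. g i a)"
    using f unfolding regular_map_def by (elim conjE exE) (rule that; assumption)
  have ort: "\<forall>i<s. \<forall>j<s. i \<noteq> j \<longrightarrow> g i ?u * g j ?u = 0" using ort0[rule_format, OF u] by simp
  have "\<forall>i. \<exists>h. i < s \<longrightarrow> star_hom h (generated_cstar A) (generated_cstar B) \<and> (\<forall>a\<in>A. g i a = h a)"
  proof
    fix i
    show "\<exists>h. i < s \<longrightarrow> star_hom h (generated_cstar A) (generated_cstar B) \<and> (\<forall>a\<in>A. g i a = h a)"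
    proof (cases "i < s")
      case True
      then have "star_extendible (g i) A B" using g by simp
      then show ?thesis unfolding star_extendible_def by blast
    qed simp
  qed
  from choice[OF this] obtain h where
    h0: "\<forall>i. i < s \<longrightarrow> star_hom (h i) (generated_cstar A) (generated_cstar B) \<and> (\<forall>a\<in>A. g i a = h i a)" ..
  have h: "\<And>i. i < s \<Longrightarrow> star_hom (h i) (generated_cstar A) (generated_cstar B)"
    "\<And>i a. i < s \<Longrightarrow> a \<in> A \<Longrightarrow> g i a = h i a" using h0 by simp_all
  have "regular_family_on {..<s} h A B"
    unfolding regular_family_on_def
  proof (intro conjI ballI allI impI)
    show "finite {..<s}" by simp
  next
    fix i assume "i \<in> {..<s}"
    then have i: "i < s" by simp
    show "star_hom (h i) (generated_cstar A) (generated_cstar B)" by (rule h(1)[OF i])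
    show "h i ` A \<subseteq> B" using g i h(2) unfolding star_extendible_def by fastforce
    show "h i e = 0 \<or> minimal_in (generated_cstar B) (h i e)" if e: "minimal_in (generated_cstar A) e" for e
    proof (rule hom_minimal[OF A C G(1) h(1)[OF i] _ e])
      fix p assume p: "p \<in> atoms C"
      note P = minimal_inD[OF digraph_atoms_minimal[OF A C p]] and pA = digraph_atoms_mem[OF A C p]
      have "rank_in (generated_cstar A) p = 1"
        using rank_in_eq_1_iff[OF G(1) G(2)[OF A] P(1,2)] digraph_atoms_minimal[OF A C p] by blast
      then have "rank_in (generated_cstar B) (g i p) \<le> 1"
        using g i pA P(2) unfolding multiplicity_one_def by blast
      then have r: "rank_in (generated_cstar B) (h i p) \<le> 1" using h(2)[OF i pA] by simp
      have "h i p \<in> generated_cstar B" "projection (h i p)"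
        using star_homD(1)[OF h(1)[OF i] P(1)] star_hom_projection[OF h(1)[OF i] P(1,2)] .
      then show "h i p = 0 \<or> minimal_in (generated_cstar B) (h i p)"
        using r rank_in_le_1_iff[OF G(1) G(2)[OF B]] by blast
    qed
  next
    fix i j x y assume "i \<in> {..<s}" "j \<in> {..<s}" and ij: "i \<noteq> j" and x: "x \<in> generated_cstar A" and y: "y \<in> generated_cstar A"
    then have i: "i < s" and j: "j < s" by auto
    have uA: "?u \<in> A" "?u \<in> generated_cstar A" using digraph_unit_mem[OF A C] by auto
    have hx: "h i x = h i x * h i ?u"
      using star_homD(3)[OF h(1)[OF i] x uA(2)] digraph_unit(2)[OF A C x] by simp
    have hy: "h j y = h j ?u * h j y"
      using star_homD(3)[OF h(1)[OF j] uA(2) y] digraph_unit(1)[OF A C y] by simp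
    have "h i x * h j y = h i x * (h i ?u * h j ?u) * h j y"
      using hx hy by (metis mult.assoc)
    also have "h i ?u * h j ?u = g i ?u * g j ?u" by (simp only: h(2)[OF i uA(1)] h(2)[OF j uA(1)])
    also have "\<dots> = 0" using ort[rule_format, OF i j ij] .
    finally show "h i x * h j y = 0" by simp
  qed
  moreover have "\<forall>a\<in>A. f a = (\<Sum>i<s. h i a)" using fs h(2) by simp
  ultimately show ?thesis by blast
qed

lemma regular_family_comp:
  assumes g: "regular_family_on I g A B" and h: "regular_family_on J h B D"
  shows "regular_family_on (I \<times> J) (\<lambda>(i, j) x. h j (g i x)) A D"
proof -
  note R = regular_family_onD[OF g] and H = regular_family_onD[OF h]
  have gm: "g i x \<in> generated_cstar B" if "i \<in> I" "x \<in> generated_cstar A" for i x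
    using star_homD(1)[OF R(2)] that by blast
  have "star_hom (\<lambda>x. h j (g i x)) (generated_cstar A) (generated_cstar D)" if ij: "i \<in> I" "j \<in> J" for i j
    unfolding star_hom_def
    using star_homD[OF R(2)[OF ij(1)]] star_homD[OF H(2)[OF ij(2)]] by auto
  moreover have "h j (g i x) * h j' (g i' y) = 0"
    if ij: "i \<in> I" "j \<in> J" "i' \<in> I" "j' \<in> J" "(i, j) \<noteq> (i', j')" and x: "x \<in> generated_cstar A" and y: "y \<in> generated_cstar A"
    for i j i' j' x y
  proof (cases "j = j'")
    case True
    then have "i \<noteq> i'" using ij by auto
    then have "g i x * g i' y = 0" using R(5) ij x y by blast
    then have "h j (g i x * g i' y) = 0" using star_hom_zero[OF H(2)[OF ij(2)] generated_subalgebra] by simp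
    then show ?thesis using star_homD(3)[OF H(2)[OF ij(2)] gm[OF ij(1) x] gm[OF ij(3) y]] True by simp
  next
    case False
    then show ?thesis using H(5) ij gm x y by blast
  qed
  moreover have "h j (g i e) = 0 \<or> minimal_in (generated_cstar D) (h j (g i e))"
    if ij: "i \<in> I" "j \<in> J" and e: "minimal_in (generated_cstar A) e" for i j e
    using R(4)[OF ij(1) e] H(4)[OF ij(2)] star_hom_zero[OF H(2)[OF ij(2)] generated_subalgebra] by auto
  moreover have "h j (g i x) \<in> D" if "i \<in> I" "j \<in> J" "x \<in> A" for i j x
    using that R(3) H(3) by blast
  ultimately show ?thesis
    using R(1) H(1) by (intro regular_family_onI) (fastforce simp del: mult_eq_0_iff)+
qed

text \<open>Both \<open>Z\<close> and \<open>star Z\<close> lie in \<open>B\<close>, so conjugation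
  by this unitary preserves \<open>B\<close> itself and not merely the generated algebra. This is
  how the approximately inner automorphism is undone.\<close>

lemma regular_family_conj:
  assumes g: "regular_family_on I g A B" and B: "digraph_algebra B" and D: "masa D B"
    and Z: "Z \<in> B" "star Z \<in> B" "star Z * Z = \<Sum>(atoms D)" "Z * star Z = \<Sum>(atoms D)"
  shows "regular_family_on I (\<lambda>i x. Z * g i x * star Z) A B"
proof -
  note R = regular_family_onD[OF g] and G = generated_subalgebra[of B]
  have ZG: "Z \<in> generated_cstar B" "star Z \<in> generated_cstar B" using Z generated_superset by blast+
  have zz: "star Z * (Z * x) = x" if "x \<in> generated_cstar B" for x
    using digraph_unit(1)[OF B D that] Z(3) by (simp flip: mult.assoc)
  have gm: "g i x \<in> generated_cstar B" if "i \<in> I" "x \<in> generated_cstar A" for i x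
    using star_homD(1)[OF R(2)] that by blast
  have prod: "(Z * x * star Z) * (Z * y * star Z) = Z * (x * y) * star Z" if "y \<in> generated_cstar B" for x y
    using zz[OF that] by (simp add: mult.assoc) (metis mult.assoc)
  have "star_hom (\<lambda>x. Z * g i x * star Z) (generated_cstar A) (generated_cstar B)" if i: "i \<in> I" for i
    unfolding star_hom_def using star_homD[OF R(2)[OF i]] prod gm[OF i] ZG
    by (auto simp: subalgebra_mult[OF G] distrib_left distrib_right scaleC_mult_left scaleC_mult_right star_mult mult.assoc)
  moreover have "Z * g i x * star Z \<in> B" if "i \<in> I" "x \<in> A" for i x
    using R(3)[OF that] Z digraph_subalgebra[OF B] by (simp add: subalgebra_mult)
  moreover have "(Z * g i x * star Z) * (Z * g j y * star Z) = 0"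
    if "i \<in> I" "j \<in> I" "i \<noteq> j" "x \<in> generated_cstar A" "y \<in> generated_cstar A" for i j x y
    using prod[OF gm, of j y "g i x"] R(5)[OF that] that by simp
  moreover have "Z * g i e * star Z = 0 \<or> minimal_in (generated_cstar B) (Z * g i e * star Z)"
    if i: "i \<in> I" and e: "minimal_in (generated_cstar A) e" for i e
  proof (cases "g i e = 0")
    case False
    then have m: "minimal_in (generated_cstar B) (g i e)" using R(4)[OF i e] by blast
    note M = minimal_inD[OF m]
    have pz: "projection (Z * g i e * star Z)"
      using prod[OF M(1), of "g i e"] M(4,5) by (simp add: projection_def star_mult mult.assoc)
    have nz: "Z * g i e * star Z \<noteq> 0"
    proof
      assume "Z * g i e * star Z = 0"
      then have "star Z * (Z * (g i e * star Z)) * Z = 0" by (simp add: mult.assoc)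
      then have "g i e * (star Z * Z) = 0" using zz[of "g i e * star Z"] M(1) ZG by (simp add: subalgebra_mult[OF G] mult.assoc)
      then show False using digraph_unit(2)[OF B D M(1)] Z(3) False by simp
    qed
    have "minimal_in (generated_cstar B) (Z * g i e * star Z)"
    proof (rule minimal_transfer[OF generated_star_subalgebra m, where u = "Z * g i e" and \<beta> = 1])
      show "Z * g i e \<in> generated_cstar B" "Z * g i e * star Z \<in> generated_cstar B"
        using M(1) ZG by (simp_all add: subalgebra_mult[OF G])
      show "Z * g i e * g i e = Z * g i e" using M(5) by (simp add: mult.assoc)
      show "Z * g i e * star (Z * g i e) = 1 *\<^sub>C (Z * g i e * star Z)"
        using M(4,5) by (simp add: star_mult) (metis mult.assoc)
    qed (use pz nz in auto)
    then show ?thesis ..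
  qed simp
  ultimately show ?thesis
    using R(1) by (intro regular_family_onI) blast+
qed

lemma orthogonal_projections_abelian:
  assumes Q: "finite Q" "\<And>q. q \<in> Q \<Longrightarrow> projection q" "\<And>q r. q \<in> Q \<Longrightarrow> r \<in> Q \<Longrightarrow> q \<noteq> r \<Longrightarrow> q * r = (0::'a::cstar_algebra)"
  shows "abelian_star_subalgebra {\<Sum>q\<in>Q. c q *\<^sub>C q |c. True}"
proof -
  let ?s = "\<lambda>c. \<Sum>q\<in>Q. c q *\<^sub>C q"
  have mult: "?s c * ?s d = ?s (\<lambda>q. c q * d q)" for c d
  proof -
    have "?s c * ?s d = (\<Sum>q\<in>Q. \<Sum>r\<in>Q. if r = q then (c q * d q) *\<^sub>C q else 0)"
      unfolding sum_product using Q(2,3)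
      by (intro sum.cong refl) (auto simp: scaleC_mult_left scaleC_mult_right scaleC_scaleC projection_def mult.commute)
    then show ?thesis using Q(1) by simp
  qed
  have add: "?s c + ?s d = ?s (\<lambda>q. c q + d q)" for c d by (simp add: scaleC_add_left sum.distrib)
  have sc: "a *\<^sub>C ?s c = ?s (\<lambda>q. a * c q)" for a c by (simp add: cvs.scale_sum_right scaleC_scaleC)
  have st: "star (?s c) = ?s (\<lambda>q. cnj (c q))" for c
    using Q(2) by (simp add: star_sum star_scaleC projection_def)
  have mk: "?s c \<in> {?s c |c. True}" for c by (rule CollectI, rule exI[of _ c]) simp
  show ?thesis
    unfolding abelian_star_subalgebra_def star_subalgebra_def subalgebra_def
  proof (intro conjI ballI allI)
    show "0 \<in> {?s c |c. True}" by (rule CollectI, rule exI[of _ "\<lambda>q. 0"]) simp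
    fix x y assume "x \<in> {?s c |c. True}" "y \<in> {?s c |c. True}"
    then obtain c d where cd: "x = ?s c" "y = ?s d" by blast
    show "x + y \<in> {?s c |c. True}" unfolding cd add by (rule mk)
    show "x * y \<in> {?s c |c. True}" unfolding cd mult by (rule mk)
    show "x * y = y * x" unfolding cd mult by (simp add: mult.commute)
  next
    fix a x assume "x \<in> {?s c |c. True}"
    then obtain c where c: "x = ?s c" by blast
    show "a *\<^sub>C x \<in> {?s c |c. True}" unfolding c sc by (rule mk)
    show "star x \<in> {?s c |c. True}" unfolding c st by (rule mk)
  qed
qed

lemma masa_span:
  assumes A: "digraph_algebra A" and C: "masa C A" and x: "x \<in> C"
  shows "\<exists>c. x = (\<Sum>e\<in>atoms C. c e *\<^sub>C e)"
  by (rule atoms_expansion[OF masaD(2)[OF C] masa_fd[OF C digraph_fd[OF A]] x])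

text \<open>The images \<open>g\<^sub>i(e)\<close> of the atoms are orthogonal minimal projections; any masa containing
  them works, because it acts by scalars on each of them.\<close>

lemma standard_masa_exists:
  assumes A: "digraph_algebra A" and B: "digraph_algebra B" and C: "masa C A" and r: "regular_family_on I g A B"
  shows "\<exists>D. masa D B \<and> (\<forall>c\<in>C. (\<Sum>i\<in>I. g i c) \<in> D) \<and>
    (\<forall>v\<in>normaliser C (generated_cstar A). (\<Sum>i\<in>I. g i v) \<in> normaliser D (generated_cstar B))"
proof -
  note R = regular_family_onD[OF r] and GA = generated_subalgebra[of A] and H = star_homD[OF R(2)]
  let ?G = "generated_cstar A"
  note atG = minimal_inD(1)[OF digraph_atoms_minimal[OF A C]]
  define Q where "Q = (\<lambda>(i, e). g i e) ` (I \<times> atoms C)"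
  define D0 where "D0 = {\<Sum>q\<in>Q. c q *\<^sub>C q |c. True}"
  have finQ: "finite Q" using R(1) digraph_atoms_finite[OF A C] by (simp add: Q_def)
  have Qp: "projection q" if qQ: "q \<in> Q" for q
  proof -
    obtain i e where q: "i \<in> I" "e \<in> atoms C" "q = g i e" using qQ unfolding Q_def by auto
    then show ?thesis using star_hom_projection[OF R(2)[OF q(1)] atG[OF q(2)] atoms_projection[OF q(2)]] by simp
  qed
  have Qo: "q * r = 0" if qr: "q \<in> Q" "r \<in> Q" "q \<noteq> r" for q r
  proof -
    obtain i e where q: "i \<in> I" "e \<in> atoms C" "q = g i e" using qr(1) unfolding Q_def by auto
    obtain j f where r: "j \<in> I" "f \<in> atoms C" "r = g j f" using qr(2) unfolding Q_def by auto
    show ?thesis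
    proof (cases "i = j")
      case True
      then have "e \<noteq> f" using qr q r by auto
      then have "e * f = 0" using digraph_atoms_mult[OF A C q(2) r(2)] by simp
      then show ?thesis using H(3)[OF q(1) atG[OF q(2)] atG[OF r(2)]] q r True star_hom_zero[OF R(2)[OF q(1)] GA] by simp
    next
      case False
      then show ?thesis using R(5) q r atG by blast
    qed
  qed
  have D0: "abelian_star_subalgebra D0" unfolding D0_def by (rule orthogonal_projections_abelian[OF finQ Qp Qo])
  have QB: "q \<in> B" if "q \<in> Q" for q using that R(3) digraph_atoms_mem[OF A C] by (auto simp: Q_def)
  have "D0 \<subseteq> B"
    unfolding D0_def using QB
    by (auto intro!: subalgebra_sum[OF digraph_subalgebra[OF B]] subalgebra_scale[OF digraph_subalgebra[OF B]])
  then obtain D where D: "masa D B" "D0 \<subseteq> D" using masa_extension[OF digraph_fd[OF B] D0] by blast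
  have geD: "g i e \<in> D" if ie: "i \<in> I" "e \<in> atoms C" for i e
  proof -
    have qQ: "g i e \<in> Q" using ie by (auto simp: Q_def)
    have "g i e = (\<Sum>q\<in>Q. (if q = g i e then 1 else 0) *\<^sub>C q)"
      using finQ qQ by (simp add: if_distrib[of "\<lambda>c. c *\<^sub>C _"] cong: if_cong)
    then have "g i e \<in> D0" unfolding D0_def by (intro CollectI exI[of _ "\<lambda>q. if q = g i e then 1 else 0"]) simp
    then show ?thesis using D(2) by blast
  qed
  note Dsub = masaD(4)[OF D(1)] and Dcom = abelian_star_subalgebraD(3)[OF masaD(2)[OF D(1)]]
  have CG: "C \<subseteq> ?G" using masaD(1)[OF C] generated_superset by blast
  have gC: "g i c \<in> D" if i: "i \<in> I" and c: "c \<in> C" for i c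
  proof -
    obtain k where k: "c = (\<Sum>e\<in>atoms C. k e *\<^sub>C e)" using masa_span[OF A C c] by blast
    have "g i c = (\<Sum>e\<in>atoms C. k e *\<^sub>C g i e)"
      unfolding k using star_hom_sum[OF R(2)[OF i] GA, of "atoms C" "\<lambda>e. k e *\<^sub>C e"] H(4)[OF i] atG
      by (simp add: subalgebra_scale[OF GA])
    then show ?thesis using geD[OF i] by (simp add: subalgebra_sum[OF Dsub] subalgebra_scale[OF Dsub])
  qed
  have DG: "d \<in> generated_cstar B" if "d \<in> D" for d using that masaD(1)[OF D(1)] generated_superset by blast
  let ?f = "\<lambda>x. \<Sum>i\<in>I. g i x" and ?u = "\<Sum>(atoms C)"
  note F = regular_family_star_hom[OF r]
  have uG: "?u \<in> ?G" "?u \<in> C" using digraph_unit_mem[OF A C] by auto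
  have half: "star (?f v) * d * ?f v \<in> D"
    if v: "v \<in> ?G" "\<forall>c\<in>C. star v * c * v \<in> C" and d: "d \<in> D" for v d
  proof -
    have sv: "star v \<in> ?G" using v star_subalgebra_star[OF generated_star_subalgebra] by blast
    have gs: "star (g i v) = g i (star v)" if "i \<in> I" for i using H(5)[OF that v(1)] by simp
    have uv: "g i v = g i ?u * g i v" if i: "i \<in> I" for i
      using H(3)[OF i uG(1) v(1)] digraph_unit(1)[OF A C v(1)] by simp
    \<comment> \<open>Each \<open>g i ?u\<close> lies in \<open>D\<close>, hence commutes with
      \<open>d\<close>; the images of the unit under different summands are orthogonal, so the cross
      terms vanish.\<close>
    have off: "star (g i v) * d * g j v = 0" if i: "i \<in> I" and j: "j \<in> I" and "i \<noteq> j" for i j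
    proof -
      have "star (g i v) = star (g i v) * g i ?u"
        using uv[OF i] projectionD(1)[OF star_hom_projection[OF R(2)[OF i] uG(1) sum_atoms_projection[OF masaD(2)[OF C] order_refl]]]
        by (metis star_mult)
      then have "star (g i v) * d * g j v = star (g i v) * (g i ?u * d) * g j v" by (metis mult.assoc)
      also have "g i ?u * d = d * g i ?u" using Dcom[OF gC[OF i uG(2)] d] .
      finally have "star (g i v) * d * g j v = star (g i v) * d * (g i ?u * g j v)" by (simp add: mult.assoc)
      then show ?thesis using R(5)[OF i j \<open>i \<noteq> j\<close> uG(1) v(1)] by simp
    qed
    \<comment> \<open>Here \<open>d\<close> acts by a scalar on each \<open>g i e\<close>, which
      replaces \<open>d\<close> by a combination of images of atoms; and \<open>v\<close> normalises
      \<open>C\<close>.\<close>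
    have diag: "star (g i v) * d * g i v \<in> D" if i: "i \<in> I" for i
    proof -
      have "\<exists>c. d * g i e = c *\<^sub>C g i e" if e: "e \<in> atoms C" for e
      proof -
        have ge: "projection (g i e)" using star_hom_projection[OF R(2)[OF i] atG[OF e] atoms_projection[OF e]] .
        have "d * g i e = g i e * d * g i e"
          using Dcom[OF d geD[OF i e]] projectionD(2)[OF ge] by (metis mult.assoc)
        moreover have "\<exists>c. g i e * d * g i e = c *\<^sub>C g i e"
          using R(4)[OF i digraph_atoms_minimal[OF A C e]] minimal_inD(6)[OF _ DG[OF d]] by fastforce
        ultimately show ?thesis by simp
      qed
      then obtain c where c: "\<And>e. e \<in> atoms C \<Longrightarrow> d * g i e = c e *\<^sub>C g i e" by metis
      have giu: "g i ?u = (\<Sum>e\<in>atoms C. g i e)" using star_hom_sum[OF R(2)[OF i] GA atG] by simp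
      have "star (g i v) * d * g i v = star (g i v) * (d * g i ?u) * g i v" using uv[OF i] by (metis mult.assoc)
      also have "\<dots> = (\<Sum>e\<in>atoms C. c e *\<^sub>C (g i (star v) * g i e * g i v))"
        unfolding giu gs[OF i] using c
        by (simp add: sum_distrib_left sum_distrib_right scaleC_mult_left scaleC_mult_right)
      also have "\<dots> = (\<Sum>e\<in>atoms C. c e *\<^sub>C g i (star v * e * v))"
        using H(3)[OF i] sv v(1) atG by (simp add: subalgebra_mult[OF GA])
      also have "\<dots> \<in> D"
        using v(2) gC[OF i] atoms_mem by (intro subalgebra_sum[OF Dsub] subalgebra_scale[OF Dsub]) blast
      finally show ?thesis .
    qed
    have "star (?f v) * d * ?f v = (\<Sum>i\<in>I. \<Sum>j\<in>I. star (g i v) * d * g j v)"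
      unfolding star_sum sum_distrib_right sum_distrib_left by (rule sum.swap)
    also have "\<dots> = (\<Sum>i\<in>I. \<Sum>j\<in>I. if j = i then star (g i v) * d * g i v else 0)"
      using off by (intro sum.cong refl) auto
    also have "\<dots> \<in> D" using R(1) diag by (simp add: subalgebra_sum[OF Dsub])
    finally show ?thesis .
  qed
  have "?f v \<in> normaliser D (generated_cstar B)" if v: "v \<in> normaliser C ?G" for v
  proof -
    have v': "v \<in> ?G" "partial_isometry v" "\<forall>c\<in>C. star v * c * v \<in> C" "\<forall>c\<in>C. v * c * star v \<in> C"
      using v by (auto simp: normaliser_def)
    have sv: "star v \<in> ?G" using v'(1) star_subalgebra_star[OF generated_star_subalgebra] by blast
    have sf: "?f (star v) = star (?f v)" using star_homD(5)[OF F v'(1)] .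
    have "?f v * star (?f v) * ?f v = ?f v"
      using v'(2) sf star_homD(3)[OF F] v'(1) sv unfolding partial_isometry_def
      by (metis subalgebra_mult[OF GA])
    moreover have "?f v * d * star (?f v) \<in> D" if "d \<in> D" for d
      using half[OF sv _ that] v'(4) sf by simp
    ultimately show ?thesis
      using half[OF v'(1,3)] star_homD(1)[OF F v'(1)] by (simp add: normaliser_def partial_isometry_def)
  qed
  moreover have "?f c \<in> D" if "c \<in> C" for c using gC that by (auto intro: subalgebra_sum[OF Dsub])
  ultimately show ?thesis using D(1) by blast
qed

text \<open>The maps are given by a regular family on all of \<open>generated_cstar (A k)\<close>,
  and normalisers are taken there as well: the matrix units of the generated algebra, to which
  normalisation will be applied, need not lie in \<open>A k\<close>.\<close>

locale standard_system =
  fixes A :: "nat \<Rightarrow> 'a::cstar_algebra set" and \<phi> :: "nat \<Rightarrow> 'a \<Rightarrow> 'a" and C :: "nat \<Rightarrow> 'a set"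
  assumes dig: "\<And>k. digraph_algebra (A k)"
    and msa: "\<And>k. masa (C k) (A k)"
    and fam: "\<And>k. \<exists>(I::nat set) g. regular_family_on I g (A k) (A (Suc k)) \<and> \<phi> k = (\<lambda>x. \<Sum>i\<in>I. g i x)"
    and diag: "\<And>k c. c \<in> C k \<Longrightarrow> \<phi> k c \<in> C (Suc k)"
    and nrm: "\<And>k v. v \<in> normaliser (C k) (generated_cstar (A k)) \<Longrightarrow>
      \<phi> k v \<in> normaliser (C (Suc k)) (generated_cstar (A (Suc k)))"

text \<open>\<open>\<phi>'\<close> sums the extensions of the regular summands, so it is asserted to
  agree with \<open>\<phi>\<close> on \<open>A k\<close> only. The masas are chosen recursively,
  each from its predecessor by \<open>standard_masa_exists\<close>.\<close>

lemma standard_system_exists: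
  assumes F: "regular_family F" and s: "system_in F A \<phi>"
  shows "\<exists>\<phi>' C. standard_system A \<phi>' C \<and> (\<forall>k. \<forall>a\<in>A k. \<phi>' k a = \<phi> k a)"
proof -
  have dig: "digraph_algebra (A k)" and reg: "regular_map (\<phi> k) (A k) (A (Suc k))" for k
    using F s unfolding regular_family_def system_in_def by blast+
  have "\<forall>k. \<exists>p :: nat \<times> (nat \<Rightarrow> 'a \<Rightarrow> 'a). regular_family_on {..<fst p} (snd p) (A k) (A (Suc k)) \<and> (\<forall>a\<in>A k. \<phi> k a = (\<Sum>i<fst p. snd p i a))"
  proof
    fix k
    obtain s :: nat and g where "regular_family_on {..<s} g (A k) (A (Suc k)) \<and> (\<forall>a\<in>A k. \<phi> k a = (\<Sum>i<s. g i a))"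
      using regular_mapE[OF reg dig dig] by blast
    then show "\<exists>p :: nat \<times> (nat \<Rightarrow> 'a \<Rightarrow> 'a). regular_family_on {..<fst p} (snd p) (A k) (A (Suc k)) \<and> (\<forall>a\<in>A k. \<phi> k a = (\<Sum>i<fst p. snd p i a))"
      by (intro exI[of _ "(s, g)"]) simp
  qed
  from choice[OF this] obtain p :: "nat \<Rightarrow> nat \<times> (nat \<Rightarrow> 'a \<Rightarrow> 'a)" where
    p0: "\<forall>k. regular_family_on {..<fst (p k)} (snd (p k)) (A k) (A (Suc k)) \<and>
      (\<forall>a\<in>A k. \<phi> k a = (\<Sum>i<fst (p k). snd (p k) i a))" ..
  have p: "\<And>k. regular_family_on {..<fst (p k)} (snd (p k)) (A k) (A (Suc k))"
      "\<And>k a. a \<in> A k \<Longrightarrow> \<phi> k a = (\<Sum>i<fst (p k). snd (p k) i a)"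
    using p0 by simp_all
  define \<phi>' where "\<phi>' k x = (\<Sum>i<fst (p k). snd (p k) i x)" for k x
  have "\<exists>C. \<forall>k. masa (C k) (A k) \<and> ((\<forall>c\<in>C k. \<phi>' k c \<in> C (Suc k)) \<and>
    (\<forall>v\<in>normaliser (C k) (generated_cstar (A k)). \<phi>' k v \<in> normaliser (C (Suc k)) (generated_cstar (A (Suc k)))))"
  proof (rule dependent_nat_choice)
    show "\<exists>C. masa C (A 0)" using fd_masa_exists[OF digraph_subalgebra digraph_fd] dig by metis
    fix C k assume "masa C (A k)"
    from standard_masa_exists[OF dig dig this p(1)]
    show "\<exists>D. masa D (A (Suc k)) \<and> ((\<forall>c\<in>C. \<phi>' k c \<in> D) \<and>
      (\<forall>v\<in>normaliser C (generated_cstar (A k)). \<phi>' k v \<in> normaliser D (generated_cstar (A (Suc k)))))"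
      unfolding \<phi>'_def .
  qed
  then obtain C where C: "\<And>k. masa (C k) (A k)" "\<And>k c. c \<in> C k \<Longrightarrow> \<phi>' k c \<in> C (Suc k)"
    "\<And>k v. v \<in> normaliser (C k) (generated_cstar (A k)) \<Longrightarrow> \<phi>' k v \<in> normaliser (C (Suc k)) (generated_cstar (A (Suc k)))"
    by blast
  have "standard_system A \<phi>' C"
  proof
    show "\<exists>(I::nat set) g. regular_family_on I g (A k) (A (Suc k)) \<and> \<phi>' k = (\<lambda>x. \<Sum>i\<in>I. g i x)" for k
      using p(1) unfolding \<phi>'_def by blast
  qed (use dig C in auto)
  moreover have "\<forall>k. \<forall>a\<in>A k. \<phi>' k a = \<phi> k a" using p(2) by (simp add: \<phi>'_def)
  ultimately show ?thesis by blast
qed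

subsection \<open>Limits of direct systems\<close>

lemma seq_equiv_refl: "Bseq x \<Longrightarrow> seq_equiv x x"
  by (simp add: seq_equiv_def)

lemma seq_class_add: "Bseq x \<Longrightarrow> Bseq y \<Longrightarrow> seq_class x + seq_class y = seq_class (\<lambda>n. x n + y n :: 'a::real_normed_algebra)"
  by (rule plus_seq_algebra.abs_eq) (auto intro: seq_equiv_refl)

lemma seq_class_mult: "Bseq x \<Longrightarrow> Bseq y \<Longrightarrow> seq_class x * seq_class y = seq_class (\<lambda>n. x n * y n :: 'a::real_normed_algebra)"
  by (rule times_seq_algebra.abs_eq) (auto intro: seq_equiv_refl)

lemma seq_class_star: "Bseq x \<Longrightarrow> star (seq_class x) = seq_class (\<lambda>n. star (x n :: 'a::cstar_algebra))"
  by (rule star_seq_algebra.abs_eq) (auto intro: seq_equiv_refl)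

lemma seq_class_scale: "Bseq x \<Longrightarrow> c *\<^sub>C seq_class x = seq_class (\<lambda>n. c *\<^sub>C (x n :: 'a::cstar_algebra))"
  by (rule scaleC_seq_algebra.abs_eq) (auto intro: seq_equiv_refl)

lemma seq_class_diff: "Bseq x \<Longrightarrow> Bseq y \<Longrightarrow> seq_class x - seq_class y = seq_class (\<lambda>n. x n - y n :: 'a::cstar_algebra)"
proof -
  assume x: "Bseq x" and y: "Bseq y"
  have "- seq_class y = seq_class (\<lambda>n. - y n)" using seq_class_scale[OF y, of "-1"] by simp
  then have "seq_class x - seq_class y = seq_class x + seq_class (\<lambda>n. - y n)"
    by (simp only: diff_conv_add_uminus)
  also have "\<dots> = seq_class (\<lambda>n. x n - y n)" using seq_class_add[OF x Bseq_uminus[OF y]] by simp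
  finally show ?thesis .
qed

lemma seq_class_zero: "seq_class (\<lambda>n. 0) = (0 :: 'a::real_normed_algebra seq_algebra)"
  by (simp add: zero_seq_algebra_def)

lemma seq_class_norm_le:
  assumes "Bseq x" "\<forall>\<^sub>F n in sequentially. norm (x n) \<le> c"
  shows "norm (seq_class x :: 'a::cstar_algebra seq_algebra) \<le> c"
  using seq_class_diff_norm_le[of x "\<lambda>n. 0" c] assms by (simp add: seq_class_zero)

lemma seq_class_norm_less:
  assumes "Bseq x" "norm (seq_class x :: 'a::cstar_algebra seq_algebra) < c"
  shows "\<forall>\<^sub>F n in sequentially. norm (x n) < c"
  using seq_class_diff_norm_less[of x "\<lambda>n. 0" c] assms by (simp add: seq_class_zero)

lemma seq_class_eq_iff:
  assumes "Bseq x" "Bseq y"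
  shows "seq_class x = (seq_class y :: 'a::cstar_algebra seq_algebra) \<longleftrightarrow> (\<lambda>n. x n - y n) \<longlonglongrightarrow> 0"
proof
  assume "seq_class x = seq_class y"
  then have "norm (seq_class (\<lambda>n. x n - y n)) < e" if "e > 0" for e
    using seq_class_diff[OF assms] that by simp
  then have "\<forall>\<^sub>F n in sequentially. norm (x n - y n) < e" if "e > 0" for e
    using seq_class_norm_less[OF Bseq_diff[OF assms]] that by blast
  then show "(\<lambda>n. x n - y n) \<longlonglongrightarrow> 0" by (simp add: tendsto_iff)
next
  assume l: "(\<lambda>n. x n - y n) \<longlonglongrightarrow> 0"
  have "norm (seq_class x - seq_class y) \<le> e" if "e > 0" for e
  proof (rule seq_class_diff_norm_le[OF assms])
    have "\<forall>\<^sub>F n in sequentially. norm (x n - y n) < e" using l that by (simp add: tendsto_iff)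
    then show "\<forall>\<^sub>F n in sequentially. norm (x n - y n) \<le> e" by eventually_elim simp
  qed
  then have "norm (seq_class x - seq_class y) \<le> 0" by (rule field_le_epsilon) simp
  then show "seq_class x = seq_class y" by simp
qed

lemma seq_class_eqI:
  assumes "Bseq x" "Bseq y" "\<forall>\<^sub>F n in sequentially. x n = y n"
  shows "seq_class x = (seq_class y :: 'a::cstar_algebra seq_algebra)"
proof -
  have "\<forall>\<^sub>F n in sequentially. x n - y n = 0" using assms(3) by eventually_elim simp
  then show ?thesis unfolding seq_class_eq_iff[OF assms(1,2)] by (rule tendsto_eventually)
qed

lemma Bseq_bounded: "(\<And>n. norm (x n) \<le> c) \<Longrightarrow> Bseq x"
  by (rule BseqI')

text \<open>One selection must serve all \<open>e\<close> at once. It suffices to pick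
  \<open>z k\<close> within \<open>1/(k+1)\<close> of the best possible distance, since the best
  distances tend to zero.\<close>

lemma seq_selection:
  fixes x :: "nat \<Rightarrow> 'a::real_normed_vector"
  assumes ne: "\<And>k. T k \<noteq> {}" and ev: "\<And>e. e > 0 \<Longrightarrow> \<forall>\<^sub>F k in sequentially. \<exists>z\<in>T k. norm (x k - z) < e"
  shows "\<exists>z. (\<forall>k. z k \<in> T k) \<and> (\<lambda>k. x k - z k) \<longlonglongrightarrow> 0"
proof -
  have "\<exists>z\<in>T k. dist (x k) z < infdist (x k) (T k) + inverse (real (Suc k))" for k
  proof -
    have "Inf (dist (x k) ` T k) < infdist (x k) (T k) + inverse (real (Suc k))"
      using infdist_notempty[OF ne[of k], of "x k"] by simp
    from cInf_lessD[OF _ this] show ?thesis using ne[of k] by blast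
  qed
  then obtain z where z: "\<And>k. z k \<in> T k" "\<And>k. dist (x k) (z k) < infdist (x k) (T k) + inverse (real (Suc k))"
    by metis
  have "(\<lambda>k. infdist (x k) (T k)) \<longlonglongrightarrow> 0"
  proof (rule tendstoI)
    fix e :: real assume "e > 0"
    from ev[OF this] show "\<forall>\<^sub>F k in sequentially. dist (infdist (x k) (T k)) 0 < e"
    proof eventually_elim
      case (elim k)
      then obtain y where "y \<in> T k" "norm (x k - y) < e" by blast
      then show ?case using infdist_le[of y "T k" "x k"] infdist_nonneg[of "x k" "T k"] by (simp add: dist_norm)
    qed
  qed
  then have l: "(\<lambda>k. infdist (x k) (T k) + inverse (real (Suc k))) \<longlonglongrightarrow> 0 + 0"
    by (intro tendsto_add LIMSEQ_inverse_real_of_nat)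
  have "(\<lambda>k. x k - z k) \<longlonglongrightarrow> 0"
  proof (rule Lim_null_comparison[where g = "\<lambda>k. infdist (x k) (T k) + inverse (real (Suc k))"])
    show "\<forall>\<^sub>F k in sequentially. norm (x k - z k) \<le> infdist (x k) (T k) + inverse (real (Suc k))"
      using z(2) by (simp add: dist_norm less_imp_le)
  qed (use l in simp)
  then show ?thesis using z(1) by blast
qed

text \<open>The classes that have a representative with entries in the \<open>T k\<close>. Maps
  acting entrywise are defined on it, and it is closed, so it contains closed limits.\<close>

definition seq_product :: "(nat \<Rightarrow> 'a::cstar_algebra set) \<Rightarrow> 'a seq_algebra set" where
  "seq_product T = {seq_class x |x. Bseq x \<and> (\<forall>k. x k \<in> T k)}"

lemma seq_productI: "Bseq x \<Longrightarrow> (\<And>k. x k \<in> T k) \<Longrightarrow> seq_class x \<in> seq_product T"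
  unfolding seq_product_def by blast

lemma seq_product_approx:
  assumes ne: "\<And>k. T k \<noteq> {}" and a: "\<And>e. e > 0 \<Longrightarrow> \<exists>Y\<in>seq_product T. norm (X - Y) < e"
  shows "X \<in> seq_product T"
proof -
  obtain x where x: "Bseq x" "X = seq_class x" by (rule seq_class_cases)
  have "\<forall>\<^sub>F k in sequentially. \<exists>z\<in>T k. norm (x k - z) < e" if e: "e > 0" for e
  proof -
    obtain Y where Y: "Y \<in> seq_product T" "norm (X - Y) < e" using a[OF e] by blast
    obtain y where y: "Bseq y" "\<And>k. y k \<in> T k" "Y = seq_class y" using Y(1) unfolding seq_product_def by blast
    have "\<forall>\<^sub>F k in sequentially. norm (x k - y k) < e"
      using seq_class_diff_norm_less[OF x(1) y(1)] Y(2) x(2) y(3) by simp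
    then show ?thesis by eventually_elim (use y(2) in blast)
  qed
  from seq_selection[OF ne this] obtain z where z: "\<And>k. z k \<in> T k" "(\<lambda>k. x k - z k) \<longlonglongrightarrow> 0" by blast
  have "convergent (\<lambda>k. x k - z k)" using z(2) by (auto simp: convergent_def)
  then have "Bseq (\<lambda>k. x k - (x k - z k))" by (intro Bseq_diff[OF x(1)] convergent_imp_Bseq)
  then have bz: "Bseq z" by simp
  then have "X = seq_class z" using z(2) x seq_class_eq_iff by blast
  then show ?thesis using bz z(1) by (simp add: seq_productI)
qed

lemma seq_product_closed: "(\<And>k. T k \<noteq> {}) \<Longrightarrow> closed (seq_product T)"
proof -
  assume ne: "\<And>k. T k \<noteq> {}"
  have "X \<in> seq_product T" if "X \<in> closure (seq_product T)" for X
    using that by (intro seq_product_approx[OF ne]) (auto simp: closure_approachable dist_norm norm_minus_commute)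
  then show ?thesis using closure_subset_eq by blast
qed

lemma seq_product_star_subalgebra:
  assumes T: "\<And>k. star_subalgebra (T k)" shows "star_subalgebra (seq_product T)"
proof -
  note sub = star_subalgebraD[OF T]
  show ?thesis
    unfolding star_subalgebra_def subalgebra_def
  proof (intro conjI ballI allI)
    show "0 \<in> seq_product T"
      unfolding seq_class_zero[symmetric] by (rule seq_productI) (auto simp: subalgebra_zero[OF sub])
  next
    fix X Y assume "X \<in> seq_product T" "Y \<in> seq_product T"
    then obtain x y where x: "Bseq x" "\<And>k. x k \<in> T k" "X = seq_class x" and y: "Bseq y" "\<And>k. y k \<in> T k" "Y = seq_class y"
      unfolding seq_product_def by blast
    show "X + Y \<in> seq_product T" unfolding x(3) y(3) seq_class_add[OF x(1) y(1)]
      by (rule seq_productI) (auto simp: Bseq_plus x y subalgebra_add[OF sub])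
    show "X * Y \<in> seq_product T" unfolding x(3) y(3) seq_class_mult[OF x(1) y(1)]
      by (rule seq_productI) (auto simp: Bseq_times x y subalgebra_mult[OF sub])
  next
    fix c X assume "X \<in> seq_product T"
    then obtain x where x: "Bseq x" "\<And>k. x k \<in> T k" "X = seq_class x" unfolding seq_product_def by blast
    show "c *\<^sub>C X \<in> seq_product T" unfolding x(3) seq_class_scale[OF x(1)]
      by (rule seq_productI) (auto simp: Bseq_scaleC x subalgebra_scale[OF sub])
    show "star X \<in> seq_product T" unfolding x(3) seq_class_star[OF x(1)]
      by (rule seq_productI) (auto simp: Bseq_star x star_subalgebra_star[OF T])
  qed
qed

text \<open>For \<open>k < s\<close> the truncated index \<open>k - s\<close> reads the entry \<open>x 0\<close>; this does not affect the class.\<close>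

definition seq_hom ::
  "(nat \<Rightarrow> 'a::cstar_algebra set) \<Rightarrow> (nat \<Rightarrow> 'a \<Rightarrow> 'a) \<Rightarrow> nat \<Rightarrow> 'a seq_algebra \<Rightarrow> 'a seq_algebra" where
  "seq_hom T h s X =
     (let x = (SOME x. Bseq x \<and> (\<forall>k. x k \<in> T k) \<and> X = seq_class x) in seq_class (\<lambda>k. h k (x (k - s))))"

context
  fixes T T' :: "nat \<Rightarrow> 'a::cstar_algebra set" and h s
  assumes T: "\<And>k. star_subalgebra (T k)" and h: "\<And>k. star_hom (h k) (T (k - s)) (T' k)"
    and con: "\<And>k x. x \<in> T (k - s) \<Longrightarrow> norm (h k x) \<le> norm x"
begin

lemma seq_hom_Bseq: "Bseq x \<Longrightarrow> (\<And>k. x k \<in> T k) \<Longrightarrow> Bseq (\<lambda>k. h k (x (k - s)))"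
  unfolding Bseq_def using con order_trans by metis

text \<open>Contractivity makes the value independent of the representative, and the shift of
  indices by \<open>s\<close> preserves null sequences.\<close>

lemma seq_hom_class:
  assumes x: "Bseq x" "\<And>k. x k \<in> T k"
  shows "seq_hom T h s (seq_class x) = seq_class (\<lambda>k. h k (x (k - s)))"
proof -
  define y where "y = (SOME y. Bseq y \<and> (\<forall>k. y k \<in> T k) \<and> seq_class x = seq_class y)"
  have y: "Bseq y" "\<And>k. y k \<in> T k" "seq_class x = seq_class y"
    using someI_ex[of "\<lambda>y. Bseq y \<and> (\<forall>k. y k \<in> T k) \<and> seq_class x = seq_class y"] x unfolding y_def by blast+
  have l: "(\<lambda>k. y k - x k) \<longlonglongrightarrow> 0" using y(1,3) x(1) seq_class_eq_iff by metis
  have "filterlim (\<lambda>k. k - s) sequentially sequentially"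
    by (rule filterlim_minus_const_nat_at_top)
  then have l': "(\<lambda>k. norm (y (k - s) - x (k - s))) \<longlonglongrightarrow> 0"
    using tendsto_norm_zero[OF l] filterlim_compose[where f = "\<lambda>k. k - s"] by blast
  have "(\<lambda>k. h k (y (k - s)) - h k (x (k - s))) \<longlonglongrightarrow> 0"
  proof (rule Lim_null_comparison[OF _ l'])
    show "\<forall>\<^sub>F k in sequentially. norm (h k (y (k - s)) - h k (x (k - s))) \<le> norm (y (k - s) - x (k - s))"
    proof (rule always_eventually, rule allI)
      fix k
      have "h k (y (k - s)) - h k (x (k - s)) = h k (y (k - s) - x (k - s))"
        using star_hom_diff[OF h star_subalgebraD[OF T]] y(2) x(2) by simp
      then show "norm (h k (y (k - s)) - h k (x (k - s))) \<le> norm (y (k - s) - x (k - s))"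
        using con subalgebra_diff[OF star_subalgebraD[OF T]] y(2) x(2) by simp
    qed
  qed
  then have "seq_class (\<lambda>k. h k (y (k - s))) = seq_class (\<lambda>k. h k (x (k - s)))"
    using seq_class_eq_iff seq_hom_Bseq x y by blast
  then show ?thesis by (simp add: seq_hom_def Let_def flip: y_def)
qed

lemma seq_hom_star_hom: "star_hom (seq_hom T h s) (seq_product T) (seq_product T')"
proof -
  note H = star_homD[OF h]
  have 1: "seq_hom T h s X \<in> seq_product T' \<and> (\<forall>c. seq_hom T h s (c *\<^sub>C X) = c *\<^sub>C seq_hom T h s X) \<and>
      seq_hom T h s (star X) = star (seq_hom T h s X)"
    if X: "X \<in> seq_product T" for X
  proof -
    obtain x where x: "Bseq x" "\<And>k. x k \<in> T k" "X = seq_class x" using X unfolding seq_product_def by blast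
    note b = seq_hom_Bseq[OF x(1,2)]
    have "seq_hom T h s X \<in> seq_product T'"
      unfolding x(3) seq_hom_class[OF x(1,2)] by (rule seq_productI[OF b]) (use H(1) x(2) in auto)
    moreover have "seq_hom T h s (c *\<^sub>C X) = c *\<^sub>C seq_hom T h s X" for c
      unfolding x(3) seq_class_scale[OF x(1)] seq_hom_class[OF x(1,2)] seq_class_scale[OF b]
      using seq_hom_class[of "\<lambda>n. c *\<^sub>C x n"] Bseq_scaleC[OF x(1)] subalgebra_scale[OF star_subalgebraD[OF T]] x(2) H(4)
      by simp
    moreover have "seq_hom T h s (star X) = star (seq_hom T h s X)"
      unfolding x(3) seq_class_star[OF x(1)] seq_hom_class[OF x(1,2)] seq_class_star[OF b]
      using seq_hom_class[of "\<lambda>n. star (x n)"] Bseq_star[OF x(1)] star_subalgebra_star[OF T] x(2) H(5)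
      by simp
    ultimately show ?thesis by blast
  qed
  have 2: "seq_hom T h s (X + Y) = seq_hom T h s X + seq_hom T h s Y \<and>
     seq_hom T h s (X * Y) = seq_hom T h s X * seq_hom T h s Y"
    if X: "X \<in> seq_product T" and Y: "Y \<in> seq_product T" for X Y
  proof -
    obtain x where x: "Bseq x" "\<And>k. x k \<in> T k" "X = seq_class x" using X unfolding seq_product_def by blast
    obtain y where y: "Bseq y" "\<And>k. y k \<in> T k" "Y = seq_class y" using Y unfolding seq_product_def by blast
    note bx = seq_hom_Bseq[OF x(1,2)] and by' = seq_hom_Bseq[OF y(1,2)] and sub = star_subalgebraD[OF T]
    have "seq_hom T h s (X + Y) = seq_hom T h s X + seq_hom T h s Y"
    proof -
      have "seq_hom T h s (X + Y) = seq_class (\<lambda>k. h k (x (k - s) + y (k - s)))"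
        unfolding x(3) y(3) seq_class_add[OF x(1) y(1)]
        by (rule seq_hom_class[OF Bseq_plus[OF x(1) y(1)]]) (use subalgebra_add[OF sub] x(2) y(2) in blast)
      also have "\<dots> = seq_class (\<lambda>k. h k (x (k - s)) + h k (y (k - s)))" by (simp only: H(2)[OF x(2) y(2)])
      finally show ?thesis
        unfolding x(3) y(3) seq_hom_class[OF x(1,2)] seq_hom_class[OF y(1,2)] seq_class_add[OF bx by'] .
    qed
    moreover have "seq_hom T h s (X * Y) = seq_hom T h s X * seq_hom T h s Y"
    proof -
      have "seq_hom T h s (X * Y) = seq_class (\<lambda>k. h k (x (k - s) * y (k - s)))"
        unfolding x(3) y(3) seq_class_mult[OF x(1) y(1)]
        by (rule seq_hom_class[OF Bseq_times[OF x(1) y(1)]]) (use subalgebra_mult[OF sub] x(2) y(2) in blast)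
      also have "\<dots> = seq_class (\<lambda>k. h k (x (k - s)) * h k (y (k - s)))" by (simp only: H(3)[OF x(2) y(2)])
      finally show ?thesis
        unfolding x(3) y(3) seq_hom_class[OF x(1,2)] seq_hom_class[OF y(1,2)] seq_class_mult[OF bx by'] .
    qed
    ultimately show ?thesis by blast
  qed
  show ?thesis unfolding star_hom_def using 1 2 by blast
qed

lemma seq_hom_contractive:
  assumes X: "X \<in> seq_product T" shows "norm (seq_hom T h s X) \<le> norm X"
proof (rule field_le_epsilon)
  fix e :: real assume e: "e > 0"
  obtain x where x: "Bseq x" "\<And>k. x k \<in> T k" "X = seq_class x" using X unfolding seq_product_def by blast
  have "\<forall>\<^sub>F k in sequentially. norm (x k) < norm X + e"
    by (rule seq_class_norm_less[OF x(1)]) (use e x(3) in simp)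
  then have "\<forall>\<^sub>F k in sequentially. norm (x (k - s)) < norm X + e"
    by (rule eventually_compose_filterlim) (rule filterlim_minus_const_nat_at_top)
  then have "\<forall>\<^sub>F k in sequentially. norm (h k (x (k - s))) \<le> norm X + e"
    by eventually_elim (use con x(2) in \<open>metis less_imp_le order_trans\<close>)
  then show "norm (seq_hom T h s X) \<le> norm X + e"
    unfolding x(3) seq_hom_class[OF x(1,2)] by (rule seq_class_norm_le[OF seq_hom_Bseq[OF x(1,2)]])
qed

lemma seq_hom_tendsto:
  assumes X: "\<And>i. X i \<in> seq_product T" "Y \<in> seq_product T" "X \<longlonglongrightarrow> Y"
  shows "(\<lambda>i. seq_hom T h s (X i)) \<longlonglongrightarrow> seq_hom T h s Y"
proof -
  note sub = star_subalgebraD[OF seq_product_star_subalgebra[OF T]]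
  have "(\<lambda>i. norm (X i - Y)) \<longlonglongrightarrow> 0" using X(3) by (simp add: LIM_zero_iff tendsto_norm_zero_iff)
  then have "(\<lambda>i. seq_hom T h s (X i) - seq_hom T h s Y) \<longlonglongrightarrow> 0"
  proof (rule Lim_null_comparison[rotated])
    show "\<forall>\<^sub>F i in sequentially. norm (seq_hom T h s (X i) - seq_hom T h s Y) \<le> norm (X i - Y)"
    proof (rule always_eventually, rule allI)
      fix i
      have "seq_hom T h s (X i) - seq_hom T h s Y = seq_hom T h s (X i - Y)"
        using star_hom_diff[OF seq_hom_star_hom sub X(1) X(2)] by simp
      then show "norm (seq_hom T h s (X i) - seq_hom T h s Y) \<le> norm (X i - Y)"
        using seq_hom_contractive[OF subalgebra_diff[OF sub X(1) X(2)]] by simp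
    qed
  qed
  then show ?thesis by (simp add: LIM_zero_iff)
qed

text \<open>\<open>generated_cstar\<close> is defined from outside, so the claim is proved through a
  closed star subalgebra: the elements of the product whose image lies in
  \<open>generated_cstar M\<close>. Its closedness is the continuity of
  \<open>seq_hom\<close>.\<close>

lemma seq_hom_maps_generated:
  assumes L: "L \<subseteq> seq_product T" and M: "\<And>X. X \<in> L \<Longrightarrow> seq_hom T h s X \<in> M" and X: "X \<in> generated_cstar L"
  shows "X \<in> seq_product T" "seq_hom T h s X \<in> generated_cstar M"
proof -
  note ss = seq_product_star_subalgebra[OF T] and H = star_homD[OF seq_hom_star_hom]
  note sub = star_subalgebraD[OF ss]
  let ?S = "{X\<in>seq_product T. seq_hom T h s X \<in> generated_cstar M}"
  have "star_subalgebra ?S"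
    unfolding star_subalgebra_def subalgebra_def
    using H(2-5) star_hom_zero[OF seq_hom_star_hom sub] star_subalgebra_star[OF ss]
      star_subalgebra_star[OF generated_star_subalgebra, of _ M]
    by (auto simp: subalgebra_intros[OF sub] subalgebra_intros[OF generated_subalgebra])
  moreover have "closed ?S"
    unfolding closed_sequential_limits
  proof (intro allI impI)
    fix x l assume a: "(\<forall>n. x n \<in> ?S) \<and> x \<longlonglongrightarrow> l"
    have "closed (seq_product T)" using subalgebra_zero[OF star_subalgebraD[OF T]] by (intro seq_product_closed) blast
    then have l: "l \<in> seq_product T" using a closed_sequentially by blast
    have "(\<lambda>n. seq_hom T h s (x n)) \<longlonglongrightarrow> seq_hom T h s l" using a l by (intro seq_hom_tendsto) auto
    then have "seq_hom T h s l \<in> generated_cstar M"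
      using closed_sequentially[OF generated_closed, of "\<lambda>n. seq_hom T h s (x n)"] a by blast
    then show "l \<in> ?S" using l by blast
  qed
  moreover have "L \<subseteq> ?S" using L M generated_superset by blast
  ultimately have "generated_cstar L \<subseteq> ?S" by (rule generated_least)
  then show "X \<in> seq_product T" "seq_hom T h s X \<in> generated_cstar M" using X by auto
qed

end

lemma composite_self [simp]: "composite \<phi> n n x = x"
  by (simp add: composite_def)

lemma composite_Suc: "n \<le> j \<Longrightarrow> composite \<phi> n (Suc j) x = \<phi> j (composite \<phi> n j x)"
  by (simp add: composite_def)

lemma composite_below: "j \<le> n \<Longrightarrow> composite \<phi> n j x = x"
  by (simp add: composite_def)

lemma composite_trans: "n \<le> m \<Longrightarrow> m \<le> j \<Longrightarrow> composite \<phi> m j (composite \<phi> n m x) = composite \<phi> n j x"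
proof (induction j)
  case (Suc j)
  then show ?case by (cases "m = Suc j") (auto simp: composite_Suc)
qed (simp add: composite_def)

lemma composite_cong:
  assumes "\<And>k a. a \<in> A k \<Longrightarrow> \<phi>' k a = \<phi> k a" "\<And>k a. a \<in> A k \<Longrightarrow> \<phi> k a \<in> A (Suc k)" "x \<in> A n"
  shows "n \<le> j \<Longrightarrow> composite \<phi>' n j x = composite \<phi> n j x \<and> composite \<phi> n j x \<in> A j"
proof (induction j)
  case (Suc j)
  then show ?case using assms by (cases "n = Suc j") (auto simp: composite_Suc)
qed (use assms(3) in \<open>auto simp: composite_def\<close>)

text \<open>For \<open>j < n\<close> the map \<open>composite \<phi> n j\<close> is the identity, so
  the sequence starts with copies of \<open>x\<close>; the class does not see them.\<close>

definition limit_element :: "(nat \<Rightarrow> 'a \<Rightarrow> 'a) \<Rightarrow> nat \<Rightarrow> 'a::cstar_algebra \<Rightarrow> 'a seq_algebra" where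
  "limit_element \<phi> n x = seq_class (\<lambda>j. composite \<phi> n j x)"

lemma closure_star_subalgebra:
  assumes S: "star_subalgebra S" shows "star_subalgebra (closure (S :: 'a::cstar_algebra set))"
proof -
  note sub = star_subalgebraD[OF S]
  have tsc: "(\<lambda>n. c *\<^sub>C x n) \<longlonglongrightarrow> c *\<^sub>C l" if "x \<longlonglongrightarrow> l" for c :: complex and x :: "nat \<Rightarrow> 'a" and l
  proof -
    have "(\<lambda>n. cmod c * norm (x n - l)) \<longlonglongrightarrow> 0"
      using that by (intro tendsto_mult_right_zero) (simp add: LIM_zero_iff tendsto_norm_zero_iff)
    then have "(\<lambda>n. norm (c *\<^sub>C x n - c *\<^sub>C l)) \<longlonglongrightarrow> 0" by (simp add: norm_scaleC flip: scaleC_diff_right)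
    then show ?thesis by (simp add: LIM_zero_iff tendsto_norm_zero_iff)
  qed
  have tst: "(\<lambda>n. star (x n)) \<longlonglongrightarrow> star l" if "x \<longlonglongrightarrow> l" for x :: "nat \<Rightarrow> 'a" and l
  proof -
    have "(\<lambda>n. norm (x n - l)) \<longlonglongrightarrow> 0" using that by (simp add: LIM_zero_iff tendsto_norm_zero_iff)
    then have "(\<lambda>n. norm (star (x n) - star l)) \<longlonglongrightarrow> 0" by (simp flip: star_diff)
    then show ?thesis by (simp add: LIM_zero_iff tendsto_norm_zero_iff)
  qed
  show ?thesis
    unfolding star_subalgebra_def subalgebra_def
  proof (intro conjI ballI allI)
    show "0 \<in> closure S" using subalgebra_zero[OF sub] closure_subset by blast
  next
    fix x y assume "x \<in> closure S" "y \<in> closure S"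
    then obtain a b where a: "\<And>n. a n \<in> S" "a \<longlonglongrightarrow> x" and b: "\<And>n. b n \<in> S" "b \<longlonglongrightarrow> y"
      unfolding closure_sequential by blast
    show "x + y \<in> closure S" unfolding closure_sequential
      by (rule exI[of _ "\<lambda>n. a n + b n"]) (use tendsto_add[OF a(2) b(2)] subalgebra_add[OF sub a(1) b(1)] in blast)
    show "x * y \<in> closure S" unfolding closure_sequential
      by (rule exI[of _ "\<lambda>n. a n * b n"]) (use tendsto_mult[OF a(2) b(2)] subalgebra_mult[OF sub a(1) b(1)] in blast)
  next
    fix c x assume "x \<in> closure S"
    then obtain a where a: "\<And>n. a n \<in> S" "a \<longlonglongrightarrow> x" unfolding closure_sequential by blast
    show "c *\<^sub>C x \<in> closure S" unfolding closure_sequential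
      by (rule exI[of _ "\<lambda>n. c *\<^sub>C a n"]) (use tsc[OF a(2)] subalgebra_scale[OF sub a(1)] in blast)
    show "star x \<in> closure S" unfolding closure_sequential
      by (rule exI[of _ "\<lambda>n. star (a n)"]) (use tst[OF a(2)] star_subalgebra_star[OF S a(1)] in blast)
  qed
qed

section \<open>Direct systems of finite-dimensional C*-algebras\<close>

locale cstar_system =
  fixes G :: "nat \<Rightarrow> 'a::cstar_algebra set" and \<phi> :: "nat \<Rightarrow> 'a \<Rightarrow> 'a"
  assumes G: "\<And>k. star_subalgebra (G k)" and Gfd: "\<And>k. finite_dimensional (G k)"
    and hom: "\<And>k. star_hom (\<phi> k) (G k) (G (Suc k))"
begin

lemmas Gsub = star_subalgebraD[OF G]

lemma contractive: "x \<in> G k \<Longrightarrow> norm (\<phi> k x) \<le> norm x"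
  by (rule star_hom_contractive[OF G Gfd hom])

lemma composite_hom: "n \<le> j \<Longrightarrow> star_hom (composite \<phi> n j) (G n) (G j)"
proof (induction j)
  case 0
  then show ?case by (simp add: star_hom_def composite_def)
next
  case (Suc j)
  show ?case
  proof (cases "n = Suc j")
    case True
    then show ?thesis by (simp add: star_hom_def)
  next
    case False
    then have le: "n \<le> j" using Suc by simp
    from star_homD[OF Suc.IH[OF le]] star_homD[OF hom[of j]] show ?thesis
      unfolding star_hom_def by (auto simp: composite_Suc[OF le])
  qed
qed

lemma composite_mem: "n \<le> j \<Longrightarrow> x \<in> G n \<Longrightarrow> composite \<phi> n j x \<in> G j"
  using star_homD(1)[OF composite_hom] by blast

lemma composite_norm: "x \<in> G n \<Longrightarrow> norm (composite \<phi> n j x) \<le> norm x"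
proof (cases "n \<le> j")
  case True
  show "x \<in> G n \<Longrightarrow> ?thesis" by (rule star_hom_contractive[OF G Gfd composite_hom[OF True]])
qed (simp add: composite_below)

lemma composite_Bseq: "x \<in> G n \<Longrightarrow> Bseq (\<lambda>j. composite \<phi> n j x)"
  by (rule Bseq_bounded) (rule composite_norm)

lemma limit_element_eqI:
  assumes "x \<in> G n" "Bseq y" "\<And>j. N \<le> j \<Longrightarrow> y j = composite \<phi> n j x"
  shows "seq_class y = limit_element \<phi> n x"
  unfolding limit_element_def
proof (rule seq_class_eqI[OF assms(2) composite_Bseq[OF assms(1)]])
  show "\<forall>\<^sub>F j in sequentially. y j = composite \<phi> n j x"
    unfolding eventually_sequentially using assms(3) by blast
qed

lemma limit_element_hom: "star_hom (limit_element \<phi> n) (G n) UNIV"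
proof -
  have comp: "composite \<phi> n j (x + y) = composite \<phi> n j x + composite \<phi> n j y"
    "composite \<phi> n j (x * y) = composite \<phi> n j x * composite \<phi> n j y"
    if "x \<in> G n" "y \<in> G n" for x y j
    using star_homD(2,3)[OF composite_hom, of n j x y] that composite_below[of j n \<phi>] by (cases "n \<le> j"; simp)+
  have comp': "composite \<phi> n j (c *\<^sub>C x) = c *\<^sub>C composite \<phi> n j x" "composite \<phi> n j (star x) = star (composite \<phi> n j x)"
    if "x \<in> G n" for x j c
    using star_homD(4,5)[OF composite_hom, of n j x] that composite_below[of j n \<phi>] by (cases "n \<le> j"; simp)+
  show ?thesis
    unfolding star_hom_def limit_element_def
    by (auto simp: seq_class_add seq_class_mult seq_class_scale seq_class_star composite_Bseq comp comp')
qed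

lemma limit_element_norm: "x \<in> G n \<Longrightarrow> norm (limit_element \<phi> n x) \<le> norm x"
  unfolding limit_element_def
  by (rule seq_class_norm_le[OF composite_Bseq]) (auto intro: always_eventually composite_norm)

lemma limit_element_shift:
  assumes "n \<le> m" "x \<in> G n" shows "limit_element \<phi> m (composite \<phi> n m x) = limit_element \<phi> n x"
  unfolding limit_element_def[of \<phi> m]
proof (rule limit_element_eqI[OF assms(2), where N = m])
  show "Bseq (\<lambda>j. composite \<phi> m j (composite \<phi> n m x))" by (rule composite_Bseq[OF composite_mem[OF assms]])
  show "composite \<phi> m j (composite \<phi> n m x) = composite \<phi> n j x" if "m \<le> j" for j
    by (rule composite_trans[OF assms(1) that])
qed

text \<open>Serves three families with the same connecting maps: the algebras \<open>G\<close>
  themselves, the digraph algebras and their masas.\<close>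

definition subsystem :: "(nat \<Rightarrow> 'a set) \<Rightarrow> bool" where
  "subsystem T \<longleftrightarrow> (\<forall>k. T k \<subseteq> G k \<and> (\<forall>x\<in>T k. \<phi> k x \<in> T (Suc k)))"

lemma subsystem_self: "subsystem G"
  unfolding subsystem_def using star_homD(1)[OF hom] by blast

context
  fixes T assumes T: "subsystem T"
begin

lemma subsystem_mem: "x \<in> T k \<Longrightarrow> x \<in> G k"
  using T by (auto simp: subsystem_def)

lemma subsystem_composite: "n \<le> j \<Longrightarrow> x \<in> T n \<Longrightarrow> composite \<phi> n j x \<in> T j"
proof (induction j)
  case (Suc j)
  then show ?case using T by (cases "n = Suc j") (auto simp: composite_Suc subsystem_def)
qed (auto simp: composite_def)

lemma closed_limit_eq: "closed_limit T \<phi> = closure (\<Union>n. limit_element \<phi> n ` T n)"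
proof -
  have "seq_class ` {x. coherent T \<phi> x} = (\<Union>n. limit_element \<phi> n ` T n)"
  proof
    show "seq_class ` {x. coherent T \<phi> x} \<subseteq> (\<Union>n. limit_element \<phi> n ` T n)"
    proof
      fix X assume "X \<in> seq_class ` {x. coherent T \<phi> x}"
      then obtain x k where x: "X = seq_class x" "\<And>j. j \<ge> k \<Longrightarrow> x j \<in> T j" "\<And>j. j \<ge> k \<Longrightarrow> x (Suc j) = \<phi> j (x j)"
        by (auto simp: coherent_def)
      have xk: "x k \<in> T k" using x(2) by simp
      have comp: "x j = composite \<phi> k j (x k)" if "k \<le> j" for j
        using that
      proof (induction j)
        case (Suc j)
        then show ?case using x(3) by (cases "k = Suc j") (auto simp: composite_Suc)
      qed simp
      have "Bseq (\<lambda>j. x (j + k))"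
      proof (rule Bseq_bounded)
        show "norm (x (j + k)) \<le> norm (x k)" for j
          by (subst comp) (simp_all add: composite_norm[OF subsystem_mem[OF xk]])
      qed
      then have "Bseq x" by (rule Bseq_offset)
      then have "X = limit_element \<phi> k (x k)"
        unfolding x(1) by (rule limit_element_eqI[OF subsystem_mem[OF xk], where N = k]) (rule comp)
      then show "X \<in> (\<Union>n. limit_element \<phi> n ` T n)" using xk by blast
    qed
    show "(\<Union>n. limit_element \<phi> n ` T n) \<subseteq> seq_class ` {x. coherent T \<phi> x}"
    proof
      fix X assume "X \<in> (\<Union>n. limit_element \<phi> n ` T n)"
      then obtain n x where x: "x \<in> T n" "X = limit_element \<phi> n x" by blast
      have "coherent T \<phi> (\<lambda>j. composite \<phi> n j x)"
        unfolding coherent_def using subsystem_composite[OF _ x(1)] composite_Suc by (intro exI[of _ n]) auto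
      then show "X \<in> seq_class ` {x. coherent T \<phi> x}" unfolding x(2) limit_element_def by blast
    qed
  qed
  then show ?thesis by (simp add: closed_limit_def)
qed

lemma limit_element_mem: "x \<in> T n \<Longrightarrow> limit_element \<phi> n x \<in> closed_limit T \<phi>"
  unfolding closed_limit_eq by (rule subsetD[OF closure_subset]) auto

lemma closed_limit_closed: "closed (closed_limit T \<phi>)"
  by (simp add: closed_limit_def)

lemma closed_limit_approx:
  assumes "X \<in> closed_limit T \<phi>" "e > 0"
  shows "\<exists>N. \<forall>m\<ge>N. \<exists>x\<in>T m. norm (X - limit_element \<phi> m x) < e"
proof -
  have "X \<in> closure (\<Union>n. limit_element \<phi> n ` T n)" using assms(1) by (simp only: closed_limit_eq)
  then obtain Y where Y: "Y \<in> (\<Union>n. limit_element \<phi> n ` T n)" "dist Y X < e"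
    using assms(2) by (meson closure_approachable)
  then obtain n x where x: "x \<in> T n" "Y = limit_element \<phi> n x" by blast
  then have x: "x \<in> T n" "norm (X - limit_element \<phi> n x) < e"
    using Y(2) by (simp_all add: dist_norm norm_minus_commute)
  have "\<exists>x\<in>T m. norm (X - limit_element \<phi> m x) < e" if "m \<ge> n" for m
    using subsystem_composite[OF that x(1)] limit_element_shift[OF that subsystem_mem[OF x(1)]] x(2)
    by (intro bexI[of _ "composite \<phi> n m x"]) simp_all
  then show ?thesis by blast
qed

lemma closed_limit_induct:
  assumes X: "X \<in> closed_limit T \<phi>" and S: "closed S" and el: "\<And>n x. x \<in> T n \<Longrightarrow> limit_element \<phi> n x \<in> S"
  shows "X \<in> S"
proof -
  have "closure (\<Union>n. limit_element \<phi> n ` T n) \<subseteq> S" using el S by (intro closure_minimal) auto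
  then show ?thesis using X unfolding closed_limit_eq by blast
qed

lemma closed_limit_subset_product:
  assumes "\<And>k. 0 \<in> T k" shows "closed_limit T \<phi> \<subseteq> seq_product T"
proof
  fix X assume "X \<in> closed_limit T \<phi>"
  then show "X \<in> seq_product T"
  proof (rule closed_limit_induct)
    show "closed (seq_product T)" using assms by (intro seq_product_closed) blast
    fix n x assume x: "x \<in> T n"
    \<comment> \<open>The early entries are replaced by 0 because \<open>T j\<close> need not
      contain \<open>x\<close> for \<open>j < n\<close>.\<close>
    define y where "y j = (if j < n then 0 else composite \<phi> n j x)" for j
    have by': "Bseq y"
      by (rule Bseq_bounded[where c = "norm x"]) (auto simp: y_def composite_norm[OF subsystem_mem[OF x]])
    have "limit_element \<phi> n x = seq_class y"
      by (rule limit_element_eqI[OF subsystem_mem[OF x] by', where N = n, symmetric]) (simp add: y_def)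
    moreover have "y j \<in> T j" for j using assms subsystem_composite[OF _ x] by (auto simp: y_def)
    ultimately show "limit_element \<phi> n x \<in> seq_product T" using seq_productI[OF by'] by simp
  qed
qed

lemma closed_limit_star_subalgebra:
  assumes S: "\<And>k. star_subalgebra (T k)" shows "star_subalgebra (closed_limit T \<phi>)"
proof -
  note sub = star_subalgebraD[OF S] and H = star_homD[OF limit_element_hom]
  have "star_subalgebra (\<Union>n. limit_element \<phi> n ` T n)"
    unfolding star_subalgebra_def subalgebra_def
  proof (intro conjI ballI allI)
    show "0 \<in> (\<Union>n. limit_element \<phi> n ` T n)"
      using star_hom_zero[OF limit_element_hom Gsub, of 0] subalgebra_zero[OF sub, of 0] by (metis UN_iff UNIV_I imageI)
  next
    fix X Y assume "X \<in> (\<Union>n. limit_element \<phi> n ` T n)" "Y \<in> (\<Union>n. limit_element \<phi> n ` T n)"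
    then obtain n x m y where x: "x \<in> T n" "X = limit_element \<phi> n x" and y: "y \<in> T m" "Y = limit_element \<phi> m y" by blast
    define j where "j = max n m"
    define x' y' where "x' = composite \<phi> n j x" and "y' = composite \<phi> m j y"
    have xy: "x' \<in> T j" "y' \<in> T j" unfolding x'_def y'_def j_def
      by (rule subsystem_composite[OF _ x(1)], simp, rule subsystem_composite[OF _ y(1)], simp)
    have X: "X = limit_element \<phi> j x'" "Y = limit_element \<phi> j y'"
      unfolding x(2) y(2) x'_def y'_def j_def
      by (rule limit_element_shift[OF _ subsystem_mem[OF x(1)], symmetric], simp,
          rule limit_element_shift[OF _ subsystem_mem[OF y(1)], symmetric], simp)
    show "X + Y \<in> (\<Union>n. limit_element \<phi> n ` T n)"
      unfolding X H(2)[OF subsystem_mem[OF xy(1)] subsystem_mem[OF xy(2)], symmetric]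
      using subalgebra_add[OF sub xy] by blast
    show "X * Y \<in> (\<Union>n. limit_element \<phi> n ` T n)"
      unfolding X H(3)[OF subsystem_mem[OF xy(1)] subsystem_mem[OF xy(2)], symmetric]
      using subalgebra_mult[OF sub xy] by blast
  next
    fix c X assume "X \<in> (\<Union>n. limit_element \<phi> n ` T n)"
    then obtain n x where x: "x \<in> T n" "X = limit_element \<phi> n x" by blast
    show "c *\<^sub>C X \<in> (\<Union>n. limit_element \<phi> n ` T n)"
      unfolding x(2) H(4)[OF subsystem_mem[OF x(1)], symmetric] using subalgebra_scale[OF sub x(1)] by blast
    show "star X \<in> (\<Union>n. limit_element \<phi> n ` T n)"
      unfolding x(2) H(5)[OF subsystem_mem[OF x(1)], symmetric] using star_subalgebra_star[OF S x(1)] by blast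
  qed
  then show ?thesis unfolding closed_limit_eq by (rule closure_star_subalgebra)
qed

lemma closed_limit_commute:
  assumes com: "\<And>k x y. x \<in> T k \<Longrightarrow> y \<in> T k \<Longrightarrow> x * y = y * x"
    and X: "X \<in> closed_limit T \<phi>" and Y: "Y \<in> closed_limit T \<phi>"
  shows "X * Y = Y * X"
proof -
  note H = star_homD[OF limit_element_hom]
  have 1: "limit_element \<phi> n x * limit_element \<phi> m y = limit_element \<phi> m y * limit_element \<phi> n x"
    if x: "x \<in> T n" and y: "y \<in> T m" for n x m y
  proof -
    define j where "j = max n m"
    define x' y' where "x' = composite \<phi> n j x" and "y' = composite \<phi> m j y"
    have xy: "x' \<in> T j" "y' \<in> T j" unfolding x'_def y'_def j_def
      by (rule subsystem_composite[OF _ x], simp, rule subsystem_composite[OF _ y], simp)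
    have X: "limit_element \<phi> n x = limit_element \<phi> j x'" "limit_element \<phi> m y = limit_element \<phi> j y'"
      unfolding x'_def y'_def j_def
      by (rule limit_element_shift[OF _ subsystem_mem[OF x], symmetric], simp,
          rule limit_element_shift[OF _ subsystem_mem[OF y], symmetric], simp)
    show ?thesis unfolding X
      using H(3)[OF subsystem_mem[OF xy(1)] subsystem_mem[OF xy(2)]]
        H(3)[OF subsystem_mem[OF xy(2)] subsystem_mem[OF xy(1)]] com[OF xy] by simp
  qed
  have cl: "closed {X. X * Z = Z * X}" for Z :: "'a seq_algebra"
    by (rule closed_Collect_eq) (intro continuous_intros)+
  have 2: "limit_element \<phi> n x * Y = Y * limit_element \<phi> n x" if x: "x \<in> T n" for n x
    using closed_limit_induct[OF Y cl, of "limit_element \<phi> n x"] 1[OF x] by (metis (mono_tags, lifting) mem_Collect_eq)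
  show ?thesis using closed_limit_induct[OF X cl, of Y] 2 by blast
qed

text \<open>The connecting maps contract, so errors only add up: the image of \<open>z j\<close> at
  a later level \<open>i\<close> differs from \<open>z i\<close> by at most the tail sum of
  \<open>c\<close> from \<open>j\<close> on. Hence \<open>seq_class z\<close> is the limit of the
  elements defined by the single entries \<open>z j\<close>. This is where the summability in
  \<open>approximately_commuting\<close> enters.\<close>

lemma almost_coherent:
  assumes T0: "\<And>k. subalgebra (T k)" and z: "Bseq z" "\<And>j. n \<le> j \<Longrightarrow> z j \<in> T j"
    and err: "\<And>j. n \<le> j \<Longrightarrow> norm (\<phi> j (z j) - z (Suc j)) \<le> c j" and c: "summable c" "\<And>j. 0 \<le> c j"
  shows "seq_class z \<in> closed_limit T \<phi>"
proof -
  have step: "norm (composite \<phi> j i (z j) - z i) \<le> (\<Sum>l=j..<i. c l)" if j: "n \<le> j" and i: "j \<le> i" for i j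
    using i
  proof (induction i rule: dec_induct)
    case (step i)
    have mem: "composite \<phi> j i (z j) \<in> G i" "z i \<in> G i"
      using composite_mem[OF step.hyps(1) subsystem_mem[OF z(2)[OF j]]] subsystem_mem[OF z(2)[of i]] j step.hyps by auto
    have "composite \<phi> j (Suc i) (z j) - z (Suc i) = \<phi> i (composite \<phi> j i (z j) - z i) + (\<phi> i (z i) - z (Suc i))"
      using star_hom_diff[OF hom Gsub mem] by (simp add: composite_Suc[OF step.hyps(1)])
    also have "norm \<dots> \<le> norm (composite \<phi> j i (z j) - z i) + c i"
      using contractive[OF subalgebra_diff[OF Gsub mem]] err[of i] j step.hyps
      by (intro order_trans[OF norm_triangle_ineq] add_mono) auto
    also have "\<dots> \<le> (\<Sum>l=j..<Suc i. c l)" using step by simp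
    finally show ?case .
  qed simp
  have tail: "(\<lambda>j. \<Sum>l. c (l + j)) \<longlonglongrightarrow> 0" by (rule suminf_exist_split2[OF c(1)])
  have le: "norm (limit_element \<phi> j (z j) - seq_class z) \<le> (\<Sum>l. c (l + j))" if j: "n \<le> j" for j
    unfolding limit_element_def
  proof (rule seq_class_diff_norm_le[OF composite_Bseq[OF subsystem_mem[OF z(2)[OF j]]] z(1)])
    have "norm (composite \<phi> j i (z j) - z i) \<le> (\<Sum>l. c (l + j))" if i: "j \<le> i" for i
    proof -
      have "(\<Sum>l=j..<i. c l) = (\<Sum>l<i - j. c (l + j))"
        using sum.shift_bounds_nat_ivl[of c 0 j "i - j"] i by (simp add: lessThan_atLeast0)
      also have "\<dots> \<le> (\<Sum>l. c (l + j))"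
        using c by (intro sum_le_suminf) (auto simp: summable_iff_shift)
      finally show ?thesis using step[OF j i] by simp
    qed
    then show "\<forall>\<^sub>F i in sequentially. norm (composite \<phi> j i (z j) - z i) \<le> (\<Sum>l. c (l + j))"
      unfolding eventually_sequentially by blast
  qed
  have "(\<lambda>j. limit_element \<phi> (j + n) (z (j + n))) \<longlonglongrightarrow> seq_class z"
  proof (rule Lim_transform2)
    have "(\<lambda>j. norm (seq_class z - limit_element \<phi> (j + n) (z (j + n)))) \<longlonglongrightarrow> 0"
    proof (rule tendsto_sandwich[OF _ _ tendsto_const LIMSEQ_ignore_initial_segment[OF tail, of n]])
      show "\<forall>\<^sub>F j in sequentially. norm (seq_class z - limit_element \<phi> (j + n) (z (j + n))) \<le> (\<Sum>l. c (l + (j + n)))"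
        using le by (simp add: norm_minus_commute)
    qed simp
    then show "(\<lambda>j. seq_class z - limit_element \<phi> (j + n) (z (j + n))) \<longlonglongrightarrow> 0"
      by (rule tendsto_norm_zero_cancel)
  qed simp
  then show ?thesis
    using closed_sequentially[OF closed_limit_closed, of "\<lambda>j. limit_element \<phi> (j + n) (z (j + n))"]
      limit_element_mem[OF z(2)] by simp
qed

end

end

context standard_system
begin

lemma hom: "star_hom (\<phi> k) (generated_cstar (A k)) (generated_cstar (A (Suc k)))"
proof -
  obtain I :: "nat set" and g where g: "regular_family_on I g (A k) (A (Suc k))" "\<phi> k = (\<lambda>x. \<Sum>i\<in>I. g i x)"
    using fam by blast
  show ?thesis unfolding g(2) by (rule regular_family_star_hom[OF g(1)])
qed

lemma into: "x \<in> A k \<Longrightarrow> \<phi> k x \<in> A (Suc k)"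
proof -
  obtain I :: "nat set" and g where g: "regular_family_on I g (A k) (A (Suc k))" "\<phi> k = (\<lambda>x. \<Sum>i\<in>I. g i x)"
    using fam by blast
  show "x \<in> A k \<Longrightarrow> ?thesis" unfolding g(2) by (rule regular_family_into[OF g(1) digraph_subalgebra[OF dig]])
qed

sublocale cs: cstar_system "\<lambda>k. generated_cstar (A k)" \<phi>
  by standard (rule generated_star_subalgebra digraph_generated_fd[OF dig] hom)+

lemma composite_family:
  assumes "n \<le> j"
  shows "\<exists>(I::nat set) g. regular_family_on I g (A n) (A j) \<and> (\<forall>x\<in>generated_cstar (A n). composite \<phi> n j x = (\<Sum>i\<in>I. g i x))"
  using assms
proof (induction j rule: dec_induct)
  case base
  have "regular_family_on {0::nat} (\<lambda>_ x. x) (A n) (A n)"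
    by (rule regular_family_onI) (auto simp: star_hom_def)
  then show ?case by (intro exI[of _ "{0}"] exI[of _ "\<lambda>_ x. x"]) simp
next
  case (step j)
  obtain I :: "nat set" and g where g: "regular_family_on I g (A n) (A j)"
    "\<forall>x\<in>generated_cstar (A n). composite \<phi> n j x = (\<Sum>i\<in>I. g i x)" using step.IH by blast
  obtain J :: "nat set" and h where h: "regular_family_on J h (A j) (A (Suc j))" "\<phi> j = (\<lambda>x. \<Sum>i\<in>J. h i x)"
    using fam by blast
  note r = regular_family_comp[OF g(1) h(1)]
  obtain e where e: "bij_betw e {0..<card (I \<times> J)} (I \<times> J)"
    using ex_bij_betw_nat_finite[OF regular_family_onD(1)[OF r]] by blast
  define k where "k i = (case e i of (i, j) \<Rightarrow> \<lambda>x. h j (g i x))" for i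
  have k: "regular_family_on {0..<card (I \<times> J)} k (A n) (A (Suc j))"
    unfolding k_def using regular_family_reindex[OF r e] by (simp add: case_prod_beta')
  have "composite \<phi> n (Suc j) x = (\<Sum>i\<in>{0..<card (I \<times> J)}. k i x)" if x: "x \<in> generated_cstar (A n)" for x
  proof -
    have gm: "g i x \<in> generated_cstar (A j)" if "i \<in> I" for i
      using star_homD(1)[OF regular_family_onD(2)[OF g(1) that] x] .
    have "composite \<phi> n (Suc j) x = \<phi> j (\<Sum>i\<in>I. g i x)" using g(2) x step.hyps by (simp add: composite_Suc)
    also have "\<dots> = (\<Sum>i\<in>I. \<phi> j (g i x))" by (rule star_hom_sum[OF hom generated_subalgebra gm])
    also have "\<dots> = (\<Sum>(i, j)\<in>I \<times> J. h j (g i x))" by (simp add: h(2) sum.cartesian_product)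
    also have "\<dots> = (\<Sum>i\<in>{0..<card (I \<times> J)}. k i x)"
      using sum.reindex_bij_betw[OF e, of "\<lambda>(i, j). h j (g i x)"] by (simp add: k_def case_prod_beta')
    finally show ?thesis .
  qed
  then show ?case using k by blast
qed

lemma subsystem_A: "cs.subsystem A"
  unfolding cs.subsystem_def
proof (intro allI conjI ballI)
  show "A k \<subseteq> generated_cstar (A k)" for k by (rule generated_superset)
qed (rule into)

lemma subsystem_C: "cs.subsystem C"
  unfolding cs.subsystem_def
proof (intro allI conjI ballI)
  show "C k \<subseteq> generated_cstar (A k)" for k using masaD(1)[OF msa] generated_superset by (rule subset_trans)
qed (rule diag)

lemma generated_limit_subset: "generated_cstar (closed_limit A \<phi>) \<subseteq> closed_limit (\<lambda>k. generated_cstar (A k)) \<phi>"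
proof (rule generated_least)
  show "star_subalgebra (closed_limit (\<lambda>k. generated_cstar (A k)) \<phi>)"
    by (rule cs.closed_limit_star_subalgebra[OF cs.subsystem_self generated_star_subalgebra])
  show "closed (closed_limit (\<lambda>k. generated_cstar (A k)) \<phi>)" by (rule cs.closed_limit_closed[OF cs.subsystem_self])
  show "closed_limit A \<phi> \<subseteq> closed_limit (\<lambda>k. generated_cstar (A k)) \<phi>"
    unfolding cs.closed_limit_eq[OF subsystem_A] cs.closed_limit_eq[OF cs.subsystem_self]
    by (intro closure_mono UN_mono image_mono generated_superset order_refl)
qed

text \<open>The elements of \<open>generated_cstar (A n)\<close> whose image lies in the generated
  algebra of the limit form a star subalgebra containing \<open>A n\<close>, and
  \<open>digraph_least\<close> applies without any argument about its closure.\<close>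

lemma limit_element_generated:
  assumes x: "x \<in> generated_cstar (A n)" shows "limit_element \<phi> n x \<in> generated_cstar (closed_limit A \<phi>)"
proof -
  let ?S = "{x\<in>generated_cstar (A n). limit_element \<phi> n x \<in> generated_cstar (closed_limit A \<phi>)}"
  note H = star_homD[OF cs.limit_element_hom[of n]]
  have "star_subalgebra ?S"
    unfolding star_subalgebra_def subalgebra_def
    using H(2-5) star_hom_zero[OF cs.limit_element_hom generated_subalgebra, of n]
      star_subalgebra_star[OF generated_star_subalgebra, of _ "A n"]
      star_subalgebra_star[OF generated_star_subalgebra, of _ "closed_limit A \<phi>"]
    by (auto simp: subalgebra_intros[OF generated_subalgebra])
  moreover have "A n \<subseteq> ?S"
  proof
    fix x assume "x \<in> A n"
    then show "x \<in> ?S" using cs.limit_element_mem[OF subsystem_A] generated_superset[of "A n"]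
        generated_superset[of "closed_limit A \<phi>"] by auto
  qed
  ultimately have "generated_cstar (A n) \<subseteq> ?S" by (rule digraph_least[OF dig])
  then show ?thesis using x by blast
qed

lemma limit_C_subset: "closed_limit C \<phi> \<subseteq> closed_limit A \<phi>"
  unfolding cs.closed_limit_eq[OF subsystem_A] cs.closed_limit_eq[OF subsystem_C]
  by (intro closure_mono UN_mono image_mono masaD(1)[OF msa] order_refl)

lemma regular_map_system: "regular_map (\<phi> k) (A k) (A (Suc k))"
proof -
  obtain I :: "nat set" and g where g: "regular_family_on I g (A k) (A (Suc k))" "\<phi> k = (\<lambda>x. \<Sum>i\<in>I. g i x)"
    using fam by blast
  show ?thesis by (rule regular_mapI[OF dig dig g(1)]) (simp add: g(2))
qed

lemma standard_regular_system: "standard_regular (\<phi> k) (C k) (A k) (C (Suc k)) (A (Suc k))"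
  unfolding standard_regular_def
proof (intro conjI regular_map_system image_subsetI)
  fix v assume v: "v \<in> normaliser (C k) (A k)"
  then have "v \<in> normaliser (C k) (generated_cstar (A k))" using generated_superset by (auto simp: normaliser_def)
  then show "\<phi> k v \<in> normaliser (C (Suc k)) (A (Suc k))"
    using nrm[of v k] into[of v k] v by (auto simp: normaliser_def)
qed

end

subsection \<open>Isomorphism of the limits\<close>

locale intertwined_systems =
  A: standard_system A \<phi> C + B: standard_system B \<psi> D
  for A :: "nat \<Rightarrow> 'a::cstar_algebra set" and \<phi> C and B :: "nat \<Rightarrow> 'a set" and \<psi> D +
  fixes \<mu> \<nu> :: "nat \<Rightarrow> 'a \<Rightarrow> 'a" and a b :: "nat \<Rightarrow> real"
  assumes mu: "\<And>k. star_hom (\<mu> k) (generated_cstar (A k)) (generated_cstar (B k))"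
    and mu_into: "\<And>k x. x \<in> A k \<Longrightarrow> \<mu> k x \<in> B k"
    and nu: "\<And>k. star_hom (\<nu> k) (generated_cstar (B k)) (generated_cstar (A (Suc k)))"
    and nu_into: "\<And>k x. x \<in> B k \<Longrightarrow> \<nu> k x \<in> A (Suc k)"
    and a: "\<And>k x. x \<in> A k \<Longrightarrow> norm (\<phi> k x - \<nu> k (\<mu> k x)) \<le> a k * norm x" "\<And>k. 0 \<le> a k" "summable a"
    and b: "\<And>k x. x \<in> B k \<Longrightarrow> norm (\<psi> k x - \<mu> (Suc k) (\<nu> k x)) \<le> b k * norm x" "\<And>k. 0 \<le> b k" "summable b"
begin

abbreviation "GA \<equiv> \<lambda>k. generated_cstar (A k)"
abbreviation "GB \<equiv> \<lambda>k. generated_cstar (B k)"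
abbreviation "LA \<equiv> closed_limit A \<phi>"
abbreviation "LB \<equiv> closed_limit B \<psi>"

text \<open>\<open>\<nu> j\<close> ends in \<open>A (Suc j)\<close>, so the map into
  \<open>A k\<close> starts from \<open>B (k - 1)\<close>. For \<open>k = 0\<close> there is none,
  and the zero map fills the place without affecting classes.\<close>

definition nu_shift :: "nat \<Rightarrow> 'a \<Rightarrow> 'a" where
  "nu_shift k = (case k of 0 \<Rightarrow> \<lambda>_. 0 | Suc j \<Rightarrow> \<nu> j)"

definition theta :: "'a seq_algebra \<Rightarrow> 'a seq_algebra" where
  "theta = seq_hom GA \<mu> 0"

definition theta_inv :: "'a seq_algebra \<Rightarrow> 'a seq_algebra" where
  "theta_inv = seq_hom GB nu_shift 1"

lemma gA: "x \<in> A k \<Longrightarrow> x \<in> GA k" and gB: "x \<in> B k \<Longrightarrow> x \<in> GB k"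
  by (rule generated_superset[THEN subsetD], assumption)+

lemma mu_contr: "x \<in> GA k \<Longrightarrow> norm (\<mu> k x) \<le> norm x"
  by (rule star_hom_contractive[OF generated_star_subalgebra digraph_generated_fd[OF A.dig] mu])

lemma nu_contr: "x \<in> GB k \<Longrightarrow> norm (\<nu> k x) \<le> norm x"
  by (rule star_hom_contractive[OF generated_star_subalgebra digraph_generated_fd[OF B.dig] nu])

lemma mu_hyps: "star_hom (\<mu> k) (GA (k - 0)) (GB k)" "x \<in> GA (k - 0) \<Longrightarrow> norm (\<mu> k x) \<le> norm x"
  using mu mu_contr by simp_all

lemma nu_hyps: "star_hom (nu_shift k) (GB (k - 1)) (GA k)" "x \<in> GB (k - 1) \<Longrightarrow> norm (nu_shift k x) \<le> norm x"
proof -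
  show "star_hom (nu_shift k) (GB (k - 1)) (GA k)"
  proof (cases k)
    case 0
    then show ?thesis by (auto simp: nu_shift_def star_hom_def subalgebra_zero[OF generated_subalgebra])
  qed (simp add: nu_shift_def nu)
  show "x \<in> GB (k - 1) \<Longrightarrow> norm (nu_shift k x) \<le> norm x"
    by (cases k) (simp_all add: nu_shift_def nu_contr)
qed

lemma theta_class:
  assumes "Bseq x" "\<And>k. x k \<in> GA k"
  shows "theta (seq_class x) = seq_class (\<lambda>k. \<mu> k (x (k - 0)))"
  unfolding theta_def
  by (rule seq_hom_class[where T' = GB, OF generated_star_subalgebra mu_hyps(1)]) (fact mu_hyps(2) assms)+

lemma theta_hom: "star_hom theta (seq_product GA) (seq_product GB)"
  unfolding theta_def
  by (rule seq_hom_star_hom[where T = GA and T' = GB and s = 0, OF generated_star_subalgebra mu_hyps(1)]) (fact mu_hyps(2))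

lemma theta_tendsto:
  assumes "\<And>i. X i \<in> seq_product GA" "Y \<in> seq_product GA" "X \<longlonglongrightarrow> Y"
  shows "(\<lambda>i. theta (X i)) \<longlonglongrightarrow> theta Y"
  unfolding theta_def
  by (rule seq_hom_tendsto[where T' = GB, OF generated_star_subalgebra mu_hyps(1)]) (fact mu_hyps(2) assms)+

lemma theta_generated:
  assumes "L \<subseteq> seq_product GA" "\<And>X. X \<in> L \<Longrightarrow> theta X \<in> M" "X \<in> generated_cstar L"
  shows "X \<in> seq_product GA" "theta X \<in> generated_cstar M"
proof -
  have m: "seq_hom GA \<mu> 0 X \<in> M" if "X \<in> L" for X using assms(2)[OF that] by (simp add: theta_def)
  show "X \<in> seq_product GA"
    by (rule seq_hom_maps_generated(1)[where T' = GB, OF generated_star_subalgebra mu_hyps(1) _ assms(1) m assms(3)]) (fact mu_hyps(2))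
  show "theta X \<in> generated_cstar M"
    unfolding theta_def
    by (rule seq_hom_maps_generated(2)[where T' = GB, OF generated_star_subalgebra mu_hyps(1) _ assms(1) m assms(3)]) (fact mu_hyps(2))
qed

lemma theta_inv_class:
  assumes "Bseq x" "\<And>k. x k \<in> GB k"
  shows "theta_inv (seq_class x) = seq_class (\<lambda>k. nu_shift k (x (k - 1)))"
  unfolding theta_inv_def
  by (rule seq_hom_class[where T' = GA, OF generated_star_subalgebra nu_hyps(1)]) (fact nu_hyps(2) assms)+

lemma theta_inv_hom: "star_hom theta_inv (seq_product GB) (seq_product GA)"
  unfolding theta_inv_def
  by (rule seq_hom_star_hom[where T = GB and T' = GA and s = 1, OF generated_star_subalgebra nu_hyps(1)]) (fact nu_hyps(2))

lemma theta_inv_tendsto: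
  assumes "\<And>i. X i \<in> seq_product GB" "Y \<in> seq_product GB" "X \<longlonglongrightarrow> Y"
  shows "(\<lambda>i. theta_inv (X i)) \<longlonglongrightarrow> theta_inv Y"
  unfolding theta_inv_def
  by (rule seq_hom_tendsto[where T' = GA, OF generated_star_subalgebra nu_hyps(1)]) (fact nu_hyps(2) assms)+

lemma theta_inv_generated:
  assumes "L \<subseteq> seq_product GB" "\<And>X. X \<in> L \<Longrightarrow> theta_inv X \<in> M" "X \<in> generated_cstar L"
  shows "X \<in> seq_product GB" "theta_inv X \<in> generated_cstar M"
proof -
  have m: "seq_hom GB nu_shift 1 X \<in> M" if "X \<in> L" for X using assms(2)[OF that] by (simp add: theta_inv_def)
  show "X \<in> seq_product GB"
    by (rule seq_hom_maps_generated(1)[where T' = GA, OF generated_star_subalgebra nu_hyps(1) _ assms(1) m assms(3)]) (fact nu_hyps(2))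
  show "theta_inv X \<in> generated_cstar M"
    unfolding theta_inv_def
    by (rule seq_hom_maps_generated(2)[where T' = GA, OF generated_star_subalgebra nu_hyps(1) _ assms(1) m assms(3)]) (fact nu_hyps(2))
qed

lemma LA_product: "LA \<subseteq> seq_product GA"
proof -
  have "LA \<subseteq> closed_limit GA \<phi>" using A.generated_limit_subset generated_superset by blast
  also have "\<dots> \<subseteq> seq_product GA"
    by (rule A.cs.closed_limit_subset_product[OF A.cs.subsystem_self subalgebra_zero[OF generated_subalgebra]])
  finally show ?thesis .
qed

lemma LB_product: "LB \<subseteq> seq_product GB"
proof -
  have "LB \<subseteq> closed_limit GB \<psi>" using B.generated_limit_subset generated_superset by blast
  also have "\<dots> \<subseteq> seq_product GB"
    by (rule B.cs.closed_limit_subset_product[OF B.cs.subsystem_self subalgebra_zero[OF generated_subalgebra]])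
  finally show ?thesis .
qed

text \<open>The sequence \<open>z j = \<mu> j (composite \<phi> n j x)\<close> is in general not
  coherent. Passing through \<open>\<mu> (Suc j) (\<nu> j (z j))\<close>, its defect
  \<open>\<psi> j (z j) - z (Suc j)\<close> splits into a defect of one triangle, at most
  \<open>b j * norm x\<close>, and the image under \<open>\<mu>\<close> of a defect of the other, at
  most \<open>a j * norm x\<close>; so \<open>almost_coherent\<close> applies. Applying
  \<open>theta_inv\<close> afterwards moves entry \<open>k\<close> by at most
  \<open>a (k - 1) * norm x\<close>, which tends to zero.\<close>

lemma theta_element:
  assumes x: "x \<in> A n"
  shows "theta (limit_element \<phi> n x) \<in> LB" "theta_inv (theta (limit_element \<phi> n x)) = limit_element \<phi> n x"
    "\<And>y. Bseq y \<Longrightarrow> (\<And>j. n \<le> j \<Longrightarrow> y j = \<mu> j (composite \<phi> n j x)) \<Longrightarrow> theta (limit_element \<phi> n x) = seq_class y"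
proof -
  define x' where "x' j = (if j < n then 0 else composite \<phi> n j x)" for j
  have comp: "composite \<phi> n j x \<in> A j" if "n \<le> j" for j by (rule A.cs.subsystem_composite[OF A.subsystem_A that x])
  have x'A: "x' j \<in> A j" for j using comp subalgebra_zero[OF digraph_subalgebra[OF A.dig]] by (auto simp: x'_def)
  have nx': "norm (x' j) \<le> norm x" for j using A.cs.composite_norm[OF gA[OF x]] by (simp add: x'_def)
  have bx: "Bseq x'" by (rule Bseq_bounded[OF nx'])
  have X: "limit_element \<phi> n x = seq_class x'"
    by (rule A.cs.limit_element_eqI[OF gA[OF x] bx, where N = n, symmetric]) (simp add: x'_def)
  have Suc': "x' (Suc j) = \<phi> j (x' j)" if "n \<le> j" for j using that by (simp add: x'_def composite_Suc)
  define z where "z j = \<mu> j (x' j)" for j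
  have zB: "z j \<in> B j" for j using mu_into x'A by (simp add: z_def)
  have nz: "norm (z j) \<le> norm x" for j using mu_contr[OF gA[OF x'A[of j]]] nx'[of j] by (simp add: z_def)
  have bz: "Bseq z" by (rule Bseq_bounded[OF nz])
  have Z: "theta (limit_element \<phi> n x) = seq_class z"
    unfolding X using theta_class[OF bx gA[OF x'A]] by (simp add: z_def[abs_def])
  have err: "norm (\<psi> j (z j) - z (Suc j)) \<le> (a j + b j) * norm x" if j: "n \<le> j" for j
  proof -
    have nm: "\<nu> j (z j) \<in> A (Suc j)" using nu_into zB by blast
    have pm: "\<phi> j (x' j) \<in> A (Suc j)" using A.into x'A by blast
    have "norm (\<psi> j (z j) - \<mu> (Suc j) (\<nu> j (z j))) \<le> b j * norm (z j)" by (rule b(1)[OF zB])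
    also have "\<dots> \<le> b j * norm x" using nz b(2) by (simp add: mult_left_mono)
    finally have 1: "norm (\<psi> j (z j) - \<mu> (Suc j) (\<nu> j (z j))) \<le> b j * norm x" .
    have "norm (\<mu> (Suc j) (\<nu> j (z j)) - z (Suc j)) = norm (\<mu> (Suc j) (\<phi> j (x' j) - \<nu> j (\<mu> j (x' j))))"
      using star_hom_diff[OF mu generated_subalgebra gA[OF pm] gA[OF nm]] Suc'[OF j] by (simp add: z_def norm_minus_commute)
    also have "\<dots> \<le> norm (\<phi> j (x' j) - \<nu> j (\<mu> j (x' j)))"
      using gA[OF pm] gA[OF nm] by (intro mu_contr subalgebra_diff[OF generated_subalgebra]) (simp_all add: z_def)
    also have "\<dots> \<le> a j * norm (x' j)" by (rule a(1)[OF x'A])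
    also have "\<dots> \<le> a j * norm x" using nx' a(2) by (simp add: mult_left_mono)
    finally have 2: "norm (\<mu> (Suc j) (\<nu> j (z j)) - z (Suc j)) \<le> a j * norm x" .
    have "norm (\<psi> j (z j) - z (Suc j)) \<le> norm (\<psi> j (z j) - \<mu> (Suc j) (\<nu> j (z j))) + norm (\<mu> (Suc j) (\<nu> j (z j)) - z (Suc j))"
      using norm_triangle_ineq[of "\<psi> j (z j) - \<mu> (Suc j) (\<nu> j (z j))" "\<mu> (Suc j) (\<nu> j (z j)) - z (Suc j)"] by simp
    then show ?thesis using 1 2 by (simp add: distrib_right)
  qed
  show "theta (limit_element \<phi> n x) \<in> LB"
    unfolding Z
    by (rule B.cs.almost_coherent[OF B.subsystem_A digraph_subalgebra[OF B.dig] bz zB err])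
      (use a b in \<open>auto intro!: summable_mult2 summable_add\<close>)
  have w: "Bseq (\<lambda>k. nu_shift k (z (k - 1)))"
    by (rule Bseq_bounded[where c = "norm x"]) (rule order_trans[OF nu_hyps(2)[OF gB[OF zB]] nz])
  have "theta_inv (seq_class z) = seq_class (\<lambda>k. nu_shift k (z (k - 1)))"
    by (rule theta_inv_class[OF bz gB[OF zB]])
  also have "\<dots> = seq_class x'"
    unfolding seq_class_eq_iff[OF w bx]
  proof (rule Lim_null_comparison[where g = "\<lambda>k. a (k - 1) * norm x"])
    show "\<forall>\<^sub>F k in sequentially. norm (nu_shift k (z (k - 1)) - x' k) \<le> a (k - 1) * norm x"
      using eventually_ge_at_top[of "Suc n"]
    proof eventually_elim
      case (elim k)
      then obtain j where j: "k = Suc j" "n \<le> j" by (cases k) auto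
      have "norm (nu_shift k (z (k - 1)) - x' k) = norm (\<phi> j (x' j) - \<nu> j (\<mu> j (x' j)))"
        using Suc'[OF j(2)] by (simp add: j(1) nu_shift_def z_def norm_minus_commute)
      also have "\<dots> \<le> a j * norm (x' j)" by (rule a(1)[OF x'A])
      also have "\<dots> \<le> a j * norm x" using nx' a(2) by (simp add: mult_left_mono)
      finally show ?case by (simp add: j(1))
    qed
    have "(\<lambda>k. a (k - 1)) \<longlonglongrightarrow> 0"
      using filterlim_compose[OF summable_LIMSEQ_zero[OF a(3)] filterlim_minus_const_nat_at_top] .
    then show "(\<lambda>k. a (k - 1) * norm x) \<longlonglongrightarrow> 0" by (rule tendsto_mult_left_zero)
  qed
  finally show "theta_inv (theta (limit_element \<phi> n x)) = limit_element \<phi> n x" unfolding Z unfolding X .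
  show "theta (limit_element \<phi> n x) = seq_class y" if "Bseq y" "\<And>j. n \<le> j \<Longrightarrow> y j = \<mu> j (composite \<phi> n j x)" for y
    unfolding Z
  proof (rule seq_class_eqI[OF bz that(1)])
    show "\<forall>\<^sub>F j in sequentially. z j = y j"
      using eventually_ge_at_top[of n] by eventually_elim (simp add: that(2) z_def x'_def)
  qed
qed

text \<open>The mirror image of \<open>theta_element\<close>, shifted by one: the errors are now
  governed by \<open>a k + b (k - 1)\<close> from \<open>Suc n\<close> on, because
  \<open>w k\<close> is made from entry \<open>k - 1\<close>.\<close>

lemma theta_inv_element:
  assumes y: "y \<in> B n"
  shows "theta_inv (limit_element \<psi> n y) \<in> LA" "theta (theta_inv (limit_element \<psi> n y)) = limit_element \<psi> n y"
proof -
  define y' where "y' j = (if j < n then 0 else composite \<psi> n j y)" for j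
  have comp: "composite \<psi> n j y \<in> B j" if "n \<le> j" for j by (rule B.cs.subsystem_composite[OF B.subsystem_A that y])
  have y'B: "y' j \<in> B j" for j using comp subalgebra_zero[OF digraph_subalgebra[OF B.dig]] by (auto simp: y'_def)
  have ny': "norm (y' j) \<le> norm y" for j using B.cs.composite_norm[OF gB[OF y]] by (simp add: y'_def)
  have by': "Bseq y'" by (rule Bseq_bounded[OF ny'])
  have Y: "limit_element \<psi> n y = seq_class y'"
    by (rule B.cs.limit_element_eqI[OF gB[OF y] by', where N = n, symmetric]) (simp add: y'_def)
  have Suc': "y' (Suc j) = \<psi> j (y' j)" if "n \<le> j" for j using that by (simp add: y'_def composite_Suc)
  define w where "w k = nu_shift k (y' (k - 1))" for k
  have wA: "w k \<in> A k" for k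
  proof (cases k)
    case 0
    then show ?thesis using subalgebra_zero[OF digraph_subalgebra[OF A.dig]] by (simp add: w_def nu_shift_def)
  qed (simp add: w_def nu_shift_def nu_into y'B)
  have nw: "norm (w k) \<le> norm y" for k
    unfolding w_def by (rule order_trans[OF nu_hyps(2)[OF gB[OF y'B]] ny'])
  have bw: "Bseq w" by (rule Bseq_bounded[OF nw])
  have W: "theta_inv (limit_element \<psi> n y) = seq_class w"
    unfolding Y using theta_inv_class[OF by' gB[OF y'B]] by (simp add: w_def[abs_def])
  have err: "norm (\<phi> k (w k) - w (Suc k)) \<le> (a k + b (k - 1)) * norm y" if k: "Suc n \<le> k" for k
  proof -
    obtain j where j: "k = Suc j" "n \<le> j" using k by (cases k) auto
    have wk: "w k = \<nu> j (y' j)" "w (Suc k) = \<nu> k (\<psi> j (y' j))"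
      using Suc'[OF j(2)] by (simp_all add: w_def nu_shift_def j(1))
    have pm: "\<psi> j (y' j) \<in> B k" using B.into y'B j(1) by blast
    have mm: "\<mu> k (w k) \<in> B k" using mu_into wA by blast
    have "norm (\<phi> k (w k) - \<nu> k (\<mu> k (w k))) \<le> a k * norm (w k)" by (rule a(1)[OF wA])
    also have "\<dots> \<le> a k * norm y" using nw a(2) by (simp add: mult_left_mono)
    finally have 1: "norm (\<phi> k (w k) - \<nu> k (\<mu> k (w k))) \<le> a k * norm y" .
    have "norm (\<nu> k (\<mu> k (w k)) - w (Suc k)) = norm (\<nu> k (\<psi> j (y' j) - \<mu> k (w k)))"
      using star_hom_diff[OF nu generated_subalgebra gB[OF pm] gB[OF mm]] wk(2) by (simp add: norm_minus_commute)
    also have "\<dots> \<le> norm (\<psi> j (y' j) - \<mu> k (w k))"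
      by (rule nu_contr[OF subalgebra_diff[OF generated_subalgebra gB[OF pm] gB[OF mm]]])
    also have "\<dots> \<le> b j * norm (y' j)" using b(1)[OF y'B[of j]] wk(1) by (simp add: j(1))
    also have "\<dots> \<le> b j * norm y" using ny' b(2) by (simp add: mult_left_mono)
    finally have 2: "norm (\<nu> k (\<mu> k (w k)) - w (Suc k)) \<le> b j * norm y" .
    have "norm (\<phi> k (w k) - w (Suc k)) \<le> norm (\<phi> k (w k) - \<nu> k (\<mu> k (w k))) + norm (\<nu> k (\<mu> k (w k)) - w (Suc k))"
      using norm_triangle_ineq[of "\<phi> k (w k) - \<nu> k (\<mu> k (w k))" "\<nu> k (\<mu> k (w k)) - w (Suc k)"] by simp
    then show ?thesis using 1 2 by (simp add: distrib_right j(1))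
  qed
  have sb: "summable (\<lambda>k. b (k - 1))"
    using b(3) summable_Suc_iff[of "\<lambda>k. b (k - 1)"] by simp
  show "theta_inv (limit_element \<psi> n y) \<in> LA"
    unfolding W
    by (rule A.cs.almost_coherent[OF A.subsystem_A digraph_subalgebra[OF A.dig] bw wA err])
      (use a b sb in \<open>auto intro!: summable_mult2 summable_add\<close>)
  have v: "Bseq (\<lambda>k. \<mu> k (w k))"
    by (rule Bseq_bounded[where c = "norm y"]) (rule order_trans[OF mu_contr[OF gA[OF wA]] nw])
  have "theta (seq_class w) = seq_class (\<lambda>k. \<mu> k (w k))"
    using theta_class[OF bw gA[OF wA]] by simp
  also have "\<dots> = seq_class y'"
    unfolding seq_class_eq_iff[OF v by']
  proof (rule Lim_null_comparison[where g = "\<lambda>k. b (k - 1) * norm y"])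
    show "\<forall>\<^sub>F k in sequentially. norm (\<mu> k (w k) - y' k) \<le> b (k - 1) * norm y"
      using eventually_ge_at_top[of "Suc n"]
    proof eventually_elim
      case (elim k)
      then obtain j where j: "k = Suc j" "n \<le> j" by (cases k) auto
      have "norm (\<mu> k (w k) - y' k) = norm (\<psi> j (y' j) - \<mu> (Suc j) (\<nu> j (y' j)))"
        using Suc'[OF j(2)] by (simp add: j(1) nu_shift_def w_def norm_minus_commute)
      also have "\<dots> \<le> b j * norm (y' j)" by (rule b(1)[OF y'B])
      also have "\<dots> \<le> b j * norm y" using ny' b(2) by (simp add: mult_left_mono)
      finally show ?case by (simp add: j(1))
    qed
    show "(\<lambda>k. b (k - 1) * norm y) \<longlonglongrightarrow> 0"
      by (rule tendsto_mult_left_zero[OF summable_LIMSEQ_zero[OF sb]])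
  qed
  finally show "theta (theta_inv (limit_element \<psi> n y)) = limit_element \<psi> n y" unfolding W unfolding Y .
qed

lemma theta_LA:
  assumes X: "X \<in> LA" shows "theta X \<in> LB" "theta_inv (theta X) = X"
proof -
  obtain x where x: "\<And>i. x i \<in> (\<Union>n. limit_element \<phi> n ` A n)" "x \<longlonglongrightarrow> X"
    using X unfolding A.cs.closed_limit_eq[OF A.subsystem_A] closure_sequential by blast
  have e: "theta (x i) \<in> LB \<and> theta_inv (theta (x i)) = x i \<and> x i \<in> LA" for i
    using x(1)[of i] theta_element A.cs.limit_element_mem[OF A.subsystem_A] by auto
  have xi: "x i \<in> seq_product GA" for i using e LA_product by blast
  have XP: "X \<in> seq_product GA" using X LA_product by blast
  have t: "(\<lambda>i. theta (x i)) \<longlonglongrightarrow> theta X" by (rule theta_tendsto[OF xi XP x(2)])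
  then show tX: "theta X \<in> LB"
    using closed_sequentially[OF B.cs.closed_limit_closed[OF B.subsystem_A], of "\<lambda>i. theta (x i)"] e by blast
  have "(\<lambda>i. theta_inv (theta (x i))) \<longlonglongrightarrow> theta_inv (theta X)"
    by (rule theta_inv_tendsto[OF _ _ t]) (use e tX LB_product in blast)+
  then have "x \<longlonglongrightarrow> theta_inv (theta X)" using e by simp
  then show "theta_inv (theta X) = X" using x(2) LIMSEQ_unique by blast
qed

lemma theta_inv_LB:
  assumes Y: "Y \<in> LB" shows "theta_inv Y \<in> LA" "theta (theta_inv Y) = Y"
proof -
  obtain y where y: "\<And>i. y i \<in> (\<Union>n. limit_element \<psi> n ` B n)" "y \<longlonglongrightarrow> Y"
    using Y unfolding B.cs.closed_limit_eq[OF B.subsystem_A] closure_sequential by blast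
  have e: "theta_inv (y i) \<in> LA \<and> theta (theta_inv (y i)) = y i \<and> y i \<in> LB" for i
    using y(1)[of i] theta_inv_element B.cs.limit_element_mem[OF B.subsystem_A] by auto
  have yi: "y i \<in> seq_product GB" for i using e LB_product by blast
  have YP: "Y \<in> seq_product GB" using Y LB_product by blast
  have t: "(\<lambda>i. theta_inv (y i)) \<longlonglongrightarrow> theta_inv Y" by (rule theta_inv_tendsto[OF yi YP y(2)])
  then show tY: "theta_inv Y \<in> LA"
    using closed_sequentially[OF A.cs.closed_limit_closed[OF A.subsystem_A], of "\<lambda>i. theta_inv (y i)"] e by blast
  have "(\<lambda>i. theta (theta_inv (y i))) \<longlonglongrightarrow> theta (theta_inv Y)"
    by (rule theta_tendsto[OF _ _ t]) (use e tY LA_product in blast)+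
  then have "y \<longlonglongrightarrow> theta (theta_inv Y)" using e by simp
  then show "theta (theta_inv Y) = Y" using y(2) LIMSEQ_unique by blast
qed

lemma theta_generated_hom: "star_hom theta (generated_cstar LA) (generated_cstar LB)"
proof -
  note g = theta_generated[OF LA_product theta_LA(1)] and H = star_homD[OF theta_hom]
  show ?thesis
    unfolding star_hom_def
    by (intro conjI image_subsetI ballI allI g(2) H(2-5) g(1); assumption)
qed

lemma theta_inv_generated_hom: "star_hom theta_inv (generated_cstar LB) (generated_cstar LA)"
proof -
  note g = theta_inv_generated[OF LB_product theta_inv_LB(1)] and H = star_homD[OF theta_inv_hom]
  show ?thesis
    unfolding star_hom_def
    by (intro conjI image_subsetI ballI allI g(2) H(2-5) g(1); assumption)
qed

lemma theta_iso: "star_extendible_iso theta LA LB"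
proof -
  have bij: "bij_betw theta LA LB"
    by (rule bij_betwI[where g = theta_inv]) (use theta_LA theta_inv_LB in auto)
  have "inv_into LA theta Y = theta_inv Y" if "Y \<in> LB" for Y
  proof (rule inv_into_f_eq)
    show "inj_on theta LA" using bij by (rule bij_betw_imp_inj_on)
  qed (use theta_inv_LB that in auto)
  then have "star_extendible (inv_into LA theta) LB LA"
    unfolding star_extendible_def using theta_inv_generated_hom theta_inv_LB(1) by auto
  moreover have "star_extendible theta LA LB"
    unfolding star_extendible_def using theta_generated_hom theta_LA(1) by auto
  ultimately show ?thesis using bij by (simp add: star_extendible_iso_def)
qed

lemma theta_masa: "standard_regular_masa (theta ` closed_limit C \<phi>) LB"
proof -
  have "regular_system A \<phi>" using A.dig A.regular_map_system by (simp add: regular_system_def)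
  then show ?thesis
    unfolding standard_regular_masa_def using A.msa A.standard_regular_system theta_iso by blast
qed

lemma identity_masa: "standard_regular_masa (closed_limit D \<psi>) LB"
proof -
  have "regular_system B \<psi>" using B.dig B.regular_map_system by (simp add: regular_system_def)
  moreover have "star_hom (\<lambda>x. x) (generated_cstar LB) (generated_cstar LB)" by (simp add: star_hom_def)
  moreover have "inv_into LB (\<lambda>x. x) Y = Y" if "Y \<in> LB" for Y using that by (intro inv_into_f_eq) auto
  ultimately have "star_extendible_iso (\<lambda>x. x) LB LB"
    unfolding star_extendible_iso_def star_extendible_def by (auto simp: bij_betw_def intro!: exI[of _ "\<lambda>x. x"])
  with \<open>regular_system B \<psi>\<close> show ?thesis
    unfolding standard_regular_masa_def using B.msa B.standard_regular_system by (metis (no_types) image_ident)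
qed

end

subsection \<open>Normalisers of a standard regular masa\<close>

lemma norm_projection_mult_le:
  assumes "projection p" "projection q" shows "norm (p * x * q) \<le> norm (x::'a::cstar_algebra)"
proof -
  have "norm (p * x * q) \<le> norm p * norm x * norm q"
    by (meson mult_right_mono norm_ge_zero norm_mult_ineq order_trans)
  also have "\<dots> \<le> 1 * norm x * 1"
    using norm_projection_le[OF assms(1)] norm_projection_le[OF assms(2)] by (intro mult_mono) auto
  finally show ?thesis by simp
qed

lemma norm_projection_mult_left_le: "projection p \<Longrightarrow> norm (p * x) \<le> norm (x::'a::cstar_algebra)"
  using norm_projection_le[of p] by (intro order_trans[OF norm_mult_ineq] mult_left_le_one_le) auto

lemma norm_le_1_if_projection: "projection (star x * x) \<Longrightarrow> norm (x::'a::cstar_algebra) \<le> 1"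
  using norm_projection_le[of "star x * x"] by (simp add: cstar_identity power_le_one_iff)

lemma norm_star_mult_diff_le:
  assumes "norm x \<le> c" "norm y \<le> d" shows "norm (star x * x - star y * y) \<le> (c + d) * norm (x - y :: 'a::cstar_algebra)"
proof -
  have "star x * x - star y * y = star x * (x - y) + star (x - y) * y"
    by (simp add: right_diff_distrib left_diff_distrib star_diff)
  also have "norm \<dots> \<le> norm x * norm (x - y) + norm (x - y) * norm y"
    by (intro order_trans[OF norm_triangle_ineq] add_mono order_trans[OF norm_mult_ineq]) simp_all
  also have "\<dots> \<le> c * norm (x - y) + norm (x - y) * d"
    using assms by (intro add_mono mult_right_mono mult_left_mono) auto
  finally show ?thesis by (simp add: algebra_simps)
qed

context standard_system
begin

abbreviation "LG \<equiv> closed_limit (\<lambda>k. generated_cstar (A k)) \<phi>"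
abbreviation "LC \<equiv> closed_limit C \<phi>"
abbreviation "hat \<equiv> limit_element \<phi>"

text \<open>The conditions on \<open>V * star V\<close> and \<open>star V * V\<close> are stated
  separately because \<open>LC\<close> may lack a unit, so they are not instances of the last
  clause.\<close>

definition normalises :: "'a seq_algebra \<Rightarrow> bool" where
  "normalises V \<longleftrightarrow> V \<in> LG \<and> V * star V * V = V \<and> V * star V \<in> LC \<and> star V * V \<in> LC \<and>
     (\<forall>d\<in>LC. star V * d * V \<in> LC \<and> V * d * star V \<in> LC)"

lemma LG_star: "V \<in> LG \<Longrightarrow> star V \<in> LG"
  using star_subalgebra_star[OF cs.closed_limit_star_subalgebra[OF cs.subsystem_self generated_star_subalgebra]] .

lemma normalises_star: "normalises V \<Longrightarrow> normalises (star V)"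
  unfolding normalises_def using LG_star[of V] by (auto simp: mult.assoc) (metis star_mult star_star mult.assoc)

lemma LC_commute: "x \<in> LC \<Longrightarrow> y \<in> LC \<Longrightarrow> x * y = y * x"
  by (rule cs.closed_limit_commute[OF subsystem_C abelian_star_subalgebraD(3)[OF masaD(2)[OF msa]]])

context
  fixes m :: nat
begin

abbreviation "P \<equiv> atoms (C m)"

lemmas hat_hom = cs.limit_element_hom[of m]
lemmas hatD = star_homD(2-5)[OF hat_hom]

lemma P_gen: "p \<in> P \<Longrightarrow> p \<in> generated_cstar (A m)"
  using minimal_inD(1)[OF digraph_atoms_minimal[OF dig msa]] .

lemma hat_LC: "p \<in> P \<Longrightarrow> hat m p \<in> LC"
  by (rule cs.limit_element_mem[OF subsystem_C atoms_mem])

lemma hat_projection: "p \<in> P \<Longrightarrow> projection (hat m p)"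
  by (rule star_hom_projection[OF hat_hom P_gen atoms_projection])

lemma hat_mult: "p \<in> P \<Longrightarrow> q \<in> P \<Longrightarrow> hat m p * hat m q = (if p = q then hat m p else 0)"
  using hatD(2)[OF P_gen P_gen, of p q] digraph_atoms_mult[OF dig msa, of p m q]
    star_hom_zero[OF hat_hom generated_subalgebra] by auto

text \<open>\<open>R = star y * y\<close> is a projection below \<open>hat m q\<close>, because
  \<open>star V * hat m p * V\<close> is a projection in the commutative \<open>LC\<close>. On the
  other side \<open>star x * x = n q\<close> for the minimal \<open>q\<close>. The two differ by at
  most \<open>3 \<delta>\<close>; multiplying by \<open>R\<close> gives
  \<open>\<bar>1 - n\<bar> \<le> 3 \<delta>\<close>, and so \<open>hat m q - R\<close> is a
  projection of norm at most \<open>6 \<delta> < 1\<close>, hence zero.\<close>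

lemma corner_left:
  assumes V: "normalises V" and b: "b \<in> generated_cstar (A m)" "norm (V - hat m b) \<le> \<delta>" "\<delta> < 1/8"
    and p: "p \<in> P" and q: "q \<in> P" and y: "y = hat m p * V * hat m q" "y \<noteq> 0" and x: "x = p * b * q"
  shows "star y * y = hat m q" "norm (y - hat m x) \<le> \<delta>" "\<bar>norm x - 1\<bar> \<le> \<delta>" "norm (hat m x) = norm x"
proof -
  note pp = projectionD[OF hat_projection[OF p]] and qq = projectionD[OF hat_projection[OF q]]
  have pp3: "hat m p * (hat m p * z) = hat m p * z" for z using pp(2) by (simp flip: mult.assoc)
  have \<delta>0: "0 \<le> \<delta>" using b(2) norm_ge_zero order_trans by blast
  define S where "S = star V * hat m p * V"
  have SL: "S \<in> LC" using V hat_LC[OF p] by (simp add: S_def normalises_def)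
  have VV: "V * star V * hat m p = hat m p * (V * star V)"
    using LC_commute[OF _ hat_LC[OF p]] V by (simp add: normalises_def)
  have "S * S = star V * (hat m p * (V * star V)) * hat m p * V" by (simp add: S_def mult.assoc)
  also have "\<dots> = star V * (V * star V * hat m p) * hat m p * V" by (simp add: VV)
  also have "\<dots> = (star V * V * star V) * (hat m p * hat m p) * V" by (simp add: mult.assoc)
  also have "star V * V * star V = star V"
    using V by (simp add: normalises_def) (metis star_mult star_star mult.assoc)
  finally have "S * S = S" by (simp add: pp S_def)
  then have pS: "projection S" by (simp add: projection_def S_def star_mult pp mult.assoc)
  have com: "S * hat m q = hat m q * S" by (rule LC_commute[OF SL hat_LC[OF q]])
  have yy: "star y * y = S * hat m q"
  proof -
    have "star y * y = hat m q * star V * (hat m p * hat m p) * V * hat m q"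
      by (simp add: y star_mult pp pp3 qq mult.assoc)
    also have "\<dots> = hat m q * S * hat m q" by (simp add: pp3 S_def mult.assoc)
    also have "\<dots> = S * hat m q" using com qq by (metis mult.assoc)
    finally show ?thesis .
  qed
  define R where "R = star y * y"
  have pR: "projection R" unfolding R_def yy by (rule projection_commute_mult[OF pS hat_projection[OF q] com])
  have R0: "R \<noteq> 0" using y(2) by (simp add: R_def)
  have nR: "norm R = 1" by (rule norm_projection[OF pR R0])
  have ny: "norm y = 1" using nR cstar_identity[of y] power2_eq_imp_eq[of "norm y" 1] by (simp add: R_def)
  have Rq: "R * hat m q = R" unfolding R_def yy using qq by (simp add: mult.assoc)
  have qR: "hat m q * R = R" using Rq pR qq by (metis projectionD(1) star_mult)
  have xG: "x \<in> generated_cstar (A m)" using b(1) P_gen p q by (simp add: x subalgebra_mult[OF generated_subalgebra])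
  have hx: "hat m x = hat m p * hat m b * hat m q"
    using hatD(2) b(1) P_gen p q by (simp add: x subalgebra_mult[OF generated_subalgebra])
  have "y - hat m x = hat m p * (V - hat m b) * hat m q" by (simp add: hx y right_diff_distrib left_diff_distrib)
  then show d1: "norm (y - hat m x) \<le> \<delta>"
    using norm_projection_mult_le[OF hat_projection[OF p] hat_projection[OF q]] b(2) order_trans by metis
  define n where "n = complex_of_real ((norm x)\<^sup>2)"
  have "star x * x = n *\<^sub>C q"
    unfolding n_def
    by (rule minimal_corner(1)[OF generated_star_subalgebra digraph_atoms_minimal[OF dig msa p]
          digraph_atoms_minimal[OF dig msa q] digraph_atoms_orthogonal[OF dig msa p q] b(1) x])
  then have hxx: "star (hat m x) * hat m x = n *\<^sub>C hat m q"
    using hatD(2)[OF star_subalgebra_star[OF generated_star_subalgebra xG] xG] hatD(4)[OF xG] hatD(3)[OF P_gen[OF q]] by simp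
  have q0: "hat m q \<noteq> 0" using y by auto
  have nq: "norm (hat m q) = 1" by (rule norm_projection[OF hat_projection[OF q] q0])
  have cn: "cmod n = (norm x)\<^sup>2" unfolding n_def by (simp only: norm_of_real abs_power2)
  have "(norm (hat m x))\<^sup>2 = norm (n *\<^sub>C hat m q)" using hxx cstar_identity[of "hat m x"] by simp
  also have "\<dots> = (norm x)\<^sup>2" by (simp only: norm_scaleC nq cn mult_1_right)
  finally have "(norm (hat m x))\<^sup>2 = (norm x)\<^sup>2" .
  then show nx: "norm (hat m x) = norm x" by simp
  have "\<bar>norm (hat m x) - norm y\<bar> \<le> \<delta>" using d1 norm_triangle_ineq3[of "hat m x" y] by (simp add: norm_minus_commute)
  then show d2: "\<bar>norm x - 1\<bar> \<le> \<delta>" by (simp add: nx ny)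
  have "norm (R - n *\<^sub>C hat m q) \<le> (1 + (1 + \<delta>)) * norm (y - hat m x)"
    unfolding R_def hxx[symmetric] using ny nx d2 by (intro norm_star_mult_diff_le) auto
  also have "\<dots> \<le> (1 + (1 + 1)) * \<delta>" using d1 \<delta>0 b(3) by (intro mult_mono) auto
  finally have d3: "norm (R - n *\<^sub>C hat m q) \<le> 3 * \<delta>" by simp
  have "R * (R - n *\<^sub>C hat m q) = (1 - n) *\<^sub>C R"
    using Rq projectionD(2)[OF pR] by (simp add: right_diff_distrib scaleC_mult_right cvs.scale_left_diff_distrib)
  then have "cmod (1 - n) \<le> 3 * \<delta>"
    using norm_projection_mult_left_le[OF pR, of "R - n *\<^sub>C hat m q"] d3 nR by (simp add: norm_scaleC)
  moreover have "norm (n *\<^sub>C hat m q - hat m q) = cmod (1 - n)"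
    using nq by (metis cvs.scale_left_diff_distrib cvs.scale_one mult.right_neutral norm_minus_commute norm_scaleC)
  ultimately have "norm (R - hat m q) \<le> 6 * \<delta>"
    using d3 norm_triangle_ineq[of "R - n *\<^sub>C hat m q" "n *\<^sub>C hat m q - hat m q"] by simp
  then have "norm (hat m q - R) < 1" using b(3) by (simp add: norm_minus_commute)
  moreover have "projection (hat m q - R)" by (rule projection_diff[OF hat_projection[OF q] pR qR])
  ultimately have "hat m q - R = 0" by (intro projection_eq_0)
  then show "star y * y = hat m q" by (simp add: R_def)
qed

text \<open>This is \<open>corner_left\<close> for \<open>star V\<close>, which is approximated by
  \<open>star b\<close>.\<close>

lemma corner_right:
  assumes V: "normalises V" and b: "b \<in> generated_cstar (A m)" "norm (V - hat m b) \<le> \<delta>" "\<delta> < 1/8"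
    and p: "p \<in> P" and q: "q \<in> P" and y: "y = hat m p * V * hat m q" "y \<noteq> 0"
  shows "y * star y = hat m p"
proof -
  have sb: "star b \<in> generated_cstar (A m)" using b(1) star_subalgebra_star[OF generated_star_subalgebra] by blast
  have "star V - hat m (star b) = star (V - hat m b)" using hatD(4)[OF b(1)] by (simp add: star_diff)
  then have n: "norm (star V - hat m (star b)) \<le> \<delta>" using b(2) by simp
  have sy: "star y = hat m q * star V * hat m p"
    using projectionD(1)[OF hat_projection[OF p]] projectionD(1)[OF hat_projection[OF q]]
    by (simp add: y star_mult mult.assoc)
  have "star (star y) * star y = hat m p"
    by (rule corner_left(1)[OF normalises_star[OF V] sb n b(3) q p sy _ refl]) (use y(2) in simp)
  then show ?thesis by simp
qed

text \<open>With \<open>?u\<close> the image of the unit of level \<open>m\<close>,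
  \<open>Z = V - ?u * V\<close> has norm at most \<open>2 \<delta>\<close>, since \<open>?u\<close>
  fixes the approximant. But \<open>Z * star Z\<close> is a projection, because \<open>?u\<close>
  commutes with \<open>V * star V\<close>; being small, it is zero.\<close>

lemma normalises_expand_left:
  assumes V: "normalises V" and b: "b \<in> generated_cstar (A m)" "norm (V - hat m b) \<le> \<delta>" "\<delta> < 1/8"
  shows "hat m (\<Sum>P) * V = V"
proof -
  let ?u = "hat m (\<Sum>P)"
  have uC: "(\<Sum>P) \<in> C m" "(\<Sum>P) \<in> generated_cstar (A m)" using digraph_unit_mem[OF dig msa] by auto
  have pu: "projection ?u"
    by (rule star_hom_projection[OF hat_hom uC(2) sum_atoms_projection[OF masaD(2)[OF msa] order_refl]])
  have uL: "?u \<in> LC" by (rule cs.limit_element_mem[OF subsystem_C uC(1)])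
  have ub: "?u * hat m b = hat m b" using hatD(2)[OF uC(2) b(1)] digraph_unit(1)[OF dig msa b(1)] by simp
  define Q where "Q = V * star V"
  have Q: "projection Q" "Q \<in> LC"
    using V projection_star_mult[of "star V"] by (auto simp: Q_def normalises_def) (metis star_mult star_star mult.assoc)
  have com: "Q * ?u = ?u * Q" by (rule LC_commute[OF Q(2) uL])
  define Z where "Z = V - ?u * V"
  have "Z = (V - hat m b) - ?u * (V - hat m b)" by (simp add: Z_def right_diff_distrib ub)
  then have "norm Z \<le> norm (V - hat m b) + norm (?u * (V - hat m b))" by (simp add: norm_triangle_ineq4)
  also have "\<dots> \<le> \<delta> + \<delta>" using b(2) norm_projection_mult_left_le[OF pu, of "V - hat m b"] by linarith
  finally have nZ: "norm Z < 1" using b(3) by simp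
  have "Z * star Z = Q - ?u * Q - Q * ?u + ?u * Q * ?u"
    using projectionD(1)[OF pu] by (simp add: Z_def Q_def star_diff star_mult left_diff_distrib right_diff_distrib mult.assoc)
  also have "\<dots> = Q - ?u * Q" using com projectionD(2)[OF pu] by (simp add: mult.assoc) (simp flip: mult.assoc)
  finally have ZZ: "Z * star Z = Q - ?u * Q" .
  have "projection (?u * Q)" by (rule projection_commute_mult[OF pu Q(1)]) (simp add: com)
  then have "projection (Q - ?u * Q)"
    by (rule projection_diff[OF Q(1)]) (use com projectionD(2)[OF Q(1)] in \<open>metis mult.assoc\<close>)
  moreover have "norm (Z * star Z) < 1" using nZ by (simp add: cstar_identity' power_less_one_iff)
  ultimately have "Z * star Z = 0" unfolding ZZ[symmetric] by (intro projection_eq_0)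
  then show ?thesis by (simp add: Z_def)
qed

lemma normalises_expand_right:
  assumes V: "normalises V" and b: "b \<in> generated_cstar (A m)" "norm (V - hat m b) \<le> \<delta>" "\<delta> < 1/8"
  shows "V * hat m (\<Sum>P) = V"
proof -
  have sb: "star b \<in> generated_cstar (A m)" using b(1) star_subalgebra_star[OF generated_star_subalgebra] by blast
  have "star V - hat m (star b) = star (V - hat m b)" using hatD(4)[OF b(1)] by (simp add: star_diff)
  then have "norm (star V - hat m (star b)) \<le> \<delta>" using b(2) by simp
  then have "hat m (\<Sum>P) * star V = star V"
    by (rule normalises_expand_left[OF normalises_star[OF V] sb _ b(3)])
  then have "star (hat m (\<Sum>P) * star V) = V" by simp
  moreover have "star (hat m (\<Sum>P)) = hat m (\<Sum>P)"
    using projectionD(1)[OF star_hom_projection[OF hat_hom digraph_unit_mem(3)[OF dig msa]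
      sum_atoms_projection[OF masaD(2)[OF msa] order_refl]]] .
  ultimately show ?thesis by (simp add: star_mult)
qed

lemma hat_unit: "hat m (\<Sum>P) = (\<Sum>p\<in>P. hat m p)"
  using star_hom_sum[OF hat_hom generated_subalgebra, of P "\<lambda>p. p"] P_gen by simp

text \<open>The entry \<open>p V q\<close> of a normaliser has norm \<open>0\<close> or \<open>1\<close>, so an approximation of \<open>V\<close> at level
  \<open>m\<close> determines which entries vanish; rescaling the others gives a normaliser at level \<open>m\<close>.\<close>

lemma approximate_normaliser:
  assumes V: "normalises V" and b: "b \<in> generated_cstar (A m)" "norm (V - hat m b) \<le> \<delta>" "\<delta> < 1/8"
  shows "\<exists>w\<in>generated_cstar (A m). norm (V - hat m w) \<le> 2 * \<delta> \<and>
    star w * w = \<Sum>{q\<in>P. V * hat m q \<noteq> 0} \<and>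
    (\<forall>q\<in>P. V * hat m q = 0 \<longrightarrow> w * q = 0) \<and> (\<forall>q\<in>P. V * hat m q \<noteq> 0 \<longrightarrow> w * q * star w \<in> P) \<and>
    (\<forall>p\<in>P. hat m p * V = 0 \<longrightarrow> p * w = 0) \<and>
    (\<forall>p\<in>P. hat m p * V \<noteq> 0 \<longrightarrow> hat m p * (V * star V) = hat m p \<and>
       (\<exists>q\<in>P. V * hat m q \<noteq> 0 \<and> p * w = w * q \<and> w * q * star w = p))"
proof -
  have \<delta>0: "0 \<le> \<delta>" using b(2) norm_ge_zero order_trans by blast
  note fin = digraph_atoms_finite[OF dig[of m] msa[of m]]
  define y where "y p q = hat m p * V * hat m q" for p q
  define x where "x p q = p * b * q" for p q
  define u where "u p q = complex_of_real (1 / norm (x p q)) *\<^sub>C x p q" for p q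
  \<comment> \<open>\<open>W\<close> turns out to be the graph of a partial bijection between atoms:
    \<open>q\<close> is the source and \<open>p\<close> the range of a nonzero entry.\<close>
  define W where "W = {(p, q). p \<in> P \<and> q \<in> P \<and> y p q \<noteq> 0}"
  have WP: "p \<in> P" "q \<in> P" "y p q \<noteq> 0" if "(p, q) \<in> W" for p q using that by (auto simp: W_def)
  have finW: "finite W" by (rule finite_subset[of _ "P \<times> P"]) (use fin in \<open>auto simp: W_def\<close>)
  note Pm = digraph_atoms_mult[OF dig[of m] msa[of m]]
  have Ps: "star p = p" "p * p = p" if "p \<in> P" for p using projectionD[OF atoms_projection[OF that]] by auto
  have cl: "star (y p q) * y p q = hat m q" "norm (y p q - hat m (x p q)) \<le> \<delta>" "\<bar>norm (x p q) - 1\<bar> \<le> \<delta>"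
      "norm (hat m (x p q)) = norm (x p q)" "y p q * star (y p q) = hat m p"
    if w: "(p, q) \<in> W" for p q
    using corner_left[OF V b WP(1,2)[OF w] y_def WP(3)[OF w] x_def] corner_right[OF V b WP(1,2)[OF w] y_def WP(3)[OF w]] by auto
  have nx: "norm (x p q) > 0" if w: "(p, q) \<in> W" for p q using cl(3)[OF w] b(3) by linarith
  have xG: "x p q \<in> generated_cstar (A m)" if "p \<in> P" "q \<in> P" for p q
    using b(1) P_gen that by (simp add: x_def subalgebra_mult[OF generated_subalgebra])
  have uG: "u p q \<in> generated_cstar (A m)" if "(p, q) \<in> W" for p q
    using xG WP[OF that] by (simp add: u_def subalgebra_scale[OF generated_subalgebra])
  have pu: "p * u p q = u p q" "u p q * q = u p q" if w: "(p, q) \<in> W" for p q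
    using Ps[OF WP(1)[OF w]] Ps[OF WP(2)[OF w]]
    by (simp_all add: u_def x_def scaleC_mult_left scaleC_mult_right mult.assoc) (simp_all flip: mult.assoc)
  have pu': "r * u p q = (if r = p then u p q else 0)" "u p q * r = (if r = q then u p q else 0)"
    if w: "(p, q) \<in> W" and r: "r \<in> P" for p q r
    using pu[OF w] Pm[OF r WP(1)[OF w]] Pm[OF WP(2)[OF w] r] by (metis mult.assoc mult_zero_left, metis mult.assoc mult_zero_right)
  have uu: "star (u p q) * u p q = q" "u p q * star (u p q) = p" if w: "(p, q) \<in> W" for p q
  proof -
    have k: "complex_of_real (1 / norm (x p q)) * complex_of_real (1 / norm (x p q)) * complex_of_real ((norm (x p q))\<^sup>2) = 1"
      using nx[OF w] by (simp add: power2_eq_square flip: of_real_mult)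
    note mc = minimal_corner[OF generated_star_subalgebra digraph_atoms_minimal[OF dig msa WP(1)[OF w]]
        digraph_atoms_minimal[OF dig msa WP(2)[OF w]] digraph_atoms_orthogonal[OF dig msa WP(1,2)[OF w]] b(1) x_def]
    show "star (u p q) * u p q = q" "u p q * star (u p q) = p"
      using mc k by (simp_all add: u_def star_scaleC scaleC_mult_left scaleC_mult_right scaleC_scaleC)
  qed
  \<comment> \<open>One \<open>\<delta>\<close> for replacing \<open>y\<close> by its approximant,
    and one for normalising the latter, whose norm is within \<open>\<delta>\<close> of 1.\<close>
  have yu: "norm (y p q - hat m (u p q)) \<le> 2 * \<delta>" if w: "(p, q) \<in> W" for p q
  proof -
    define t where "t = norm (x p q)"
    have t: "t > 0" "\<bar>t - 1\<bar> \<le> \<delta>" using nx[OF w] cl(3)[OF w] by (simp_all add: t_def)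
    have "hat m (u p q) = complex_of_real (1 / t) *\<^sub>C hat m (x p q)"
      using hatD(3)[OF xG[OF WP(1,2)[OF w]]] by (simp add: u_def t_def)
    then have "hat m (x p q) - hat m (u p q) = complex_of_real (1 - 1 / t) *\<^sub>C hat m (x p q)"
      by (simp add: cvs.scale_left_diff_distrib)
    then have "norm (hat m (x p q) - hat m (u p q)) = \<bar>1 - 1 / t\<bar> * t"
      using cl(4)[OF w] by (simp only: norm_scaleC norm_of_real t_def)
    also have "\<dots> = \<bar>(1 - 1 / t) * t\<bar>" using t(1) by (simp add: abs_mult)
    also have "(1 - 1 / t) * t = t - 1" using t(1) by (simp add: field_simps)
    finally have "norm (hat m (x p q) - hat m (u p q)) \<le> \<delta>" using t(2) by simp
    then show ?thesis
      using cl(2)[OF w] norm_triangle_ineq[of "y p q - hat m (x p q)" "hat m (x p q) - hat m (u p q)"] by simp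
  qed
  note hs = projectionD[OF hat_projection]
  have VL: "star V * hat m p * V \<in> LC" "V * hat m p * star V \<in> LC" "V * star V \<in> LC" "star V * V \<in> LC" if "p \<in> P" for p
    using V hat_LC[OF that] by (auto simp: normalises_def)
  \<comment> \<open>Two entries in one row would both have range projection \<open>hat m p\<close>.
    But the product of the adjoint of one with the other contains
    \<open>hat m q * hat m q' = 0\<close>, since \<open>star V * hat m p * V\<close> lies in
    \<open>LC\<close> and commutes past \<open>hat m q\<close>.\<close>
  have right_unique: "q = q'" if w: "(p, q) \<in> W" "(p, q') \<in> W" for p q q'
  proof (rule ccontr)
    assume ne: "q \<noteq> q'"
    note p = WP(1)[OF w(1)] and q = WP(2)[OF w(1)] and q' = WP(2)[OF w(2)]
    have "star (y p q) * y p q' = hat m q * (star V * hat m p * V) * hat m q'"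
      using hs[OF p] hs[OF q] by (simp add: y_def star_mult mult.assoc) (metis mult.assoc)
    also have "\<dots> = (star V * hat m p * V) * (hat m q * hat m q')"
      using LC_commute[OF hat_LC[OF q] VL(1)[OF p]] by (simp add: mult.assoc)
    finally have 0: "star (y p q) * y p q' = 0" using hat_mult[OF q q'] ne by simp
    have "hat m p = (y p q * star (y p q)) * (y p q' * star (y p q'))" using cl(5)[OF w(1)] cl(5)[OF w(2)] hs(2)[OF p] by simp
    also have "\<dots> = y p q * (star (y p q) * y p q') * star (y p q')" by (simp add: mult.assoc)
    finally have "hat m p = 0" using 0 by simp
    then show False using WP(3)[OF w(1)] by (simp add: y_def)
  qed
  have left_unique: "p = p'" if w: "(p, q) \<in> W" "(p', q) \<in> W" for p p' q
  proof (rule ccontr)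
    assume ne: "p \<noteq> p'"
    note p = WP(1)[OF w(1)] and q = WP(2)[OF w(1)] and p' = WP(1)[OF w(2)]
    have "y p q * star (y p' q) = hat m p * (V * hat m q * star V) * hat m p'"
      using hs[OF p'] hs[OF q] by (simp add: y_def star_mult mult.assoc) (metis mult.assoc)
    also have "\<dots> = (V * hat m q * star V) * (hat m p * hat m p')"
      using LC_commute[OF hat_LC[OF p] VL(2)[OF q]] by (simp add: mult.assoc)
    finally have 0: "y p q * star (y p' q) = 0" using hat_mult[OF p p'] ne by simp
    have "hat m q = (star (y p q) * y p q) * (star (y p' q) * y p' q)" using cl(1)[OF w(1)] cl(1)[OF w(2)] hs(2)[OF q] by simp
    also have "\<dots> = star (y p q) * (y p q * star (y p' q)) * y p' q" by (simp add: mult.assoc)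
    finally have "hat m q = 0" using 0 by simp
    then show False using WP(3)[OF w(1)] by (simp add: y_def)
  qed
  define w where "w = (\<Sum>(p, q)\<in>W. u p q)"
  have wG: "w \<in> generated_cstar (A m)"
    unfolding w_def using uG by (intro subalgebra_sum[OF generated_subalgebra]) auto
  have expR: "V = (\<Sum>q\<in>P. V * hat m q)" using normalises_expand_right[OF V b] by (simp add: hat_unit sum_distrib_left)
  have expL: "V = (\<Sum>p\<in>P. hat m p * V)" using normalises_expand_left[OF V b] by (simp add: hat_unit sum_distrib_right)
  have "V = (\<Sum>p\<in>P. hat m p) * V * (\<Sum>q\<in>P. hat m q)"
    using normalises_expand_left[OF V b] normalises_expand_right[OF V b] by (simp add: hat_unit)
  also have "\<dots> = (\<Sum>p\<in>P. \<Sum>q\<in>P. y p q)"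
    by (simp add: sum_distrib_left sum_distrib_right y_def) (rule sum.swap)
  also have "\<dots> = (\<Sum>(p, q)\<in>P \<times> P. y p q)" by (rule sum.cartesian_product)
  also have "\<dots> = (\<Sum>(p, q)\<in>W. y p q)"
    by (rule sum.mono_neutral_right) (use fin in \<open>auto simp: W_def\<close>)
  finally have VW: "V = (\<Sum>(p, q)\<in>W. y p q)" .
  have hw: "hat m w = (\<Sum>(p, q)\<in>W. hat m (u p q))"
    unfolding w_def using star_hom_sum[OF hat_hom generated_subalgebra, of W "\<lambda>(p, q). u p q"] uG
    by (auto simp: case_prod_beta' split: prod.splits)
  define z where "z = (\<lambda>(p, q). y p q - hat m (u p q))"
  have zpq: "hat m p * z (p, q) = z (p, q)" "z (p, q) * hat m q = z (p, q)" if w: "(p, q) \<in> W" for p q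
  proof -
    have "hat m p * hat m (u p q) = hat m (u p q)" "hat m (u p q) * hat m q = hat m (u p q)"
      using hatD(2)[OF P_gen[OF WP(1)[OF w]] uG[OF w]] hatD(2)[OF uG[OF w] P_gen[OF WP(2)[OF w]]] pu[OF w] by simp_all
    moreover have "hat m p * y p q = y p q" "y p q * hat m q = y p q"
      using hs(2)[OF WP(1)[OF w]] hs(2)[OF WP(2)[OF w]] by (simp_all add: y_def mult.assoc) (simp flip: mult.assoc)
    ultimately show "hat m p * z (p, q) = z (p, q)" "z (p, q) * hat m q = z (p, q)"
      by (simp_all add: z_def right_diff_distrib left_diff_distrib)
  qed
  have "V - hat m w = sum z W" unfolding VW hw z_def by (simp add: sum_subtractf case_prod_beta')
  \<comment> \<open>Since \<open>W\<close> is a partial bijection, the errors have orthogonal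
    sources and ranges, and the bound does not grow with the number of entries.\<close>
  also have "norm \<dots> \<le> 2 * \<delta>"
  proof (rule norm_orthogonal_sum_le)
    fix i j assume ij: "i \<in> W" "j \<in> W" "i \<noteq> j"
    obtain p q p' q' where i: "i = (p, q)" and j: "j = (p', q')" by (cases i, cases j) auto
    note wi = ij(1)[unfolded i] and wj = ij(2)[unfolded j]
    have ne: "p \<noteq> p'" "q \<noteq> q'" using ij(3) right_unique[OF wi] left_unique[OF wi] wj by (auto simp: i j)
    have "star (z i) * z j = star (z i) * (hat m p * hat m p') * z j"
      using zpq(1)[OF wi] zpq(1)[OF wj] hs(1)[OF WP(1)[OF wi]] unfolding i j by (metis mult.assoc star_mult)
    then show "star (z i) * z j = 0" using hat_mult[OF WP(1)[OF wi] WP(1)[OF wj]] ne by simp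
    have "z i * star (z j) = z i * (hat m q * hat m q') * star (z j)"
      using zpq(2)[OF wi] zpq(2)[OF wj] hs(1)[OF WP(2)[OF wj]] unfolding i j by (metis mult.assoc star_mult)
    then show "z i * star (z j) = 0" using hat_mult[OF WP(2)[OF wi] WP(2)[OF wj]] ne by simp
  qed (use yu \<delta>0 in \<open>auto simp: z_def\<close>)
  finally have close: "norm (V - hat m w) \<le> 2 * \<delta>" .
  have wr: "w * r = (\<Sum>i\<in>W. (case i of (p, q) \<Rightarrow> if r = q then u p q else 0))" if r: "r \<in> P" for r
  proof -
    have "w * r = (\<Sum>i\<in>W. (case i of (p, q) \<Rightarrow> u p q) * r)" by (simp only: w_def sum_distrib_right)
    also have "\<dots> = (\<Sum>i\<in>W. (case i of (p, q) \<Rightarrow> if r = q then u p q else 0))"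
    proof (intro sum.cong refl)
      fix i assume i: "i \<in> W"
      obtain p q where pq: "i = (p, q)" by (cases i)
      show "(case i of (p, q) \<Rightarrow> u p q) * r = (case i of (p, q) \<Rightarrow> if r = q then u p q else 0)"
        using pu'(2)[OF i[unfolded pq] r] by (simp add: pq)
    qed
    finally show ?thesis .
  qed
  have rw: "r * w = (\<Sum>i\<in>W. (case i of (p, q) \<Rightarrow> if r = p then u p q else 0))" if r: "r \<in> P" for r
  proof -
    have "r * w = (\<Sum>i\<in>W. r * (case i of (p, q) \<Rightarrow> u p q))" by (simp only: w_def sum_distrib_left)
    also have "\<dots> = (\<Sum>i\<in>W. (case i of (p, q) \<Rightarrow> if r = p then u p q else 0))"
    proof (intro sum.cong refl)
      fix i assume i: "i \<in> W"
      obtain p q where pq: "i = (p, q)" by (cases i)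
      show "r * (case i of (p, q) \<Rightarrow> u p q) = (case i of (p, q) \<Rightarrow> if r = p then u p q else 0)"
        using pu'(1)[OF i[unfolded pq] r] by (simp add: pq)
    qed
    finally show ?thesis .
  qed
  have wq: "w * q = u p q" if pq: "(p, q) \<in> W" for p q
  proof -
    have "w * q = (\<Sum>i\<in>W. if i = (p, q) then u p q else 0)"
      unfolding wr[OF WP(2)[OF pq]]
    proof (intro sum.cong refl)
      fix i assume i: "i \<in> W"
      obtain p' q' where e: "i = (p', q')" by (cases i)
      show "(case i of (p, q') \<Rightarrow> if q = q' then u p q' else 0) = (if i = (p, q) then u p q else 0)"
        using left_unique[OF pq, of p'] i by (auto simp: e)
    qed
    also have "\<dots> = u p q" using finW pq by simp
    finally show ?thesis .
  qed
  have pw: "p * w = u p q" if pq: "(p, q) \<in> W" for p q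
  proof -
    have "p * w = (\<Sum>i\<in>W. if i = (p, q) then u p q else 0)"
      unfolding rw[OF WP(1)[OF pq]]
    proof (intro sum.cong refl)
      fix i assume i: "i \<in> W"
      obtain p' q' where e: "i = (p', q')" by (cases i)
      show "(case i of (p', q) \<Rightarrow> if p = p' then u p' q else 0) = (if i = (p, q) then u p q else 0)"
        using right_unique[OF pq, of q'] i by (auto simp: e)
    qed
    also have "\<dots> = u p q" using finW pq by simp
    finally show ?thesis .
  qed
  have Vq: "\<exists>p. (p, q) \<in> W" if q: "q \<in> P" "V * hat m q \<noteq> 0" for q
  proof (rule ccontr)
    assume "\<not> ?thesis"
    then have "(\<Sum>p\<in>P. hat m p * V * hat m q) = 0" using q(1) by (auto simp: W_def y_def intro!: sum.neutral)
    then have "V * hat m q = 0" using expL by (metis sum_distrib_right)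
    then show False using q(2) by simp
  qed
  have pV: "\<exists>q. (p, q) \<in> W" if p: "p \<in> P" "hat m p * V \<noteq> 0" for p
  proof (rule ccontr)
    assume "\<not> ?thesis"
    then have "(\<Sum>q\<in>P. hat m p * (V * hat m q)) = 0" using p(1) by (auto simp: W_def y_def mult.assoc intro!: sum.neutral)
    then have "hat m p * V = 0" using expR by (metis sum_distrib_left)
    then show False using p(2) by simp
  qed
  have Wq: "V * hat m q \<noteq> 0" if "(p, q) \<in> W" for p q using WP(3)[OF that] by (auto simp: y_def mult.assoc)
  have wq0: "w * q = 0" if q: "q \<in> P" "V * hat m q = 0" for q
    unfolding wr[OF q(1)] using Wq q(2) by (intro sum.neutral) (auto split: prod.splits)
  have pw0: "p * w = 0" if p: "p \<in> P" "hat m p * V = 0" for p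
    unfolding rw[OF p(1)] using p(2) by (intro sum.neutral) (auto simp: W_def y_def split: prod.splits)
  have unit_w: "w = (\<Sum>q\<in>P. w * q)" using digraph_unit(2)[OF dig msa wG] by (simp add: sum_distrib_left)
  have ww: "star w * w = \<Sum>{q\<in>P. V * hat m q \<noteq> 0}"
  proof -
    have "star w * w * q = (if V * hat m q \<noteq> 0 then q else 0)" if q: "q \<in> P" for q
    proof (cases "V * hat m q = 0")
      case True
      then show ?thesis using wq0[OF q] by (simp add: mult.assoc)
    next
      case False
      then obtain p where pq: "(p, q) \<in> W" using Vq[OF q] by blast
      have "star w * w * q = star w * u p q" using wq[OF pq] by (simp add: mult.assoc)
      also have "\<dots> = star (p * w) * u p q"
        using pu(1)[OF pq] Ps(1)[OF WP(1)[OF pq]] by (metis mult.assoc star_mult)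
      also have "\<dots> = q" using pw[OF pq] uu[OF pq] by simp
      finally show ?thesis using False by simp
    qed
    then have "(\<Sum>q\<in>P. star w * w * q) = (\<Sum>q\<in>P. if V * hat m q \<noteq> 0 then q else 0)" by (intro sum.cong refl)
    moreover have "star w * w = (\<Sum>q\<in>P. star w * w * q)" using unit_w by (metis (no_types, lifting) mult.assoc sum.cong sum_distrib_left)
    ultimately show ?thesis using fin by (simp add: sum.inter_filter)
  qed
  have wqw: "w * q * star w = p" if pq: "(p, q) \<in> W" for p q
  proof -
    have "w * q * star w = u p q * star (w * q)"
      using wq[OF pq] pu(2)[OF pq] Ps(1)[OF WP(2)[OF pq]] by (metis mult.assoc star_mult)
    then show ?thesis using wq[OF pq] uu[OF pq] by simp
  qed
  \<comment> \<open>The entry has range projection exactly \<open>hat m p\<close>, which therefore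
    lies below \<open>V * star V\<close>. Later this makes the \<open>w e\<close> of different atoms
    exactly orthogonal.\<close>
  have range: "hat m p * (V * star V) = hat m p" if pq: "(p, q) \<in> W" for p q
  proof -
    note p = WP(1)[OF pq] and q = WP(2)[OF pq]
    have e: "hat m p = hat m p * V * hat m q * star V * hat m p"
      using cl(5)[OF pq] hs[OF p] hs[OF q] unfolding y_def by (simp add: star_mult mult.assoc) (metis mult.assoc)
    have VV: "star V * (V * star V) = star V" using V by (simp add: normalises_def) (metis star_mult star_star mult.assoc)
    have c: "hat m p * (V * star V) = V * star V * hat m p" by (rule LC_commute[OF hat_LC[OF p] VL(3)[OF p]])
    have "hat m p * (V * star V) = hat m p * V * hat m q * star V * (hat m p * (V * star V))"
      using e by (metis mult.assoc)
    also have "\<dots> = hat m p * V * hat m q * star V * (V * star V * hat m p)" by (simp only: c)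
    also have "\<dots> = hat m p * V * hat m q * star V * hat m p" using VV by (metis mult.assoc)
    finally show ?thesis using e by simp
  qed
  have fin_p: "hat m p * (V * star V) = hat m p \<and> (\<exists>q\<in>P. V * hat m q \<noteq> 0 \<and> p * w = w * q \<and> w * q * star w = p)"
    if p: "p \<in> P" "hat m p * V \<noteq> 0" for p
  proof -
    obtain q where pq: "(p, q) \<in> W" using pV[OF p] by blast
    then show ?thesis
      using range[OF pq] Wq[OF pq] WP(2)[OF pq] pw[OF pq] wq[OF pq] wqw[OF pq] by auto
  qed
  have "w * q * star w \<in> P" if q: "q \<in> P" "V * hat m q \<noteq> 0" for q
    using Vq[OF q] wqw WP(1) by metis
  then show ?thesis using wG close ww wq0 pw0 fin_p by blast
qed

end

end

section \<open>Regular maps near a homomorphism into the limit\<close>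

lemma matrix_unit_norm_le:
  assumes "digraph_algebra A" "masa C A" "e \<in> atoms C" shows "norm (matrix_unit A C e) \<le> 1"
  by (rule norm_le_1_if_projection)
    (simp add: matrix_unit(4)[OF assms] atoms_projection[OF root_atom(1)[OF assms]])

lemma coeff_norm_le:
  assumes A: "digraph_algebra A" "masa C A" and ef: "e \<in> atoms C" "f \<in> atoms C" and x: "x \<in> generated_cstar A"
  shows "cmod (matrix_coeff A C x e f) \<le> norm x"
proof -
  let ?u = "matrix_unit A C"
  note r = root_atom(1)[OF A ef(1)]
  have "cmod (matrix_coeff A C x e f) = norm (star (?u e) * x * ?u f)"
    using coeff(1)[OF A x ef] norm_projection[OF atoms_projection[OF r] atoms_nonzero[OF r]] by (simp add: norm_scaleC)
  also have "\<dots> \<le> norm (?u e) * norm x * norm (?u f)"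
    by (intro order_trans[OF norm_mult_ineq] mult_right_mono) (simp_all add: norm_mult_ineq[of "star (?u e)", simplified])
  also have "\<dots> \<le> 1 * norm x * 1"
    using matrix_unit_norm_le[OF A ef(1)] matrix_unit_norm_le[OF A ef(2)] by (intro mult_mono) auto
  finally show ?thesis by simp
qed

context standard_system
begin

text \<open>Each matrix unit goes to a normaliser \<open>V e\<close>, which
  \<open>approximate_normaliser\<close> replaces by some \<open>w e\<close> at a common level
  \<open>m\<close>. The \<open>w e\<close> satisfy the relations of a column of matrix units
  exactly, because their sources and ranges are determined by exact conditions on
  \<open>V e\<close>. Cutting by an atom \<open>q\<close> of \<open>C m\<close> leaves
  \<open>w e * q\<close>, zero or a partial isometry between atoms, so every
  \<open>\<gamma> q\<close> has multiplicity one.\<close>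

lemma near_regular:
  fixes T :: "'a \<Rightarrow> 'a seq_algebra"
  assumes A0: "digraph_algebra A0" and C0: "masa C0 A0" and T: "star_hom T (generated_cstar A0) LG"
    and TA: "\<And>a. a \<in> A0 \<Longrightarrow> T a \<in> closed_limit A \<phi>"
    and TN: "\<And>e. e \<in> atoms C0 \<Longrightarrow> normalises (T (matrix_unit A0 C0 e))" and \<epsilon>: "\<epsilon> > 0"
  shows "\<exists>m \<gamma>. regular_family_on (atoms (C m)) \<gamma> A0 (A m) \<and>
    (\<forall>x\<in>generated_cstar A0. norm (T x - hat m (\<Sum>q\<in>atoms (C m). \<gamma> q x)) \<le> \<epsilon> * norm x)"
proof -
  let ?Q = "atoms C0" and ?u = "matrix_unit A0 C0" and ?r = "root A0 C0" and ?c = "matrix_coeff A0 C0"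
  note fin0 = digraph_atoms_finite[OF A0 C0] and TD = star_homD[OF T] and AC = A0 C0
  define K where "K = real (card ?Q)"
  \<comment> \<open>\<open>1/16\<close> keeps \<open>\<delta>\<close> below the threshold
    \<open>1/8\<close> and \<open>4 \<delta> + \<delta>\<close> below 1. The other term spreads
    \<open>\<epsilon>\<close> over the \<open>K * K\<close> pairs of atoms, each contributing an
    error of \<open>4 \<delta>\<close>.\<close>
  define \<delta> where "\<delta> = min (1/16) (\<epsilon> / (4 * (K * K) + 1))"
  have KK: "0 \<le> K * K" "4 * (K * K) + 1 > 0" by (simp_all add: K_def add_nonneg_pos)
  have \<delta>: "0 < \<delta>" "\<delta> \<le> 1/16" using \<epsilon> KK(2) unfolding \<delta>_def by simp (rule min.cobounded1)
  have "\<delta> * (4 * (K * K) + 1) \<le> \<epsilon>"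
  proof -
    have "\<delta> \<le> \<epsilon> / (4 * (K * K) + 1)" by (simp add: \<delta>_def)
    then show ?thesis using KK(2) by (simp add: pos_le_divide_eq)
  qed
  then have \<delta>K: "4 * \<delta> * (K * K) \<le> \<epsilon>" using \<delta> by (simp add: algebra_simps)
  define V where "V e = T (?u e)" for e
  note mu = matrix_unit[OF AC] and smu = star_matrix_unit[OF AC]
  have VLG: "V e \<in> LG" if "e \<in> ?Q" for e using TN[OF that] by (simp add: normalises_def V_def)
  have ev1: "\<forall>\<^sub>F m in sequentially. \<forall>e\<in>?Q. \<exists>b\<in>generated_cstar (A m). norm (V e - hat m b) < \<delta>"
  proof (rule eventually_ball_finite[OF fin0], rule ballI)
    fix e assume "e \<in> ?Q"
    from cs.closed_limit_approx[OF cs.subsystem_self VLG[OF this] \<delta>(1)]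
    show "\<forall>\<^sub>F m in sequentially. \<exists>b\<in>generated_cstar (A m). norm (V e - hat m b) < \<delta>"
      unfolding eventually_sequentially .
  qed
  have ev2: "\<forall>\<^sub>F m in sequentially. \<forall>i\<in>?Q \<times> ?Q. ?u (fst i) * star (?u (snd i)) \<in> A0 \<longrightarrow>
      (\<exists>b\<in>A m. norm (T (?u (fst i) * star (?u (snd i))) - hat m b) < \<delta>)"
  proof (rule eventually_ball_finite, use fin0 in simp, rule ballI)
    fix i
    show "\<forall>\<^sub>F m in sequentially. ?u (fst i) * star (?u (snd i)) \<in> A0 \<longrightarrow>
      (\<exists>b\<in>A m. norm (T (?u (fst i) * star (?u (snd i))) - hat m b) < \<delta>)"
    proof (cases "?u (fst i) * star (?u (snd i)) \<in> A0")
      case True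
      from cs.closed_limit_approx[OF subsystem_A TA[OF True] \<delta>(1)]
      have "\<forall>\<^sub>F m in sequentially. \<exists>b\<in>A m. norm (T (?u (fst i) * star (?u (snd i))) - hat m b) < \<delta>"
        unfolding eventually_sequentially .
      then show ?thesis by (rule eventually_mono) simp
    qed simp
  qed
  obtain m where m1: "\<forall>e\<in>?Q. \<exists>b\<in>generated_cstar (A m). norm (V e - hat m b) < \<delta>"
    and m2: "\<forall>i\<in>?Q \<times> ?Q. ?u (fst i) * star (?u (snd i)) \<in> A0 \<longrightarrow>
      (\<exists>b\<in>A m. norm (T (?u (fst i) * star (?u (snd i))) - hat m b) < \<delta>)"
    using eventually_happens'[OF sequentially_bot eventually_conj[OF ev1 ev2]] by blast
  let ?P = "atoms (C m)" and ?G = "generated_cstar (A m)"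
  note Gsub = generated_subalgebra[of "A m"] and fin = digraph_atoms_finite[OF dig[of m] msa[of m]]
  have "\<forall>e\<in>?Q. \<exists>w. w \<in> ?G \<and> norm (V e - hat m w) \<le> 2 * \<delta> \<and>
    star w * w = \<Sum>{q\<in>?P. V e * hat m q \<noteq> 0} \<and>
    (\<forall>q\<in>?P. V e * hat m q = 0 \<longrightarrow> w * q = 0) \<and> (\<forall>q\<in>?P. V e * hat m q \<noteq> 0 \<longrightarrow> w * q * star w \<in> ?P) \<and>
    (\<forall>p\<in>?P. hat m p * V e = 0 \<longrightarrow> p * w = 0) \<and>
    (\<forall>p\<in>?P. hat m p * V e \<noteq> 0 \<longrightarrow> hat m p * (V e * star (V e)) = hat m p \<and>
       (\<exists>q\<in>?P. V e * hat m q \<noteq> 0 \<and> p * w = w * q \<and> w * q * star w = p))"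
  proof
    fix e assume e: "e \<in> ?Q"
    from bspec[OF m1 e] obtain b where b: "b \<in> ?G" "norm (V e - hat m b) < \<delta>" ..
    have "normalises (V e)" using TN[OF e] by (simp add: V_def)
    from approximate_normaliser[OF this b(1) less_imp_le[OF b(2)]] \<delta>(2)
    show "\<exists>w. w \<in> ?G \<and> norm (V e - hat m w) \<le> 2 * \<delta> \<and>
      star w * w = \<Sum>{q\<in>?P. V e * hat m q \<noteq> 0} \<and>
      (\<forall>q\<in>?P. V e * hat m q = 0 \<longrightarrow> w * q = 0) \<and> (\<forall>q\<in>?P. V e * hat m q \<noteq> 0 \<longrightarrow> w * q * star w \<in> ?P) \<and>
      (\<forall>p\<in>?P. hat m p * V e = 0 \<longrightarrow> p * w = 0) \<and>
      (\<forall>p\<in>?P. hat m p * V e \<noteq> 0 \<longrightarrow> hat m p * (V e * star (V e)) = hat m p \<and>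
         (\<exists>q\<in>?P. V e * hat m q \<noteq> 0 \<and> p * w = w * q \<and> w * q * star w = p))"
      unfolding Bex_def by simp
  qed
  from bchoice[OF this] obtain w where w0: "\<forall>e\<in>?Q. w e \<in> ?G \<and> norm (V e - hat m (w e)) \<le> 2 * \<delta> \<and>
    star (w e) * w e = \<Sum>{q\<in>?P. V e * hat m q \<noteq> 0} \<and>
    (\<forall>q\<in>?P. V e * hat m q = 0 \<longrightarrow> w e * q = 0) \<and> (\<forall>q\<in>?P. V e * hat m q \<noteq> 0 \<longrightarrow> w e * q * star (w e) \<in> ?P) \<and>
    (\<forall>p\<in>?P. hat m p * V e = 0 \<longrightarrow> p * w e = 0) \<and>
    (\<forall>p\<in>?P. hat m p * V e \<noteq> 0 \<longrightarrow> hat m p * (V e * star (V e)) = hat m p \<and>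
       (\<exists>q\<in>?P. V e * hat m q \<noteq> 0 \<and> p * w e = w e * q \<and> w e * q * star (w e) = p))" ..
  have wG: "w e \<in> ?G" and wV: "norm (V e - hat m (w e)) \<le> 2 * \<delta>"
    and ww: "star (w e) * w e = \<Sum>{q\<in>?P. V e * hat m q \<noteq> 0}" if "e \<in> ?Q" for e
    using w0 that by simp_all
  have wq0: "w e * q = 0" if "e \<in> ?Q" "q \<in> ?P" "V e * hat m q = 0" for e q using w0 that by simp
  have wqw: "w e * q * star (w e) \<in> ?P" if "e \<in> ?Q" "q \<in> ?P" "V e * hat m q \<noteq> 0" for e q using w0 that by simp
  have pw0: "p * w e = 0" if "e \<in> ?Q" "p \<in> ?P" "hat m p * V e = 0" for e p using w0 that by simp
  have pw: "hat m p * (V e * star (V e)) = hat m p"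
    "\<exists>q\<in>?P. V e * hat m q \<noteq> 0 \<and> p * w e = w e * q \<and> w e * q * star (w e) = p"
    if "e \<in> ?Q" "p \<in> ?P" "hat m p * V e \<noteq> 0" for e p using w0 that by simp_all
  note Pm = digraph_atoms_mult[OF dig[of m] msa[of m]] and hD = star_homD(2-5)[OF cs.limit_element_hom[of m]]
  have Ps: "star p = p" "p * p = p" if "p \<in> ?P" for p using projectionD[OF atoms_projection[OF that]] by auto
  have PG: "p \<in> ?G" if "p \<in> ?P" for p by (rule P_gen[OF that])
  have swG: "star (w e) \<in> ?G" if "e \<in> ?Q" for e by (rule star_subalgebra_star[OF generated_star_subalgebra wG[OF that]])
  have VsV: "star (V e) * V e = T (?r e)" "V e * star (V e) = T e" if e: "e \<in> ?Q" for e
    using TD(3)[OF smu(1)[OF e] mu(1)[OF e]] TD(3)[OF mu(1)[OF e] smu(1)[OF e]] TD(5)[OF mu(1)[OF e]] mu(4,5)[OF e]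
    by (simp_all add: V_def)
  \<comment> \<open>Since \<open>star (V e) * V e = T (?r e)\<close>, the source of
    \<open>w e\<close> depends only on the root of \<open>e\<close>; \<open>dom\<close> lists the
    atoms below it.\<close>
  define dom where "dom r = {q\<in>?P. T r * hat m q \<noteq> 0}" for r
  have dom: "V e * hat m q \<noteq> 0 \<longleftrightarrow> q \<in> dom (?r e)" if e: "e \<in> ?Q" and q: "q \<in> ?P" for e q
  proof -
    have "V e * hat m q = 0" if "T (?r e) * hat m q = 0"
    proof -
      have "star (V e * hat m q) * (V e * hat m q) = star (hat m q) * (T (?r e) * hat m q)"
        using VsV(1)[OF e] by (simp add: star_mult mult.assoc) (metis mult.assoc)
      then show ?thesis using that by simp
    qed
    moreover have "T (?r e) * hat m q = 0" if "V e * hat m q = 0"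
      using VsV(1)[OF e] that by (metis mult.assoc mult_zero_right)
    ultimately show ?thesis using q by (auto simp: dom_def)
  qed
  have dP: "dom r \<subseteq> ?P" "finite (dom r)" for r using fin by (auto simp: dom_def)
  have wwd: "star (w e) * w e = \<Sum>(dom (?r e))" if e: "e \<in> ?Q" for e
    unfolding ww[OF e] using dom[OF e] dP(1) by (intro arg_cong[where f = "\<lambda>S. \<Sum>S"]) (auto simp: subset_iff)
  have sdq: "\<Sum>(dom r) * q = (if q \<in> dom r then q else 0)" "q * \<Sum>(dom r) = (if q \<in> dom r then q else 0)" if q: "q \<in> ?P" for r q
  proof -
    have "\<Sum>(dom r) * q = (\<Sum>p\<in>dom r. if p = q then q else 0)"
      unfolding sum_distrib_right using Pm[OF _ q] dP(1) by (intro sum.cong refl) (metis subsetD)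
    then show "\<Sum>(dom r) * q = (if q \<in> dom r then q else 0)" using dP(2) by simp
    have "q * \<Sum>(dom r) = (\<Sum>p\<in>dom r. if p = q then q else 0)"
      unfolding sum_distrib_left using Pm[OF q] dP(1) by (intro sum.cong refl) (metis subsetD)
    then show "q * \<Sum>(dom r) = (if q \<in> dom r then q else 0)" using dP(2) by simp
  qed
  have wq0': "w e * q = 0" if "e \<in> ?Q" "q \<in> ?P" "q \<notin> dom (?r e)" for e q
    using wq0[OF that(1,2)] dom[OF that(1,2)] that(3) by blast
  \<comment> \<open>If \<open>p * w e\<close> is nonzero, then \<open>hat m p\<close> lies below
    \<open>V e * star (V e) = T e\<close>. The projections \<open>T e\<close> and \<open>T f\<close>
    are orthogonal, so no atom \<open>p\<close> serves both.\<close>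
  have ort: "star (w e) * w f = 0" if e: "e \<in> ?Q" and f: "f \<in> ?Q" and ef: "e \<noteq> f" for e f
  proof -
    have "star (w e) * w f = star (w e) * (\<Sum>p\<in>?P. p) * w f"
      using digraph_unit(1)[OF dig msa wG[OF f]] by (simp add: mult.assoc)
    also have "\<dots> = (\<Sum>p\<in>?P. star (w e) * p * w f)" by (simp add: sum_distrib_left sum_distrib_right)
    also have "\<dots> = (\<Sum>p\<in>?P. star (p * w e) * (p * w f))"
      using Ps by (intro sum.cong refl) (simp add: star_mult mult.assoc, metis mult.assoc)
    also have "\<dots> = 0"
    proof (rule sum.neutral, rule ballI)
      fix p assume p: "p \<in> ?P"
      have "p * w e = 0 \<or> p * w f = 0"
      proof (rule ccontr)
        assume "\<not> ?thesis"
        then have "hat m p * V e \<noteq> 0" "hat m p * V f \<noteq> 0" using pw0[OF e p] pw0[OF f p] by auto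
        then have "hat m p * T e = hat m p" "hat m p * T f = hat m p" and n0: "hat m p \<noteq> 0"
          using pw(1)[OF e p] pw(1)[OF f p] VsV(2)[OF e] VsV(2)[OF f] by auto
        then have "hat m p = hat m p * (T e * T f)" by (metis mult.assoc)
        also have "T e * T f = T (e * f)"
          using TD(3) minimal_inD(1)[OF digraph_atoms_minimal[OF AC]] e f by metis
        also have "e * f = 0" using digraph_atoms_mult[OF AC e f] ef by simp
        finally show False using n0 star_hom_zero[OF T generated_subalgebra] by simp
      qed
      then show "star (p * w e) * (p * w f) = 0" by auto
    qed
    finally show ?thesis .
  qed
  have hw1: "norm (hat m (w e)) \<le> 1" if e: "e \<in> ?Q" for e
  proof -
    have "norm (w e) \<le> 1"
      by (rule norm_le_1_if_projection) (use wwd[OF e] sum_atoms_projection[OF masaD(2)[OF msa] dP(1)] in simp)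
    then show ?thesis using cs.limit_element_norm[OF wG[OF e]] by simp
  qed
  have nV: "norm (V e) \<le> 1" if e: "e \<in> ?Q" for e
    using star_hom_contractive[OF generated_star_subalgebra digraph_generated_fd[OF A0] T mu(1)[OF e]]
      matrix_unit_norm_le[OF AC e] by (simp add: V_def)
  have VV: "norm (V e * star (V f) - hat m (w e * star (w f))) \<le> 4 * \<delta>" if e: "e \<in> ?Q" and f: "f \<in> ?Q" for e f
  proof -
    have "hat m (w e * star (w f)) = hat m (w e) * star (hat m (w f))"
      using hD(2)[OF wG[OF e] swG[OF f]] hD(4)[OF wG[OF f]] by simp
    then have "V e * star (V f) - hat m (w e * star (w f)) =
        (V e - hat m (w e)) * star (V f) + hat m (w e) * star (V f - hat m (w f))"
      by (simp add: left_diff_distrib right_diff_distrib star_diff)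
    also have "norm \<dots> \<le> norm (V e - hat m (w e)) * norm (V f) + norm (hat m (w e)) * norm (V f - hat m (w f))"
      by (intro order_trans[OF norm_triangle_ineq] add_mono order_trans[OF norm_mult_ineq]) simp_all
    also have "\<dots> \<le> (2 * \<delta>) * 1 + 1 * (2 * \<delta>)"
      using wV[OF e] wV[OF f] nV[OF f] hw1[OF e] \<delta>(1) by (intro add_mono mult_mono) auto
    finally show ?thesis by simp
  qed
  define \<gamma> where "\<gamma> q = unit_map A0 C0 (\<lambda>e. w e * q)" for q
  have hom: "star_hom (\<gamma> q) (generated_cstar A0) ?G" if q: "q \<in> ?P" for q
    unfolding \<gamma>_def
  proof (rule unit_map_star_hom[OF AC generated_star_subalgebra, where R = "\<lambda>r. if q \<in> dom r then q else 0"])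
    fix e assume e: "e \<in> ?Q"
    show "w e * q \<in> ?G" using wG[OF e] PG[OF q] by (rule subalgebra_mult[OF Gsub])
    have "star (w e * q) * (w e * q) = q * (star (w e) * w e) * q" using Ps[OF q] by (simp add: star_mult mult.assoc)
    then show "star (w e * q) * (w e * q) = (if q \<in> dom (?r e) then q else 0)"
      using wwd[OF e] sdq[OF q] Ps[OF q] by auto
    show "w e * q * (if q \<in> dom (?r e) then q else 0) = w e * q"
      using wq0'[OF e q] Ps(2)[OF q] by (auto simp: mult.assoc)
    fix f assume f: "f \<in> ?Q" and ef: "e \<noteq> f"
    have "star (w e * q) * (w f * q) = star q * (star (w e) * w f) * q" by (simp add: star_mult mult.assoc)
    then show "star (w e * q) * (w f * q) = 0" using ort[OF e f ef] by simp
  qed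
  \<comment> \<open>The step that lands in \<open>A m\<close> rather than in its generated algebra.
    A nonzero entry \<open>p Z p'\<close> has norm 1 in the limit, and some \<open>b\<close> in
    \<open>A m\<close> is within \<open>5 \<delta> < 1\<close> of \<open>Z\<close> there; so
    \<open>p b p'\<close> is nonzero, and the entry of \<open>Z\<close> is a multiple of it because
    corners are lines.\<close>
  have wewf: "w e * star (w f) \<in> A m" if e: "e \<in> ?Q" and f: "f \<in> ?Q" and r: "?u e * star (?u f) \<in> A0" for e f
  proof -
    note sub = digraph_subalgebra[OF dig[of m]]
    define Z where "Z = w e * star (w f)"
    have ZG: "Z \<in> ?G" using wG[OF e] swG[OF f] by (simp add: Z_def subalgebra_mult[OF Gsub])
    obtain b where b: "b \<in> A m" "norm (T (?u e * star (?u f)) - hat m b) < \<delta>" using m2 e f r by auto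
    have bG: "b \<in> ?G" by (rule subsetD[OF generated_superset b(1)])
    have Tef: "T (?u e * star (?u f)) = V e * star (V f)"
      using TD(3)[OF mu(1)[OF e] smu(1)[OF f]] TD(5)[OF mu(1)[OF f]] by (simp add: V_def)
    have "p * Z * p' \<in> A m" if p: "p \<in> ?P" and p': "p' \<in> ?P" for p p'
    proof (cases "p * Z * p' = 0")
      case False
      have pZ: "p * Z * p' = (p * w e) * star (p' * w f)" using Ps[OF p'] by (simp add: Z_def star_mult mult.assoc)
      then have ne: "p * w e \<noteq> 0" "p' * w f \<noteq> 0" using False by auto
      then have hV: "hat m p * V e \<noteq> 0" "hat m p' * V f \<noteq> 0" using pw0[OF e p] pw0[OF f p'] by auto
      obtain q where q: "q \<in> ?P" "V e * hat m q \<noteq> 0" "p * w e = w e * q" "w e * q * star (w e) = p"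
        using pw(2)[OF e p hV(1)] by blast
      obtain q' where q': "q' \<in> ?P" "V f * hat m q' \<noteq> 0" "p' * w f = w f * q'" "w f * q' * star (w f) = p'"
        using pw(2)[OF f p' hV(2)] by blast
      have X: "p * Z * p' = w e * (q * q') * star (w f)"
        using pZ q(3) q'(3) Ps[OF q'(1)] by (simp add: star_mult mult.assoc)
      then have qq: "q = q'" using Pm[OF q(1) q'(1)] False by (cases "q = q'") auto
      have X: "p * Z * p' = w e * q * star (w f)" using X qq Ps(2)[OF q(1)] by simp
      have "(p * Z * p') * star (p * Z * p') = w e * (q * (star (w f) * w f) * q) * star (w e)"
        unfolding X using Ps[OF q(1)] by (simp add: star_mult mult.assoc)
      also have "q * (star (w f) * w f) * q = q"
        using wwd[OF f] sdq(2)[OF q(1)] dom[OF f q(1)] q'(2) qq Ps(2)[OF q(1)] by simp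
      finally have XX: "(p * Z * p') * star (p * Z * p') = p" using q(4) by simp
      define Y where "Y = p * Z * p'"
      have YG: "Y \<in> ?G" using ZG PG[OF p] PG[OF p'] by (simp add: Y_def subalgebra_mult[OF Gsub])
      have "hat m Y * star (hat m Y) = hat m p"
        using XX hD(2)[OF YG star_subalgebra_star[OF generated_star_subalgebra YG]] hD(4)[OF YG] by (simp add: Y_def)
      moreover have "norm (hat m p) = 1"
        by (rule norm_projection[OF hat_projection[OF p]]) (use hV(1) in auto)
      ultimately have nY: "(norm (hat m Y))\<^sup>2 = 1" using cstar_identity'[of "hat m Y"] by simp
      have "norm (hat m Z - hat m b) \<le> norm (V e * star (V f) - hat m Z) + norm (V e * star (V f) - hat m b)"
        using norm_triangle_ineq4[of "V e * star (V f) - hat m b" "V e * star (V f) - hat m Z"] by simp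
      also have "\<dots> < 4 * \<delta> + \<delta>" using VV[OF e f] b(2) Tef by (simp add: Z_def)
      finally have nZb: "norm (hat m Z - hat m b) < 1" using \<delta>(2) by simp
      have "p * b * p' \<noteq> 0"
      proof
        assume z: "p * b * p' = 0"
        have e3: "hat m (p * x * p') = hat m p * hat m x * hat m p'" if "x \<in> ?G" for x
          using hD(2) that PG[OF p] PG[OF p'] by (simp add: subalgebra_mult[OF Gsub])
        have "hat m Y = hat m p * (hat m Z - hat m b) * hat m p'"
          using e3[OF ZG] e3[OF bG] z star_hom_zero[OF cs.limit_element_hom Gsub]
          by (simp add: Y_def right_diff_distrib left_diff_distrib)
        then have "norm (hat m Y) < 1"
          using norm_projection_mult_le[OF hat_projection[OF p] hat_projection[OF p'], of "hat m Z - hat m b"] nZb by simp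
        then have "(norm (hat m Y))\<^sup>2 < 1" by (simp add: power_less_one_iff)
        then show False using nY by simp
      qed
      from digraph_line[OF dig msa p p' ZG bG this] obtain c where "p * Z * p' = c *\<^sub>C (p * b * p')" by blast
      moreover have "p * b * p' \<in> A m"
        using b(1) digraph_atoms_mem[OF dig msa] p p' sub by (simp add: subalgebra_mult)
      ultimately show ?thesis using sub by (simp add: subalgebra_scale)
    qed (simp add: subalgebra_zero[OF sub])
    then have "(\<Sum>p\<in>?P. \<Sum>p'\<in>?P. p * Z * p') \<in> A m" by (intro subalgebra_sum[OF sub])
    then show ?thesis using digraph_expand[OF dig msa ZG] by (simp add: Z_def)
  qed
  have into: "\<gamma> q x \<in> A m" if q: "q \<in> ?P" and x: "x \<in> A0" for q x
  proof -
    note sub = digraph_subalgebra[OF dig[of m]] and sub0 = digraph_subalgebra[OF A0]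
    have xG: "x \<in> generated_cstar A0" by (rule subsetD[OF generated_superset x])
    \<comment> \<open>A nonzero coefficient shows that the matrix unit for \<open>e\<close> and
      \<open>f\<close> lies in \<open>A0\<close>. The term then factors as the atom
      \<open>w e * q * star (w e)\<close> times \<open>w e * star (w f)\<close>, both in
      \<open>A m\<close>.\<close>
    have "?c x e f *\<^sub>C (w e * q * star (w f * q)) \<in> A m" if e: "e \<in> ?Q" and f: "f \<in> ?Q" for e f
    proof (cases "?c x e f = 0 \<or> q \<notin> dom (?r e)")
      case True
      then show ?thesis using wq0'[OF e q] by (auto simp: subalgebra_zero[OF sub])
    next
      case False
      have "e * x * f \<in> A0" using digraph_atoms_mem[OF AC] e f x sub0 by (simp add: subalgebra_mult)
      then have "inverse (?c x e f) *\<^sub>C (?c x e f *\<^sub>C (?u e * star (?u f))) \<in> A0"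
        unfolding coeff(3)[OF AC xG e f] by (rule subalgebra_scale[OF sub0])
      then have "?u e * star (?u f) \<in> A0" using False by (simp add: scaleC_scaleC)
      then have 1: "w e * star (w f) \<in> A m" by (rule wewf[OF e f])
      have "w e * q * star (w e) \<in> ?P" using wqw[OF e q] dom[OF e q] False by blast
      then have 2: "w e * q * star (w e) \<in> A m" using digraph_atoms_mem[OF dig msa] by blast
      have "w e * q * star (w f * q) = w e * (q * (star (w e) * w e)) * star (w f)"
        using wwd[OF e] sdq(2)[OF q] False Ps[OF q] by (simp add: star_mult mult.assoc) (metis mult.assoc)
      then have "w e * q * star (w f * q) = (w e * q * star (w e)) * (w e * star (w f))" by (simp add: mult.assoc)
      then show ?thesis using 1 2 sub by (simp add: subalgebra_mult subalgebra_scale)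
    qed
    then show ?thesis unfolding \<gamma>_def unit_map_def by (intro subalgebra_sum[OF sub])
  qed
  have fam: "regular_family_on ?P \<gamma> A0 (A m)"
  proof (rule regular_family_onI[OF fin hom into])
    fix q g assume q: "q \<in> ?P" and g: "minimal_in (generated_cstar A0) g"
    show "\<gamma> q g = 0 \<or> minimal_in ?G (\<gamma> q g)"
    proof (rule hom_minimal[OF AC generated_star_subalgebra hom[OF q] _ g])
      fix e assume e: "e \<in> ?Q"
      have "\<gamma> q e = w e * q * star (w e)"
        unfolding \<gamma>_def unit_map_atom[OF AC e] using Ps[OF q] by (simp add: star_mult mult.assoc) (metis mult.assoc)
      then show "\<gamma> q e = 0 \<or> minimal_in ?G (\<gamma> q e)"
        using wqw[OF e q] wq0[OF e q] digraph_atoms_minimal[OF dig msa] by (metis mult_zero_left)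
    qed
  next
    fix q q' x y assume q: "q \<in> ?P" and q': "q' \<in> ?P" and ne: "q \<noteq> q'"
    have "(?c x e f *\<^sub>C (w e * q * star (w f * q))) * (?c y e' f' *\<^sub>C (w e' * q' * star (w f' * q'))) = 0"
      if "e \<in> ?Q" "f \<in> ?Q" "e' \<in> ?Q" "f' \<in> ?Q" for e f e' f'
    proof -
      have "star (w f * q) * (w e' * q') = q * (star (w f) * w e') * q'" using Ps[OF q] by (simp add: star_mult mult.assoc)
      also have "\<dots> = 0"
        using ort[OF that(2,3)] wwd[OF that(2)] sdq(2)[OF q] Pm[OF q q'] ne by (cases "f = e'") auto
      finally have 0: "star (w f * q) * (w e' * q') = 0" .
      have "(w e * q * star (w f * q)) * (w e' * q' * star (w f' * q')) =
        w e * q * (star (w f * q) * (w e' * q')) * star (w f' * q')" by (simp add: mult.assoc)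
      then show ?thesis using 0 by (simp add: scaleC_mult_left scaleC_mult_right)
    qed
    then show "\<gamma> q x * \<gamma> q' y = 0"
      unfolding \<gamma>_def unit_map_def sum_product by (intro sum.neutral ballI) auto
  qed
  have "norm (T x - hat m (\<Sum>q\<in>?P. \<gamma> q x)) \<le> \<epsilon> * norm x" if x: "x \<in> generated_cstar A0" for x
  proof -
    have "(\<Sum>q\<in>?P. \<gamma> q x) = (\<Sum>q\<in>?P. \<Sum>e\<in>?Q. \<Sum>f\<in>?Q. ?c x e f *\<^sub>C (w e * q * star (w f)))"
      unfolding \<gamma>_def unit_map_def using Ps
      by (intro sum.cong refl) (simp add: star_mult mult.assoc, metis mult.assoc)
    also have "\<dots> = (\<Sum>e\<in>?Q. \<Sum>q\<in>?P. \<Sum>f\<in>?Q. ?c x e f *\<^sub>C (w e * q * star (w f)))" by (rule sum.swap)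
    also have "\<dots> = (\<Sum>e\<in>?Q. \<Sum>f\<in>?Q. \<Sum>q\<in>?P. ?c x e f *\<^sub>C (w e * q * star (w f)))"
      by (intro sum.cong refl sum.swap)
    also have "\<dots> = (\<Sum>e\<in>?Q. \<Sum>f\<in>?Q. ?c x e f *\<^sub>C (w e * star (w f)))"
    proof (intro sum.cong refl)
      fix e f assume "e \<in> ?Q"
      then have "w e = (\<Sum>q\<in>?P. w e * q)" using digraph_unit(2)[OF dig msa wG] by (simp add: sum_distrib_left)
      then have "w e * star (w f) = (\<Sum>q\<in>?P. w e * q * star (w f))" by (metis sum_distrib_right)
      then show "(\<Sum>q\<in>?P. ?c x e f *\<^sub>C (w e * q * star (w f))) = ?c x e f *\<^sub>C (w e * star (w f))"
        by (simp add: cvs.scale_sum_right)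
    qed
    finally have s: "(\<Sum>q\<in>?P. \<gamma> q x) = (\<Sum>e\<in>?Q. \<Sum>f\<in>?Q. ?c x e f *\<^sub>C (w e * star (w f)))" .
    have wwG: "w e * star (w f) \<in> ?G" if "e \<in> ?Q" "f \<in> ?Q" for e f
      using wG swG that by (simp add: subalgebra_mult[OF Gsub])
    have h1: "hat m (\<Sum>q\<in>?P. \<gamma> q x) = (\<Sum>e\<in>?Q. hat m (\<Sum>f\<in>?Q. ?c x e f *\<^sub>C (w e * star (w f))))"
      unfolding s using wwG
      by (intro star_hom_sum[OF cs.limit_element_hom Gsub] subalgebra_sum[OF Gsub] subalgebra_scale[OF Gsub]) auto
    also have "\<dots> = (\<Sum>e\<in>?Q. \<Sum>f\<in>?Q. hat m (?c x e f *\<^sub>C (w e * star (w f))))"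
      using wwG by (intro sum.cong refl star_hom_sum[OF cs.limit_element_hom Gsub] subalgebra_scale[OF Gsub]) auto
    also have "\<dots> = (\<Sum>e\<in>?Q. \<Sum>f\<in>?Q. ?c x e f *\<^sub>C hat m (w e * star (w f)))"
      using wwG hD(3) by (intro sum.cong refl) auto
    finally have h: "hat m (\<Sum>q\<in>?P. \<gamma> q x) = (\<Sum>e\<in>?Q. \<Sum>f\<in>?Q. ?c x e f *\<^sub>C hat m (w e * star (w f)))" .
    note uG = unit_product_mem[OF AC] and S0 = generated_subalgebra[of A0]
    have "T x = T (\<Sum>e\<in>?Q. \<Sum>f\<in>?Q. ?c x e f *\<^sub>C (?u e * star (?u f)))" using coeff_expand[OF AC x] by simp
    also have "\<dots> = (\<Sum>e\<in>?Q. T (\<Sum>f\<in>?Q. ?c x e f *\<^sub>C (?u e * star (?u f))))"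
      using uG by (intro star_hom_sum[OF T S0] subalgebra_sum[OF S0] subalgebra_scale[OF S0]) auto
    also have "\<dots> = (\<Sum>e\<in>?Q. \<Sum>f\<in>?Q. T (?c x e f *\<^sub>C (?u e * star (?u f))))"
      using uG by (intro sum.cong refl star_hom_sum[OF T S0] subalgebra_scale[OF S0]) auto
    also have "\<dots> = (\<Sum>e\<in>?Q. \<Sum>f\<in>?Q. ?c x e f *\<^sub>C (V e * star (V f)))"
      using uG TD(4) TD(3)[OF mu(1) smu(1)] TD(5)[OF mu(1)] by (intro sum.cong refl) (auto simp: V_def)
    finally have Tx: "T x = (\<Sum>e\<in>?Q. \<Sum>f\<in>?Q. ?c x e f *\<^sub>C (V e * star (V f)))" .
    have "T x - hat m (\<Sum>q\<in>?P. \<gamma> q x) =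
        (\<Sum>e\<in>?Q. \<Sum>f\<in>?Q. ?c x e f *\<^sub>C (V e * star (V f) - hat m (w e * star (w f))))"
      unfolding Tx h by (simp add: sum_subtractf scaleC_diff_right)
    also have "norm \<dots> \<le> (\<Sum>e\<in>?Q. \<Sum>f\<in>?Q. norm (?c x e f *\<^sub>C (V e * star (V f) - hat m (w e * star (w f)))))"
      by (intro order_trans[OF norm_sum] sum_mono norm_sum)
    also have "\<dots> \<le> (\<Sum>e\<in>?Q. \<Sum>f\<in>?Q. norm x * (4 * \<delta>))"
    proof (intro sum_mono)
      fix e f assume e: "e \<in> ?Q" and f: "f \<in> ?Q"
      show "norm (?c x e f *\<^sub>C (V e * star (V f) - hat m (w e * star (w f)))) \<le> norm x * (4 * \<delta>)"
        unfolding norm_scaleC by (intro mult_mono coeff_norm_le[OF AC e f x] VV[OF e f]) simp_all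
    qed
    also have "\<dots> = 4 * \<delta> * (K * K) * norm x" by (simp add: K_def)
    also have "\<dots> \<le> \<epsilon> * norm x" using \<delta>K by (rule mult_right_mono) simp
    finally show ?thesis .
  qed
  then show ?thesis using fam by blast
qed

end

subsection \<open>Lifting unitaries\<close>

text \<open>Triangular truncation is not bounded independently of the dimension. The pinching by the
  projections \<open>g\<^sub>i(1)\<close> cuts \<open>b\<close> into blocks whose size is controlled by \<open>A\<close> alone, and on
  those the truncation costs at most a factor \<open>N\<^sup>2\<close>.\<close>

lemma pinched_truncation:
  assumes A: "digraph_algebra A" and C: "masa C A" and B: "digraph_algebra B" and r: "regular_family_on I g A B"
    and x: "x \<in> generated_cstar A" and b: "b \<in> B" and c: "c \<in> B"
  shows "\<exists>z\<in>B. star z \<in> B \<and>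
    norm (b - z) \<le> 2 * norm (b - (\<Sum>i\<in>I. g i x)) + real (card (atoms C)) * real (card (atoms C)) * norm (b - star c)"
proof -
  let ?P = "atoms C" and ?G = "generated_cstar A" and ?H = "generated_cstar B"
  note R = regular_family_onD[OF r] and GA = generated_subalgebra[of A] and sub = digraph_subalgebra[OF B]
    and fin = digraph_atoms_finite[OF A C] and atG = minimal_inD(1)[OF digraph_atoms_minimal[OF A C]]
  define y where "y = (\<Sum>i\<in>I. g i x)"
  define q where "q i e = g i e" for i e
  define t where "t i = g i (\<Sum>?P)" for i
  have uG: "(\<Sum>?P) \<in> ?G" by (rule digraph_unit_mem[OF A C])
  have tq: "t i = (\<Sum>e\<in>?P. q i e)" if "i \<in> I" for i
    using star_hom_sum[OF R(2)[OF that] GA, of ?P "\<lambda>e. e"] atG by (simp add: t_def q_def)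
  have pt: "projection (t i)" if "i \<in> I" for i
    unfolding t_def using star_hom_projection[OF R(2)[OF that] uG sum_atoms_projection[OF masaD(2)[OF C] order_refl]] .
  have pq: "projection (q i e)" if "i \<in> I" "e \<in> ?P" for i e
    unfolding q_def using star_hom_projection[OF R(2)[OF that(1)] atG[OF that(2)] atoms_projection[OF that(2)]] .
  have tt: "t i * t j = 0" if "i \<in> I" "j \<in> I" "i \<noteq> j" for i j unfolding t_def using R(5)[OF that uG uG] .
  have qq: "q i e * q j f = 0" if "i \<in> I" "j \<in> I" "i \<noteq> j" "e \<in> ?P" "f \<in> ?P" for i j e f
    unfolding q_def using R(5)[OF that(1-3) atG[OF that(4)] atG[OF that(5)]] .
  have qB: "q i e \<in> B" if "i \<in> I" "e \<in> ?P" for i e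
    unfolding q_def using R(3)[OF that(1) digraph_atoms_mem[OF A C that(2)]] .
  define b' where "b' = (\<Sum>i\<in>I. t i * b * t i)"
  \<comment> \<open>Pinching fixes \<open>y\<close>, so the pinched \<open>b\<close> is as close to
    \<open>y\<close> as \<open>b\<close> itself.\<close>
  have ty: "t i * y * t i = g i x" if i: "i \<in> I" for i
  proof -
    have "t i * y = (\<Sum>j\<in>I. if j = i then g i x else 0)"
      unfolding y_def sum_distrib_left
    proof (intro sum.cong refl)
      fix j assume j: "j \<in> I"
      show "t i * g j x = (if j = i then g i x else 0)"
        using star_homD(3)[OF R(2)[OF i] uG x] digraph_unit(1)[OF A C x] R(5)[OF i j _ uG x]
        by (auto simp: t_def)
    qed
    then have "t i * y = g i x" using R(1) i by simp
    then show ?thesis using star_homD(3)[OF R(2)[OF i] x uG] digraph_unit(2)[OF A C x] by (simp add: t_def)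
  qed
  have "b' - y = (\<Sum>i\<in>I. t i * (b - y) * t i)"
    unfolding b'_def using ty by (simp add: right_diff_distrib left_diff_distrib sum_subtractf) (simp add: y_def)
  also have "norm \<dots> \<le> norm (b - y)"
  proof (rule norm_orthogonal_sum_le)
    fix i j assume ij: "i \<in> I" "j \<in> I" "i \<noteq> j"
    have "star (t i * (b - y) * t i) * (t j * (b - y) * t j) = t i * star (b - y) * (t i * t j) * (b - y) * t j"
      using projectionD(1)[OF pt[OF ij(1)]] by (simp add: star_mult mult.assoc)
    then show "star (t i * (b - y) * t i) * (t j * (b - y) * t j) = 0" using tt[OF ij] by simp
    have "(t i * (b - y) * t i) * star (t j * (b - y) * t j) = t i * (b - y) * (t i * t j) * star (b - y) * t j"
      using projectionD(1)[OF pt[OF ij(2)]] by (simp add: star_mult mult.assoc)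
    then show "(t i * (b - y) * t i) * star (t j * (b - y) * t j) = 0" using tt[OF ij] by simp
  qed (use norm_projection_mult_le[OF pt pt] in simp_all)
  finally have n1: "norm (b' - y) \<le> norm (b - y)" .
  \<comment> \<open>The entries whose adjoint lies in \<open>B\<close> are kept; the kept part
    \<open>z\<close> then lies in \<open>B\<close> together with its adjoint.\<close>
  define s where "s i e f \<longleftrightarrow> star (q i e * b * q i f) \<in> B" for i e f
  define z where "z = (\<Sum>e\<in>?P. \<Sum>f\<in>?P. \<Sum>i\<in>I. if s i e f then q i e * b * q i f else 0)"
  have zz: "z \<in> B" "star z \<in> B"
    unfolding z_def star_sum
    by (intro subalgebra_sum[OF sub]; auto simp: s_def qB b subalgebra_zero[OF sub] intro!: subalgebra_mult[OF sub])+
  have "b' = (\<Sum>i\<in>I. \<Sum>e\<in>?P. \<Sum>f\<in>?P. q i e * b * q i f)"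
    unfolding b'_def
  proof (intro sum.cong refl)
    fix i assume i: "i \<in> I"
    show "t i * b * t i = (\<Sum>e\<in>?P. \<Sum>f\<in>?P. q i e * b * q i f)"
      unfolding tq[OF i] by (simp add: sum_distrib_left sum_distrib_right) (rule sum.swap)
  qed
  also have "\<dots> = (\<Sum>e\<in>?P. \<Sum>i\<in>I. \<Sum>f\<in>?P. q i e * b * q i f)" by (rule sum.swap)
  also have "\<dots> = (\<Sum>e\<in>?P. \<Sum>f\<in>?P. \<Sum>i\<in>I. q i e * b * q i f)" by (intro sum.cong refl sum.swap)
  finally have b'_eq: "b' = (\<Sum>e\<in>?P. \<Sum>f\<in>?P. \<Sum>i\<in>I. q i e * b * q i f)" .
  define d where "d i e f = (if s i e f then 0 else q i e * b * q i f)" for i e f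
  have "b' - z = (\<Sum>e\<in>?P. \<Sum>f\<in>?P. \<Sum>i\<in>I. d i e f)"
    unfolding b'_eq z_def sum_subtractf[symmetric] by (intro sum.cong refl) (simp add: d_def)
  also have "norm \<dots> \<le> (\<Sum>e\<in>?P. \<Sum>f\<in>?P. norm (\<Sum>i\<in>I. d i e f))"
    by (intro order_trans[OF norm_sum] sum_mono norm_sum)
  also have "\<dots> \<le> (\<Sum>e\<in>?P. \<Sum>f\<in>?P. norm (b - star c))"
  proof (intro sum_mono)
    fix e f assume e: "e \<in> ?P" and f: "f \<in> ?P"
    \<comment> \<open>For fixed \<open>e\<close> and \<open>f\<close> the entries for different
      \<open>i\<close> are orthogonal, so the number of summands of the regular map does not enter
      the bound.\<close>
    show "norm (\<Sum>i\<in>I. d i e f) \<le> norm (b - star c)"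
    proof (rule norm_orthogonal_sum_le)
      fix i j assume ij: "i \<in> I" "j \<in> I" "i \<noteq> j"
      have "star (q i e * b * q i f) * (q j e * b * q j f) = q i f * star b * (q i e * q j e) * b * q j f"
        using projectionD(1)[OF pq[OF ij(1) e]] projectionD(1)[OF pq[OF ij(1) f]] by (simp add: star_mult mult.assoc)
      then show "star (d i e f) * d j e f = 0" using qq[OF ij e e] by (simp add: d_def)
      have "(q i e * b * q i f) * star (q j e * b * q j f) = q i e * b * (q i f * q j f) * star b * q j e"
        using projectionD(1)[OF pq[OF ij(2) e]] projectionD(1)[OF pq[OF ij(2) f]] by (simp add: star_mult mult.assoc)
      then show "d i e f * star (d j e f) = 0" using qq[OF ij f f] by (simp add: d_def)
    next
      fix i assume i: "i \<in> I"
      show "norm (d i e f) \<le> norm (b - star c)"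
      proof (cases "s i e f")
        case False
        \<comment> \<open>A nonzero entry of \<open>star c\<close> would make the entry of
          \<open>b\<close> a multiple of it, and the adjoint of that a multiple of an entry of
          \<open>c\<close>, which is in \<open>B\<close>. So the entry of \<open>star c\<close>
          vanishes wherever an entry of \<open>b\<close> is discarded, and the discarded entry is
          one of \<open>b - star c\<close>.\<close>
        have "q i e * star c * q i f = 0"
        proof (rule ccontr)
          assume ne: "q i e * star c * q i f \<noteq> 0"
          have min: "minimal_in ?H (q i e)" "minimal_in ?H (q i f)"
            using R(4)[OF i digraph_atoms_minimal[OF A C e]] R(4)[OF i digraph_atoms_minimal[OF A C f]] ne
            by (auto simp: q_def)
          have ef: "q i e = q i f \<or> q i e * q i f = 0"
            using star_homD(3)[OF R(2)[OF i] atG[OF e] atG[OF f]] digraph_atoms_mult[OF A C e f]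
              star_hom_zero[OF R(2)[OF i] GA] by (cases "e = f") (auto simp: q_def)
          have bH: "b \<in> ?H" by (rule subsetD[OF generated_superset b])
          have cH: "star c \<in> ?H" by (rule star_subalgebra_star[OF generated_star_subalgebra subsetD[OF generated_superset c]])
          obtain k where k: "q i e * b * q i f = k *\<^sub>C (q i e * star c * q i f)"
            using minimal_corner_line[OF generated_star_subalgebra min ef bH cH ne] by blast
          have "star (q i e * b * q i f) = cnj k *\<^sub>C (q i f * c * q i e)"
            unfolding k using projectionD(1)[OF pq[OF i e]] projectionD(1)[OF pq[OF i f]]
            by (simp add: star_scaleC star_mult mult.assoc)
          also have "\<dots> \<in> B" using qB[OF i e] qB[OF i f] c by (intro subalgebra_scale[OF sub] subalgebra_mult[OF sub])
          finally show False using False by (simp add: s_def)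
        qed
        then have "d i e f = q i e * (b - star c) * q i f"
          using False by (simp add: d_def right_diff_distrib left_diff_distrib)
        then show ?thesis using norm_projection_mult_le[OF pq[OF i e] pq[OF i f]] by simp
      qed (simp add: d_def)
    qed simp
  qed
  also have "\<dots> = real (card ?P) * real (card ?P) * norm (b - star c)" by simp
  finally have n2: "norm (b' - z) \<le> real (card ?P) * real (card ?P) * norm (b - star c)" .
  have "norm (b - z) \<le> norm (b - y) + norm (b' - y) + norm (b' - z)"
    using norm_triangle_ineq[of "b - b'" "b' - z"] norm_triangle_ineq4[of "b - y" "b' - y"] by simp
  then have "norm (b - z) \<le> 2 * norm (b - y) + real (card ?P) * real (card ?P) * norm (b - star c)"
    using n1 n2 by linarith
  then show ?thesis using zz unfolding y_def by blast
qed

text \<open>With \<open>s = sqrt \<mu>\<close> one has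
  \<open>(1/s - 1) * s * (1 + s) = 1 - \<mu>\<close>, and \<open>s * (1 + s)\<close> is at least 1
  because \<open>\<mu> \<ge> 7/8\<close>.\<close>

lemma inverse_sqrt_bound:
  assumes "\<bar>\<mu> - 1\<bar> \<le> \<eta>" "\<eta> \<le> 1/8" shows "\<bar>1 / sqrt \<mu> - 1\<bar> \<le> (\<eta>::real)"
proof -
  have \<mu>: "\<mu> \<ge> 7/8" using assms by linarith
  define s where "s = sqrt \<mu>"
  have s: "s > 0" "s * s = \<mu>" using \<mu> by (simp_all add: s_def)
  have "s \<ge> 1/2"
  proof (rule ccontr)
    assume "\<not> 1/2 \<le> s"
    then have "s * s < 1/2 * (1/2)" using s(1) by (intro mult_strict_mono) auto
    then show False using s(2) \<mu> by simp
  qed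
  then have ge: "s * (1 + s) \<ge> 1" using s(2) \<mu> by (simp add: distrib_left)
  have "(1 / s - 1) * s = 1 - s" using s(1) by (simp add: left_diff_distrib)
  then have "(1 / s - 1) * (s * (1 + s)) = (1 - s) * (1 + s)" by (simp flip: mult.assoc)
  also have "\<dots> = 1 - \<mu>" by (simp add: algebra_simps flip: s(2))
  finally have "\<bar>(1 / s - 1) * (s * (1 + s))\<bar> = \<bar>1 - \<mu>\<bar>" by simp
  then have eq: "\<bar>1 / s - 1\<bar> * (s * (1 + s)) = \<bar>1 - \<mu>\<bar>" using ge abs_mult[of "1 / s - 1" "s * (1 + s)"] by simp
  have "\<bar>1 / s - 1\<bar> * 1 \<le> \<bar>1 / s - 1\<bar> * (s * (1 + s))" by (rule mult_left_mono[OF ge]) simp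
  also have "\<dots> = \<bar>1 - \<mu>\<bar>" by (rule eq)
  finally show ?thesis using assms(1) by (simp add: s_def abs_minus_commute)
qed

text \<open>Polar decomposition \<open>Z = y (y\<^sup>*y)\<^sup>-\<^sup>1\<^sup>/\<^sup>2\<close>.\<close>

lemma near_unitary:
  assumes B: "digraph_algebra B" and D: "masa D B" and y: "y \<in> B" "star y \<in> B"
    and n: "norm (star y * y - \<Sum>(atoms D)) \<le> \<eta>" "norm (y * star y - \<Sum>(atoms D)) \<le> \<eta>" "\<eta> \<le> 1/8"
  shows "\<exists>Z\<in>B. star Z \<in> B \<and> star Z * Z = \<Sum>(atoms D) \<and> Z * star Z = \<Sum>(atoms D) \<and> norm (Z - y) \<le> 2 * \<eta>"
proof -
  define u where "u = \<Sum>(atoms D)"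
  note sub = digraph_subalgebra[OF B]
  have \<eta>0: "0 \<le> \<eta>" using n(1) norm_ge_zero order_trans by blast
  have uB: "u \<in> B" using digraph_unit_mem(2)[OF B D] by (simp add: u_def)
  have pu: "projection u" unfolding u_def by (rule sum_atoms_projection[OF masaD(2)[OF D] order_refl])
  have uu: "u * b = b" "b * u = b" if "b \<in> B" for b
    using digraph_unit[OF B D subsetD[OF generated_superset that]] by (simp_all add: u_def)
  define h where "h = star y * y"
  \<comment> \<open>Functional calculus for \<open>h\<close> by diagonalising it: a masa
    \<open>E\<close> of the commutant \<open>M\<close> contains \<open>h\<close>, so
    \<open>h\<close> acts on the atoms of \<open>E\<close> by real scalars
    \<open>\<kappa> e\<close>, and the inverse square root is formed on the atoms. All of
    \<open>M\<close> lies in \<open>B\<close> together with its adjoints.\<close>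
  define M where "M = {b\<in>B. star b \<in> B \<and> b * h = h * b}"
  have hB: "h \<in> B" using y by (simp add: h_def subalgebra_mult[OF sub])
  have sh: "star h = h" by (simp add: h_def star_mult)
  have Mss: "star_subalgebra M"
    unfolding star_subalgebra_def subalgebra_def
  proof (intro conjI ballI allI)
    show "0 \<in> M" by (simp add: M_def subalgebra_zero[OF sub])
  next
    fix x z assume xz: "x \<in> M" "z \<in> M"
    then show "x + z \<in> M" by (simp add: M_def subalgebra_add[OF sub] star_add distrib_left distrib_right)
    have "x * z * h = h * (x * z)" using xz by (simp add: M_def) (metis mult.assoc)
    then show "x * z \<in> M" using xz by (simp add: M_def subalgebra_mult[OF sub] star_mult)
  next
    fix c x assume x: "x \<in> M"
    then show "c *\<^sub>C x \<in> M" by (simp add: M_def subalgebra_scale[OF sub] star_scaleC scaleC_mult_left scaleC_mult_right)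
    have "star x * h = star (h * x)" "h * star x = star (x * h)" using sh by (simp_all add: star_mult)
    then show "star x \<in> M" using x by (simp add: M_def)
  qed
  have Mfd: "finite_dimensional M" by (rule finite_dimensional_subset[OF digraph_fd[OF B]]) (auto simp: M_def)
  obtain E where E: "masa E M" using fd_masa_exists[OF star_subalgebraD[OF Mss] Mfd] .
  note abE = masaD(2)[OF E] and fdE = masa_fd[OF E Mfd]
  have hM: "h \<in> M" using hB sh by (simp add: M_def)
  have "h * e = e * h" if "e \<in> E" for e using that masaD(1)[OF E] by (auto simp: M_def)
  then have hE: "h \<in> E" by (rule masa_commutant[OF star_subalgebraD[OF Mss] E hM sh])
  have uM: "u \<in> M" using uB uu[OF hB] projectionD(1)[OF pu] by (simp add: M_def)
  have EB: "e \<in> B" if "e \<in> E" for e using that masaD(1)[OF E] by (auto simp: M_def)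
  have "(\<Sum>(atoms E)) \<in> E" using atoms_mem by (intro subalgebra_sum[OF masaD(4)[OF E]]) blast
  then have sumE: "(\<Sum>(atoms E)) = u"
    using masa_unit(1)[OF Mss Mfd E uM] uu(2)[OF EB] by metis
  have finE: "finite (atoms E)" by (rule finite_atoms[OF abE fdE])
  have "\<forall>e\<in>atoms E. \<exists>c. h * e = c *\<^sub>C e" using hE by (auto simp: atoms_def)
  then obtain k where k: "\<And>e. e \<in> atoms E \<Longrightarrow> h * e = k e *\<^sub>C e" by metis
  have he: "h * e = e * h" if "e \<in> atoms E" for e
    using abelian_star_subalgebraD(3)[OF abE hE atoms_mem[OF that]] .
  define \<kappa> where "\<kappa> e = Re (k e)" for e
  have kr: "k e = complex_of_real (\<kappa> e)" if e: "e \<in> atoms E" for e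
  proof -
    have "star (h * e) = h * e" using sh projectionD(1)[OF atoms_projection[OF e]] he[OF e] by (simp add: star_mult)
    then have "cnj (k e) *\<^sub>C e = k e *\<^sub>C e"
      using k[OF e] projectionD(1)[OF atoms_projection[OF e]] by (simp add: star_scaleC)
    then have "cnj (k e) = k e" using atoms_nonzero[OF e] by (simp add: cvs.scale_cancel_right)
    then have "k e \<in> \<real>" by (simp add: Reals_cnj_iff)
    then show ?thesis by (simp add: \<kappa>_def complex_is_Real_iff complex_eq_iff)
  qed
  have kb: "\<bar>\<kappa> e - 1\<bar> \<le> \<eta>" if e: "e \<in> atoms E" for e
  proof -
    have "(h - u) * e = (k e - 1) *\<^sub>C e"
      using k[OF e] uu(1)[OF EB[OF atoms_mem[OF e]]] by (simp add: left_diff_distrib cvs.scale_left_diff_distrib)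
    then have "cmod (k e - 1) = norm ((h - u) * e)"
      using norm_projection[OF atoms_projection[OF e] atoms_nonzero[OF e]] by (simp add: norm_scaleC)
    also have "\<dots> \<le> norm (h - u) * norm e" by (rule norm_mult_ineq)
    also have "\<dots> \<le> \<eta>" using n(1) norm_projection[OF atoms_projection[OF e] atoms_nonzero[OF e]] by (simp add: h_def u_def)
    finally have "cmod (complex_of_real (\<kappa> e - 1)) \<le> \<eta>" using kr[OF e] by simp
    then show ?thesis by (simp only: norm_of_real)
  qed
  have kpos: "\<kappa> e > 0" if "e \<in> atoms E" for e using kb[OF that] n(3) by linarith
  define s where "s = (\<Sum>e\<in>atoms E. complex_of_real (1 / sqrt (\<kappa> e)) *\<^sub>C e)"
  have sE: "s \<in> E" unfolding s_def
    using atoms_mem by (intro subalgebra_sum[OF masaD(4)[OF E]] subalgebra_scale[OF masaD(4)[OF E]]) blast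
  have sB: "s \<in> B" by (rule EB[OF sE])
  have ss: "star s = s"
    unfolding s_def star_sum by (intro sum.cong refl) (simp add: star_scaleC projectionD(1)[OF atoms_projection])
  have se: "s * e = complex_of_real (1 / sqrt (\<kappa> e)) *\<^sub>C e" if e: "e \<in> atoms E" for e
  proof -
    have "s * e = (\<Sum>f\<in>atoms E. if f = e then complex_of_real (1 / sqrt (\<kappa> e)) *\<^sub>C e else 0)"
      unfolding s_def sum_distrib_right using atoms_mult[OF abE _ e] by (intro sum.cong refl) (auto simp: scaleC_mult_left)
    then show ?thesis using finE e by simp
  qed
  have shse: "s * h * s * e = e" if e: "e \<in> atoms E" for e
  proof -
    have k1: "complex_of_real (1 / sqrt (\<kappa> e)) * complex_of_real (\<kappa> e) * complex_of_real (1 / sqrt (\<kappa> e)) = 1"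
      using kpos[OF e] by (simp flip: of_real_mult)
    have "s * h * s * e = s * (h * (s * e))" by (simp add: mult.assoc)
    also have "\<dots> = (complex_of_real (1 / sqrt (\<kappa> e)) * complex_of_real (\<kappa> e) * complex_of_real (1 / sqrt (\<kappa> e))) *\<^sub>C e"
      by (simp only: se[OF e] k[OF e] kr[OF e] scaleC_mult_right scaleC_scaleC mult_ac)
    finally show ?thesis unfolding k1 by simp
  qed
  have "s * h * s = s * h * s * u" using sB hB uu(2) subalgebra_mult[OF sub] by metis
  also have "\<dots> = u" unfolding sumE[symmetric] sum_distrib_left using shse by simp
  finally have shs: "s * h * s = u" .
  have nsu: "norm (s - u) \<le> \<eta>"
  proof -
    have "s - u = (\<Sum>e\<in>atoms E. complex_of_real (1 / sqrt (\<kappa> e) - 1) *\<^sub>C e)"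
      unfolding sumE[symmetric] s_def by (simp add: sum_subtractf cvs.scale_left_diff_distrib)
    also have "norm \<dots> \<le> \<eta>"
    proof (rule norm_orthogonal_sum_le)
      fix e f assume ef: "e \<in> atoms E" "f \<in> atoms E" "e \<noteq> f"
      show "star (complex_of_real (1 / sqrt (\<kappa> e) - 1) *\<^sub>C e) * (complex_of_real (1 / sqrt (\<kappa> f) - 1) *\<^sub>C f) = 0"
        "(complex_of_real (1 / sqrt (\<kappa> e) - 1) *\<^sub>C e) * star (complex_of_real (1 / sqrt (\<kappa> f) - 1) *\<^sub>C f) = 0"
        using atoms_mult[OF abE ef(1,2)] ef(3) projectionD(1)[OF atoms_projection[OF ef(1)]] projectionD(1)[OF atoms_projection[OF ef(2)]]
        by (simp_all add: star_scaleC scaleC_mult_left scaleC_mult_right)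
    next
      fix e assume e: "e \<in> atoms E"
      have "norm (complex_of_real (1 / sqrt (\<kappa> e) - 1) *\<^sub>C e) = \<bar>1 / sqrt (\<kappa> e) - 1\<bar>"
        using norm_projection[OF atoms_projection[OF e] atoms_nonzero[OF e]] by (simp only: norm_scaleC norm_of_real mult_1_right)
      then show "norm (complex_of_real (1 / sqrt (\<kappa> e) - 1) *\<^sub>C e) \<le> \<eta>"
        using inverse_sqrt_bound[OF kb[OF e] n(3)] by simp
    qed (rule \<eta>0)
    finally show ?thesis .
  qed
  define Z where "Z = y * s"
  have ZB: "Z \<in> B" "star Z \<in> B" using y sB ss by (simp_all add: Z_def star_mult subalgebra_mult[OF sub])
  have ZZ: "star Z * Z = u" using shs ss by (simp add: Z_def star_mult h_def mult.assoc)
  have nu: "norm u \<le> 1" by (rule norm_projection_le[OF pu])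
  have "(norm y)\<^sup>2 = norm h" by (simp add: h_def cstar_identity)
  also have "\<dots> \<le> norm (h - u) + norm u" using norm_triangle_ineq[of "h - u" u] by simp
  also have "\<dots> \<le> 2\<^sup>2" using n(1,3) nu by (simp add: h_def u_def)
  finally have ny: "norm y \<le> 2" by (rule power2_le_imp_le) simp
  have "Z - y = y * (s - u)" using uu(2)[OF y(1)] by (simp add: Z_def right_diff_distrib)
  then have "norm (Z - y) \<le> norm y * norm (s - u)" by (simp add: norm_mult_ineq)
  also have "\<dots> \<le> 2 * \<eta>" using ny nsu by (intro mult_mono) auto
  finally have nZy: "norm (Z - y) \<le> 2 * \<eta>" .
  have nZ: "norm Z \<le> 1" by (rule norm_le_1_if_projection) (simp add: ZZ pu)
  have pZ: "projection (Z * star Z)"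
    using projection_star_mult[of "star Z"] ZZ uu(1)[OF ZB(2)] by simp
  have "projection (u - Z * star Z)"
    by (rule projection_diff[OF pu pZ]) (rule uu(1)[OF subalgebra_mult[OF sub ZB]])
  \<comment> \<open>\<open>star Z * Z = u\<close> holds exactly. The other product is a projection
    below \<open>u\<close> at distance at most \<open>7 \<eta> \<le> 7/8\<close>, hence equal to
    \<open>u\<close>.\<close>
  moreover have "norm (u - Z * star Z) < 1"
  proof -
    have "norm (Z * star Z - y * star y) \<le> (1 + 2) * norm (star Z - star y)"
      using norm_star_mult_diff_le[of "star Z" 1 "star y" 2] nZ ny by simp
    also have "norm (star Z - star y) = norm (Z - y)" using norm_star[of "Z - y"] by (simp only: star_diff)
    finally have "norm (Z * star Z - y * star y) \<le> 6 * \<eta>" using nZy by simp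
    then have "norm (Z * star Z - u) \<le> 6 * \<eta> + \<eta>"
      using norm_triangle_ineq[of "Z * star Z - y * star y" "y * star y - u"] n(2) by (simp add: u_def)
    then show ?thesis using n(3) by (simp add: norm_minus_commute)
  qed
  ultimately have "u - Z * star Z = 0" by (rule projection_eq_0)
  then show ?thesis using ZB ZZ nZy unfolding u_def by (intro bexI[of _ Z]) simp_all
qed

context standard_system
begin

text \<open>Representing sequences \<open>b\<close> of \<open>u\<close> and \<open>c\<close> of
  \<open>star u\<close> satisfy that \<open>b j - star (c j)\<close> tends to 0, but
  \<open>b j\<close> need not have its adjoint in \<open>A j\<close>.
  \<open>pinched_truncation\<close>, applied to the system map from a fixed level \<open>N\<close>,
  corrects \<open>b j\<close> at a cost controlled by \<open>N\<close>, and
  \<open>seq_selection\<close> combines the corrections for all precisions.\<close>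

lemma diagonal_part_lift:
  assumes u: "u \<in> closed_limit A \<phi>" "star u \<in> closed_limit A \<phi>"
  shows "\<exists>z. Bseq z \<and> (\<forall>j. z j \<in> A j \<and> star (z j) \<in> A j) \<and> u = seq_class z"
proof -
  have LP: "closed_limit A \<phi> \<subseteq> seq_product A"
    by (rule cs.closed_limit_subset_product[OF subsystem_A subalgebra_zero[OF digraph_subalgebra[OF dig]]])
  obtain b where b: "Bseq b" "\<And>j. b j \<in> A j" "u = seq_class b" using u(1) LP unfolding seq_product_def by blast
  obtain c where c: "Bseq c" "\<And>j. c j \<in> A j" "star u = seq_class c" using u(2) LP unfolding seq_product_def by blast
  define M where "M j = {x\<in>A j. star x \<in> A j}" for j
  have ne: "M j \<noteq> {}" for j using subalgebra_zero[OF digraph_subalgebra[OF dig]] by (auto simp: M_def intro!: exI[of _ 0])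
  have "u = seq_class (\<lambda>j. star (c j))" using seq_class_star[OF c(1)] c(3) by (metis star_star)
  then have bc: "(\<lambda>j. b j - star (c j)) \<longlonglongrightarrow> 0" using b seq_class_eq_iff[OF b(1) Bseq_star[OF c(1)]] by simp
  have "\<forall>\<^sub>F j in sequentially. \<exists>z\<in>M j. norm (b j - z) < e" if e: "e > 0" for e
  proof -
    obtain N where N: "\<forall>m\<ge>N. \<exists>x\<in>A m. norm (u - hat m x) < e/4"
      using cs.closed_limit_approx[OF subsystem_A u(1), of "e/4"] e by auto
    then obtain x where x: "x \<in> A N" "norm (u - hat N x) < e/4" by blast
    have xG: "x \<in> generated_cstar (A N)" by (rule subsetD[OF generated_superset x(1)])
    \<comment> \<open>Fixed before \<open>j\<close>. Of the error \<open>e\<close>, twice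
      \<open>e/4\<close> goes to the distance from the system map, and at most \<open>e/4\<close> to
      \<open>K\<close> times the distance of \<open>b j\<close> from
      \<open>star (c j)\<close>.\<close>
    define K where "K = real (card (atoms (C N))) * real (card (atoms (C N)))"
    have K: "0 \<le> K" by (simp add: K_def)
    have e1: "\<forall>\<^sub>F j in sequentially. norm (b j - composite \<phi> N j x) < e/4"
      by (rule seq_class_diff_norm_less[OF b(1) cs.composite_Bseq[OF xG]]) (use x(2) b(3) in \<open>simp add: limit_element_def\<close>)
    have "\<forall>\<^sub>F j in sequentially. norm (b j - star (c j)) < e / (4 * (K + 1))"
      using bc e K by (simp add: tendsto_iff)
    with e1 eventually_ge_at_top[of N] show ?thesis
    proof eventually_elim
      case (elim j)
      obtain I :: "nat set" and g where g: "regular_family_on I g (A N) (A j)"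
        "\<forall>x\<in>generated_cstar (A N). composite \<phi> N j x = (\<Sum>i\<in>I. g i x)"
        using composite_family[OF elim(2)] by blast
      obtain z where z: "z \<in> A j" "star z \<in> A j"
        "norm (b j - z) \<le> 2 * norm (b j - composite \<phi> N j x) + K * norm (b j - star (c j))"
        using pinched_truncation[OF dig msa dig g(1) xG b(2) c(2)] g(2) xG unfolding K_def by auto
      have "K * norm (b j - star (c j)) \<le> K * (e / (4 * (K + 1)))"
        using elim(3) K by (intro mult_left_mono) auto
      also have "\<dots> \<le> e / 4" using K e by (simp add: field_simps)
      finally have "norm (b j - z) < e" using z(3) elim(1) e by linarith
      then show ?case using z by (auto simp: M_def)
    qed
  qed
  from seq_selection[OF ne this] obtain z where z: "\<forall>j. z j \<in> M j" "(\<lambda>j. b j - z j) \<longlonglongrightarrow> 0" by blast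
  have "convergent (\<lambda>j. b j - z j)" using z(2) by (auto simp: convergent_def)
  then have "Bseq (\<lambda>j. b j - (b j - z j))" by (intro Bseq_diff[OF b(1)] convergent_imp_Bseq)
  then have bz: "Bseq z" by simp
  then have "u = seq_class z" using z(2) b seq_class_eq_iff by blast
  then show ?thesis using bz z(1) by (auto simp: M_def)
qed

text \<open>\<open>k\<close> and \<open>u\<close> describe the unitary \<open>k + u\<close> of the
  unitisation. At level \<open>j\<close> the scalar becomes a multiple of the unit of
  \<open>A j\<close>, the relations hold up to \<open>\<eta>\<close>, and
  \<open>near_unitary\<close> makes them exact; as \<open>z j\<close> and its adjoint lie in
  \<open>A j\<close>, so do \<open>Z\<close> and its adjoint.\<close>

lemma unitary_lift:
  assumes z: "Bseq z" "\<And>j. z j \<in> A j" "\<And>j. star (z j) \<in> A j" "u = seq_class z"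
    and k: "cnj k * k = 1"
    and u: "cnj k *\<^sub>C u + k *\<^sub>C star u + star u * u = 0" "cnj k *\<^sub>C u + k *\<^sub>C star u + u * star u = 0"
    and e: "e > 0"
  shows "\<forall>\<^sub>F j in sequentially. \<exists>Z\<in>A j. star Z \<in> A j \<and> star Z * Z = \<Sum>(atoms (C j)) \<and>
    Z * star Z = \<Sum>(atoms (C j)) \<and> norm (Z - (k *\<^sub>C \<Sum>(atoms (C j)) + z j)) \<le> e"
proof -
  define \<eta> where "\<eta> = min (1/8) (e/2)"
  have \<eta>: "0 < \<eta>" "\<eta> \<le> 1/8" "2 * \<eta> \<le> e" using e by (auto simp: \<eta>_def)
  have b: "Bseq (\<lambda>j. cnj k *\<^sub>C z j + k *\<^sub>C star (z j))" "Bseq (\<lambda>j. star (z j) * z j)" "Bseq (\<lambda>j. z j * star (z j))"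
    by (intro Bseq_plus Bseq_scaleC Bseq_star Bseq_times z(1))+
  have "seq_class (\<lambda>j. (cnj k *\<^sub>C z j + k *\<^sub>C star (z j)) + star (z j) * z j) = 0"
    using u(1) unfolding z(4)
    by (simp add: seq_class_star seq_class_scale seq_class_mult seq_class_add z(1) b Bseq_scaleC Bseq_star)
  then have "\<forall>\<^sub>F j in sequentially. norm ((cnj k *\<^sub>C z j + k *\<^sub>C star (z j)) + star (z j) * z j) < \<eta>"
    using \<eta>(1) by (intro seq_class_norm_less Bseq_plus[OF b(1,2)]) simp
  moreover have "seq_class (\<lambda>j. (cnj k *\<^sub>C z j + k *\<^sub>C star (z j)) + z j * star (z j)) = 0"
    using u(2) unfolding z(4)
    by (simp add: seq_class_star seq_class_scale seq_class_mult seq_class_add z(1) b Bseq_scaleC Bseq_star)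
  then have "\<forall>\<^sub>F j in sequentially. norm ((cnj k *\<^sub>C z j + k *\<^sub>C star (z j)) + z j * star (z j)) < \<eta>"
    using \<eta>(1) by (intro seq_class_norm_less Bseq_plus[OF b(1,3)]) simp
  ultimately show ?thesis
  proof eventually_elim
    case (elim j)
    let ?u = "\<Sum>(atoms (C j))"
    define y where "y = k *\<^sub>C ?u + z j"
    note uA = digraph_unit_mem(2)[OF dig[of j] msa[of j]] and sub = digraph_subalgebra[OF dig[of j]]
    have pu: "projection ?u" by (rule sum_atoms_projection[OF masaD(2)[OF msa] order_refl])
    have ug: "?u * x = x" "x * ?u = x" if "x \<in> A j" for x
      using digraph_unit[OF dig msa subsetD[OF generated_superset that]] by simp_all
    have yA: "y \<in> A j" "star y \<in> A j" using uA z projectionD(1)[OF pu]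
      by (simp_all add: y_def star_add star_scaleC subalgebra_add[OF sub] subalgebra_scale[OF sub])
    have sy: "star y = cnj k *\<^sub>C ?u + star (z j)" using projectionD(1)[OF pu] by (simp add: y_def star_add star_scaleC)
    have kk: "k * cnj k = 1" using k by (simp add: mult.commute)
    have 1: "star y * y - ?u = (cnj k *\<^sub>C z j + k *\<^sub>C star (z j)) + star (z j) * z j"
      unfolding sy unfolding y_def using ug[OF z(2)] ug[OF z(3)] projectionD(2)[OF pu]
      by (simp add: distrib_left distrib_right scaleC_mult_left scaleC_mult_right scaleC_scaleC scaleC_add_right k kk)
    have 2: "y * star y - ?u = (cnj k *\<^sub>C z j + k *\<^sub>C star (z j)) + z j * star (z j)"
      unfolding sy unfolding y_def using ug[OF z(2)] ug[OF z(3)] projectionD(2)[OF pu]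
      by (simp add: distrib_left distrib_right scaleC_mult_left scaleC_mult_right scaleC_scaleC scaleC_add_right k kk)
    have "\<exists>Z\<in>A j. star Z \<in> A j \<and> star Z * Z = ?u \<and> Z * star Z = ?u \<and> norm (Z - y) \<le> 2 * \<eta>"
      by (rule near_unitary[OF dig msa yA _ _ \<eta>(2)]) (use elim 1 2 in simp_all)
    then show ?case using \<eta>(3) unfolding y_def by (meson order_trans)
  qed
qed

end

text \<open>\<open>a \<mapsto> (k + u) a (k + u)\<^sup>*\<close> with \<open>k + u\<close> in the unitisation.\<close>

definition conj_by :: "complex \<Rightarrow> 'a::cstar_algebra \<Rightarrow> 'a \<Rightarrow> 'a" where
  "conj_by k u a = cnj k *\<^sub>C (k *\<^sub>C a + u * a) + (k *\<^sub>C a + u * a) * star u"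

text \<open>Unitarity of \<open>k + u\<close> in the unitisation, with both relations expanded and
  the scalar part separated from the rest.\<close>

definition unitary_pair :: "complex \<Rightarrow> 'a::cstar_algebra \<Rightarrow> bool" where
  "unitary_pair k u \<longleftrightarrow> cnj k * k = 1 \<and> cnj k *\<^sub>C u + k *\<^sub>C star u + star u * u = 0 \<and>
     cnj k *\<^sub>C u + k *\<^sub>C star u + u * star u = 0"

lemma unitary_pair_star: "unitary_pair k u \<Longrightarrow> unitary_pair (cnj k) (star u)"
  by (simp add: unitary_pair_def mult.commute add.commute)

lemma conj_by_diff: "conj_by k u (a - b) = conj_by k u a - conj_by k u b"
  by (simp add: conj_by_def scaleC_diff_right right_diff_distrib left_diff_distrib algebra_simps scaleC_add_right)

text \<open>\<open>conj_by\<close> is left multiplication \<open>W\<close> by \<open>k + u\<close>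
  followed by right multiplication \<open>R\<close> by its adjoint. Each is inverted by its primed
  counterpart, and left and right multiplications commute.\<close>

lemma conj_by_inverse:
  assumes "unitary_pair k u" shows "conj_by (cnj k) (star u) (conj_by k u a) = a"
proof -
  have kk: "cnj k * k = 1" "k * cnj k = 1" using assms by (simp_all add: unitary_pair_def mult.commute)
  have r: "cnj k *\<^sub>C u + k *\<^sub>C star u + star u * u = 0" using assms by (simp add: unitary_pair_def)
  define W where "W b = k *\<^sub>C b + u * b" for b
  define W' where "W' b = cnj k *\<^sub>C b + star u * b" for b
  define R where "R b = cnj k *\<^sub>C b + b * star u" for b
  define R' where "R' b = k *\<^sub>C b + b * u" for b
  have WW: "W' (W b) = b" for b
  proof -
    have "W' (W b) = (cnj k * k) *\<^sub>C b + (cnj k *\<^sub>C u + k *\<^sub>C star u + star u * u) * b"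
      by (simp add: W_def W'_def scaleC_add_right scaleC_scaleC distrib_left distrib_right scaleC_mult_left scaleC_mult_right
          add.assoc mult.assoc)
    then show ?thesis by (simp add: kk r)
  qed
  have RR: "R' (R b) = b" for b
  proof -
    have "R' (R b) = (k * cnj k) *\<^sub>C b + b * (cnj k *\<^sub>C u + k *\<^sub>C star u + star u * u)"
      by (simp add: R_def R'_def scaleC_add_right scaleC_scaleC distrib_left distrib_right scaleC_mult_left scaleC_mult_right
          add.assoc mult.assoc add.left_commute)
    then show ?thesis by (simp add: kk r)
  qed
  have com: "W' (R b) = R (W' b)" for b
    by (simp add: R_def W'_def scaleC_add_right scaleC_scaleC distrib_left distrib_right scaleC_mult_left scaleC_mult_right
        add.assoc add.left_commute mult.assoc)
  have 1: "conj_by k u b = R (W b)" for b by (simp add: conj_by_def R_def W_def)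
  have 2: "conj_by (cnj k) (star u) b = R' (W' b)" for b by (simp add: conj_by_def R'_def W'_def)
  show ?thesis unfolding 1 2 com WW RR ..
qed

lemma unitary_pair_norm:
  assumes "unitary_pair k u" shows "cmod k = 1" "norm u \<le> 2"
proof -
  have "cnj k * k = 1" using assms by (simp add: unitary_pair_def)
  then have "cmod k * cmod k = 1" by (metis complex_mod_cnj norm_mult norm_one)
  then have "(cmod k)\<^sup>2 = 1" by (simp add: power2_eq_square)
  then show k: "cmod k = 1" using power2_eq_imp_eq[of "cmod k" 1] by (metis norm_ge_zero one_power2 zero_le_one)
  have "star u * u = - (cnj k *\<^sub>C u + k *\<^sub>C star u)"
    using assms unfolding unitary_pair_def eq_neg_iff_add_eq_0 by (simp only: add_ac)
  then have "(norm u)\<^sup>2 = norm (cnj k *\<^sub>C u + k *\<^sub>C star u)" using cstar_identity[of u] by (simp only: norm_minus_cancel)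
  also have "\<dots> \<le> norm u + norm u" using norm_triangle_ineq[of "cnj k *\<^sub>C u" "k *\<^sub>C star u"] by (simp add: norm_scaleC k)
  finally have "norm u * norm u \<le> 2 * norm u" by (simp add: power2_eq_square)
  then show "norm u \<le> 2" by (cases "norm u = 0") auto
qed

text \<open>A crude count: multiplying by \<open>k + u\<close> costs at most the factor
  \<open>1 + 2\<close> on each side, whence 9. The factor is absorbed by the tolerances in
  \<open>approximate_by_regular\<close>.\<close>

lemma conj_by_norm:
  assumes "unitary_pair k u" shows "norm (conj_by k u a) \<le> 9 * norm a"
proof -
  note n = unitary_pair_norm[OF assms]
  define b where "b = k *\<^sub>C a + u * a"
  have "norm b \<le> norm (k *\<^sub>C a) + norm (u * a)" unfolding b_def by (rule norm_triangle_ineq)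
  also have "\<dots> \<le> norm a + 2 * norm a"
    using n by (intro add_mono order_trans[OF norm_mult_ineq] mult_right_mono) (simp_all add: norm_scaleC)
  finally have b: "norm b \<le> 3 * norm a" by simp
  have "norm (conj_by k u a) \<le> norm (cnj k *\<^sub>C b) + norm (b * star u)"
    unfolding conj_by_def b_def[symmetric] by (rule norm_triangle_ineq)
  also have "\<dots> \<le> norm b + norm b * 2"
    using n by (intro add_mono order_trans[OF norm_mult_ineq] mult_left_mono) (simp_all add: norm_scaleC)
  finally show ?thesis using b by simp
qed

lemma conj_by_unit:
  assumes "p * a = a" "a * p = a" "star p = p"
  shows "conj_by k u a = (k *\<^sub>C p + u) * a * star (k *\<^sub>C p + u)"
  using assms
  by (simp add: conj_by_def star_add star_scaleC distrib_left distrib_right scaleC_mult_left scaleC_mult_right scaleC_add_right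
      mult.assoc scaleC_scaleC)

lemma conj_by_class:
  assumes "Bseq z" "Bseq a"
  shows "Bseq (\<lambda>j. conj_by k (z j) (a j))" "conj_by k (seq_class z) (seq_class a) = seq_class (\<lambda>j. conj_by k (z j) (a j))"
proof -
  have b: "Bseq (\<lambda>j. k *\<^sub>C a j + z j * a j)" "Bseq (\<lambda>j. star (z j))"
    by (intro Bseq_plus Bseq_scaleC Bseq_times Bseq_star assms)+
  show "Bseq (\<lambda>j. conj_by k (z j) (a j))"
    unfolding conj_by_def by (intro Bseq_plus Bseq_scaleC Bseq_times b)
  show "conj_by k (seq_class z) (seq_class a) = seq_class (\<lambda>j. conj_by k (z j) (a j))"
    unfolding conj_by_def
    by (simp add: seq_class_star seq_class_scale seq_class_mult seq_class_add assms b Bseq_scaleC Bseq_times)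
qed

text \<open>In the unital case \<open>U\<^sup>*\<close> is replaced by \<open>1 + (U\<^sup>* - e)\<close>.\<close>

lemma approximately_inner_conj:
  assumes \<alpha>: "approximately_inner \<alpha> L" and S: "finite S" "S \<subseteq> L" and \<epsilon>: "\<epsilon> > 0"
    and L: "\<And>x y. x \<in> L \<Longrightarrow> y \<in> L \<Longrightarrow> x - y \<in> L"
  shows "\<exists>k u. u \<in> L \<and> star u \<in> L \<and> unitary_pair k u \<and> (\<forall>a\<in>S. norm (\<alpha> a - conj_by k u a) < \<epsilon>)"
proof (cases "\<exists>e. cstar_algebra_class.is_unit L e")
  case True
  then obtain U where U: "U \<in> L" "star U \<in> L" "cstar_algebra_class.is_unit L (star U * U)"
    "cstar_algebra_class.is_unit L (U * star U)" "\<forall>a\<in>S. norm (\<alpha> a - star U * a * U) < \<epsilon>"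
    using \<alpha>[unfolded approximately_inner_def, THEN conjunct2, rule_format, of S \<epsilon>] S \<epsilon> by auto
  define e where "e = star U * U"
  have eu: "e \<in> L" "\<And>a. a \<in> L \<Longrightarrow> e * a = a" "\<And>a. a \<in> L \<Longrightarrow> a * e = a"
    using U(3) by (simp_all add: cstar_algebra_class.is_unit_def e_def)
  have e2: "U * star U = e"
    using U(4) eu(1,2) unfolding cstar_algebra_class.is_unit_def by metis
  have se: "star e = e" by (simp add: e_def star_mult)
  define u where "u = star U - e"
  have su: "star u = U - e" by (simp add: u_def star_diff se)
  have uL: "u \<in> L" "star u \<in> L" unfolding su unfolding u_def using L U(1,2) eu(1) by blast+
  have p: "unitary_pair 1 u"
    unfolding unitary_pair_def su unfolding u_def
    using eu(2,3)[OF U(1)] eu(2,3)[OF U(2)] eu(2)[OF eu(1)] e2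
    by (simp add: right_diff_distrib left_diff_distrib flip: e_def)
  have "conj_by 1 u a = star U * a * U" if a: "a \<in> S" for a
  proof -
    have aL: "a \<in> L" using a S by blast
    have 1: "1 *\<^sub>C a + u * a = star U * a" using eu(2)[OF aL] by (simp add: u_def left_diff_distrib)
    have "star U * a * e = star U * a" using eu(3)[OF aL] by (simp add: mult.assoc)
    then show ?thesis unfolding conj_by_def 1 su by (simp add: right_diff_distrib)
  qed
  then show ?thesis using uL p U(5) by (intro exI[of _ 1] exI[of _ u]) simp
next
  case False
  then obtain U where U: "snd U \<in> L" "star (snd U) \<in> L" "unitisation_mult (unitisation_star U) U = (1, 0)"
    "unitisation_mult U (unitisation_star U) = (1, 0)"
    "\<forall>a\<in>S. norm (\<alpha> a - snd (unitisation_mult (unitisation_mult (unitisation_star U) (0, a)) U)) < \<epsilon>"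
    using \<alpha>[unfolded approximately_inner_def, THEN conjunct2, rule_format, of S \<epsilon>] S \<epsilon> False
    by (simp only: if_False) blast
  define k u where "k = cnj (fst U)" and "u = star (snd U)"
  have "unitary_pair k u"
    using U(3,4) by (simp add: unitary_pair_def unitisation_mult_def unitisation_star_def k_def u_def mult.commute add.commute)
  moreover have "snd (unitisation_mult (unitisation_mult (unitisation_star U) (0, a)) U) = conj_by k u a" for a
    by (simp add: unitisation_mult_def unitisation_star_def conj_by_def k_def u_def)
  ultimately show ?thesis using U by (intro exI[of _ k] exI[of _ u]) (simp add: u_def)
qed

lemma matrix_unit_normaliser:
  assumes A: "digraph_algebra A" and C: "masa C A" and e: "e \<in> atoms C"
  shows "matrix_unit A C e \<in> normaliser C (generated_cstar A)"
proof -
  define v where "v = matrix_unit A C e"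
  note mu = matrix_unit[OF A C e, folded v_def] and smu = star_matrix_unit[OF A C e, folded v_def]
    and r = root_atom(1)[OF A C e] and Csub = masaD(4)[OF C]
  have C1: "star v * c * v \<in> C" and C2: "v * c * star v \<in> C" if c: "c \<in> C" for c
  proof -
    obtain k where k: "c = (\<Sum>f\<in>atoms C. k f *\<^sub>C f)" using masa_span[OF A C c] by blast
    have "star v * f * v \<in> C" if f: "f \<in> atoms C" for f
    proof -
      have "star v * f * v = star v * (e * f) * v" using smu(2) by (metis mult.assoc)
      then show ?thesis using digraph_atoms_mult[OF A C e f] smu(2) mu(4) atoms_mem[OF r] subalgebra_zero[OF Csub]
        by (cases "e = f") (simp_all add: mult.assoc)
    qed
    then show "star v * c * v \<in> C"
      unfolding k sum_distrib_left sum_distrib_right scaleC_mult_right scaleC_mult_left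
      by (intro subalgebra_sum[OF Csub] subalgebra_scale[OF Csub])
    have "v * f * star v \<in> C" if f: "f \<in> atoms C" for f
    proof -
      have "v * f * star v = v * (root A C e * f) * star v" using mu(3) by (metis mult.assoc)
      then show ?thesis using digraph_atoms_mult[OF A C r f] mu(3,5) atoms_mem[OF e] subalgebra_zero[OF Csub]
        by (cases "root A C e = f") simp_all
    qed
    then show "v * c * star v \<in> C"
      unfolding k sum_distrib_left sum_distrib_right scaleC_mult_right scaleC_mult_left
      by (intro subalgebra_sum[OF Csub] subalgebra_scale[OF Csub])
  qed
  have "partial_isometry v" using mu(2,5) by (simp add: partial_isometry_def)
  then show ?thesis using mu(1) C1 C2 unfolding normaliser_def v_def[symmetric] by blast
qed

context standard_system
begin

lemma composite_normaliser:
  assumes v: "v \<in> normaliser (C n) (generated_cstar (A n))" and "n \<le> j"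
  shows "composite \<phi> n j v \<in> normaliser (C j) (generated_cstar (A j))"
  using assms(2)
proof (induction j rule: dec_induct)
  case (step j)
  then show ?case using nrm by (simp add: composite_Suc)
qed (simp add: v)

text \<open>An element of some \<open>C k\<close> and \<open>v\<close> are moved to a common level,
  where \<open>v\<close> is still a normaliser; general \<open>X\<close> follows because the
  conditions are closed.\<close>

lemma normaliser_limit:
  assumes v: "v \<in> normaliser (C n) (generated_cstar (A n))" and X: "X \<in> LC"
  shows "star (hat n v) * X * hat n v \<in> LC" "hat n v * X * star (hat n v) \<in> LC"
proof -
  define V where "V = hat n v"
  have vG: "v \<in> generated_cstar (A n)" using v by (simp add: normaliser_def)
  have el: "star V * hat k c * V \<in> LC \<and> V * hat k c * star V \<in> LC" if c: "c \<in> C k" for k c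
  proof -
    define j where "j = max n k"
    have nj: "n \<le> j" "k \<le> j" by (simp_all add: j_def)
    define v' c' where "v' = composite \<phi> n j v" and "c' = composite \<phi> k j c"
    have cG: "c \<in> generated_cstar (A k)" by (rule cs.subsystem_mem[OF subsystem_C c])
    have v': "v' \<in> normaliser (C j) (generated_cstar (A j))" unfolding v'_def by (rule composite_normaliser[OF v nj(1)])
    have c': "c' \<in> C j" unfolding c'_def by (rule cs.subsystem_composite[OF subsystem_C nj(2) c])
    have vG': "v' \<in> generated_cstar (A j)" "star v' \<in> generated_cstar (A j)" "c' \<in> generated_cstar (A j)"
      using v' star_subalgebra_star[OF generated_star_subalgebra] cs.subsystem_mem[OF subsystem_C c'] by (auto simp: normaliser_def)
    have V: "V = hat j v'" unfolding V_def v'_def by (rule cs.limit_element_shift[OF nj(1) vG, symmetric])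
    have K: "hat k c = hat j c'" unfolding c'_def by (rule cs.limit_element_shift[OF nj(2) cG, symmetric])
    note H = star_homD(3,5)[OF cs.limit_element_hom[of j]] and M = subalgebra_mult[OF generated_subalgebra]
    have "star V * hat k c * V = hat j (star v' * c' * v')" "V * hat k c * star V = hat j (v' * c' * star v')"
      unfolding V K using H(1)[OF M[OF vG'(2,3)] vG'(1)] H(1)[OF vG'(2,3)] H(2)[OF vG'(1)]
        H(1)[OF M[OF vG'(1,3)] vG'(2)] H(1)[OF vG'(1,3)] by simp_all
    moreover have "star v' * c' * v' \<in> C j" "v' * c' * star v' \<in> C j" using v' c' by (auto simp: normaliser_def)
    ultimately show ?thesis using cs.limit_element_mem[OF subsystem_C] by simp
  qed
  have cl: "closed LC" by (rule cs.closed_limit_closed[OF subsystem_C])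
  have "closed ((\<lambda>X. star V * X * V) -` LC)" by (intro continuous_closed_vimage cl continuous_intros)
  then have "X \<in> (\<lambda>X. star V * X * V) -` LC" by (rule cs.closed_limit_induct[OF subsystem_C X]) (use el in simp)
  then show "star (hat n v) * X * hat n v \<in> LC" by (simp add: V_def)
  have "closed ((\<lambda>X. V * X * star V) -` LC)" by (intro continuous_closed_vimage cl continuous_intros)
  then have "X \<in> (\<lambda>X. V * X * star V) -` LC" by (rule cs.closed_limit_induct[OF subsystem_C X]) (use el in simp)
  then show "hat n v * X * star (hat n v) \<in> LC" by (simp add: V_def)
qed

lemma closed_limit_diff:
  assumes X: "X \<in> closed_limit A \<phi>" and Y: "Y \<in> closed_limit A \<phi>"
  shows "X - Y \<in> closed_limit A \<phi>"
proof -
  have "\<exists>Z\<in>closed_limit A \<phi>. dist Z (X - Y) < e" if e: "e > 0" for e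
  proof -
    obtain N M where N: "\<forall>m\<ge>N. \<exists>x\<in>A m. norm (X - hat m x) < e/2" and M: "\<forall>m\<ge>M. \<exists>x\<in>A m. norm (Y - hat m x) < e/2"
      using cs.closed_limit_approx[OF subsystem_A X, of "e/2"] cs.closed_limit_approx[OF subsystem_A Y, of "e/2"] e by auto
    define m where "m = max N M"
    obtain x where x: "x \<in> A m" "norm (X - hat m x) < e/2" using spec[OF N, of m] by (auto simp: m_def)
    obtain y where y: "y \<in> A m" "norm (Y - hat m y) < e/2" using spec[OF M, of m] by (auto simp: m_def)
    have "hat m (x - y) = hat m x - hat m y"
      by (rule star_hom_diff[OF cs.limit_element_hom generated_subalgebra]) (use x y generated_superset in blast)+
    then have "hat m (x - y) - (X - Y) = (Y - hat m y) - (X - hat m x)" by simp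
    then have "dist (hat m (x - y)) (X - Y) = norm ((Y - hat m y) - (X - hat m x))" by (simp only: dist_norm)
    then have "dist (hat m (x - y)) (X - Y) < e"
      using norm_triangle_ineq4[of "Y - hat m y" "X - hat m x"] x(2) y(2) by linarith
    moreover have "hat m (x - y) \<in> closed_limit A \<phi>"
      using x(1) y(1) by (intro cs.limit_element_mem[OF subsystem_A] subalgebra_diff[OF digraph_subalgebra[OF dig]])
    ultimately show ?thesis by blast
  qed
  then have "X - Y \<in> closure (closed_limit A \<phi>)" unfolding closure_approachable by blast
  then show ?thesis using cs.closed_limit_closed[OF subsystem_A] by simp
qed

end

section \<open>Undoing the approximately inner automorphism\<close>

context intertwined_systems
begin

text \<open>The approximant sends \<open>x\<close> to \<open>composite \<psi> m j (f x)\<close>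
  conjugated by a unitary \<open>Z\<close> of \<open>B j\<close>, with \<open>f\<close> from
  \<open>near_regular\<close>. The comparison is made in the limit on a finite test set of
  \<open>A n\<close>, read off at all large levels \<open>j\<close>, and extended to
  \<open>A n\<close> by linearity.\<close>

lemma approximate_by_regular:
  assumes \<alpha>: "approximately_inner \<alpha> LB" and \<alpha>D: "\<alpha> ` theta ` closed_limit C \<phi> = closed_limit D \<psi>" and \<epsilon>: "\<epsilon> > 0"
  shows "\<forall>\<^sub>F j in sequentially. \<exists>\<gamma>. regular_map \<gamma> (A n) (B j) \<and> complex_linear_on (A n) \<gamma> \<and>
    (\<forall>x\<in>A n. norm (\<mu> j (composite \<phi> n j x) - \<gamma> x) \<le> \<epsilon> * norm x)"
proof -
  have iso: "star_extendible \<alpha> LB LB" using \<alpha> by (simp add: approximately_inner_def star_extendible_iso_def)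
  then obtain g where g: "star_hom g (generated_cstar LB) (generated_cstar LB)" "\<And>a. a \<in> LB \<Longrightarrow> \<alpha> a = g a"
    and \<alpha>L: "\<And>a. a \<in> LB \<Longrightarrow> \<alpha> a \<in> LB" unfolding star_extendible_def by blast
  define h where "h = limit_element \<phi> n"
  have hh: "star_hom h (GA n) UNIV" unfolding h_def by (rule A.cs.limit_element_hom)
  have hG: "h x \<in> generated_cstar LA" if "x \<in> GA n" for x unfolding h_def by (rule A.limit_element_generated[OF that])
  \<comment> \<open>\<open>g\<close> extends \<open>\<alpha>\<close> to the generated algebra. It is
    needed since the matrix units of \<open>GA n\<close> may leave \<open>A n\<close>, and then
    their images leave \<open>LB\<close>, where \<open>\<alpha>\<close> is controlled.\<close>
  define T where "T x = g (theta (h x))" for x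
  note th = star_homD[OF theta_generated_hom] and gh = star_homD[OF g(1)] and hD = star_homD[OF hh]
  have tG: "theta (h x) \<in> generated_cstar LB" if "x \<in> GA n" for x using th(1) hG that by blast
  have T: "star_hom T (GA n) B.LG"
    unfolding star_hom_def T_def
  proof (intro conjI image_subsetI ballI allI)
    fix x assume x: "x \<in> GA n"
    show "g (theta (h x)) \<in> B.LG" using gh(1)[OF tG[OF x]] B.generated_limit_subset by blast
    show "g (theta (h (c *\<^sub>C x))) = c *\<^sub>C g (theta (h x))" for c
      by (simp only: hD(4)[OF x] th(4)[OF hG[OF x]] gh(4)[OF tG[OF x]])
    show "g (theta (h (star x))) = star (g (theta (h x)))"
      by (simp only: hD(5)[OF x] th(5)[OF hG[OF x]] gh(5)[OF tG[OF x]])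
    fix y assume y: "y \<in> GA n"
    show "g (theta (h (x + y))) = g (theta (h x)) + g (theta (h y))"
      by (simp only: hD(2)[OF x y] th(2)[OF hG[OF x] hG[OF y]] gh(2)[OF tG[OF x] tG[OF y]])
    show "g (theta (h (x * y))) = g (theta (h x)) * g (theta (h y))"
      by (simp only: hD(3)[OF x y] th(3)[OF hG[OF x] hG[OF y]] gh(3)[OF tG[OF x] tG[OF y]])
  qed
  note TD = star_homD[OF T]
  have hA: "h x \<in> LA" if "x \<in> A n" for x unfolding h_def by (rule A.cs.limit_element_mem[OF A.subsystem_A that])
  have T\<alpha>: "T x = \<alpha> (theta (h x))" if "x \<in> A n" for x using g(2)[OF theta_LA(1)[OF hA[OF that]]] by (simp add: T_def)
  have TA: "T x \<in> LB" if "x \<in> A n" for x using \<alpha>L[OF theta_LA(1)[OF hA[OF that]]] T\<alpha>[OF that] by simp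
  have gD: "g (theta X) \<in> B.LC" if X: "X \<in> A.LC" for X
  proof -
    have "theta X \<in> LB" using X A.limit_C_subset theta_LA(1) by blast
    then have "g (theta X) = \<alpha> (theta X)" using g(2) by simp
    then show ?thesis using X \<alpha>D by blast
  qed
  have TC: "T c \<in> B.LC" if "c \<in> C n" for c
    unfolding T_def h_def by (rule gD[OF A.cs.limit_element_mem[OF A.subsystem_C that]])
  have TN: "B.normalises (T (matrix_unit (A n) (C n) e))" if e: "e \<in> atoms (C n)" for e
  proof -
    define v where "v = matrix_unit (A n) (C n) e"
    have vn: "v \<in> normaliser (C n) (GA n)" unfolding v_def by (rule matrix_unit_normaliser[OF A.dig A.msa e])
    note mu' = matrix_unit[OF A.dig A.msa e, folded v_def] and smu = star_matrix_unit[OF A.dig A.msa e, folded v_def]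
    have sT: "star (T v) = T (star v)" using TD(5)[OF mu'(1)] by simp
    have 1: "T v * star (T v) = T e" "star (T v) * T v = T (root (A n) (C n) e)"
      unfolding sT using TD(3)[OF mu'(1) smu(1)] TD(3)[OF smu(1) mu'(1)] mu'(4,5) by simp_all
    have eG: "e \<in> GA n" using minimal_inD(1)[OF digraph_atoms_minimal[OF A.dig A.msa e]] .
    have 2: "T v * star (T v) * T v = T v" unfolding 1 using TD(3)[OF eG mu'(1)] mu'(2) by simp
    have 3: "T e \<in> B.LC" "T (root (A n) (C n) e) \<in> B.LC"
      using TC atoms_mem[OF e] atoms_mem[OF root_atom(1)[OF A.dig A.msa e]] by auto
    have hvG: "h v \<in> generated_cstar LA" "star (h v) \<in> generated_cstar LA"
      using hG[OF mu'(1)] star_subalgebra_star[OF generated_star_subalgebra] by blast+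
    have 4: "star (T v) * d * T v \<in> B.LC \<and> T v * d * star (T v) \<in> B.LC" if d: "d \<in> B.LC" for d
    proof -
      \<comment> \<open>Every element of the masa of the second system is the image of some
        \<open>c\<close> in that of the first, so the normalising conditions can be checked before
        \<open>theta\<close> and \<open>\<alpha>\<close> are applied.\<close>
      obtain c where c: "c \<in> A.LC" "d = \<alpha> (theta c)" using d \<alpha>D by blast
      have cL: "c \<in> LA" using c(1) A.limit_C_subset by blast
      have cG: "c \<in> generated_cstar LA" by (rule subsetD[OF generated_superset cL])
      have dg: "d = g (theta c)" using c(2) g(2)[OF theta_LA(1)[OF cL]] by simp
      note M = subalgebra_mult[OF generated_subalgebra]
      have gt: "g (theta (X * Y)) = g (theta X) * g (theta Y)"
        if "X \<in> generated_cstar LA" "Y \<in> generated_cstar LA" for X Y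
        using th(3)[OF that] gh(3)[OF th(1)[OF that(1)] th(1)[OF that(2)]] by simp
      have gs: "star (T v) = g (theta (star (h v)))"
        unfolding T_def using th(5)[OF hvG(1)] gh(5)[OF th(1)[OF hvG(1)]] by simp
      have "star (T v) * d * T v = g (theta (star (h v) * c * h v))"
        using gt[OF M[OF hvG(2) cG] hvG(1)] gt[OF hvG(2) cG] by (simp add: gs dg) (simp add: T_def)
      moreover have "T v * d * star (T v) = g (theta (h v * c * star (h v)))"
        using gt[OF M[OF hvG(1) cG] hvG(2)] gt[OF hvG(1) cG] by (simp add: gs dg) (simp add: T_def)
      ultimately show ?thesis using gD A.normaliser_limit[OF vn c(1)] by (simp add: h_def)
    qed
    show ?thesis
      unfolding B.normalises_def v_def[symmetric] using TD(1)[OF mu'(1)] 1 2 3 4 by simp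
  qed
  obtain S K where S: "finite S" "S \<subseteq> A n" "0 \<le> K" and
    SK: "\<And>(f::'a \<Rightarrow> 'a) \<delta>. complex_linear_on (A n) f \<Longrightarrow> 0 \<le> \<delta> \<Longrightarrow> \<forall>s\<in>S. norm (f s) \<le> \<delta>
       \<Longrightarrow> \<forall>x\<in>A n. norm (f x) \<le> K * \<delta> * norm x"
    using digraph_finite_test[OF A.dig, where ?'b = 'a] by metis
  \<comment> \<open>\<open>K\<close> is the constant of the finite test: an error
    \<open>\<delta>\<close> on \<open>S\<close> becomes at most
    \<open>K * \<delta> \<le> \<epsilon>\<close> on the unit ball of \<open>A n\<close>.\<close>
  define \<delta> where "\<delta> = \<epsilon> / (K + 1)"
  have \<delta>: "\<delta> > 0" "K * \<delta> \<le> \<epsilon>" using \<epsilon> S(3) by (simp_all add: \<delta>_def field_simps)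
  define R where "R = (\<Sum>s\<in>S. norm s)"
  have R: "0 \<le> R" "\<And>s. s \<in> S \<Longrightarrow> norm s \<le> R"
    unfolding R_def using S(1) by (auto intro: sum_nonneg member_le_sum)
  \<comment> \<open>The budget on \<open>S\<close> is \<open>\<delta>\<close>. Undoing the
    conjugation multiplies errors by 9, so \<open>\<delta> / 36\<close> for the approximation of
    \<open>\<alpha>\<close> and \<open>\<epsilon>1 * R\<close> for \<open>near_regular\<close> cost
    at most \<open>\<delta> / 4\<close> each. This leaves room for the strict bound
    \<open>3 * \<delta> / 4\<close> at the levels \<open>j\<close>.\<close>
  define \<epsilon>1 where "\<epsilon>1 = \<delta> / (36 * (R + 1))"
  have \<epsilon>1: "\<epsilon>1 > 0" "9 * (\<epsilon>1 * R) \<le> \<delta> / 4" using \<delta>(1) R(1) by (simp_all add: \<epsilon>1_def field_simps)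
  \<comment> \<open>The last quarter pays for replacing \<open>Y\<close> by the exact unitary
    \<open>Z\<close>: with \<open>norm Y \<le> 2\<close> and \<open>norm Z \<le> 1\<close> this
    costs \<open>3 * \<epsilon>4 * R\<close>.\<close>
  define \<epsilon>4 where "\<epsilon>4 = min 1 (\<delta> / (12 * (R + 1)))"
  have \<epsilon>4: "\<epsilon>4 > 0" "\<epsilon>4 \<le> 1" using \<delta>(1) R(1) by (simp_all add: \<epsilon>4_def)
  have "\<epsilon>4 * (12 * (R + 1)) \<le> \<delta>"
  proof -
    have "\<epsilon>4 \<le> \<delta> / (12 * (R + 1))" by (simp add: \<epsilon>4_def)
    moreover have "0 < 12 * (R + 1)" using R(1) by simp
    ultimately show ?thesis by (simp only: pos_le_divide_eq)
  qed
  then have \<epsilon>4R: "3 * \<epsilon>4 * R \<le> \<delta> / 4" using \<epsilon>4(1) by (simp add: algebra_simps)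
  obtain m \<gamma> where \<gamma>: "regular_family_on (atoms (D m)) \<gamma> (A n) (B m)"
    and \<gamma>T: "\<And>x. x \<in> GA n \<Longrightarrow> norm (T x - B.hat m (\<Sum>q\<in>atoms (D m). \<gamma> q x)) \<le> \<epsilon>1 * norm x"
    using B.near_regular[OF A.dig A.msa T TA TN \<epsilon>1(1)] by blast
  define f where "f x = (\<Sum>q\<in>atoms (D m). \<gamma> q x)" for x
  have fh: "star_hom f (GA n) (GB m)" unfolding f_def using regular_family_star_hom[OF \<gamma>] .
  have fc: "norm (f x) \<le> norm x" if "x \<in> GA n" for x
    by (rule star_hom_contractive[OF generated_star_subalgebra digraph_generated_fd[OF A.dig] fh that])
  have SL: "(\<lambda>s. theta (h s)) ` S \<subseteq> LB" using S(2) theta_LA(1)[OF hA] by blast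
  obtain k u where u: "u \<in> LB" "star u \<in> LB" "unitary_pair k u"
    and k: "\<forall>a\<in>(\<lambda>s. theta (h s)) ` S. norm (\<alpha> a - conj_by k u a) < \<delta> / 36"
    using approximately_inner_conj[OF \<alpha> finite_imageI[OF S(1)] SL, of "\<delta> / 36"] \<delta>(1) B.closed_limit_diff by auto
  note up = unitary_pair_star[OF u(3)]
  obtain z where z: "Bseq z" "\<forall>j. z j \<in> B j \<and> star (z j) \<in> B j" "star u = seq_class z"
    using B.diagonal_part_lift[OF u(2)] u(1) by auto
  have lim: "norm (theta (h s) - conj_by (cnj k) (star u) (B.hat m (f s))) < 3 * \<delta> / 4" if s: "s \<in> S" for s
  proof -
    have sA: "s \<in> A n" using s S(2) by blast
    have sG: "s \<in> GA n" by (rule gA[OF sA])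
    define X where "X = theta (h s)"
    have n1: "norm (conj_by k u X - T s) \<le> \<delta> / 36"
      using bspec[OF k, of X] s T\<alpha>[OF sA] by (simp add: X_def norm_minus_commute less_imp_le)
    have n2: "norm (T s - B.hat m (f s)) \<le> \<epsilon>1 * R"
      using order_trans[OF \<gamma>T[OF sG] mult_left_mono[OF R(2)[OF s], of \<epsilon>1]] \<epsilon>1(1) by (simp add: f_def)
    have "X - conj_by (cnj k) (star u) (B.hat m (f s)) =
        conj_by (cnj k) (star u) (conj_by k u X - T s) + conj_by (cnj k) (star u) (T s - B.hat m (f s))"
      by (simp add: conj_by_diff conj_by_inverse[OF u(3)])
    also have "norm \<dots> \<le> 9 * norm (conj_by k u X - T s) + 9 * norm (T s - B.hat m (f s))"
      by (intro order_trans[OF norm_triangle_ineq] add_mono conj_by_norm[OF up])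
    also have "\<dots> \<le> \<delta> / 4 + \<delta> / 4" using n1 n2 \<epsilon>1(2) by linarith
    finally show ?thesis using \<delta>(1) by (simp add: X_def)
  qed
  \<comment> \<open>Entries below \<open>n\<close> are set to 0: there
    \<open>composite \<phi> n j\<close> is the identity, and \<open>\<mu> j\<close> would be applied
    outside its domain, where nothing bounds it.\<close>
  have ev1: "\<forall>\<^sub>F j in sequentially. \<forall>s\<in>S.
      norm ((if j < n then 0 else \<mu> j (composite \<phi> n j s)) - conj_by (cnj k) (z j) (composite \<psi> m j (f s))) < 3 * \<delta> / 4"
  proof (rule eventually_ball_finite[OF S(1)], rule ballI)
    fix s assume s: "s \<in> S"
    have sA: "s \<in> A n" using s S(2) by blast
    have sG: "s \<in> GA n" by (rule gA[OF sA])
    define y where "y j = (if j < n then 0 else \<mu> j (composite \<phi> n j s))" for j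
    have "norm (y j) \<le> norm s" for j
      using mu_contr[OF A.cs.composite_mem[OF _ sG, of j]] A.cs.composite_norm[OF sG, of j] by (auto simp: y_def intro: order_trans)
    then have by': "Bseq y" by (rule Bseq_bounded)
    have th_y: "theta (h s) = seq_class y" unfolding h_def by (rule theta_element(3)[OF sA by']) (simp add: y_def)
    have fs: "f s \<in> GB m" by (rule star_homD(1)[OF fh sG])
    note cb = conj_by_class[OF z(1) B.cs.composite_Bseq[OF fs]]
    have "norm (seq_class y - seq_class (\<lambda>j. conj_by (cnj k) (z j) (composite \<psi> m j (f s)))) < 3 * \<delta> / 4"
      using lim[OF s] unfolding th_y z(3) limit_element_def cb(2) .
    from seq_class_diff_norm_less[OF by' cb(1) this]
    show "\<forall>\<^sub>F j in sequentially. norm ((if j < n then 0 else \<mu> j (composite \<phi> n j s)) - conj_by (cnj k) (z j) (composite \<psi> m j (f s))) < 3 * \<delta> / 4"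
      by (simp add: y_def)
  qed
  have ev2: "\<forall>\<^sub>F j in sequentially. \<exists>Z\<in>B j. star Z \<in> B j \<and> star Z * Z = \<Sum>(atoms (D j)) \<and>
      Z * star Z = \<Sum>(atoms (D j)) \<and> norm (Z - (cnj k *\<^sub>C \<Sum>(atoms (D j)) + z j)) \<le> \<epsilon>4"
    by (rule B.unitary_lift[OF z(1) _ _ z(3)]) (use z(2) up \<epsilon>4(1) in \<open>simp_all add: unitary_pair_def\<close>)
  from ev1 ev2 eventually_ge_at_top[of "max m n"] show ?thesis
  proof eventually_elim
    case (elim j)
    then have mj: "m \<le> j" and nj: "n \<le> j" by simp_all
    let ?p = "\<Sum>(atoms (D j))"
    obtain Z where Z: "Z \<in> B j" "star Z \<in> B j" "star Z * Z = ?p" "Z * star Z = ?p"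
      and ZY: "norm (Z - (cnj k *\<^sub>C ?p + z j)) \<le> \<epsilon>4" using elim(2) by blast
    define Y where "Y = cnj k *\<^sub>C ?p + z j"
    have pp: "projection ?p" by (rule sum_atoms_projection[OF masaD(2)[OF B.msa] order_refl])
    obtain J :: "nat set" and d where d: "regular_family_on J d (B m) (B j)"
      "\<forall>x\<in>GB m. composite \<psi> m j x = (\<Sum>i\<in>J. d i x)" using B.composite_family[OF mj] by blast
    note fam = regular_family_conj[OF regular_family_comp[OF \<gamma> d(1)] B.dig B.msa Z]
    define \<gamma>' where "\<gamma>' x = Z * composite \<psi> m j (f x) * star Z" for x
    have "\<gamma>' x = (\<Sum>i\<in>atoms (D m) \<times> J. Z * (case i of (i, j) \<Rightarrow> \<lambda>x. d j (\<gamma> i x)) x * star Z)" if x: "x \<in> A n" for x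
    proof -
      have gm: "\<gamma> q x \<in> GB m" if "q \<in> atoms (D m)" for q
        using star_homD(1)[OF regular_family_onD(2)[OF \<gamma> that] gA[OF x]] .
      have "composite \<psi> m j (f x) = (\<Sum>i\<in>J. d i (\<Sum>q\<in>atoms (D m). \<gamma> q x))"
        using d(2) star_homD(1)[OF fh gA[OF x]] by (simp add: f_def)
      also have "\<dots> = (\<Sum>i\<in>J. \<Sum>q\<in>atoms (D m). d i (\<gamma> q x))"
        using gm by (intro sum.cong refl star_hom_sum[OF regular_family_onD(2)[OF d(1)] generated_subalgebra]) auto
      also have "\<dots> = (\<Sum>q\<in>atoms (D m). \<Sum>i\<in>J. d i (\<gamma> q x))" by (rule sum.swap)
      also have "\<dots> = (\<Sum>(q, i)\<in>atoms (D m) \<times> J. d i (\<gamma> q x))" by (rule sum.cartesian_product)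
      finally show ?thesis by (simp add: \<gamma>'_def sum_distrib_left sum_distrib_right case_prod_beta')
    qed
    then have reg: "regular_map \<gamma>' (A n) (B j)" by (rule regular_mapI[OF A.dig B.dig fam])
    have fG: "f x \<in> GB m" if "x \<in> A n" for x by (rule star_homD(1)[OF fh gA[OF that]])
    have lin\<gamma>: "complex_linear_on (A n) \<gamma>'"
      unfolding complex_linear_on_def \<gamma>'_def
      using star_homD(2,4)[OF fh] star_homD(2,4)[OF B.cs.composite_hom[OF mj]] gA fG
      by (simp add: distrib_left distrib_right scaleC_mult_left scaleC_mult_right)
    have lin\<mu>: "complex_linear_on (A n) (\<lambda>x. \<mu> j (composite \<phi> n j x))"
      unfolding complex_linear_on_def
      using star_homD(1,2,4)[OF A.cs.composite_hom[OF nj]] star_homD(2,4)[OF mu] gA by simp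
    have Zn: "norm Z \<le> 1" by (rule norm_le_1_if_projection) (simp add: Z pp)
    have Yn: "norm Y \<le> 2" using norm_triangle_ineq3[of Z Y] ZY Zn \<epsilon>4(2) norm_triangle_ineq[of "Y - Z" Z]
      by (simp add: Y_def norm_minus_commute)
    have "norm (\<mu> j (composite \<phi> n j s) - \<gamma>' s) \<le> \<delta>" if s: "s \<in> S" for s
    proof -
      have sA: "s \<in> A n" using s S(2) by blast
      define a where "a = composite \<psi> m j (f s)"
      have aG: "a \<in> GB j" unfolding a_def by (rule B.cs.composite_mem[OF mj fG[OF sA]])
      have na: "norm a \<le> R"
        using B.cs.composite_norm[OF fG[OF sA], of j] fc[OF gA[OF sA]] R(2)[OF s] by (simp add: a_def)
      have "conj_by (cnj k) (z j) a = Y * a * star Y"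
        unfolding Y_def using digraph_unit[OF B.dig B.msa aG] projectionD(1)[OF pp] by (intro conj_by_unit) auto
      then have 1: "norm (\<mu> j (composite \<phi> n j s) - Y * a * star Y) < 3 * \<delta> / 4"
        using bspec[OF elim(1) s] nj by (simp add: a_def)
      have "Y * a * star Y - Z * a * star Z = (Y - Z) * a * star Y + Z * a * star (Y - Z)"
        by (simp add: star_diff left_diff_distrib right_diff_distrib)
      also have "norm \<dots> \<le> norm (Y - Z) * norm a * norm Y + norm Z * norm a * norm (Y - Z)"
        by (intro order_trans[OF norm_triangle_ineq] add_mono order_trans[OF norm_mult_ineq] mult_mono norm_mult_ineq) simp_all
      also have "\<dots> \<le> \<epsilon>4 * R * 2 + 1 * R * \<epsilon>4"
        using ZY Zn Yn na R(1) \<epsilon>4(1)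
        by (intro add_mono mult_mono) (simp_all add: Y_def norm_minus_commute)
      finally have 2: "norm (Y * a * star Y - Z * a * star Z) \<le> \<delta> / 4" using \<epsilon>4R by (simp add: algebra_simps)
      have "norm (\<mu> j (composite \<phi> n j s) - Z * a * star Z) \<le> \<delta>"
        using norm_triangle_ineq[of "\<mu> j (composite \<phi> n j s) - Y * a * star Y" "Y * a * star Y - Z * a * star Z"] 1 2 by simp
      then show ?thesis by (simp add: \<gamma>'_def a_def)
    qed
    then have "\<forall>x\<in>A n. norm (\<mu> j (composite \<phi> n j x) - \<gamma>' x) \<le> K * \<delta> * norm x"
      using \<delta>(1) by (intro SK complex_linear_on_diff[OF lin\<mu> lin\<gamma>]) auto
    then have "\<forall>x\<in>A n. norm (\<mu> j (composite \<phi> n j x) - \<gamma>' x) \<le> \<epsilon> * norm x"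
      using mult_right_mono[OF \<delta>(2)] by (meson norm_ge_zero order_trans)
    then show ?case using reg lin\<gamma> by blast
  qed
qed

end

subsection \<open>Approximation of the diagonal maps\<close>

text \<open>A supremum of reals is informative only for a bounded set; finite dimension supplies the
  bound. The second claim follows by scaling \<open>x\<close> to norm 1.\<close>

lemma map_norm_bound:
  fixes f :: "'a::cstar_algebra \<Rightarrow> 'b::cstar_algebra"
  assumes A: "digraph_algebra A" and f: "complex_linear_on A f"
  shows "0 \<le> map_norm A f" and "x \<in> A \<Longrightarrow> norm (f x) \<le> map_norm A f * norm x"
proof -
  obtain S K where S: "finite S" "0 \<le> K" and
    SK: "\<And>(g::'a \<Rightarrow> 'b) \<delta>. complex_linear_on A g \<Longrightarrow> 0 \<le> \<delta> \<Longrightarrow> \<forall>s\<in>S. norm (g s) \<le> \<delta>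
       \<Longrightarrow> \<forall>x\<in>A. norm (g x) \<le> K * \<delta> * norm x"
    using digraph_finite_test[OF A, where ?'b = 'b] by metis
  define R where "R = (\<Sum>s\<in>S. norm (f s))"
  have R: "0 \<le> R" "\<forall>s\<in>S. norm (f s) \<le> R"
    unfolding R_def using S(1) by (auto intro: sum_nonneg member_le_sum)
  have M: "norm (f x) \<le> K * R * norm x" if "x \<in> A" for x using SK[OF f R] that by blast
  have f0: "norm (f 0) = 0" and A0: "0 \<in> A"
    using M[of 0] digraph_subalgebra[OF A] by (simp_all add: subalgebra_def)
  have bdd: "bdd_above ((\<lambda>a. norm (f a)) ` {a\<in>A. norm a \<le> 1})"
  proof (rule bdd_aboveI2)
    fix a assume a: "a \<in> {a\<in>A. norm a \<le> 1}"
    then have "K * R * norm a \<le> K * R * 1" using S(2) R(1) by (intro mult_left_mono) auto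
    then show "norm (f a) \<le> K * R" using M[of a] a by simp
  qed
  have le: "norm (f a) \<le> map_norm A f" if "a \<in> A" "norm a \<le> 1" for a
    unfolding map_norm_def by (rule cSUP_upper[OF _ bdd]) (use that in simp)
  show "0 \<le> map_norm A f" using le[OF A0] f0 by simp
  show "norm (f x) \<le> map_norm A f * norm x" if x: "x \<in> A"
  proof (cases "x = 0")
    case False
    define c where "c = complex_of_real (1 / norm x)"
    have c: "cmod c = 1 / norm x" by (simp add: c_def norm_divide)
    have "c *\<^sub>C x \<in> A" using digraph_subalgebra[OF A] x by (simp add: subalgebra_def)
    then have "norm (f (c *\<^sub>C x)) \<le> map_norm A f" using False by (intro le) (simp_all add: norm_scaleC c)
    then have "1 / norm x * norm (f x) \<le> map_norm A f"
      using f x by (simp add: complex_linear_on_def norm_scaleC c)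
    then show ?thesis using False by (simp add: field_simps)
  qed (simp add: f0)
qed

lemma map_norm_le:
  assumes "0 \<in> A" "\<And>x. x \<in> A \<Longrightarrow> norm (f x) \<le> c * norm x" "0 \<le> c"
  shows "map_norm A f \<le> c"
  unfolding map_norm_def
proof (rule cSUP_least)
  show "{a\<in>A. norm a \<le> 1} \<noteq> {}" using assms(1) by force
  fix a assume a: "a \<in> {a\<in>A. norm a \<le> 1}"
  then have "c * norm a \<le> c * 1" using assms(3) by (intro mult_left_mono) auto
  then show "norm (f a) \<le> c" using assms(2)[of a] a by simp
qed

lemma complex_linear_on_comp:
  "complex_linear_on A f \<Longrightarrow> f ` A \<subseteq> B \<Longrightarrow> complex_linear_on B g \<Longrightarrow> complex_linear_on A (g \<circ> f)"
  unfolding complex_linear_on_def image_subset_iff by simp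

lemma family_dist_le:
  assumes "(A, \<gamma>, B) \<in> F" "map_norm A (\<lambda>a. \<alpha> a - \<gamma> a) \<le> \<epsilon>"
  shows "family_dist F A \<alpha> B \<le> ereal \<epsilon>"
  unfolding family_dist_def by (rule INF_lower2[of \<gamma>]) (use assms in auto)

lemma star_extendible_linear:
  assumes A: "subalgebra A" and f: "star_extendible f A B"
  shows "complex_linear_on A f"
proof -
  obtain g where g: "star_hom g (generated_cstar A) (generated_cstar B)" "\<forall>a\<in>A. f a = g a"
    using f unfolding star_extendible_def by blast
  have "complex_linear_on A g"
    by (rule complex_linear_on_subset[OF star_hom_linear[OF g(1)] generated_superset])
  then show ?thesis using A g(2) by (simp add: complex_linear_on_def subalgebra_def)
qed

lemma family_dist_nonneg:
  assumes F: "regular_family F" and A: "digraph_algebra A" and \<alpha>: "complex_linear_on A \<alpha>"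
  shows "0 \<le> family_dist F A \<alpha> B"
  unfolding family_dist_def
proof (rule INF_greatest)
  fix \<gamma> assume "\<gamma> \<in> {\<gamma>. (A, \<gamma>, B) \<in> F}"
  then have "star_extendible \<gamma> A B" using F unfolding regular_family_def regular_map_def by blast
  then have "complex_linear_on A \<gamma>" by (rule star_extendible_linear[OF digraph_subalgebra[OF A]])
  then show "0 \<le> ereal (map_norm A (\<lambda>a. \<alpha> a - \<gamma> a))"
    using map_norm_bound(1)[OF A complex_linear_on_diff[OF \<alpha>]] by simp
qed

lemma closed_limit_cong:
  assumes "\<And>k a. a \<in> A k \<Longrightarrow> \<phi>' k a = \<phi> k a"
  shows "closed_limit A \<phi>' = closed_limit A \<phi>"
proof -
  have "coherent A \<phi>' x \<longleftrightarrow> coherent A \<phi> x" for x unfolding coherent_def using assms by metis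
  then show ?thesis by (simp add: closed_limit_def)
qed

lemma system_inD:
  assumes "regular_family F" "system_in F A \<phi>"
  shows "digraph_algebra (A k)" "regular_map (\<phi> k) (A k) (A (Suc k))"
    "complex_linear_on (A k) (\<phi> k)" "a \<in> A k \<Longrightarrow> \<phi> k a \<in> A (Suc k)"
proof -
  show A: "digraph_algebra (A k)" and r: "regular_map (\<phi> k) (A k) (A (Suc k))"
    using assms unfolding regular_family_def system_in_def by blast+
  then have s: "star_extendible (\<phi> k) (A k) (A (Suc k))" by (simp add: regular_map_def)
  then show "complex_linear_on (A k) (\<phi> k)" by (rule star_extendible_linear[OF digraph_subalgebra[OF A]])
  show "a \<in> A k \<Longrightarrow> \<phi> k a \<in> A (Suc k)" using s by (auto simp: star_extendible_def)
qed

lemma composite_linear: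
  assumes "regular_family F" "system_in F A \<phi>"
  shows "n \<le> j \<Longrightarrow> complex_linear_on (A n) (composite \<phi> n j) \<and> composite \<phi> n j ` A n \<subseteq> A j"
proof (induction j)
  case 0
  then show ?case by (simp add: complex_linear_on_def)
next
  case (Suc j)
  show ?case
  proof (cases "n = Suc j")
    case False
    then have nj: "n \<le> j" using Suc by simp
    have "composite \<phi> n (Suc j) = \<phi> j \<circ> composite \<phi> n j" using nj by (simp add: composite_Suc fun_eq_iff)
    moreover have "complex_linear_on (A n) (\<phi> j \<circ> composite \<phi> n j)"
      using Suc.IH[OF nj] system_inD(3)[OF assms] by (intro complex_linear_on_comp[of _ _ "A j"]) auto
    ultimately show ?thesis using Suc.IH[OF nj] system_inD(4)[OF assms] by (auto simp: o_def)
  qed (auto simp: complex_linear_on_def)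
qed

lemma star_extendible_choice:
  assumes "\<And>k. star_extendible (f k) (A k) (B k)"
  obtains g where "\<And>k. star_hom (g k) (generated_cstar (A k)) (generated_cstar (B k))"
    "\<And>k a. a \<in> A k \<Longrightarrow> f k a = g k a" "\<And>k a. a \<in> A k \<Longrightarrow> g k a \<in> B k"
proof -
  have "\<forall>k. \<exists>g. star_hom g (generated_cstar (A k)) (generated_cstar (B k)) \<and> (\<forall>a\<in>A k. f k a = g a)"
    using assms unfolding star_extendible_def by blast
  then obtain g where g: "\<And>k. star_hom (g k) (generated_cstar (A k)) (generated_cstar (B k))"
    "\<And>k a. a \<in> A k \<Longrightarrow> f k a = g k a" by metis
  have "g k a \<in> B k" if a: "a \<in> A k" for k a
    using assms[of k] a g(2)[OF a] by (auto simp: star_extendible_def)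
  then show ?thesis using that[OF g] by blast
qed

text \<open>The maps are replaced by star-homomorphisms of the generated algebras that agree with
  them on \<open>A k\<close> and \<open>B k\<close>; closed limits, composites and distances depend
  on the values there only. The masa hypothesis is applied to the limit of \<open>B\<close>, with
  one masa carried over by \<open>theta\<close> and the other coming from the system
  \<open>B\<close> itself.\<close>

lemma diagonal_near_family:
  fixes F :: "'a::cstar_algebra algebra_map set"
  assumes F: "regular_family F" and sat: "saturated F"
    and masas: "\<forall>L\<in>Lim_class F. \<forall>C D. standard_regular_masa C L \<and> standard_regular_masa D L \<longrightarrow>
           (\<exists>\<alpha>. approximately_inner \<alpha> L \<and> \<alpha> ` C = D)"
    and sA: "system_in F A \<phi>" and sB: "system_in F B \<psi>"
    and com: "approximately_commuting A \<phi> B \<psi> \<mu> \<nu>" and \<epsilon>: "\<epsilon> > 0"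
  shows "\<forall>\<^sub>F j in sequentially. family_dist F (A n) (\<mu> j \<circ> composite \<phi> n j) (B j) \<le> ereal \<epsilon>"
proof -
  note A = system_inD[OF F sA] and B = system_inD[OF F sB]
  obtain \<phi>' C where S1: "standard_system A \<phi>' C" and \<phi>': "\<And>k a. a \<in> A k \<Longrightarrow> \<phi>' k a = \<phi> k a"
    using standard_system_exists[OF F sA] by blast
  obtain \<psi>' D where S2: "standard_system B \<psi>' D" and \<psi>': "\<And>k a. a \<in> B k \<Longrightarrow> \<psi>' k a = \<psi> k a"
    using standard_system_exists[OF F sB] by blast
  have sm: "star_extendible (\<mu> k) (A k) (B k)" and sn: "star_extendible (\<nu> k) (B k) (A (Suc k))" for k
    using com by (simp_all add: approximately_commuting_def)
  obtain \<mu>' where mu: "\<And>k. star_hom (\<mu>' k) (generated_cstar (A k)) (generated_cstar (B k))"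
    "\<And>k a. a \<in> A k \<Longrightarrow> \<mu> k a = \<mu>' k a" "\<And>k a. a \<in> A k \<Longrightarrow> \<mu>' k a \<in> B k"
    using star_extendible_choice[of \<mu> A B, OF sm] by blast
  obtain \<nu>' where nu: "\<And>k. star_hom (\<nu>' k) (generated_cstar (B k)) (generated_cstar (A (Suc k)))"
    "\<And>k a. a \<in> B k \<Longrightarrow> \<nu> k a = \<nu>' k a" "\<And>k a. a \<in> B k \<Longrightarrow> \<nu>' k a \<in> A (Suc k)"
    using star_extendible_choice[of \<nu> B "\<lambda>k. A (Suc k)", OF sn] by blast
  define a where "a k = map_norm (A k) (\<lambda>x. \<phi> k x - \<nu> k (\<mu> k x))" for k
  define b where "b k = map_norm (B k) (\<lambda>x. \<psi> k x - \<mu> (Suc k) (\<nu> k x))" for k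
  have lm: "complex_linear_on (A k) (\<mu> k)" "\<mu> k ` A k \<subseteq> B k"
    and ln: "complex_linear_on (B k) (\<nu> k)" "\<nu> k ` B k \<subseteq> A (Suc k)" for k
    using star_extendible_linear[OF digraph_subalgebra[OF A(1)] sm] sm[of k]
      star_extendible_linear[OF digraph_subalgebra[OF B(1)] sn] sn[of k] by (auto simp: star_extendible_def)
  have la: "complex_linear_on (A k) (\<lambda>x. \<phi> k x - \<nu> k (\<mu> k x))" for k
    using complex_linear_on_diff[OF A(3) complex_linear_on_comp[OF lm ln(1)]] by (simp add: o_def)
  have lb: "complex_linear_on (B k) (\<lambda>x. \<psi> k x - \<mu> (Suc k) (\<nu> k x))" for k
    using complex_linear_on_diff[OF B(3) complex_linear_on_comp[OF ln lm(1)]] by (simp add: o_def)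
  interpret S: intertwined_systems A \<phi>' C B \<psi>' D \<mu>' \<nu>' a b
  proof (intro intertwined_systems.intro S1 S2 intertwined_systems_axioms.intro mu(1,3) nu(1,3))
    fix k x
    show "0 \<le> a k" "0 \<le> b k"
      unfolding a_def b_def by (rule map_norm_bound(1)[OF A(1) la], rule map_norm_bound(1)[OF B(1) lb])
    show "summable a" "summable b" using com by (simp_all add: approximately_commuting_def a_def[abs_def] b_def[abs_def])
    show "norm (\<phi>' k x - \<nu>' k (\<mu>' k x)) \<le> a k * norm x" if x: "x \<in> A k"
      using map_norm_bound(2)[OF A(1) la x] x mu(3)[OF x] by (simp add: a_def \<phi>' mu(2) nu(2))
    show "norm (\<psi>' k x - \<mu>' (Suc k) (\<nu>' k x)) \<le> b k * norm x" if x: "x \<in> B k"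
      using map_norm_bound(2)[OF B(1) lb x] x nu(3)[OF x] by (simp add: b_def \<psi>' mu(2) nu(2))
  qed
  have "closed_limit B \<psi>' \<in> Lim_class F"
    using closed_limit_cong[of B \<psi>' \<psi>, OF \<psi>'] sB unfolding Lim_class_def by blast
  then obtain \<alpha> where \<alpha>: "approximately_inner \<alpha> (closed_limit B \<psi>')"
    "\<alpha> ` S.theta ` closed_limit C \<phi>' = closed_limit D \<psi>'"
    using masas S.theta_masa S.identity_masa by blast
  \<comment> \<open>\<open>j \<ge> 1\<close> because \<open>saturated\<close> asks for
    \<open>B j\<close> to be the range algebra of some map in \<open>F\<close>; \<open>B 0\<close>
    is only known to be a domain algebra.\<close>
  from S.approximate_by_regular[OF \<alpha> \<epsilon>, of n] eventually_ge_at_top[of "max 1 n"]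
  show ?thesis
  proof eventually_elim
    case (elim j)
    then obtain \<gamma> where \<gamma>: "regular_map \<gamma> (A n) (B j)"
      "\<And>x. x \<in> A n \<Longrightarrow> norm (\<mu>' j (composite \<phi>' n j x) - \<gamma> x) \<le> \<epsilon> * norm x" by blast
    obtain i where i: "j = Suc i" using elim(2) by (cases j) auto
    have "(A n, \<phi> n, A (Suc n)) \<in> F" "(B i, \<psi> i, B j) \<in> F" using sA sB i by (simp_all add: system_in_def)
    then have \<gamma>F: "(A n, \<gamma>, B j) \<in> F" using sat \<gamma>(1) unfolding saturated_def by blast
    have "norm ((\<mu> j \<circ> composite \<phi> n j) x - \<gamma> x) \<le> \<epsilon> * norm x" if x: "x \<in> A n" for x
    proof -
      have "composite \<phi>' n j x = composite \<phi> n j x" "composite \<phi> n j x \<in> A j"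
        using composite_cong[of A \<phi>' \<phi> x n j, OF \<phi>' A(4) x] elim(2) by simp_all
      then show ?thesis using \<gamma>(2)[OF x] by (simp add: mu(2))
    qed
    then have "map_norm (A n) (\<lambda>x. (\<mu> j \<circ> composite \<phi> n j) x - \<gamma> x) \<le> \<epsilon>"
      using \<epsilon> digraph_subalgebra[OF A(1)] by (intro map_norm_le) (simp_all add: subalgebra_def)
    then show ?case by (rule family_dist_le[OF \<gamma>F])
  qed
qed

text \<open>The ladder restarted at \<open>B 0\<close>: the two kinds of diagonal maps exchange
  roles, and the first series loses its first term.\<close>

lemma approximately_commuting_shift:
  assumes "approximately_commuting A \<phi> B \<psi> \<mu> \<nu>"
  shows "approximately_commuting B \<psi> (\<lambda>k. A (Suc k)) (\<lambda>k. \<phi> (Suc k)) \<nu> (\<lambda>k. \<mu> (Suc k))"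
  using assms summable_Suc_iff[of "\<lambda>k. map_norm (A k) (\<lambda>a. \<phi> k a - \<nu> k (\<mu> k a))"]
  by (simp add: approximately_commuting_def)

lemma ereal_tendsto_0_if_le_inverse:
  assumes "\<And>k. 0 \<le> d k" "\<And>k. d k \<le> ereal (inverse (real (Suc k)))"
  shows "d \<longlonglongrightarrow> 0"
proof (rule tendsto_sandwich[of "\<lambda>_. 0" d sequentially "\<lambda>k. ereal (inverse (real (Suc k)))" 0])
  show "(\<lambda>k. ereal (inverse (real (Suc k)))) \<longlonglongrightarrow> 0"
    using tendsto_ereal[OF LIMSEQ_inverse_real_of_nat] by (simp only: zero_ereal_def)
  show "(\<lambda>_. 0 :: ereal) \<longlonglongrightarrow> 0" by simp
qed (use assms in simp_all)

theorem theorem6p6: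
  fixes F :: "'a::cstar_algebra algebra_map set" and E :: "'a set set"
  assumes "regular_family F" and "saturated F"
    and "perturbationally_stable E" and "\<forall>(A, f, B)\<in>F. A \<in> E \<and> B \<in> E"
    and "\<forall>L\<in>Lim_class F. \<forall>C D. standard_regular_masa C L \<and> standard_regular_masa D L \<longrightarrow>
           (\<exists>\<alpha>. approximately_inner \<alpha> L \<and> \<alpha> ` C = D)"
  shows "approximately_functorial F"
  unfolding approximately_functorial_def
proof (intro allI impI, elim conjE)
  fix A \<phi> B \<psi> and \<mu> \<nu> :: "nat \<Rightarrow> 'a \<Rightarrow> 'a"
  assume sA: "system_in F A \<phi>" and sB: "system_in F B \<psi>" and com: "approximately_commuting A \<phi> B \<psi> \<mu> \<nu>"
  note A = system_inD[OF assms(1) sA] and B = system_inD[OF assms(1) sB]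
  note near = diagonal_near_family[OF assms(1,2,5)]
  have sA': "system_in F (\<lambda>k. A (Suc k)) (\<lambda>k. \<phi> (Suc k))" using sA by (simp add: system_in_def)
  define p where "p n j = family_dist F (A n) (\<mu> j \<circ> composite \<phi> n j) (B j)" for n j
  define q where "q m j = family_dist F (B m) (\<nu> j \<circ> composite \<psi> m j) (A (Suc j))" for m j
  have p: "\<forall>\<^sub>F j in sequentially. p n j \<le> ereal \<epsilon>" if "\<epsilon> > 0" for n \<epsilon>
    unfolding p_def by (rule near[OF sA sB com that])
  have q: "\<forall>\<^sub>F j in sequentially. q m j \<le> ereal \<epsilon>" if "\<epsilon> > 0" for m \<epsilon>
    unfolding q_def by (rule near[OF sB sA' approximately_commuting_shift[OF com] that])
  let ?e = "\<lambda>k::nat. inverse (real (Suc k))"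
  have e: "?e k > 0" for k by simp
  have next_m: "\<exists>m\<ge>n. p n m \<le> ereal (?e k)" for n k
    using eventually_happens'[OF sequentially_bot eventually_conj[OF p[OF e[of k], of n] eventually_ge_at_top[of n]]] by blast
  \<comment> \<open>\<open>\<nu> j\<close> ends in \<open>A (Suc j)\<close>, so an index
    \<open>j \<ge> m\<close> is recorded as \<open>n' = Suc j\<close>; this also gives the strict
    inequality.\<close>
  have next_n: "\<exists>n'>m. q m (n' - 1) \<le> ereal (?e k)" for m k
  proof -
    obtain j where "q m j \<le> ereal (?e k)" "m \<le> j"
      using eventually_happens'[OF sequentially_bot eventually_conj[OF q[OF e[of k], of m] eventually_ge_at_top[of m]]] by blast
    then show ?thesis by (intro exI[of _ "Suc j"]) simp
  qed
  \<comment> \<open>The pairs are the \<open>(n k, m k)\<close>. The distance from \<open>A\<close>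
    to \<open>B\<close> is a property of one pair, the distance back links a pair to its successor,
    as \<open>dependent_nat_choice\<close> requires.\<close>
  have "\<exists>f. \<forall>k. (fst (f k) \<le> snd (f k) \<and> p (fst (f k)) (snd (f k)) \<le> ereal (?e k)) \<and>
    (snd (f k) < fst (f (Suc k)) \<and> q (snd (f k)) (fst (f (Suc k)) - 1) \<le> ereal (?e k))"
  proof (rule dependent_nat_choice)
    show "\<exists>x. fst x \<le> snd x \<and> p (fst x) (snd x) \<le> ereal (?e 0)" using next_m[of 0 0] by force
    fix x :: "nat \<times> nat" and k
    obtain n' where n': "n' > snd x" "q (snd x) (n' - 1) \<le> ereal (?e k)" using next_n by blast
    obtain m' where "m' \<ge> n'" "p n' m' \<le> ereal (?e (Suc k))" using next_m by blast
    then show "\<exists>y. (fst y \<le> snd y \<and> p (fst y) (snd y) \<le> ereal (?e (Suc k))) \<and>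
      (snd x < fst y \<and> q (snd x) (fst y - 1) \<le> ereal (?e k))"
      using n' by (intro exI[of _ "(n', m')"]) simp
  qed
  then obtain f where f: "\<And>k. fst (f k) \<le> snd (f k)" "\<And>k. p (fst (f k)) (snd (f k)) \<le> ereal (?e k)"
    "\<And>k. snd (f k) < fst (f (Suc k))" "\<And>k. q (snd (f k)) (fst (f (Suc k)) - 1) \<le> ereal (?e k)" by blast
  define n m where "n k = fst (f k)" and "m k = snd (f k)" for k
  note f = f[folded n_def m_def]
  have lin\<mu>: "complex_linear_on (A k) (\<mu> k)" and lin\<nu>: "complex_linear_on (B k) (\<nu> k)" for k
    using com unfolding approximately_commuting_def
    by (blast intro: star_extendible_linear[OF digraph_subalgebra[OF A(1)]] star_extendible_linear[OF digraph_subalgebra[OF B(1)]])+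
  \<comment> \<open>The distances are extended reals, so convergence to 0 also needs a lower bound.
    It holds for \<open>i \<le> j\<close>, where the composite is linear on the finite-dimensional
    domain and \<open>map_norm\<close> is a genuine norm.\<close>
  have p0: "0 \<le> p i j" if "i \<le> j" for i j
    unfolding p_def using composite_linear[OF assms(1) sA that] lin\<mu>
    by (intro family_dist_nonneg[OF assms(1) A(1)] complex_linear_on_comp[of _ _ "A j"]) auto
  have q0: "0 \<le> q i j" if "i \<le> j" for i j
    unfolding q_def using composite_linear[OF assms(1) sB that] lin\<nu>
    by (intro family_dist_nonneg[OF assms(1) B(1)] complex_linear_on_comp[of _ _ "B j"]) auto
  have mn: "m k \<le> n (Suc k) - 1" "Suc (n (Suc k) - 1) = n (Suc k)" for k using f(3)[of k] by simp_all
  have "(\<lambda>k. p (n k) (m k)) \<longlonglongrightarrow> 0"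
    by (rule ereal_tendsto_0_if_le_inverse[OF p0[OF f(1)] f(2)])
  moreover have "(\<lambda>k. q (m k) (n (Suc k) - 1)) \<longlonglongrightarrow> 0"
    by (rule ereal_tendsto_0_if_le_inverse[OF q0[OF mn(1)] f(4)])
  ultimately show "\<exists>n m. (\<forall>k. n k \<le> m k \<and> m k < n (Suc k)) \<and>
     (\<lambda>k. family_dist F (A (n k)) (\<mu> (m k) \<circ> composite \<phi> (n k) (m k)) (B (m k))) \<longlonglongrightarrow> 0 \<and>
     (\<lambda>k. family_dist F (B (m k)) (\<nu> (n (Suc k) - 1) \<circ> composite \<psi> (m k) (n (Suc k) - 1)) (A (n (Suc k)))) \<longlonglongrightarrow> 0"
    using f(1,3) unfolding p_def q_def mn(2) by blast
qed

end
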